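(* Let $\mu>\rho-1$ and let $\nu$ be a probability measure on $\Pi_q$ with finite second moment $\int_{\Pi_q}\|r\|^2\,d\nu(r)<\infty$. Then $\sigma^2:=\frac1{2\mu}\int_{\Pi_q}r^2\,d\nu(r)\in\Pi_q$ exists (entrywise integral), and the probability measures $T_{n^{-1/2}I}(\nu^{(n)})=(T_{n^{-1/2}I}(\nu))^{(n)}$ converge weakly to the squared Wishart distribution $W(\sigma^2)$ as $n\to\infty$.
   Context: Let $\mathbb F\in\{\mathbb R,\mathbb C,\mathbb H\}$ with real dimension $d\in\{1,2,4\}$, $q\in\mathbb N$, $M_q$ the $q\times q$ matrices over $\mathbb F$, $x^*=\bar x^t$, $H_q$ the Hermitian matrices with norm $\|x\|=(\mathrm{Re}\,\mathrm{tr}(x^*x))^{1/2}$, $\Pi_q$ the positive semidefinite ones, $\Omega_q$ its interior, $\sqrt r$ the positive semidefinite square root, $\Delta$ the determinant function of the cone $\Omega_q$, $\Gamma_{\Omega_q}$ its Gamma function. $\rho=d(q-\frac12)+1$, $n_0=q+\frac d2q(q-1)$. For $\mu>\rho-1$, $D=\{v\in M_q:v^*v<I\}$, $\kappa_\mu=\int_D\Delta(I-v^*v)^{\mu-\rho}dv$, and $X_{q,\mu}=(\Pi_q,*_\mu)$ is $\Pi_q$ with the convolution obtained by bilinear weakly continuous extension of $(\delta_r*_\mu\delta_s)(f)=\kappa_\mu^{-1}\int_D f\big(\sqrt{r^2+s^2+svr+rv^*s}\big)\Delta(I-vv^* )^{\mu-\rho}dv$; $\nu^{(n)}$ is the $n$-fold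 $*_\mu$-convolution power. Haar measure $\omega_\mu(f)=\frac{\pi^{q\mu}}{\Gamma_{\Omega_q}(\mu)}\int_{\Omega_q}f(\sqrt r)\Delta(r)^{\mu-n_0/q}dr$. For $a\in M_q$, $T_a(r)=\sqrt{ar^2a^*}$, acting on measures by image measures (so $T_{cI}(r)=cr$ for $c>0$). Standard squared Wishart distribution $dW(r)=(2\pi)^{-q\mu}e^{-\mathrm{tr}(r^2)/2}d\omega_\mu(r)$; $W(s^2):=T_s(W)$ for $s\in\Pi_q$. *)

theory Defs
  imports "HOL-Probability.Probability" "HOL-Library.Countable_Set"
begin

section \<open>Scalars: R, C, H embedded in real^4 (basis 1, i, j, k at components 0,1,2,3)\<close>

type_synonym scal = "real^4"
type_synonym 'q mat = "real^4^'q^'q"   (* x $ i $ j = entry (i,j) *)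

definition comps :: "nat \<Rightarrow> 4 set" where
  "comps d = (if d = 1 then {0} else if d = 2 then {0, 1} else UNIV)"

definition qmul :: "scal \<Rightarrow> scal \<Rightarrow> scal" where
  "qmul a b = (\<chi> k.
     if k = 0 then a$0*b$0 - a$1*b$1 - a$2*b$2 - a$3*b$3
     else if k = 1 then a$0*b$1 + a$1*b$0 + a$2*b$3 - a$3*b$2
     else if k = 2 then a$0*b$2 - a$1*b$3 + a$2*b$0 + a$3*b$1
     else a$0*b$3 + a$1*b$2 - a$2*b$1 + a$3*b$0)"

definition qconj :: "scal \<Rightarrow> scal" where
  "qconj a = (\<chi> k. if k = 0 then a$0 else - a$k)"

definition qone :: scal where
  "qone = (\<chi> k. if k = 0 then 1 else 0)"

definition In_M :: "nat \<Rightarrow> 'q::finite mat \<Rightarrow> bool" where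
  "In_M d x \<longleftrightarrow> (\<forall>i j k. k \<notin> comps d \<longrightarrow> x$i$j$k = 0)"

definition mmul :: "'q::finite mat \<Rightarrow> 'q mat \<Rightarrow> 'q mat" where
  "mmul x y = (\<chi> i j. \<Sum>l\<in>UNIV. qmul (x$i$l) (y$l$j))"

definition madj :: "'q::finite mat \<Rightarrow> 'q mat" where
  "madj x = (\<chi> i j. qconj (x$j$i))"

definition mid :: "'q::finite mat" where
  "mid = (\<chi> i j. if i = j then qone else 0)"

definition rdiag :: "('q::finite \<Rightarrow> real) \<Rightarrow> 'q mat" where
  "rdiag l = (\<chi> i j. if i = j then l i *\<^sub>R qone else 0)"

definition retr :: "'q::finite mat \<Rightarrow> real" where
  "retr x = (\<Sum>i\<in>UNIV. x$i$i$0)"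

definition Herm :: "nat \<Rightarrow> 'q::finite mat set" where
  "Herm d = {x. In_M d x \<and> madj x = x}"

definition PiQ :: "nat \<Rightarrow> 'q::finite mat set" where
  "PiQ d = {x. x \<in> Herm d \<and>
     (\<forall>v::real^4^'q. (\<forall>i k. k \<notin> comps d \<longrightarrow> v$i$k = 0) \<longrightarrow>
        0 \<le> (\<Sum>i\<in>UNIV. \<Sum>j\<in>UNIV. qmul (qmul (qconj (v$i)) (x$i$j)) (v$j)) $ 0)}"

definition OmegaQ :: "nat \<Rightarrow> 'q::finite mat set" where
  "OmegaQ d = {x \<in> PiQ d. \<exists>e>0. \<forall>y\<in>Herm d. dist y x < e \<longrightarrow> y \<in> PiQ d}"

definition unitary :: "nat \<Rightarrow> 'q::finite mat \<Rightarrow> bool" where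
  "unitary d u \<longleftrightarrow> In_M d u \<and> mmul (madj u) u = mid"

text \<open>Determinant of the cone: product of the (real) eigenvalues of a Hermitian matrix.\<close>
definition Delta :: "nat \<Rightarrow> 'q::finite mat \<Rightarrow> real" where
  "Delta d x = (THE p. \<exists>u l. unitary d u \<and> x = mmul u (mmul (rdiag l) (madj u))
                           \<and> p = (\<Prod>i\<in>UNIV. l i))"

definition msqrt :: "nat \<Rightarrow> 'q::finite mat \<Rightarrow> 'q mat" where
  "msqrt d r = (THE s. s \<in> PiQ d \<and> mmul s s = r)"

definition lebM :: "nat \<Rightarrow> 'q::finite mat measure" where
  "lebM d = distr (PiM {(i,j,k). k \<in> comps d} (\<lambda>_. lborel)) borel
     (\<lambda>f. \<chi> i j k. if k \<in> comps d then f (i,j,k) else 0)"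

definition qord :: "'q::finite \<Rightarrow> nat" where
  "qord = to_nat_on UNIV"

definition lebH :: "nat \<Rightarrow> 'q::finite mat measure" where
  "lebH d = distr (PiM {(i,j,k). (i = j \<and> k = 0) \<or> (qord i < qord j \<and> k \<in> comps d)} (\<lambda>_. lborel))
     borel
     (\<lambda>f. \<chi> i j. if i = j then (\<chi> k. if k = 0 then f (i,i,0) else 0)
                 else if qord i < qord j then (\<chi> k. if k \<in> comps d then f (i,j,k) else 0)
                 else qconj (\<chi> k. if k \<in> comps d then f (j,i,k) else 0))"

definition rho :: "nat \<Rightarrow> 'q::finite itself \<Rightarrow> real" where
  "rho d _ = real d * (real CARD('q) - 1/2) + 1"

definition n0 :: "nat \<Rightarrow> 'q::finite itself \<Rightarrow> real" where
  "n0 d _ = real CARD('q) + real d / 2 * real CARD('q) * (real CARD('q) - 1)"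

definition Dset :: "nat \<Rightarrow> 'q::finite mat set" where
  "Dset d = {v. In_M d v \<and> mid - mmul (madj v) v \<in> OmegaQ d}"

definition kappa :: "nat \<Rightarrow> real \<Rightarrow> 'q::finite itself \<Rightarrow> real" where
  "kappa d \<mu> Q = (LINT v:(Dset d :: 'q mat set)|lebM d.
                    Delta d (mid - mmul (madj v) v) powr (\<mu> - rho d Q))"

definition GammaOmega :: "nat \<Rightarrow> real \<Rightarrow> 'q::finite itself \<Rightarrow> real" where
  "GammaOmega d \<mu> Q = (LINT x:(OmegaQ d :: 'q mat set)|lebH d.
                    exp (- retr x) * Delta d x powr (\<mu> - n0 d Q / real CARD('q)))"

definition PiS :: "nat \<Rightarrow> 'q::finite mat measure" where
  "PiS d = restrict_space borel (PiQ d)"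

definition pconv :: "nat \<Rightarrow> real \<Rightarrow> 'q::finite mat \<Rightarrow> 'q mat \<Rightarrow> 'q mat measure" where
  "pconv d \<mu> r s = distr
     (density (lebM d) (\<lambda>v. ennreal (indicator (Dset d) v *
         Delta d (mid - mmul v (madj v)) powr (\<mu> - rho d TYPE('q)) / kappa d \<mu> TYPE('q))))
     (PiS d)
     (\<lambda>v. msqrt d (mmul r r + mmul s s + mmul s (mmul v r) + mmul r (mmul (madj v) s)))"

definition mconv :: "nat \<Rightarrow> real \<Rightarrow> 'q::finite mat measure \<Rightarrow> 'q mat measure \<Rightarrow> 'q mat measure" where
  "mconv d \<mu> \<nu>1 \<nu>2 = \<nu>1 \<bind> (\<lambda>r. \<nu>2 \<bind> (\<lambda>s. pconv d \<mu> r s))"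

fun convpow :: "nat \<Rightarrow> real \<Rightarrow> 'q::finite mat measure \<Rightarrow> nat \<Rightarrow> 'q mat measure" where
  "convpow d \<mu> \<nu> 0 = return (PiS d) 0"
| "convpow d \<mu> \<nu> (Suc n) = mconv d \<mu> (convpow d \<mu> \<nu> n) \<nu>"

definition Tmap :: "nat \<Rightarrow> 'q::finite mat \<Rightarrow> 'q mat \<Rightarrow> 'q mat" where
  "Tmap d a r = msqrt d (mmul a (mmul (mmul r r) (madj a)))"

definition Tmeas :: "nat \<Rightarrow> 'q::finite mat \<Rightarrow> 'q mat measure \<Rightarrow> 'q mat measure" where
  "Tmeas d a \<nu> = distr \<nu> (PiS d) (Tmap d a)"

definition haar :: "nat \<Rightarrow> real \<Rightarrow> 'q::finite mat measure" where
  "haar d \<mu> = distr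
     (density (lebH d) (\<lambda>r. ennreal (indicator (OmegaQ d) r *
        (pi powr (real CARD('q) * \<mu>) / GammaOmega d \<mu> TYPE('q)) *
        Delta d r powr (\<mu> - n0 d TYPE('q) / real CARD('q)))))
     (PiS d) (msqrt d)"

definition wishart :: "nat \<Rightarrow> real \<Rightarrow> 'q::finite mat measure" where
  "wishart d \<mu> = density (haar d \<mu>)
     (\<lambda>r. ennreal ((2 * pi) powr (- real CARD('q) * \<mu>) * exp (- retr (mmul r r) / 2)))"

definition wishart_sq :: "nat \<Rightarrow> real \<Rightarrow> 'q::finite mat \<Rightarrow> 'q mat measure" where
  "wishart_sq d \<mu> s2 = Tmeas d (msqrt d s2) (wishart d \<mu>)"

definition weak_conv_Pi :: "nat \<Rightarrow> (nat \<Rightarrow> 'q::finite mat measure) \<Rightarrow> 'q mat measure \<Rightarrow> bool" where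
  "weak_conv_Pi d Ms M \<longleftrightarrow>
     (\<forall>f :: 'q mat \<Rightarrow> real. continuous_on (PiQ d) f \<and> bounded (f ` PiQ d) \<longrightarrow>
        (\<lambda>n. integral\<^sup>L (Ms n) f) \<longlonglongrightarrow> integral\<^sup>L M f)"

end

theory Submission
  imports Defs
begin

text \<open>
Laplace transforms \<open>\<integral> exp (- tr (a r\<^sup>2)) dP(r)\<close>, \<open>a\<close> positive semidefinite, determine weak convergence of tight
sequences on the cone, because finite linear combinations of the functions \<open>exp (- tr (a r\<^sup>2))\<close> form a
point-separating algebra (Stone--Weierstrass). The second moments of the rescaled convolution powers are
constant in \<open>n\<close>, which gives tightness.

The Laplace transforms are computed by a Lindeberg argument. After diagonalising \<open>a\<^sup>1\<^sup>/\<^sup>2 \<sigma>\<^sup>2 a\<^sup>1\<^sup>/\<^sup>2\<close> with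
eigenvalues \<open>l\<^sub>i\<close>, consider the heat flow \<open>h\<^sub>t(r) = \<Prod>\<^sub>i (1 + 2 t l\<^sub>i)\<^sup>-\<^sup>\<mu> exp (- tr (a\<^sub>t r\<^sup>2))\<close> started at
\<open>exp (- tr (a r\<^sup>2))\<close>. One convolution with \<open>\<nu>\<close> scaled by \<open>n\<^sup>-\<^sup>1\<^sup>/\<^sup>2\<close> moves \<open>h\<^sub>t\<close> to \<open>h\<^sub>t\<^sub>+\<^sub>1\<^sub>/\<^sub>n\<close> up to \<open>o(1/n)\<close>; this only
uses that the matrix ball law has mean zero and covariance \<open>1/(2\<mu>)\<close> times the identity, which follows by
integrating out one column of \<open>v\<close> at a time. Hence the \<open>n\<close>-fold convolution power has Laplace transform
tending to \<open>h\<^sub>1(0) = \<Delta>(1 + 2 a\<^sup>1\<^sup>/\<^sup>2 \<sigma>\<^sup>2 a\<^sup>1\<^sup>/\<^sup>2)\<^sup>-\<^sup>\<mu>\<close>. The squared Wishart law has the same transform by the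
transformation behaviour of the Lebesgue measure on Hermitian matrices under \<open>x \<mapsto> g x g\<^sup>*\<close>.
\<close>

text \<open>The convolution is not a sum of independent vectors, and no transform that is
  multiplicative for it is used. The exchange argument runs because the Laplace kernels stay in an
  explicit family under the heat flow and because the error of one step is bounded uniformly in r:
  the decaying exponential outweighs the growth in r of its own Taylor terms. Truncating with
  \<open>min (norm s) 1\<close> yields o(1/n) from second moments alone.

  The three fields are handled at once as subalgebras of the quaternions in \<open>real^4\<close>.
  Determinants over a noncommutative field are reached through the real matrix of left
  multiplication, whose determinant is the fourth power of \<open>Delta\<close> on the cone for
  every d. Changes of variables are done without Jacobians: translation invariance fixes a measure
  on a subspace up to a factor, and the factor is read off from the unit ball or a coordinate box.
  The condition on \<mu> says that the exponent \<mu> - rho exceeds -1, and 1/(2 \<mu>) originates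
  in the second moment of a Euclidean ball with density (1 - |y|^2)^a.\<close>

lemma four_eq_zero: "(4::4) = 0" by simp

text \<open>The library enumerates the type \<open>4\<close> as 1, 2, 3, 4, and the numeral 4 is 0
  there; the components are to be read as 0 (real part) and 1, 2, 3.\<close>

lemma sum_4': "sum f (UNIV::4 set) = f 0 + f 1 + f 2 + f 3"
  by (simp add: sum_4 four_eq_zero ac_simps)

lemma forall_4': "(\<forall>i::4. P i) \<longleftrightarrow> P 0 \<and> P 1 \<and> P 2 \<and> P 3"
  unfolding forall_4 four_eq_zero by auto

lemma scal_eq_iff: "(a::scal) = b \<longleftrightarrow> a$0 = b$0 \<and> a$1 = b$1 \<and> a$2 = b$2 \<and> a$3 = b$3"
  by (simp add: vec_eq_iff forall_4')

section \<open>Arithmetic of the scalars\<close>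

lemma qmul_nth [simp]:
  "qmul a b $ 0 = a$0*b$0 - a$1*b$1 - a$2*b$2 - a$3*b$3"
  "qmul a b $ 1 = a$0*b$1 + a$1*b$0 + a$2*b$3 - a$3*b$2"
  "qmul a b $ 2 = a$0*b$2 - a$1*b$3 + a$2*b$0 + a$3*b$1"
  "qmul a b $ 3 = a$0*b$3 + a$1*b$2 - a$2*b$1 + a$3*b$0"
  by (simp_all add: qmul_def)

lemma qconj_nth [simp]: "qconj a $ k = (if k = 0 then a$0 else - a$k)"
  by (simp add: qconj_def)

lemma qone_nth [simp]: "qone $ k = (if k = 0 then 1 else 0)"
  by (simp add: qone_def)

lemma qmul_assoc: "qmul (qmul a b) c = qmul a (qmul b c)"
  by (simp add: scal_eq_iff algebra_simps)

lemma qmul_linear_simps [simp]: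
  "qmul (a + b) c = qmul a c + qmul b c" "qmul a (b + c) = qmul a b + qmul a c"
  "qmul (a - b) c = qmul a c - qmul b c" "qmul a (b - c) = qmul a b - qmul a c"
  "qmul (t *\<^sub>R a) c = t *\<^sub>R qmul a c" "qmul a (t *\<^sub>R c) = t *\<^sub>R qmul a c"
  "qmul 0 c = 0" "qmul a 0 = 0" "qmul (- a) c = - qmul a c" "qmul a (- c) = - qmul a c"
  "qmul qone a = a" "qmul a qone = a"
  by (simp_all add: scal_eq_iff algebra_simps)

lemma qmul_sum_left: "qmul (sum f A) c = (\<Sum>i\<in>A. qmul (f i) c)"
  by (induction A rule: infinite_finite_induct) simp_all

lemma qmul_sum_right: "qmul c (sum f A) = (\<Sum>i\<in>A. qmul c (f i))"
  by (induction A rule: infinite_finite_induct) simp_all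

lemma qconj_simps [simp]:
  "qconj (qmul a b) = qmul (qconj b) (qconj a)" "qconj (qconj a) = a"
  "qconj (a + b) = qconj a + qconj b" "qconj (a - b) = qconj a - qconj b"
  "qconj (t *\<^sub>R a) = t *\<^sub>R qconj a" "qconj 0 = 0" "qconj (- a) = - qconj a" "qconj qone = qone"
  by (simp_all add: scal_eq_iff algebra_simps)

lemma qconj_sum: "qconj (sum f A) = (\<Sum>i\<in>A. qconj (f i))"
  by (induction A rule: infinite_finite_induct) simp_all

lemma inner_scal: "(a::scal) \<bullet> b = a$0*b$0 + a$1*b$1 + a$2*b$2 + a$3*b$3"
  by (simp add: inner_vec_def sum_4')

text \<open>The Euclidean inner product of \<open>real^4\<close> is the real part of
  \<open>qmul (qconj a) b\<close>, so multiplication by a scalar has multiplication by its conjugate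
  as adjoint.\<close>

lemma inner_qmul_left: "qmul a b \<bullet> c = b \<bullet> qmul (qconj a) c"
  by (simp add: inner_scal algebra_simps)

lemma inner_qmul_right: "qmul a b \<bullet> c = a \<bullet> qmul c (qconj b)"
  by (simp add: inner_scal algebra_simps)

lemma qmul_qconj_self: "qmul (qconj a) a = (norm a)\<^sup>2 *\<^sub>R qone"
  unfolding power2_norm_eq_inner by (simp add: scal_eq_iff inner_scal algebra_simps)

lemma norm_qmul: "norm (qmul a b) = norm a * norm b"
proof -
  have "(norm (qmul a b))\<^sup>2 = (norm a * norm b)\<^sup>2"
    by (simp add: power2_norm_eq_inner power_mult_distrib inner_qmul_left qmul_assoc[symmetric] qmul_qconj_self)
  then show ?thesis by (simp add: power2_eq_iff_nonneg)
qed

section \<open>Matrices\<close>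

lemma mat_eq_iff: "(x::'q::finite mat) = y \<longleftrightarrow> (\<forall>i j. x$i$j = y$i$j)"
  by (auto simp: vec_eq_iff)

lemma mmul_nth: "mmul x y $ i $ j = (\<Sum>l\<in>UNIV. qmul (x$i$l) (y$l$j))"
  by (simp add: mmul_def)

lemma madj_nth [simp]: "madj x $ i $ j = qconj (x$j$i)"
  by (simp add: madj_def)

lemma mid_nth: "mid $ i $ j = (if i = j then qone else 0)"
  by (simp add: mid_def)

lemma rdiag_nth: "rdiag l $ i $ j = (if i = j then l i *\<^sub>R qone else 0)"
  by (simp add: rdiag_def)

lemma mmul_assoc: "mmul (mmul x y) z = mmul x (mmul y z)"
proof -
  have "(\<Sum>l\<in>UNIV. \<Sum>m\<in>UNIV. qmul (qmul (x$i$m) (y$m$l)) (z$l$j)) =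
        (\<Sum>m\<in>UNIV. \<Sum>l\<in>UNIV. qmul (x$i$m) (qmul (y$m$l) (z$l$j)))" for i j
    by (subst sum.swap) (simp add: qmul_assoc)
  then show ?thesis
    by (simp add: mat_eq_iff mmul_nth qmul_sum_left qmul_sum_right)
qed

lemma mmul_linear_simps [simp]:
  "mmul (a + b) c = mmul a c + mmul b c" "mmul a (b + c) = mmul a b + mmul a c"
  "mmul (a - b) c = mmul a c - mmul b c" "mmul a (b - c) = mmul a b - mmul a c"
  "mmul (t *\<^sub>R a) c = t *\<^sub>R mmul a c" "mmul a (t *\<^sub>R c) = t *\<^sub>R mmul a c"
  "mmul 0 c = 0" "mmul a 0 = 0" "mmul (- a) c = - mmul a c" "mmul a (- c) = - mmul a c"
  by (simp_all add: mat_eq_iff mmul_nth sum.distrib sum_subtractf scaleR_sum_right sum_negf)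

lemma mmul_mid [simp]: "mmul mid x = x" "mmul x mid = x"
  by (simp_all add: mat_eq_iff mmul_nth mid_nth if_distrib[of "qmul _"] if_distrib[of "\<lambda>f. qmul f _"] cong: if_cong)

lemma bounded_bilinear_mmul: "bounded_bilinear (mmul :: 'q::finite mat \<Rightarrow> _)"
  by (intro bilinear_conv_bounded_bilinear[THEN iffD1]) (simp add: bilinear_def linear_iff)

lemmas continuous_on_mmul [continuous_intros] = bounded_bilinear.continuous_on[OF bounded_bilinear_mmul]

lemma madj_simps [simp]:
  "madj (mmul a b) = mmul (madj b) (madj a)" "madj (madj a) = a"
  "madj (a + b) = madj a + madj b" "madj (a - b) = madj a - madj b"
  "madj (t *\<^sub>R a) = t *\<^sub>R madj a" "madj 0 = 0" "madj (- a) = - madj a" "madj mid = mid"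
  "madj (rdiag l) = rdiag l"
  by (auto simp: mat_eq_iff mmul_nth qconj_sum mid_nth rdiag_nth)

lemma linear_madj: "linear madj" by (simp add: linear_iff)

lemmas bounded_linear_madj = linear_madj[THEN linear_conv_bounded_linear[THEN iffD1]]
lemmas continuous_on_madj [continuous_intros] = bounded_linear.continuous_on[OF bounded_linear_madj]

lemma inner_mat: "(x::'q::finite mat) \<bullet> y = (\<Sum>i\<in>UNIV. \<Sum>j\<in>UNIV. x$i$j \<bullet> y$i$j)"
  by (simp add: inner_vec_def)

text \<open>Over the quaternions the trace is not cyclic, but its real part is. The adjunction rules
  for the real inner product take the place of cyclicity throughout;
  \<open>retr_mmul_commute\<close> is derived from them.\<close>

lemma inner_mmul_left: "mmul a b \<bullet> c = b \<bullet> mmul (madj a) c"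
proof -
  have "mmul a b \<bullet> c = (\<Sum>i\<in>UNIV. \<Sum>j\<in>UNIV. \<Sum>l\<in>UNIV. qmul (a$i$l) (b$l$j) \<bullet> c$i$j)"
    by (simp add: inner_mat mmul_nth inner_sum_left)
  also have "\<dots> = (\<Sum>i\<in>UNIV. \<Sum>l\<in>UNIV. \<Sum>j\<in>UNIV. qmul (a$i$l) (b$l$j) \<bullet> c$i$j)"
    by (intro sum.cong refl sum.swap)
  also have "\<dots> = (\<Sum>l\<in>UNIV. \<Sum>i\<in>UNIV. \<Sum>j\<in>UNIV. qmul (a$i$l) (b$l$j) \<bullet> c$i$j)"
    by (rule sum.swap)
  also have "\<dots> = (\<Sum>l\<in>UNIV. \<Sum>j\<in>UNIV. \<Sum>i\<in>UNIV. qmul (a$i$l) (b$l$j) \<bullet> c$i$j)"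
    by (intro sum.cong refl sum.swap)
  also have "\<dots> = b \<bullet> mmul (madj a) c"
    by (simp add: inner_mat mmul_nth inner_sum_right inner_qmul_left)
  finally show ?thesis .
qed

lemma inner_madj [simp]: "madj a \<bullet> madj b = a \<bullet> b"
proof -
  have *: "qconj p \<bullet> qconj q = p \<bullet> q" for p q by (simp add: inner_scal)
  show ?thesis unfolding inner_mat madj_nth * by (rule sum.swap)
qed

lemma inner_madj_left: "madj a \<bullet> b = a \<bullet> madj b"
  using inner_madj[of a "madj b"] by simp

lemma inner_mmul_right: "mmul a b \<bullet> c = a \<bullet> mmul c (madj b)"
  using inner_mmul_left[of "madj b" "madj a" "madj c"]
  by (metis inner_madj madj_simps(1) madj_simps(2))

lemma norm_madj [simp]: "norm (madj a) = norm a"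
  by (simp add: norm_eq_sqrt_inner)

lemma norm_mat_sq: "(norm (x::'q::finite mat))\<^sup>2 = (\<Sum>i\<in>UNIV. \<Sum>j\<in>UNIV. (norm (x$i$j))\<^sup>2)"
  by (simp add: power2_norm_eq_inner inner_mat)

lemma norm_mmul: "norm (mmul a b) \<le> norm a * norm (b :: 'q::finite mat)"
proof -
  have "(norm (mmul a b $ i $ j))\<^sup>2 \<le> (\<Sum>l\<in>UNIV. (norm (a$i$l))\<^sup>2) * (\<Sum>l\<in>UNIV. (norm (b$l$j))\<^sup>2)" for i j
  proof -
    have "norm (mmul a b $ i $ j) \<le> (\<Sum>l\<in>UNIV. norm (a$i$l) * norm (b$l$j))"
      unfolding mmul_nth by (rule order_trans[OF norm_sum]) (simp add: norm_qmul)
    then have "(norm (mmul a b $ i $ j))\<^sup>2 \<le> (\<Sum>l\<in>UNIV. norm (a$i$l) * norm (b$l$j))\<^sup>2"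
      by (simp add: power_mono)
    also have "\<dots> \<le> (\<Sum>l\<in>UNIV. (norm (a$i$l))\<^sup>2) * (\<Sum>l\<in>UNIV. (norm (b$l$j))\<^sup>2)"
      by (rule Cauchy_Schwarz_ineq_sum)
    finally show ?thesis .
  qed
  then have "(norm (mmul a b))\<^sup>2 \<le> (\<Sum>i\<in>UNIV. \<Sum>j\<in>UNIV. (\<Sum>l\<in>UNIV. (norm (a$i$l))\<^sup>2) * (\<Sum>l\<in>UNIV. (norm (b$l$j))\<^sup>2))"
    unfolding norm_mat_sq by (intro sum_mono)
  also have "\<dots> = (\<Sum>i\<in>UNIV. \<Sum>l\<in>UNIV. (norm (a$i$l))\<^sup>2) * (\<Sum>j\<in>UNIV. \<Sum>l\<in>UNIV. (norm (b$l$j))\<^sup>2)"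
    by (rule sum_product[symmetric])
  also have "(\<Sum>j\<in>UNIV. \<Sum>l\<in>UNIV. (norm (b$l$j))\<^sup>2) = (norm b)\<^sup>2"
    unfolding norm_mat_sq by (rule sum.swap)
  also have "(\<Sum>i\<in>UNIV. \<Sum>l\<in>UNIV. (norm (a$i$l))\<^sup>2) = (norm a)\<^sup>2"
    by (rule norm_mat_sq[symmetric])
  finally have "(norm (mmul a b))\<^sup>2 \<le> (norm a * norm b)\<^sup>2" by (simp only: power_mult_distrib)
  then show ?thesis by (rule power2_le_imp_le) simp
qed

lemma retr_eq_inner: "retr x = mid \<bullet> x"
proof -
  have *: "qone \<bullet> p = p$0" for p by (simp add: inner_scal)
  show ?thesis
    unfolding retr_def inner_mat mid_nth if_distrib[of "\<lambda>p. p \<bullet> _"] *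
    by (simp cong: if_cong)
qed

lemma inner_eq_retr: "a \<bullet> b = retr (mmul (madj a) b)"
  using inner_mmul_left[of "a" mid b] by (simp add: retr_eq_inner)

lemma retr_mmul_commute: "retr (mmul a b) = retr (mmul b a)"
  using inner_eq_retr[of "madj a" b] inner_eq_retr[of "madj b" a] inner_madj[of "madj a" b]
  by (metis inner_commute madj_simps(2))

lemma rdiag_mmul: "mmul (rdiag l) (rdiag m) = rdiag (\<lambda>i. l i * m i)"
  by (auto simp: mat_eq_iff mmul_nth rdiag_nth if_distrib[of "qmul _"] if_distrib[of "\<lambda>f. qmul f _"] cong: if_cong)

lemma rdiag_one: "rdiag (\<lambda>i. 1) = mid"
  by (simp add: mat_eq_iff rdiag_nth mid_nth)

lemma rdiag_linear: "rdiag (\<lambda>i. l i + m i) = rdiag l + rdiag m" "rdiag (\<lambda>i. t * l i) = t *\<^sub>R rdiag l"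
  "rdiag (\<lambda>i. l i - m i) = rdiag l - rdiag m"
  by (auto simp: mat_eq_iff rdiag_nth algebra_simps)

lemma rdiag_mmul_nth: "mmul (rdiag l) x $ i $ j = l i *\<^sub>R (x$i$j)"
  by (simp add: mmul_nth rdiag_nth if_distrib[of "\<lambda>f. qmul f _"] cong: if_cong)

lemma mmul_rdiag_nth: "mmul x (rdiag l) $ i $ j = l j *\<^sub>R (x$i$j)"
  by (simp add: mmul_nth rdiag_nth if_distrib[of "\<lambda>f. qmul _ f"] cong: if_cong)

section \<open>Left multiplication matrices\<close>

text \<open>Real matrix of multiplication by x on one column, with rows and columns indexed by a
  matrix index and a quaternion component. It is an injective ring homomorphism, so determinants and
  one-sided inverses can be taken from real matrices. All four components are kept for every d, so
  the size is always 4 times \<open>CARD('q)\<close>.\<close>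

definition lmat :: "'q::finite mat \<Rightarrow> real^('q \<times> 4)^('q \<times> 4)" where
  "lmat x = (\<chi> p r. qmul (x $ fst p $ fst r) (axis (snd r) 1) $ snd p)"

lemma qmul_expand: "qmul a b $ k = (\<Sum>m\<in>UNIV. qmul a (axis m 1) $ k * b $ m)"
proof -
  have "b = (\<Sum>m\<in>UNIV. (b$m) *\<^sub>R axis m 1)"
    using basis_expansion[of b] by (simp add: scalar_mult_eq_scaleR)
  then have "qmul a b = (\<Sum>m\<in>UNIV. (b$m) *\<^sub>R qmul a (axis m 1))"
    using qmul_sum_right[of a "\<lambda>m. (b$m) *\<^sub>R axis m 1" UNIV] by (simp only: qmul_linear_simps)
  then show ?thesis by (simp add: sum_component mult.commute)
qed

lemma lmat_mmul: "lmat (mmul x y) = lmat x ** lmat y"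
proof -
  have "qmul (mmul x y $ i $ j) (axis m 1) $ k =
     (\<Sum>r\<in>UNIV. qmul (x$i$fst r) (axis (snd r) 1) $ k * qmul (y$fst r$j) (axis m 1) $ snd r)" for i j k m
  proof -
    have "qmul (mmul x y $ i $ j) (axis m 1) $ k = (\<Sum>l\<in>UNIV. qmul (x$i$l) (qmul (y$l$j) (axis m 1)) $ k)"
      by (simp add: mmul_nth qmul_sum_left qmul_assoc)
    also have "\<dots> = (\<Sum>l\<in>UNIV. \<Sum>n\<in>UNIV. qmul (x$i$l) (axis n 1) $ k * qmul (y$l$j) (axis m 1) $ n)"
      by (intro sum.cong refl qmul_expand)
    also have "\<dots> = (\<Sum>r\<in>UNIV \<times> UNIV. qmul (x$i$fst r) (axis (snd r) 1) $ k * qmul (y$fst r$j) (axis m 1) $ snd r)"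
      by (simp add: sum.cartesian_product case_prod_beta)
    finally show ?thesis by simp
  qed
  then show ?thesis
    by (simp add: lmat_def matrix_matrix_mult_def vec_eq_iff)
qed

lemma lmat_linear: "lmat (x + y) = lmat x + lmat y" "lmat (t *\<^sub>R x) = t *\<^sub>R lmat x"
  by (simp_all add: lmat_def vec_eq_iff)

lemma lmat_rdiag: "lmat (rdiag l) = (\<chi> p r. if p = r then l (fst p) else 0)"
  by (auto simp: lmat_def vec_eq_iff rdiag_nth axis_def)

text \<open>Each real eigenvalue occurs once per quaternion component, hence the fourth power for
  all three fields alike.\<close>

lemma det_lmat_rdiag:
  fixes l :: "'q::finite \<Rightarrow> real"
  shows "det (lmat (rdiag l)) = (\<Prod>i\<in>UNIV. l i) ^ 4"
proof -
  have "det (lmat (rdiag l)) = (\<Prod>p\<in>(UNIV::('q \<times> 4) set). l (fst p))"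
    by (subst det_diagonal) (auto simp: lmat_rdiag intro!: prod.cong)
  also have "\<dots> = (\<Prod>i\<in>UNIV. \<Prod>k\<in>(UNIV::4 set). l i)"
    by (simp add: prod.cartesian_product case_prod_beta del: prod_constant)
  also have "\<dots> = (\<Prod>i\<in>UNIV. l i) ^ 4" by (simp add: prod_power_distrib)
  finally show ?thesis .
qed

lemma lmat_mid: "lmat mid = mat 1"
  unfolding rdiag_one[symmetric] lmat_rdiag by (simp add: mat_def vec_eq_iff)

lemma qone_eq_axis: "qone = axis 0 1"
  by (simp add: vec_eq_iff axis_def)

lemma lmat_inj: "lmat x = lmat y \<Longrightarrow> x = y"
proof (simp add: mat_eq_iff, intro allI)
  fix i j assume "lmat x = lmat y"
  then have "lmat x $ (i,k) $ (j,0) = lmat y $ (i,k) $ (j,0)" for k by simp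
  then have "qmul (x$i$j) qone $ k = qmul (y$i$j) qone $ k" for k
    unfolding qone_eq_axis by (simp add: lmat_def)
  then show "x$i$j = y$i$j" by (simp add: vec_eq_iff)
qed

lemma mmul_left_right_inverse: "mmul x y = mid \<Longrightarrow> mmul y x = (mid :: 'q::finite mat)"
  by (metis lmat_inj lmat_mid lmat_mmul matrix_left_right_inverse)

lemma det_lmat_mmul: "det (lmat (mmul x y)) = det (lmat x) * det (lmat y)"
  by (simp add: lmat_mmul det_mul)

lemma continuous_on_det_lmat:
  fixes A :: "'q::finite mat set"
  shows "continuous_on A (\<lambda>x. det (lmat x))"
proof -
  have "linear (\<lambda>x::'q mat. lmat x $ p $ r)" for p r :: "'q \<times> 4"
    by (simp add: linear_iff lmat_linear)
  then show ?thesis unfolding det_def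
    by (intro continuous_intros linear_continuous_on linear_conv_bounded_linear[THEN iffD1])
qed

text \<open>A maximiser of the Rayleigh quotient on the unit sphere of V is an eigenvector. Being
  about real subspaces, this serves all three fields.\<close>

lemma selfadjoint_eigenvector:
  fixes f :: "'a::euclidean_space \<Rightarrow> 'a"
  assumes V: "subspace V" "V \<noteq> {0}" and f: "linear f" "f ` V \<subseteq> V"
    and sa: "\<And>v w. v \<in> V \<Longrightarrow> w \<in> V \<Longrightarrow> v \<bullet> f w = f v \<bullet> w"
  obtains v c where "v \<in> V" "norm v = 1" "f v = c *\<^sub>R v"
proof -
  let ?K = "V \<inter> sphere 0 1"
  obtain w where w: "w \<in> V" "w \<noteq> 0" using V subspace_0 by blast
  then have "(1 / norm w) *\<^sub>R w \<in> ?K" using V(1) by (simp add: subspace_scale)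
  then have ne: "?K \<noteq> {}" by blast
  have "continuous_on ?K (\<lambda>v. v \<bullet> f v)"
    using f(1) by (intro continuous_intros linear_continuous_on linear_conv_bounded_linear[THEN iffD1])
  moreover have "compact ?K" by (intro closed_Int_compact closed_subspace V) simp
  ultimately obtain v where v: "v \<in> ?K" and max: "\<And>w. w \<in> ?K \<Longrightarrow> w \<bullet> f w \<le> v \<bullet> f v"
    using continuous_attains_sup[OF _ ne] by blast
  define c where "c = v \<bullet> f v"
  have le: "w \<bullet> f w \<le> c * (norm w)\<^sup>2" if "w \<in> V" for w
  proof (cases "w = 0")
    case False
    let ?z = "(1 / norm w) *\<^sub>R w"
    have "?z \<bullet> f ?z \<le> c" unfolding c_def using that False V(1)
      by (intro max) (simp add: subspace_scale)
    then show ?thesis using False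
      by (simp add: linear_cmul[OF f(1)] power2_eq_square field_simps)
  qed (simp add: linear_0[OF f(1)])
  define g where "g = f v - c *\<^sub>R v"
  have gV: "g \<in> V" unfolding g_def using v f(2) V(1) by (auto intro: subspace_diff subspace_scale)
  \<comment> \<open>Maximality of v along the line v + t g. The linear coefficient is twice |g|^2
    because g is the first variation; such a quadratic can be nonpositive for all t only if g =
    0.\<close>
  have q: "2 * t * (norm g)\<^sup>2 + t\<^sup>2 * (g \<bullet> f g - c * (norm g)\<^sup>2) \<le> 0" for t
  proof -
    have "v + t *\<^sub>R g \<in> V" using v gV V(1) by (auto intro: subspace_add subspace_scale)
    from le[OF this] have "(v + t *\<^sub>R g) \<bullet> f (v + t *\<^sub>R g) \<le> c * (norm (v + t *\<^sub>R g))\<^sup>2" .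
    moreover have "v \<bullet> f g = f v \<bullet> g" using sa v gV by auto
    moreover have "v \<bullet> v = 1" using v by (simp add: norm_eq_sqrt_inner)
    moreover have "(norm g)\<^sup>2 = g \<bullet> f v - c * (g \<bullet> v)"
      unfolding power2_norm_eq_inner by (subst (2) g_def) (simp add: inner_simps)
    ultimately show ?thesis
      by (simp add: linear_add[OF f(1)] linear_cmul[OF f(1)] power2_norm_eq_inner inner_simps c_def[symmetric])
        (simp add: algebra_simps inner_commute power2_eq_square)
  qed
  have "g = 0"
  proof (rule ccontr)
    assume "g \<noteq> 0"
    then have p: "(norm g)\<^sup>2 > 0" by simp
    \<comment> \<open>b exceeds the absolute value of the quadratic coefficient. After division by
      t, the choice t = |g|^2 / b lets the quadratic part cancel at most half of 2 |g|^2.\<close>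
    define b where "b = \<bar>g \<bullet> f g - c * (norm g)\<^sup>2\<bar> + 1"
    define t where "t = (norm g)\<^sup>2 / b"
    have b: "b > 0" unfolding b_def by linarith
    then have t: "t > 0" using p by (simp add: t_def)
    have "t * (2 * (norm g)\<^sup>2 + t * (g \<bullet> f g - c * (norm g)\<^sup>2)) \<le> 0"
      using q[of t] by (simp add: algebra_simps power2_eq_square)
    then have "2 * (norm g)\<^sup>2 + t * (g \<bullet> f g - c * (norm g)\<^sup>2) \<le> 0"
      using t by (simp add: mult_le_0_iff)
    moreover have "t * (g \<bullet> f g - c * (norm g)\<^sup>2) \<ge> t * (- b)"
      using t by (intro mult_left_mono) (auto simp: b_def)
    moreover have "t * b = (norm g)\<^sup>2" using b by (simp add: t_def)
    ultimately show False using p by simp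
  qed
  then show ?thesis using that[of v c] v by (auto simp: g_def)
qed

section \<open>Matrices over the chosen field and the positive semidefinite cone\<close>

locale field_dim =
  fixes d :: nat
  assumes d: "d \<in> {1, 2, 4}"
begin

text \<open>\<open>comps d\<close> spans R, C or H inside the quaternions, and each of these is
  closed under multiplication.\<close>

lemma qmul_comps:
  assumes "\<And>k. k \<notin> comps d \<Longrightarrow> a$k = 0" "\<And>k. k \<notin> comps d \<Longrightarrow> b$k = 0" "k \<notin> comps d"
  shows "qmul a b $ k = 0"
proof -
  have "\<forall>k. k \<notin> comps d \<longrightarrow> qmul a b $ k = 0"
    using d assms(1,2) unfolding comps_def by (auto simp: forall_4' split: if_splits)
  then show ?thesis using assms(3) by blast
qed

lemma zero_in_comps: "0 \<in> comps d" by (simp add: comps_def)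

lemma card_comps: "card (comps d) = d"
  using d by (auto simp: comps_def)

lemma In_M_simps [simp]:
  "In_M d 0" "In_M d mid" "In_M d (rdiag l)"
  "In_M d x \<Longrightarrow> In_M d (madj x)"
  "In_M d x \<Longrightarrow> In_M d (t *\<^sub>R x)" "In_M d x \<Longrightarrow> In_M d (- x)"
  "In_M d x \<Longrightarrow> In_M d y \<Longrightarrow> In_M d (x + y)"
  "In_M d x \<Longrightarrow> In_M d y \<Longrightarrow> In_M d (x - y)"
  "In_M d x \<Longrightarrow> In_M d y \<Longrightarrow> In_M d (mmul x y)"
  using zero_in_comps
  by (auto simp: In_M_def mid_nth rdiag_nth mmul_nth intro!: sum.neutral qmul_comps)

lemma Herm_simps [simp]:
  "0 \<in> Herm d" "mid \<in> Herm d" "rdiag l \<in> Herm d"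
  "x \<in> Herm d \<Longrightarrow> t *\<^sub>R x \<in> Herm d" "x \<in> Herm d \<Longrightarrow> y \<in> Herm d \<Longrightarrow> x + y \<in> Herm d"
  "x \<in> Herm d \<Longrightarrow> y \<in> Herm d \<Longrightarrow> x - y \<in> Herm d"
  "In_M d g \<Longrightarrow> x \<in> Herm d \<Longrightarrow> mmul g (mmul x (madj g)) \<in> Herm d"
  by (auto simp: Herm_def mmul_assoc)

lemma Herm_D [simp]: "x \<in> Herm d \<Longrightarrow> In_M d x" "x \<in> Herm d \<Longrightarrow> madj x = x"
  by (auto simp: Herm_def)

lemma inner_mmul_self:
  "m \<bullet> mmul x m =
     (\<Sum>k\<in>UNIV. (\<Sum>i\<in>UNIV. \<Sum>j\<in>UNIV. qmul (qmul (qconj (m$i$k)) (x$i$j)) (m$j$k)) $ 0)"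
proof -
  have *: "p \<bullet> qmul y q = qmul (qmul (qconj p) y) q $ 0" for p q y
    by (simp add: inner_scal algebra_simps)
  have "m \<bullet> mmul x m = (\<Sum>i\<in>UNIV. \<Sum>k\<in>UNIV. \<Sum>j\<in>UNIV. qmul (qmul (qconj (m$i$k)) (x$i$j)) (m$j$k) $ 0)"
    unfolding inner_mat mmul_nth inner_sum_right * ..
  also have "\<dots> = (\<Sum>k\<in>UNIV. \<Sum>i\<in>UNIV. \<Sum>j\<in>UNIV. qmul (qmul (qconj (m$i$k)) (x$i$j)) (m$j$k) $ 0)"
    by (rule sum.swap)
  finally show ?thesis by (simp only: sum_component)
qed

text \<open>The definition tests the quadratic form on vectors, this version on whole matrices m,
  where it is the sum of the forms at the columns of m. For the converse the vector v is repeated in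
  every column, which multiplies the form by \<open>CARD('q)\<close>. The matrix version fits the
  adjunction rules.\<close>

lemma PiQ_iff:
  "(x::'q::finite mat) \<in> PiQ d \<longleftrightarrow> x \<in> Herm d \<and> (\<forall>m. In_M d m \<longrightarrow> 0 \<le> m \<bullet> mmul x m)"
proof safe
  assume x: "x \<in> PiQ d"
  then show "x \<in> Herm d" by (simp add: PiQ_def)
  fix m :: "'q mat" assume m: "In_M d m"
  have "0 \<le> (\<Sum>i\<in>UNIV. \<Sum>j\<in>UNIV. qmul (qmul (qconj (m$i$k)) (x$i$j)) (m$j$k)) $ 0" for k
  proof -
    have "\<forall>i n. n \<notin> comps d \<longrightarrow> (\<chi> i. m$i$k) $ i $ n = 0"
      using m by (simp add: In_M_def)
    with x have "0 \<le> (\<Sum>i\<in>UNIV. \<Sum>j\<in>UNIV.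
       qmul (qmul (qconj ((\<chi> i. m$i$k)$i)) (x$i$j)) ((\<chi> i. m$i$k)$j)) $ 0"
      unfolding PiQ_def by blast
    then show ?thesis by (simp only: vec_lambda_beta)
  qed
  then show "0 \<le> m \<bullet> mmul x m" unfolding inner_mmul_self by (rule sum_nonneg)
next
  assume x: "x \<in> Herm d" "\<forall>m. In_M d m \<longrightarrow> 0 \<le> m \<bullet> mmul x m"
  have "0 \<le> (\<Sum>i\<in>UNIV. \<Sum>j\<in>UNIV. qmul (qmul (qconj (v$i)) (x$i$j)) (v$j)) $ 0"
    if v: "\<forall>i k. k \<notin> comps d \<longrightarrow> v$i$k = 0" for v :: "real^4^'q"
  proof -
    have "In_M d (\<chi> i j. v$i)" using v by (simp add: In_M_def)
    then have "0 \<le> (\<chi> i j. v$i) \<bullet> mmul x (\<chi> i j. v$i)" using x by blast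
    also have "(\<chi> i j. v$i) \<bullet> mmul x (\<chi> i j. v$i) =
        (\<Sum>k\<in>(UNIV::'q set). (\<Sum>i\<in>UNIV. \<Sum>j\<in>UNIV. qmul (qmul (qconj (v$i)) (x$i$j)) (v$j)) $ 0)"
      unfolding inner_mmul_self vec_lambda_beta ..
    finally have "0 \<le> real CARD('q) * (\<Sum>i\<in>UNIV. \<Sum>j\<in>UNIV. qmul (qmul (qconj (v$i)) (x$i$j)) (v$j)) $ 0"
      by (simp only: sum_constant)
    moreover have "0 \<le> c * y \<Longrightarrow> 0 < c \<Longrightarrow> 0 \<le> y" for c y :: real by (simp add: zero_le_mult_iff)
    moreover have "0 < real CARD('q)" by simp
    ultimately show ?thesis by blast
  qed
  then show "x \<in> PiQ d" using x(1) unfolding PiQ_def by blast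
qed

lemma PiQ_Herm [simp]: "x \<in> PiQ d \<Longrightarrow> x \<in> Herm d" by (simp add: PiQ_iff)

lemma PiQ_nonneg: "x \<in> PiQ d \<Longrightarrow> In_M d m \<Longrightarrow> 0 \<le> m \<bullet> mmul x m" unfolding PiQ_iff by blast

lemma PiQ_simps [simp]:
  "0 \<in> PiQ d" "mid \<in> PiQ d" "x \<in> PiQ d \<Longrightarrow> 0 \<le> t \<Longrightarrow> t *\<^sub>R x \<in> PiQ d"
  "x \<in> PiQ d \<Longrightarrow> y \<in> PiQ d \<Longrightarrow> x + y \<in> PiQ d"
  by (auto simp: PiQ_iff inner_simps simp del: PiQ_Herm)

lemma inner_conj: "m \<bullet> mmul (mmul g (mmul x (madj g))) m = mmul (madj g) m \<bullet> mmul x (mmul (madj g) m)"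
  by (simp add: mmul_assoc inner_mmul_left)

lemma PiQ_conj: "In_M d g \<Longrightarrow> x \<in> PiQ d \<Longrightarrow> mmul g (mmul x (madj g)) \<in> PiQ d"
  unfolding PiQ_iff inner_conj by (simp del: PiQ_Herm)

lemma PiQ_mmul_madj: "In_M d g \<Longrightarrow> mmul g (madj g) \<in> PiQ d"
  using PiQ_conj[of g mid] by simp

lemma PiQ_square: "x \<in> Herm d \<Longrightarrow> mmul x x \<in> PiQ d"
  using PiQ_mmul_madj[of x] by simp

lemma OmegaQ_iff:
  "(x::'q::finite mat) \<in> OmegaQ d \<longleftrightarrow>
     x \<in> Herm d \<and> (\<exists>e>0. \<forall>m. In_M d m \<longrightarrow> e * (norm m)\<^sup>2 \<le> m \<bullet> mmul x m)"
proof safe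
  assume x: "x \<in> OmegaQ d"
  then show xH: "x \<in> Herm d" by (simp add: OmegaQ_def)
  from x obtain e where e: "e > 0" "\<And>y. y \<in> Herm d \<Longrightarrow> dist y x < e \<Longrightarrow> y \<in> PiQ d"
    by (auto simp: OmegaQ_def)
  \<comment> \<open>Small enough that x - c I still lies within distance e of x; semidefiniteness of
    that matrix is the uniform lower bound with constant c.\<close>
  define c where "c = e / (2 * (norm (mid :: 'q mat) + 1))"
  have c: "c > 0" using e by (simp add: c_def add_nonneg_pos)
  have "c * norm (mid :: 'q mat) < c * (2 * (norm (mid :: 'q mat) + 1))"
    by (intro mult_strict_left_mono c) (simp add: algebra_simps add_nonneg_pos)
  also have "\<dots> = e" using norm_ge_zero[of "mid :: 'q mat"] by (simp add: c_def add_nonneg_eq_0_iff)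
  finally have "x - c *\<^sub>R mid \<in> PiQ d"
    using xH c by (intro e) (simp_all add: dist_norm)
  then have "c * (norm m)\<^sup>2 \<le> m \<bullet> mmul x m" if "In_M d m" for m
    using that by (auto simp: PiQ_iff inner_simps power2_norm_eq_inner simp del: PiQ_Herm)
  then show "\<exists>e>0. \<forall>m. In_M d m \<longrightarrow> e * (norm m)\<^sup>2 \<le> m \<bullet> mmul x m" using c by blast
next
  fix e :: real assume xH: "x \<in> Herm d" and e: "e > 0" "\<forall>m. In_M d m \<longrightarrow> e * (norm m)\<^sup>2 \<le> m \<bullet> mmul x m"
  have *: "y \<in> PiQ d" if "y \<in> Herm d" "dist y x < e" for y
    unfolding PiQ_iff
  proof safe
    fix m :: "'q mat" assume m: "In_M d m"
    have "\<bar>m \<bullet> mmul (y - x) m\<bar> \<le> norm m * norm (mmul (y - x) m)" by (rule Cauchy_Schwarz_ineq2)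
    also have "\<dots> \<le> norm m * (norm (y - x) * norm m)" by (intro mult_left_mono norm_mmul) simp
    also have "\<dots> \<le> norm m * (e * norm m)" using that(2)
      by (intro mult_left_mono mult_right_mono) (simp_all add: dist_norm)
    also have "\<dots> \<le> m \<bullet> mmul x m" using e(2) m by (simp add: power2_eq_square ac_simps)
    finally show "0 \<le> m \<bullet> mmul y m" by (simp add: inner_simps)
  qed fact
  moreover have "x \<in> PiQ d" using * xH e by simp
  ultimately show "x \<in> OmegaQ d" using e(1) unfolding OmegaQ_def by blast
qed

lemma OmegaQ_PiQ [simp]: "x \<in> OmegaQ d \<Longrightarrow> x \<in> PiQ d" by (simp add: OmegaQ_def)

text \<open>Since m = \<open>mmul (madj h) (mmul (madj g) m)\<close>, the lower bound for x passes
  to the conjugate at the price of the factor (|h| + 1)^2.\<close>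

lemma OmegaQ_conj:
  assumes g: "In_M d g" "In_M d h" "mmul g h = mid" and x: "(x::'q::finite mat) \<in> OmegaQ d"
  shows "mmul g (mmul x (madj g)) \<in> OmegaQ d"
proof -
  from x obtain e where e: "e > 0" "\<And>m. In_M d m \<Longrightarrow> e * (norm m)\<^sup>2 \<le> m \<bullet> mmul x m" and xH: "x \<in> Herm d"
    unfolding OmegaQ_iff by blast
  define c where "c = e / (norm h + 1)\<^sup>2"
  have h1: "0 < (norm h + 1)\<^sup>2" using norm_ge_zero[of h] by (intro zero_less_power) linarith
  have c: "c > 0" using e h1 by (simp add: c_def)
  have "c * (norm m)\<^sup>2 \<le> m \<bullet> mmul (mmul g (mmul x (madj g))) m" if m: "In_M d m" for m
  proof -
    have "mmul (madj h) (madj g) = mid" using g(3) by (metis madj_simps(1) madj_simps(8))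
    then have "m = mmul (madj h) (mmul (madj g) m)" by (simp add: mmul_assoc[symmetric])
    then have "norm m \<le> norm (madj h) * norm (mmul (madj g) m)" by (metis norm_mmul)
    also have "\<dots> \<le> (norm h + 1) * norm (mmul (madj g) m)" by (intro mult_right_mono) simp_all
    finally have "(norm m)\<^sup>2 \<le> (norm h + 1)\<^sup>2 * (norm (mmul (madj g) m))\<^sup>2"
      by (metis norm_ge_zero power_mono power_mult_distrib)
    then have "c * (norm m)\<^sup>2 \<le> c * ((norm h + 1)\<^sup>2 * (norm (mmul (madj g) m))\<^sup>2)"
      using c by (intro mult_left_mono) simp_all
    also have "\<dots> = e * (norm (mmul (madj g) m))\<^sup>2" using h1 by (simp add: c_def)
    also have "\<dots> \<le> m \<bullet> mmul (mmul g (mmul x (madj g))) m"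
      unfolding inner_conj using g m by (intro e(2)) simp
    finally show ?thesis .
  qed
  then show ?thesis unfolding OmegaQ_iff using g xH c by auto
qed

section \<open>Spectral decomposition\<close>

text \<open>Orthonormal eigenvectors are collected one column at a time. A vector is stored as a
  matrix whose only nonzero column is j, so a partial result is a matrix whose columns outside S
  vanish, and appending a column is adding a matrix. The eigenvalues come out real, so they commute
  with the scalars and may stand on the right in \<open>mmul u (rdiag l)\<close>.\<close>

lemma spectral_columns:
  assumes x: "(x::'q::finite mat) \<in> Herm d"
  shows "finite S \<Longrightarrow> \<exists>u l. In_M d u \<and> (\<forall>i j. j \<notin> S \<longrightarrow> u$i$j = 0) \<and>
     mmul (madj u) u = rdiag (\<lambda>i. if i \<in> S then 1 else 0) \<and> mmul x u = mmul u (rdiag l)"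
proof (induction S rule: finite_induct)
  case empty
  show ?case by (rule exI[of _ 0]) (auto simp: mat_eq_iff rdiag_nth)
next
  case (insert j S)
  then obtain u l where u: "In_M d u" "\<And>i k. k \<notin> S \<Longrightarrow> u$i$k = 0"
    "mmul (madj u) u = rdiag (\<lambda>i. if i \<in> S then 1 else 0)" "mmul x u = mmul u (rdiag l)" by blast
  define C where "C = {m::'q mat. In_M d m \<and> (\<forall>i k. k \<noteq> j \<longrightarrow> m$i$k = 0)}"
  define V where "V = {m \<in> C. mmul (madj u) m = 0}"
  have C: "subspace C" unfolding C_def by (auto intro!: subspaceI)
  have V: "subspace V" using C unfolding V_def by (auto intro!: subspaceI simp: subspace_add subspace_0 subspace_scale)
  have mC: "mmul y m \<in> C" if "In_M d y" "m \<in> C" for y m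
    using that by (auto simp: C_def mmul_nth)
  have lin: "linear (mmul y)" for y :: "'q mat" by (simp add: linear_iff)
  \<comment> \<open>If V were trivial, multiplication by \<open>madj u\<close> would be injective on
    C and hence onto by dimension. But column j of u is still zero, so the (j, j) entry of
    \<open>mmul (madj u) m\<close> vanishes and the unit in that place is not reached.\<close>
  have "V \<noteq> {0}"
  proof
    assume V0: "V = {0}"
    let ?f = "mmul (madj u)"
    have inj: "inj_on ?f C"
      using V0 C by (intro linear_inj_on_iff_eq_0[THEN iffD2] lin) (auto simp: V_def)
    have "?f ` C \<subseteq> C" using mC u(1) by auto
    moreover have "dim (?f ` C) = dim C" using inj C lin by (metis dim_image_eq span_eq_iff)
    ultimately have "?f ` C = C"
      using C lin by (intro subspace_dim_equal) (auto intro: linear_subspace_image)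
    moreover have "(\<chi> i k. if i = j \<and> k = j then qone else 0) \<in> C"
      using zero_in_comps by (auto simp: C_def In_M_def)
    ultimately obtain m where "(\<chi> i k. if i = j \<and> k = j then qone else 0) = ?f m" by blast
    from this[THEN arg_cong, of "\<lambda>z. z$j$j"] have "qone = (\<Sum>l\<in>UNIV. qmul (qconj (u$l$j)) (m$l$j))"
      by (simp add: mmul_nth)
    also have "\<dots> = 0" using u(2)[of j] insert.hyps by simp
    finally show False by (simp add: scal_eq_iff)
  qed
  moreover have "mmul x ` V \<subseteq> V"
  proof safe
    fix m assume m: "m \<in> V"
    have "mmul (madj u) (mmul x m) = mmul (madj (mmul x u)) m" using x by (simp add: mmul_assoc)
    also have "\<dots> = mmul (rdiag l) (mmul (madj u) m)" by (simp add: u mmul_assoc)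
    finally show "mmul x m \<in> V" using m mC x by (simp add: V_def)
  qed
  moreover have "v \<bullet> mmul x w = mmul x v \<bullet> w" for v w using x by (simp add: inner_mmul_left)
  ultimately obtain m c where m: "m \<in> V" "norm m = 1" "mmul x m = c *\<^sub>R m"
    by (metis selfadjoint_eigenvector[OF V _ lin])
  have mj: "\<And>i k. k \<noteq> j \<Longrightarrow> m$i$k = 0" and mM: "In_M d m" and um: "mmul (madj u) m = 0"
    using m by (auto simp: V_def C_def)
  have mu: "mmul (madj m) u = 0" using um by (metis madj_simps(1) madj_simps(2) madj_simps(6))
  \<comment> \<open>The product of a scalar with its conjugate is real, so |m| = 1 already makes the
    (j, j) entry equal to the unit.\<close>
  have mm: "mmul (madj m) m = rdiag (\<lambda>i. if i = j then 1 else 0)"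
  proof -
    have "(\<Sum>l\<in>UNIV. qmul (qconj (m$l$j)) (m$l$j)) = (\<Sum>l\<in>UNIV. (norm (m$l$j))\<^sup>2) *\<^sub>R qone"
      by (simp add: qmul_qconj_self scaleR_sum_left)
    also have "(\<Sum>l\<in>UNIV. (norm (m$l$j))\<^sup>2) = (norm m)\<^sup>2"
    proof -
      have "(\<Sum>k\<in>UNIV. (norm (m$i$k))\<^sup>2) = (norm (m$i$j))\<^sup>2" for i
        by (subst sum.remove[of _ j]) (auto simp: mj)
      then show ?thesis by (simp add: norm_mat_sq)
    qed
    finally have jj: "(\<Sum>l\<in>UNIV. qmul (qconj (m$l$j)) (m$l$j)) = qone" by (simp add: m)
    show ?thesis
      unfolding mat_eq_iff mmul_nth rdiag_nth madj_nth
    proof (intro allI)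
      fix i k
      show "(\<Sum>l\<in>UNIV. qmul (qconj (m$l$i)) (m$l$k)) = (if i = k then (if i = j then 1 else 0) *\<^sub>R qone else 0)"
        by (cases "i = j"; cases "k = j") (auto simp: jj mj)
    qed
  qed
  have "In_M d (u + m)" using u mM by simp
  moreover have "\<forall>i k. k \<notin> insert j S \<longrightarrow> (u + m)$i$k = 0" using u mj by auto
  moreover have "mmul (madj (u + m)) (u + m) = rdiag (\<lambda>i. if i \<in> insert j S then 1 else 0)"
    using insert.hyps by (auto simp: u um mu mm mat_eq_iff rdiag_nth)
  moreover have "mmul x (u + m) = mmul (u + m) (rdiag (l(j := c)))"
    using insert.hyps u(2) mj by (auto simp: u(4) m mat_eq_iff mmul_rdiag_nth)
  ultimately show ?case by blast
qed

lemma unitary_right: "unitary d u \<Longrightarrow> mmul u (madj u) = mid"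
  unfolding unitary_def using mmul_left_right_inverse by blast

lemma unitary_left: "unitary d u \<Longrightarrow> mmul (madj u) u = mid" by (simp add: unitary_def)

lemma unitary_In_M [simp]: "unitary d u \<Longrightarrow> In_M d u" by (simp add: unitary_def)

lemma unitary_cancel:
  assumes "unitary d u"
  shows "mmul u (mmul (madj u) x) = x" "mmul (madj u) (mmul u x) = x"
  using assms by (simp_all add: mmul_assoc[symmetric] unitary_right unitary_left)

lemma spectral:
  assumes x: "(x::'q::finite mat) \<in> Herm d"
  obtains u l where "unitary d u" "x = mmul u (mmul (rdiag l) (madj u))"
proof -
  obtain u l where u: "In_M d u" "mmul (madj u) u = rdiag (\<lambda>i. if i \<in> (UNIV::'q set) then 1 else 0)"
    "mmul x u = mmul u (rdiag l)" using spectral_columns[OF x finite] by blast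
  then have un: "unitary d u" by (simp add: unitary_def rdiag_one)
  have "x = mmul (mmul x u) (madj u)" using un by (simp add: mmul_assoc unitary_right)
  then have "x = mmul u (mmul (rdiag l) (madj u))" by (simp add: u mmul_assoc)
  then show ?thesis using that un by blast
qed

lemma inner_mmul_rdiag: "m \<bullet> mmul (rdiag l) m = (\<Sum>i\<in>UNIV. l i * (\<Sum>j\<in>UNIV. (norm (m$i$j))\<^sup>2))"
  by (simp add: inner_mat rdiag_mmul_nth power2_norm_eq_inner sum_distrib_left)

lemma PiQ_rdiag: "rdiag l \<in> PiQ d \<longleftrightarrow> (\<forall>i. 0 \<le> l (i::'q::finite))"
proof
  assume l: "rdiag l \<in> PiQ d"
  show "\<forall>i. 0 \<le> l i"
  proof
    fix i
    have "0 \<le> rdiag (\<lambda>j. if j = i then 1 else 0) \<bullet> mmul (rdiag l) (rdiag (\<lambda>j. if j = i then 1 else 0))"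
      using l by (intro PiQ_nonneg) simp_all
    also have "\<dots> = l i"
    proof -
      have "(\<Sum>j\<in>UNIV. (norm (rdiag (\<lambda>j. if j = i then 1 else 0) $ k $ j))\<^sup>2) = (if k = i then 1 else 0)" for k
        by (subst sum.remove[of _ k]) (auto simp: rdiag_nth norm_eq_sqrt_inner inner_scal)
      then show ?thesis unfolding inner_mmul_rdiag by (subst sum.remove[of _ i]) auto
    qed
    finally show "0 \<le> l i" .
  qed
next
  assume "\<forall>i. 0 \<le> l i"
  then show "rdiag l \<in> PiQ d" unfolding PiQ_iff inner_mmul_rdiag by (auto intro!: sum_nonneg mult_nonneg_nonneg)
qed

lemma rdiag_OmegaQ:
  assumes "\<And>i. 0 < l (i::'q::finite)" shows "rdiag l \<in> OmegaQ d"
proof -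
  have "Min (range l) > 0" using assms by (subst Min_gr_iff) auto
  moreover have "Min (range l) * (norm m)\<^sup>2 \<le> m \<bullet> mmul (rdiag l) m" for m
    unfolding inner_mmul_rdiag norm_mat_sq sum_distrib_left[of "Min _"]
    by (intro sum_mono) (auto simp: sum_distrib_left[symmetric] intro!: mult_right_mono sum_nonneg)
  ultimately show ?thesis unfolding OmegaQ_iff using Herm_simps(3) by blast
qed

lemma conj_unitary_iff:
  assumes "unitary d u"
  shows "mmul u (mmul x (madj u)) \<in> PiQ d \<longleftrightarrow> x \<in> PiQ d"
  using PiQ_conj[of u x] PiQ_conj[of "madj u" "mmul u (mmul x (madj u))"] assms
  by (auto simp: mmul_assoc unitary_cancel unitary_left)

lemma spectral_psd:
  assumes x: "(x::'q::finite mat) \<in> PiQ d"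
  obtains u l where "unitary d u" "\<And>i. 0 \<le> l i" "x = mmul u (mmul (rdiag l) (madj u))"
proof -
  obtain u l where u: "unitary d u" "x = mmul u (mmul (rdiag l) (madj u))"
    using x spectral PiQ_Herm by blast
  then have "rdiag l \<in> PiQ d" using x conj_unitary_iff by blast
  then show ?thesis using that u by (auto simp: PiQ_rdiag)
qed

section \<open>The determinant\<close>

lemma det_lmat_spectral:
  assumes "unitary d u" shows "det (lmat (mmul u (mmul (rdiag l) (madj u)))) = (\<Prod>i\<in>UNIV. l i) ^ 4"
proof -
  have "det (lmat u) * det (lmat (madj u)) = 1"
    using det_lmat_mmul[of u "madj u"] unitary_right[OF assms] by (simp add: lmat_mid)
  then show ?thesis by (simp add: det_lmat_mmul det_lmat_rdiag)
qed

text \<open>Independence of the decomposition: the fourth power of the eigenvalue product is the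
  determinant of \<open>lmat\<close>, and a fourth root is unique among nonnegative numbers. The
  argument loses signs, hence the restriction to nonnegative eigenvalues.\<close>

lemma Delta_spectral:
  assumes u: "unitary d u" and l: "\<And>i. 0 \<le> l (i::'q::finite)"
  shows "Delta d (mmul u (mmul (rdiag l) (madj u))) = (\<Prod>i\<in>UNIV. l i)"
  unfolding Delta_def
proof (rule the_equality)
  let ?x = "mmul u (mmul (rdiag l) (madj u))"
  fix p assume "\<exists>u l. unitary d u \<and> ?x = mmul u (mmul (rdiag l) (madj u)) \<and> p = (\<Prod>i\<in>UNIV. l i)"
  then obtain u' l' where u': "unitary d u'" "?x = mmul u' (mmul (rdiag l') (madj u'))"
    and p: "p = (\<Prod>i\<in>UNIV. l' i)" by blast
  have "?x \<in> PiQ d" using u l by (simp add: conj_unitary_iff PiQ_rdiag)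
  then have "\<And>i. 0 \<le> l' i" unfolding u'(2) using u' by (simp add: conj_unitary_iff PiQ_rdiag)
  then have "0 \<le> p" unfolding p by (intro prod_nonneg) simp
  moreover have "0 \<le> (\<Prod>i\<in>UNIV. l i)" using l by (intro prod_nonneg) simp
  moreover have "p ^ 4 = (\<Prod>i\<in>UNIV. l i) ^ 4"
    unfolding p using det_lmat_spectral[OF u] det_lmat_spectral[OF u'(1)] u'(2) by metis
  ultimately show "p = (\<Prod>i\<in>UNIV. l i)" by (metis power_eq_imp_eq_base zero_less_numeral)
qed (use u in blast)

lemma Delta_nonneg: "(x::'q::finite mat) \<in> PiQ d \<Longrightarrow> 0 \<le> Delta d x"
  by (erule spectral_psd) (auto simp: Delta_spectral intro!: prod_nonneg)

lemma Delta_pow4: "(x::'q::finite mat) \<in> PiQ d \<Longrightarrow> Delta d x ^ 4 = det (lmat x)"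
  by (erule spectral_psd) (auto simp: Delta_spectral det_lmat_spectral)

lemma Delta_eqI:
  assumes "(x::'q::finite mat) \<in> PiQ d" "0 \<le> p" "p ^ 4 = det (lmat x)"
  shows "Delta d x = p"
  using assms Delta_nonneg Delta_pow4 by (metis power_eq_imp_eq_base zero_less_numeral)

lemma Delta_rdiag: "(\<And>i. 0 \<le> l (i::'q::finite)) \<Longrightarrow> Delta d (rdiag l) = (\<Prod>i\<in>UNIV. l i)"
  by (intro Delta_eqI) (auto simp: PiQ_rdiag det_lmat_rdiag intro!: prod_nonneg)

lemma Delta_mid [simp]: "Delta d (mid :: 'q::finite mat) = 1"
  unfolding rdiag_one[symmetric] by (simp add: Delta_rdiag)

lemma Delta_conj:
  assumes g: "In_M d g" and x: "(x::'q::finite mat) \<in> PiQ d"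
  shows "Delta d (mmul g (mmul x (madj g))) = Delta d (mmul g (madj g)) * Delta d x"
proof (intro Delta_eqI PiQ_conj g x mult_nonneg_nonneg Delta_nonneg PiQ_mmul_madj)
  have "det (lmat (mmul g (mmul x (madj g)))) = det (lmat (mmul g (madj g))) * det (lmat x)"
    by (simp add: det_lmat_mmul)
  then show "(Delta d (mmul g (madj g)) * Delta d x) ^ 4 = det (lmat (mmul g (mmul x (madj g))))"
    using g x by (simp add: power_mult_distrib Delta_pow4 PiQ_mmul_madj)
qed

text \<open>On the cone \<open>Delta\<close> is the fourth root of a polynomial in the entries,
  which is continuous regardless of how the eigenvalues move.\<close>

lemma continuous_on_Delta: "continuous_on (PiQ d) (Delta d :: 'q::finite mat \<Rightarrow> real)"
proof -
  have "continuous_on (PiQ d :: 'q mat set) (\<lambda>x. root 4 (det (lmat x)))"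
    by (intro continuous_intros continuous_on_det_lmat)
  then show ?thesis
    by (rule continuous_on_eq) (simp add: Delta_pow4[symmetric] real_root_power_cancel Delta_nonneg)
qed

text \<open>Interior points have eigenvalues bounded below by e, because x - e I is still
  semidefinite; conversely a positive product of nonnegative eigenvalues has no zero factor.\<close>

lemma OmegaQ_iff_Delta: "(x::'q::finite mat) \<in> OmegaQ d \<longleftrightarrow> x \<in> PiQ d \<and> Delta d x > 0"
proof safe
  assume x: "x \<in> OmegaQ d"
  then show P: "x \<in> PiQ d" by simp
  then obtain u l where u: "unitary d u" "\<And>i. 0 \<le> l i" "x = mmul u (mmul (rdiag l) (madj u))"
    by (rule spectral_psd) blast
  from x obtain e where e: "e > 0" "\<And>m. In_M d m \<Longrightarrow> e * (norm m)\<^sup>2 \<le> m \<bullet> mmul x m" unfolding OmegaQ_iff by blast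
  have "x - e *\<^sub>R mid \<in> PiQ d" using P e unfolding PiQ_iff by (auto simp: inner_simps power2_norm_eq_inner)
  also have "x - e *\<^sub>R mid = mmul u (mmul (rdiag (\<lambda>i. l i - e * 1)) (madj u))"
    unfolding rdiag_linear rdiag_one using u by (simp add: unitary_right)
  finally have "\<And>i. e \<le> l i" using u by (auto simp: conj_unitary_iff PiQ_rdiag)
  then have "\<And>i. 0 < l i" using e less_le_trans by blast
  then show "0 < Delta d x" using u by (auto simp: Delta_spectral intro!: prod_pos)
next
  assume x: "x \<in> PiQ d" "0 < Delta d x"
  then obtain u l where u: "unitary d u" "\<And>i. 0 \<le> l i" "x = mmul u (mmul (rdiag l) (madj u))"
    by (metis spectral_psd)
  then have p: "(\<Prod>i\<in>UNIV. l i) \<noteq> 0" using x Delta_spectral[of u l] by (metis less_irrefl)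
  have "l i \<noteq> 0" for i
    using p prod_zero[of UNIV l] by (metis UNIV_I finite)
  then have "\<And>i. 0 < l i" using u(2) by (metis less_eq_real_def)
  then show "x \<in> OmegaQ d" unfolding u(3) using u(1)
    by (intro OmegaQ_conj[where h = "madj u"] rdiag_OmegaQ) (auto simp: unitary_right)
qed

section \<open>Square roots\<close>

lemma PiQ_sqrt_exists:
  assumes "(x::'q::finite mat) \<in> PiQ d" obtains s where "s \<in> PiQ d" "mmul s s = x"
proof -
  obtain u l where u: "unitary d u" "\<And>i. 0 \<le> l i" "x = mmul u (mmul (rdiag l) (madj u))"
    using assms by (metis spectral_psd)
  let ?s = "mmul u (mmul (rdiag (\<lambda>i. sqrt (l i))) (madj u))"
  have "?s \<in> PiQ d" using u by (simp add: conj_unitary_iff PiQ_rdiag)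
  moreover have "mmul ?s ?s = x"
    using u by (simp add: mmul_assoc unitary_cancel) (simp add: mmul_assoc[symmetric] rdiag_mmul)
  ultimately show ?thesis using that by blast
qed

lemma PiQ_inner_zero:
  assumes x: "(x::'q::finite mat) \<in> PiQ d" and m: "m \<bullet> mmul x m = 0"
  shows "mmul x m = 0"
proof -
  obtain s where s: "s \<in> PiQ d" "mmul s s = x" using x by (metis PiQ_sqrt_exists)
  then have "mmul s m \<bullet> mmul s m = 0"
    using m by (simp add: inner_mmul_left mmul_assoc[symmetric])
  then show ?thesis unfolding s(2)[symmetric] by (simp add: mmul_assoc)
qed

text \<open>With e = s - t one has s e + e t = s^2 - t^2 = 0. Pairing with e gives two nonnegative
  terms with sum zero, so s and t both annihilate e, hence e^2 = 0 and e = 0.\<close>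

lemma PiQ_sqrt_unique:
  assumes s: "(s::'q::finite mat) \<in> PiQ d" and t: "t \<in> PiQ d" and eq: "mmul s s = mmul t t"
  shows "s = t"
proof -
  define e where "e = s - t"
  have e: "e \<in> Herm d" using s t by (simp add: e_def)
  have "mmul s e + mmul e t = 0" using eq by (simp add: e_def)
  then have "e \<bullet> mmul s e + e \<bullet> mmul e t = 0" by (metis inner_add_right inner_zero_right)
  moreover have "e \<bullet> mmul e t = e \<bullet> mmul t e"
    using e t inner_madj[of e "mmul e t"] by simp
  moreover have "0 \<le> e \<bullet> mmul s e" "0 \<le> e \<bullet> mmul t e" using s t e by (auto intro: PiQ_nonneg)
  ultimately have "mmul s e = 0" "mmul t e = 0" using s t by (auto intro!: PiQ_inner_zero)
  then have "mmul e e = 0" by (simp add: e_def)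
  then have "e \<bullet> e = 0" using e inner_mmul_left[of e mid e] by simp
  then show ?thesis by (simp add: e_def)
qed

lemma msqrt_eqI: "(s::'q::finite mat) \<in> PiQ d \<Longrightarrow> mmul s s = r \<Longrightarrow> msqrt d r = s"
  unfolding msqrt_def by (rule the_equality) (auto intro: PiQ_sqrt_unique)

lemma msqrt_PiQ [simp]: "(r::'q::finite mat) \<in> PiQ d \<Longrightarrow> msqrt d r \<in> PiQ d"
  by (metis PiQ_sqrt_exists msqrt_eqI)

lemma msqrt_square [simp]: "(r::'q::finite mat) \<in> PiQ d \<Longrightarrow> mmul (msqrt d r) (msqrt d r) = r"
  by (metis PiQ_sqrt_exists msqrt_eqI)

lemma norm_sq_eq_retr: "x \<in> Herm d \<Longrightarrow> (norm x)\<^sup>2 = retr (mmul x x)"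
  by (simp add: power2_norm_eq_inner inner_eq_retr)

lemma retr_conj_unitary: "unitary d u \<Longrightarrow> retr (mmul u (mmul x (madj u))) = retr x"
  by (subst retr_mmul_commute) (simp add: mmul_assoc unitary_left)

lemma retr_rdiag: "retr (rdiag l) = (\<Sum>i\<in>UNIV. l i)"
  by (simp add: retr_def rdiag_nth)

lemma norm_le_retr:
  assumes "(x::'q::finite mat) \<in> PiQ d" shows "norm x \<le> retr x"
proof -
  obtain u l where u: "unitary d u" "\<And>i. 0 \<le> l i" "x = mmul u (mmul (rdiag l) (madj u))"
    using assms by (metis spectral_psd)
  have r: "retr x = (\<Sum>i\<in>UNIV. l i)" unfolding u(3) using u by (simp add: retr_conj_unitary retr_rdiag)
  have "mmul x x = mmul u (mmul (rdiag (\<lambda>i. l i * l i)) (madj u))"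
    using u by (simp add: mmul_assoc unitary_cancel) (simp add: mmul_assoc[symmetric] rdiag_mmul)
  then have "(norm x)\<^sup>2 = (\<Sum>i\<in>UNIV. l i * l i)"
    using assms u by (simp add: norm_sq_eq_retr retr_conj_unitary retr_rdiag)
  also have "\<dots> \<le> (\<Sum>i\<in>UNIV. l i * (\<Sum>j\<in>UNIV. l j))"
    using u(2) by (intro sum_mono mult_left_mono member_le_sum) auto
  also have "\<dots> = (retr x)\<^sup>2" by (simp add: r power2_eq_square sum_distrib_right)
  finally show ?thesis by (rule power2_le_imp_le) (simp only: r sum_nonneg u(2))
qed

lemma subspace_In_M: "subspace {x. In_M d (x::'q::finite mat)}"
  by (auto intro!: subspaceI)

lemma subspace_Herm: "subspace (Herm d :: 'q::finite mat set)"
  by (auto intro!: subspaceI)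

lemmas closed_In_M = closed_subspace[OF subspace_In_M]
lemmas closed_Herm = closed_subspace[OF subspace_Herm]

lemma closed_PiQ: "closed (PiQ d :: 'q::finite mat set)"
proof -
  have *: "PiQ d = Herm d \<inter> (\<Inter>m\<in>{m. In_M d m}. {x::'q mat. 0 \<le> m \<bullet> mmul x m})"
    by (rule set_eqI) (unfold PiQ_iff, blast)
  have "closed {x::'q mat. 0 \<le> m \<bullet> mmul x m}" for m
    by (intro closed_Collect_le continuous_on_const continuous_on_inner continuous_on_mmul continuous_on_id)
  then show ?thesis unfolding * by (intro closed_Int closed_Herm closed_INT ballI)
qed

lemma continuous_on_retr: "continuous_on A retr"
  unfolding retr_eq_inner by (intro continuous_intros)

text \<open>Squaring is a continuous injection on the cone, so on a compact piece K its inverse is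
  continuous. The squared norm of a root is the trace of its square, so all roots of points near x
  lie in one such K.\<close>

lemma continuous_on_msqrt: "continuous_on (PiQ d) (msqrt d :: 'q::finite mat \<Rightarrow> _)"
proof -
  let ?sq = "\<lambda>s::'q mat. mmul s s"
  have "continuous (at x within PiQ d) (msqrt d)" if x: "x \<in> PiQ d" for x :: "'q mat"
  proof -
    define R where "R = retr x + 1"
    define K :: "'q mat set" where "K = PiQ d \<inter> {s. (norm s)\<^sup>2 \<le> R}"
    have "K \<subseteq> cball 0 (max 1 R)"
    proof
      fix s assume "s \<in> K"
      then have "(norm s)\<^sup>2 \<le> R" by (simp add: K_def)
      then have "norm s \<le> max 1 R"
        using self_le_power[of "norm s" 2] by (cases "norm s \<le> 1") auto
      then show "s \<in> cball 0 (max 1 R)" by simp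
    qed
    moreover have "closed K" unfolding K_def
      by (intro closed_Int closed_PiQ closed_Collect_le continuous_intros)
    ultimately have K: "compact K" by (metis bounded_cball bounded_subset compact_eq_bounded_closed)
    have "continuous_on (?sq ` K) (msqrt d)"
      by (rule continuous_on_inv[OF _ K]) (auto intro!: continuous_intros msqrt_eqI simp: K_def)
    moreover have sub: "PiQ d \<inter> {y. retr y < R} \<subseteq> ?sq ` K"
    proof
      fix y :: "'q mat" assume y: "y \<in> PiQ d \<inter> {y. retr y < R}"
      then have "msqrt d y \<in> K" using norm_sq_eq_retr[of "msqrt d y"] by (simp add: K_def)
      then show "y \<in> ?sq ` K" using y by (intro image_eqI[of _ _ "msqrt d y"]) simp_all
    qed
    ultimately have "continuous (at x within PiQ d \<inter> {y. retr y < R}) (msqrt d)"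
      using x by (intro continuous_on_imp_continuous_within[OF continuous_on_subset[OF _ sub]]) (auto simp: R_def)
    moreover have "at x within PiQ d \<inter> {y. retr y < R} = at x within PiQ d"
      by (rule at_within_nhd[where S = "{y. retr y < R}"])
        (auto simp: R_def intro!: open_Collect_less continuous_on_retr continuous_intros)
    ultimately show ?thesis by simp
  qed
  then show ?thesis by (simp add: continuous_on_eq_continuous_within)
qed

end

section \<open>Translation invariant measures on subspaces\<close>

text \<open>Haar measure of the additive group V, kept as a Borel measure on the ambient space so
  that linear maps of the space act by \<open>distr\<close>. Translation invariance determines it up
  to a factor, which replaces Jacobian computations: a linear bijection of V multiplies L by a
  constant, and one set decides which.\<close>

locale haar_on =
  fixes V :: "'a::euclidean_space set" and L :: "'a measure"
  assumes sets_L [simp, measurable_cong]: "sets L = sets borel"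
    and V: "subspace V"
    and AE_V: "AE x in L. x \<in> V"
    and trans: "\<And>a. a \<in> V \<Longrightarrow> distr L borel ((+) a) = L"
    and fin: "\<And>r. emeasure L (cball 0 r) < \<infinity>"
    and pos: "\<And>r. r > 0 \<Longrightarrow> emeasure L (ball 0 r) > 0"
begin

lemma space_L [simp]: "space L = UNIV"
  using sets_eq_imp_space_eq[OF sets_L] by simp

lemma V_borel [measurable]: "V \<in> sets borel"
  using V by (simp add: borel_closed closed_subspace)

sublocale sigma_finite_measure L
proof
  show "\<exists>A. countable A \<and> A \<subseteq> sets L \<and> \<Union> A = space L \<and> (\<forall>a\<in>A. emeasure L a \<noteq> \<infinity>)"
  proof (intro exI[of _ "range (\<lambda>n::nat. cball 0 (real n))"] conjI)
    show "\<Union> (range (\<lambda>n::nat. cball 0 (real n))) = space L"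
      by (auto intro: real_arch_simple)
    show "\<forall>a\<in>range (\<lambda>n::nat. cball 0 (real n)). emeasure L a \<noteq> \<infinity>"
      using fin by (auto simp: less_top)
  qed auto
qed

lemma nn_integral_trans:
  assumes "a \<in> V" and [measurable]: "f \<in> borel_measurable borel"
  shows "(\<integral>\<^sup>+x. f (a + x) \<partial>L) = (\<integral>\<^sup>+x. f x \<partial>L)"
proof -
  have "(\<integral>\<^sup>+x. f x \<partial>L) = (\<integral>\<^sup>+x. f x \<partial>distr L borel ((+) a))" using trans assms by simp
  also have "\<dots> = (\<integral>\<^sup>+x. f (a + x) \<partial>L)" by (subst nn_integral_distr) auto
  finally show ?thesis by simp
qed

lemma plus_L [measurable, simp]: "(+) b \<in> borel_measurable L"
  by (simp add: measurable_cong_sets[OF sets_L refl])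

lemma emeasure_ball_ne_0: "r > 0 \<Longrightarrow> emeasure L (ball 0 r) \<noteq> 0"
  using pos[of r] by simp

lemma emeasure_ball_ne_top: "emeasure L (ball 0 r) \<noteq> \<infinity>"
proof -
  have "emeasure L (ball 0 r) \<le> emeasure L (cball 0 r)" by (intro emeasure_mono) auto
  then show ?thesis using fin[of r] by (auto simp: top_unique)
qed

end

text \<open>Fubini for the function B(y) A(y + x) on the product of L and M, with B the unit ball:
  shifting x gives L(B) M(A), shifting y and then x gives M(B) L(A). The claim is cross-multiplied
  to stay clear of division in \<open>ennreal\<close>.\<close>

lemma haar_on_unique:
  assumes "haar_on V L" "haar_on V M" and A [measurable]: "A \<in> sets borel"
  shows "emeasure M A * emeasure L (ball 0 1) = emeasure M (ball 0 1) * emeasure L A"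
proof -
  interpret L: haar_on V L by fact
  interpret M: haar_on V M by fact
  interpret P: pair_sigma_finite L M ..
  let ?A = "indicator A :: 'a \<Rightarrow> ennreal" and ?B = "indicator (ball 0 1) :: 'a \<Rightarrow> ennreal"
  have [measurable]: "ball 0 1 \<in> sets (borel :: 'a measure)" by simp
  have "(\<lambda>p. ?B (fst p) * ?A (fst p + snd p)) \<in> borel_measurable (borel \<Otimes>\<^sub>M borel)"
    "(\<lambda>p. ?B (fst p - snd p) * ?A (fst p)) \<in> borel_measurable (borel \<Otimes>\<^sub>M borel)" by measurable
  then have m: "(\<lambda>(y, x). ?B y * ?A (y + x)) \<in> borel_measurable (L \<Otimes>\<^sub>M M)"
    "(\<lambda>(y, x). ?B (y - x) * ?A y) \<in> borel_measurable (L \<Otimes>\<^sub>M M)"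
    by (simp_all add: measurable_cong_sets[OF sets_pair_measure_cong[OF L.sets_L M.sets_L] refl] case_prod_beta')
  have "emeasure M A * emeasure L (ball 0 1) = (\<integral>\<^sup>+y. ?B y * emeasure M A \<partial>L)"
    by (subst nn_integral_multc) (auto simp: mult.commute intro!: borel_measurable_indicator)
  also have "\<dots> = (\<integral>\<^sup>+y. ?B y * (\<integral>\<^sup>+x. ?A (y + x) \<partial>M) \<partial>L)"
    by (rule nn_integral_cong_AE) (use L.AE_V in eventually_elim, simp add: M.nn_integral_trans)
  also have "\<dots> = (\<integral>\<^sup>+y. (\<integral>\<^sup>+x. ?B y * ?A (y + x) \<partial>M) \<partial>L)"
    by (simp add: nn_integral_cmult)
  also have "\<dots> = (\<integral>\<^sup>+x. (\<integral>\<^sup>+y. ?B y * ?A (y + x) \<partial>L) \<partial>M)"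
    by (rule P.Fubini'[symmetric]) (rule m)
  also have "\<dots> = (\<integral>\<^sup>+x. (\<integral>\<^sup>+y. ?B (y - x) * ?A y \<partial>L) \<partial>M)"
  proof (rule nn_integral_cong_AE, use M.AE_V in eventually_elim)
    fix x assume "x \<in> V"
    then have "- x \<in> V" using L.V by (simp add: subspace_neg)
    from L.nn_integral_trans[OF this, of "\<lambda>y. ?B y * ?A (y + x)"]
    show "(\<integral>\<^sup>+y. ?B y * ?A (y + x) \<partial>L) = (\<integral>\<^sup>+y. ?B (y - x) * ?A y \<partial>L)" by simp
  qed
  also have "\<dots> = (\<integral>\<^sup>+y. (\<integral>\<^sup>+x. ?B (y - x) * ?A y \<partial>M) \<partial>L)"
    by (rule P.Fubini') (rule m)
  also have "\<dots> = (\<integral>\<^sup>+y. emeasure M (ball 0 1) * ?A y \<partial>L)"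
  proof (rule nn_integral_cong_AE, use L.AE_V in eventually_elim)
    fix y assume y: "y \<in> V"
    have "(\<integral>\<^sup>+x. ?B (y - x) * ?A y \<partial>M) = (\<integral>\<^sup>+x. ?B (y - x) \<partial>M) * ?A y"
      by (rule nn_integral_multc) measurable
    \<comment> \<open>Translation by y turns y - x into - x, and the ball is symmetric.\<close>
    also have "(\<integral>\<^sup>+x. ?B (y - x) \<partial>M) = (\<integral>\<^sup>+x. ?B (y - (y + x)) \<partial>M)"
      by (rule M.nn_integral_trans[OF y, symmetric]) measurable
    also have "\<dots> = (\<integral>\<^sup>+x. ?B x \<partial>M)" by (intro nn_integral_cong) (auto simp: indicator_def)
    finally show "(\<integral>\<^sup>+x. ?B (y - x) * ?A y \<partial>M) = emeasure M (ball 0 1) * ?A y" by simp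
  qed
  also have "\<dots> = emeasure M (ball 0 1) * emeasure L A" by (simp add: nn_integral_cmult)
  finally show ?thesis .
qed

context haar_on
begin

lemma linear_borel [measurable]: "linear T \<Longrightarrow> T \<in> borel_measurable borel" for T :: "'a \<Rightarrow> 'a"
  by (intro borel_measurable_continuous_onI linear_continuous_on linear_conv_bounded_linear[THEN iffD1])

lemma linear_L: "linear T \<Longrightarrow> T \<in> borel_measurable L" for T :: "'a \<Rightarrow> 'a"
  by (simp add: linear_borel measurable_cong_sets[OF sets_L refl])

lemma haar_on_image:
  assumes T: "linear T" "T ` V = V" "inj_on T V"
  shows "haar_on V (distr L borel T)"
proof
  have [simp, measurable]: "T \<in> borel_measurable borel" "T \<in> borel_measurable L"
    using T(1) linear_borel linear_L by auto
  have bl: "bounded_linear T" using T(1) linear_conv_bounded_linear by blast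
  show "AE x in distr L borel T. x \<in> V"
    by (subst AE_distr_iff) (use AE_V T(2) in \<open>auto elim!: eventually_mono\<close>)
  show "distr (distr L borel T) borel ((+) a) = distr L borel T" if a: "a \<in> V" for a
  proof -
    obtain b where b: "b \<in> V" "a = T b" using a T(2) by (metis imageE)
    have "distr (distr L borel T) borel ((+) a) = distr (distr L borel ((+) b)) borel T"
      by (subst (1 2) distr_distr) (auto simp: comp_def b linear_add[OF T(1)])
    then show ?thesis using trans b by simp
  qed
  fix r :: real
  \<comment> \<open>Injectivity on a finite-dimensional space gives a lower norm bound, so preimages
    of balls are bounded within V and have finite measure.\<close>
  obtain c where c: "c > 0" "\<And>x. x \<in> V \<Longrightarrow> c * norm x \<le> norm (T x)"
    using injective_imp_isometric[OF closed_subspace[OF V] V bl] T linear_inj_on_iff_eq_0[OF T(1) V]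
    by blast
  have "emeasure L (T -` cball 0 r) \<le> emeasure L (cball 0 (r / c))"
    by (rule emeasure_mono_AE) (use AE_V c in \<open>auto elim!: eventually_mono simp: field_simps intro: order_trans\<close>)
  then show "emeasure (distr L borel T) (cball 0 r) < \<infinity>"
    using fin[of "r / c"] by (subst emeasure_distr) (auto intro: le_less_trans)
  assume r: "r > 0"
  obtain B where B: "B > 0" "\<And>x. norm (T x) \<le> norm x * B"
    using bounded_linear.pos_bounded[OF bl] by blast
  have "0 < emeasure L (ball 0 (r / B))" using r B by (intro pos) simp
  also have "\<dots> \<le> emeasure L (T -` ball 0 r)"
  proof (intro emeasure_mono subsetI)
    fix x :: 'a assume "x \<in> ball 0 (r / B)"
    then have "norm x * B < r" using B by (simp add: field_simps)
    then show "x \<in> T -` ball 0 r" using B(2)[of x] by auto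
  qed (use measurable_sets_borel[of T borel "ball 0 r"] in simp)
  finally show "0 < emeasure (distr L borel T) (ball 0 r)" by (subst emeasure_distr) auto
qed (use V in auto)

text \<open>The image measure is again invariant and gives the unit ball the same mass, so
  uniqueness identifies it with L.\<close>

lemma distr_isometry:
  assumes T: "linear T" "T ` V = V" "\<And>x. x \<in> V \<Longrightarrow> norm (T x) = norm x"
  shows "distr L borel T = L"
proof (rule measure_eqI)
  have [simp, measurable]: "T \<in> borel_measurable borel" "T \<in> borel_measurable L"
    using T(1) linear_borel linear_L by auto
  have "inj_on T V" using T(3) linear_inj_on_iff_eq_0[OF T(1) V] by (metis norm_eq_zero)
  then have H: "haar_on V (distr L borel T)" using T haar_on_image by blast
  have "emeasure (distr L borel T) (ball 0 1) = emeasure L (T -` ball 0 1)"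
    by (subst emeasure_distr) auto
  also have "\<dots> = emeasure L (ball 0 1)"
    by (rule emeasure_eq_AE) (use AE_V T measurable_sets_borel[of T borel "ball 0 1"] in \<open>auto elim!: eventually_mono\<close>)
  finally have "emeasure (distr L borel T) (ball 0 1) = emeasure L (ball 0 1)" .
  then have "emeasure L (ball 0 1) * emeasure (distr L borel T) A = emeasure L (ball 0 1) * emeasure L A"
    if "A \<in> sets (distr L borel T)" for A
    using haar_on_unique[OF haar_on_axioms H, of A] that by (simp add: mult.commute)
  then show "emeasure (distr L borel T) A = emeasure L A" if "A \<in> sets (distr L borel T)" for A
    using that emeasure_ball_ne_0[of 1] emeasure_ball_ne_top[of 1]
    by (simp add: ennreal_mult_cancel_left)
qed simp

lemma nn_integral_isometry:
  assumes T: "linear T" "T ` V = V" "\<And>x. x \<in> V \<Longrightarrow> norm (T x) = norm x"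
    and [measurable]: "f \<in> borel_measurable borel"
  shows "(\<integral>\<^sup>+x. f (T x) \<partial>L) = (\<integral>\<^sup>+x. f x \<partial>L)"
proof -
  have [simp, measurable]: "T \<in> borel_measurable borel" "T \<in> borel_measurable L"
    using T(1) linear_borel linear_L by auto
  have "(\<integral>\<^sup>+x. f x \<partial>L) = (\<integral>\<^sup>+x. f x \<partial>distr L borel T)" using distr_isometry T by simp
  then show ?thesis by (simp add: nn_integral_distr)
qed

end

section \<open>Lebesgue measure in an orthogonal frame\<close>

text \<open>Lebesgue measure in the coordinates of an orthogonal family. The vectors are not
  normalised: off-diagonal coordinates of Hermitian matrices use vectors of squared norm 2, while
  the measure counts the coordinate itself.\<close>

locale frame =
  fixes I :: "'i set" and e :: "'i \<Rightarrow> 'a::euclidean_space"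
  assumes I: "finite I" and nz: "\<And>i. i \<in> I \<Longrightarrow> e i \<noteq> 0"
    and orth: "\<And>i j. i \<in> I \<Longrightarrow> j \<in> I \<Longrightarrow> i \<noteq> j \<Longrightarrow> e i \<bullet> e j = 0"
begin

definition "comb f = (\<Sum>i\<in>I. f i *\<^sub>R e i)"
definition "F = range comb"
definition "leb = distr (PiM I (\<lambda>_. lborel)) borel comb"

sublocale product_sigma_finite "\<lambda>_. lborel :: real measure" by standard

lemma measurable_comb [measurable]: "comb \<in> borel_measurable (PiM I (\<lambda>_. lborel))"
  unfolding comb_def[abs_def] by measurable

lemma comb_restrict: "comb (restrict f I) = comb f" unfolding comb_def by (intro sum.cong) auto

lemma comb_add: "comb (\<lambda>i. f i + g i) = comb f + comb g"
  by (simp add: comb_def algebra_simps sum.distrib)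

lemma comb_scale: "comb (\<lambda>i. t * f i) = t *\<^sub>R comb f"
  by (simp add: comb_def scaleR_sum_right)

lemma subspace_F: "subspace F"
  unfolding F_def
proof (rule subspaceI)
  show "0 \<in> range comb" by (rule image_eqI[of _ _ "\<lambda>_. 0"]) (auto simp: comb_def)
qed (auto simp: comb_add[symmetric] comb_scale[symmetric])

lemma e_in_F: "i \<in> I \<Longrightarrow> e i \<in> F"
  unfolding F_def by (rule image_eqI[of _ _ "\<lambda>j. if j = i then 1 else 0"])
    (use I in \<open>auto simp: comb_def if_distrib[of "\<lambda>x. x *\<^sub>R _"] cong: if_cong\<close>)

lemma comb_F: "comb f \<in> F" by (simp add: F_def)

lemma comb_inner: "i \<in> I \<Longrightarrow> comb f \<bullet> e i = f i * (norm (e i))\<^sup>2"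
proof -
  assume i: "i \<in> I"
  have "comb f \<bullet> e i = (\<Sum>j\<in>I. f j * (e j \<bullet> e i))" by (simp add: comb_def inner_sum_left)
  also have "\<dots> = f i * (e i \<bullet> e i)" using I i orth by (subst sum.remove[of _ i]) auto
  finally show ?thesis by (simp add: power2_norm_eq_inner)
qed

lemma parseval: "y \<in> F \<Longrightarrow> (\<Sum>i\<in>I. ((e i /\<^sub>R norm (e i)) \<bullet> y)\<^sup>2) = (norm y)\<^sup>2"
proof -
  assume "y \<in> F"
  then obtain f where f: "y = comb f" by (auto simp: F_def)
  have "(norm y)\<^sup>2 = (\<Sum>i\<in>I. f i * (comb f \<bullet> e i))"
    unfolding f power2_norm_eq_inner by (subst (2) comb_def) (simp add: inner_sum_right)
  also have "\<dots> = (\<Sum>i\<in>I. ((e i /\<^sub>R norm (e i)) \<bullet> y)\<^sup>2)"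
  proof (rule sum.cong[OF refl])
    fix i assume i: "i \<in> I"
    show "f i * (comb f \<bullet> e i) = ((e i /\<^sub>R norm (e i)) \<bullet> y)\<^sup>2"
      using nz[OF i] comb_inner[OF i, of f] unfolding f
      by (simp add: inner_commute[of "e i"] power2_eq_square divide_simps)
  qed
  finally show ?thesis by simp
qed

lemma emeasure_leb: "A \<in> sets borel \<Longrightarrow> emeasure leb A = emeasure (PiM I (\<lambda>_. lborel)) (comb -` A \<inter> space (PiM I (\<lambda>_. lborel)))"
  unfolding leb_def by (rule emeasure_distr) simp_all

lemma PiM_translate:
  "distr (PiM I (\<lambda>_. lborel)) (PiM I (\<lambda>_. lborel)) (\<lambda>f. \<lambda>i\<in>I. a i + f i :: real) = PiM I (\<lambda>_. lborel)"
proof (rule PiM_eqI[OF I])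
  have [intro]: "(+) c -` S \<in> sets borel" if "S \<in> sets borel" for c :: real and S
    using measurable_sets_borel[OF _ that, of "(+) c"] by simp
  fix A :: "'i \<Rightarrow> real set" assume A: "\<And>i. i \<in> I \<Longrightarrow> A i \<in> sets lborel"
  have "emeasure (distr (PiM I (\<lambda>_. lborel)) (PiM I (\<lambda>_. lborel)) (\<lambda>f. \<lambda>i\<in>I. a i + f i)) (Pi\<^sub>E I A)
     = emeasure (PiM I (\<lambda>_. lborel)) (Pi\<^sub>E I (\<lambda>i. (+) (a i) -` A i))"
    using I A by (subst emeasure_distr)
      (auto intro!: arg_cong2[where f = emeasure] sets_PiM_I_finite simp: space_PiM PiE_iff)
  also have "\<dots> = (\<Prod>i\<in>I. emeasure lborel ((+) (a i) -` A i))"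
    using I A by (intro emeasure_PiM) auto
  also have "\<dots> = (\<Prod>i\<in>I. emeasure lborel (A i))"
  proof (rule prod.cong[OF refl])
    fix i assume "i \<in> I"
    then have "emeasure (distr lborel borel ((+) (a i))) (A i) = emeasure lborel ((+) (a i) -` A i)"
      using A by (subst emeasure_distr) auto
    then show "emeasure lborel ((+) (a i) -` A i) = emeasure lborel (A i)"
      by (simp add: lborel_distr_plus)
  qed
  finally show "emeasure (distr (PiM I (\<lambda>_. lborel)) (PiM I (\<lambda>_. lborel)) (\<lambda>f. \<lambda>i\<in>I. a i + f i)) (Pi\<^sub>E I A)
     = (\<Prod>i\<in>I. emeasure lborel (A i))" .
qed simp

sublocale haar_on F leb
proof
  show "sets leb = sets borel" by (simp add: leb_def)
  show "subspace F" by (rule subspace_F)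
  have [measurable]: "F \<in> sets borel" using subspace_F by (simp add: borel_closed closed_subspace)
  show "AE x in leb. x \<in> F"
    unfolding leb_def by (subst AE_distr_iff) (simp_all add: comb_F)
  show "distr leb borel ((+) a) = leb" if a: "a \<in> F" for a
  proof -
    obtain g where g: "a = comb g" using a by (auto simp: F_def)
    have "distr leb borel ((+) a) = distr (PiM I (\<lambda>_. lborel)) borel (\<lambda>f. comb g + comb f)"
      unfolding leb_def g by (subst distr_distr) (auto simp: comp_def)
    also have "\<dots> = distr (distr (PiM I (\<lambda>_. lborel)) (PiM I (\<lambda>_. lborel)) (\<lambda>f. \<lambda>i\<in>I. g i + f i)) borel comb"
      by (subst distr_distr) (auto simp: comp_def comb_restrict comb_add)
    finally show ?thesis by (simp add: PiM_translate leb_def)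
  qed
  fix r :: real
  have "emeasure leb (cball 0 r) \<le> emeasure (PiM I (\<lambda>_. lborel)) (Pi\<^sub>E I (\<lambda>i. {- r / norm (e i) .. r / norm (e i)}))"
  proof (subst emeasure_leb)
    show "emeasure (PiM I (\<lambda>_. lborel)) (comb -` cball 0 r \<inter> space (PiM I (\<lambda>_. lborel))) \<le>
       emeasure (PiM I (\<lambda>_. lborel)) (Pi\<^sub>E I (\<lambda>i. {- r / norm (e i) .. r / norm (e i)}))"
    proof (intro emeasure_mono subsetI PiE_I)
      fix f i assume f: "f \<in> comb -` cball 0 r \<inter> space (PiM I (\<lambda>_. lborel))" and i: "i \<in> I"
      have "\<bar>f i * (norm (e i))\<^sup>2\<bar> \<le> norm (comb f) * norm (e i)"
        unfolding comb_inner[OF i, symmetric] by (rule Cauchy_Schwarz_ineq2)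
      also have "\<dots> \<le> r * norm (e i)" using f by (intro mult_right_mono) auto
      finally have "\<bar>f i\<bar> * norm (e i) \<le> r"
        using nz[OF i] by (simp add: abs_mult power2_eq_square mult.assoc[symmetric])
      then have "\<bar>f i\<bar> \<le> r / norm (e i)" using nz[OF i] by (simp add: field_simps)
      then show "f i \<in> {- r / norm (e i) .. r / norm (e i)}" by auto
    qed (use I in \<open>auto simp: space_PiM PiE_iff extensional_def intro!: sets_PiM_I_finite\<close>)
  qed simp
  also have "\<dots> < \<infinity>"
    using I by (subst emeasure_PiM) (simp_all add: emeasure_lborel_Icc_eq prod_ennreal)
  finally show "emeasure leb (cball 0 r) < \<infinity>" .
  assume r: "r > 0"
  define \<delta> where "\<delta> = r / (2 * ((\<Sum>i\<in>I. norm (e i)) + 1))"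
  have s: "(\<Sum>i\<in>I. norm (e i)) + 1 > 0" by (intro add_nonneg_pos sum_nonneg) auto
  have \<delta>: "\<delta> > 0" using r s by (simp add: \<delta>_def)
  have "0 < emeasure (PiM I (\<lambda>_. lborel)) (Pi\<^sub>E I (\<lambda>i. {-\<delta>..\<delta>}))"
    using I \<delta> by (subst emeasure_PiM) (simp_all add: emeasure_lborel_Icc_eq ennreal_power)
  also have "\<dots> \<le> emeasure leb (ball 0 r)"
  proof (subst emeasure_leb)
    show "emeasure (PiM I (\<lambda>_. lborel)) (Pi\<^sub>E I (\<lambda>i. {-\<delta>..\<delta>})) \<le>
      emeasure (PiM I (\<lambda>_. lborel)) (comb -` ball 0 r \<inter> space (PiM I (\<lambda>_. lborel)))"
    proof (intro emeasure_mono subsetI)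
      fix f assume f: "f \<in> Pi\<^sub>E I (\<lambda>i. {-\<delta>..\<delta>})"
      have "norm (comb f) \<le> (\<Sum>i\<in>I. \<delta> * norm (e i))"
        unfolding comb_def
      proof (rule sum_norm_le)
        fix i assume "i \<in> I"
        then have "\<bar>f i\<bar> \<le> \<delta>" using f by (auto simp: PiE_iff abs_le_iff)
        then show "norm (f i *\<^sub>R e i) \<le> \<delta> * norm (e i)" by (simp add: mult_right_mono)
      qed
      also have "\<dots> = \<delta> * (\<Sum>i\<in>I. norm (e i))" by (simp add: sum_distrib_left)
      also have "\<dots> < \<delta> * (2 * ((\<Sum>i\<in>I. norm (e i)) + 1))"
        using \<delta> s by (intro mult_strict_left_mono) auto
      also have "\<dots> = r" using s by (simp add: \<delta>_def)
      finally show "f \<in> comb -` ball 0 r \<inter> space (PiM I (\<lambda>_. lborel))"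
        using f by (auto simp: space_PiM PiE_iff)
    qed measurable
  qed simp
  finally show "0 < emeasure leb (ball 0 r)" .
qed

text \<open>Boxes are described by inner products with the \<open>e i\<close> rather than by
  coordinates, so that they are Borel sets of the whole space.\<close>

lemma emeasure_leb_box:
  assumes t: "\<And>i. i \<in> I \<Longrightarrow> t i > 0"
  shows "emeasure leb {x. \<forall>i\<in>I. 0 \<le> x \<bullet> e i \<and> x \<bullet> e i \<le> t i * (norm (e i))\<^sup>2} = ennreal (\<Prod>i\<in>I. t i)"
proof -
  have A: "closed {x. \<forall>i\<in>I. 0 \<le> x \<bullet> e i \<and> x \<bullet> e i \<le> t i * (norm (e i))\<^sup>2}"
  proof -
    have "{x. \<forall>i\<in>I. 0 \<le> x \<bullet> e i \<and> x \<bullet> e i \<le> t i * (norm (e i))\<^sup>2} =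
      (\<Inter>i\<in>I. {x. 0 \<le> x \<bullet> e i} \<inter> {x. x \<bullet> e i \<le> t i * (norm (e i))\<^sup>2})" by auto
    also have "closed \<dots>"
      by (intro closed_INT ballI closed_Int closed_Collect_le continuous_intros)
    finally show ?thesis .
  qed
  have "emeasure leb {x. \<forall>i\<in>I. 0 \<le> x \<bullet> e i \<and> x \<bullet> e i \<le> t i * (norm (e i))\<^sup>2} =
     emeasure (PiM I (\<lambda>_. lborel)) (Pi\<^sub>E I (\<lambda>i. {0..t i}))"
    using A by (subst emeasure_leb)
      (auto simp: comb_inner space_PiM PiE_iff zero_le_mult_iff nz intro!: arg_cong2[where f = emeasure])
  also have "\<dots> = (\<Prod>i\<in>I. ennreal (t i))"
    using I t by (subst emeasure_PiM) (auto intro!: prod.cong simp: less_imp_le)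
  also have "\<dots> = ennreal (\<Prod>i\<in>I. t i)" using t by (intro prod_ennreal) (auto simp: less_imp_le)
  finally show ?thesis .
qed

text \<open>The image of \<open>leb\<close> under T is invariant on F, hence a multiple of
  \<open>leb\<close>. The multiple is read off from the unit box, whose preimage is a box with sides
  1 / t i.\<close>

lemma nn_integral_diag:
  assumes T: "linear T" and t: "\<And>i. i \<in> I \<Longrightarrow> t i > 0" "\<And>i. i \<in> I \<Longrightarrow> T (e i) = t i *\<^sub>R e i"
    and f [measurable]: "f \<in> borel_measurable borel"
  shows "(\<integral>\<^sup>+x. f (T x) \<partial>leb) = ennreal (\<Prod>i\<in>I. 1 / t i) * (\<integral>\<^sup>+x. f x \<partial>leb)"
proof -
  have [simp, measurable]: "T \<in> borel_measurable borel" "T \<in> borel_measurable leb"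
    using T linear_borel linear_L by auto
  have Tc: "T (comb g) = comb (\<lambda>i. t i * g i)" for g
    using t by (simp add: comb_def linear_sum[OF T] linear_cmul[OF T] mult.commute)
  have "comb g \<in> T ` F" for g
  proof (rule image_eqI[of _ _ "comb (\<lambda>i. g i / t i)"])
    show "comb g = T (comb (\<lambda>i. g i / t i))"
      unfolding Tc unfolding comb_def using t by (intro sum.cong) (auto simp: less_imp_neq[THEN not_sym])
  qed (simp add: F_def)
  then have img: "T ` F = F" by (auto simp: F_def Tc)
  moreover have "inj_on T F"
  proof (rule linear_inj_on_iff_eq_0[THEN iffD2, OF T subspace_F], safe)
    fix x assume x: "x \<in> F" "T x = 0"
    then obtain g where g: "x = comb g" by (auto simp: F_def)
    have "g i = 0" if i: "i \<in> I" for i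
      using comb_inner[OF i, of "\<lambda>i. t i * g i"] x i t(1)[OF i] nz[OF i] by (auto simp: g Tc)
    then show "x = 0" by (simp add: g comb_def)
  qed
  ultimately have H: "haar_on F (distr leb borel T)" by (intro haar_on_image T)
  let ?A = "{x. \<forall>i\<in>I. 0 \<le> x \<bullet> e i \<and> x \<bullet> e i \<le> (norm (e i))\<^sup>2}"
  have Acl: "closed ?A"
  proof -
    have "?A = (\<Inter>i\<in>I. {x. 0 \<le> x \<bullet> e i} \<inter> {x. x \<bullet> e i \<le> (norm (e i))\<^sup>2})" by auto
    also have "closed \<dots>" by (intro closed_INT ballI closed_Int closed_Collect_le continuous_intros)
    finally show ?thesis .
  qed
  then have [measurable]: "?A \<in> sets borel" by simp
  have c: "emeasure (distr leb borel T) ?A = ennreal (\<Prod>i\<in>I. 1 / t i)"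
  proof -
    have "emeasure (distr leb borel T) ?A = emeasure leb (T -` ?A)" by (subst emeasure_distr) auto
    also have "\<dots> = emeasure leb {x. \<forall>i\<in>I. 0 \<le> x \<bullet> e i \<and> x \<bullet> e i \<le> (1 / t i) * (norm (e i))\<^sup>2}"
    proof (rule emeasure_eq_AE, use AE_V in eventually_elim)
      fix x assume "x \<in> F"
      then obtain g where g: "x = comb g" by (auto simp: F_def)
      have "0 \<le> T x \<bullet> e i \<and> T x \<bullet> e i \<le> (norm (e i))\<^sup>2 \<longleftrightarrow>
         0 \<le> x \<bullet> e i \<and> x \<bullet> e i \<le> (1 / t i) * (norm (e i))\<^sup>2" if i: "i \<in> I" for i
      proof -
        have "\<not> t i * (norm (e i))\<^sup>2 \<le> 0" using t(1)[OF i] nz[OF i] by (simp add: not_le)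
        then show ?thesis
          using t(1)[OF i] nz[OF i] by (simp add: g Tc comb_inner[OF i] zero_le_mult_iff field_simps)
      qed
      then show "x \<in> T -` ?A \<longleftrightarrow> x \<in> {x. \<forall>i\<in>I. 0 \<le> x \<bullet> e i \<and> x \<bullet> e i \<le> (1 / t i) * (norm (e i))\<^sup>2}"
        by auto
    next
      show "{x. \<forall>i\<in>I. 0 \<le> x \<bullet> e i \<and> x \<bullet> e i \<le> (1 / t i) * (norm (e i))\<^sup>2} \<in> sets leb"
      proof -
        have "{x. \<forall>i\<in>I. 0 \<le> x \<bullet> e i \<and> x \<bullet> e i \<le> (1 / t i) * (norm (e i))\<^sup>2} =
          (\<Inter>i\<in>I. {x. 0 \<le> x \<bullet> e i} \<inter> {x. x \<bullet> e i \<le> (1 / t i) * (norm (e i))\<^sup>2})" by auto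
        also have "closed \<dots>" by (intro closed_INT ballI closed_Int closed_Collect_le continuous_intros)
        finally show ?thesis by simp
      qed
    qed (use measurable_sets_borel[of T borel ?A] in simp)
    also have "\<dots> = ennreal (\<Prod>i\<in>I. 1 / t i)" using t by (intro emeasure_leb_box) auto
    finally show ?thesis .
  qed
  have A1: "emeasure leb ?A = 1" using emeasure_leb_box[of "\<lambda>_. 1"] by simp
  have "distr leb borel T = scale_measure (ennreal (\<Prod>i\<in>I. 1 / t i)) leb"
  proof (rule measure_eqI)
    fix A assume "A \<in> sets (distr leb borel T)"
    then have A [measurable]: "A \<in> sets borel" by simp
    have *: "emeasure (distr leb borel T) (ball 0 1) = ennreal (\<Prod>i\<in>I. 1 / t i) * emeasure leb (ball 0 1)"
      using haar_on_unique[OF haar_on_axioms H, of ?A] by (simp add: c A1)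
    have "emeasure leb (ball 0 1) * emeasure (distr leb borel T) A =
      emeasure leb (ball 0 1) * (ennreal (\<Prod>i\<in>I. 1 / t i) * emeasure leb A)"
      using haar_on_unique[OF haar_on_axioms H A] by (simp add: * ac_simps)
    then show "emeasure (distr leb borel T) A = emeasure (scale_measure (ennreal (\<Prod>i\<in>I. 1 / t i)) leb) A"
      using emeasure_ball_ne_0[of 1] emeasure_ball_ne_top[of 1]
      by (simp add: ennreal_mult_cancel_left)
  qed simp
  then have "(\<integral>\<^sup>+x. f x \<partial>distr leb borel T) = ennreal (\<Prod>i\<in>I. 1 / t i) * (\<integral>\<^sup>+x. f x \<partial>leb)"
    by (simp add: nn_integral_scale_measure measurable_cong_sets[OF sets_L refl])
  then show ?thesis by (simp add: nn_integral_distr)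
qed

lemma nn_integral_scale:
  assumes "t > 0" "f \<in> borel_measurable borel"
  shows "(\<integral>\<^sup>+x. f (t *\<^sub>R x) \<partial>leb) = ennreal (t powr - real (card I)) * (\<integral>\<^sup>+x. f x \<partial>leb)"
proof -
  have "(\<Prod>i\<in>I. 1 / t) = t powr - real (card I)"
    using assms(1) by (simp add: powr_minus powr_realpow field_simps power_one_over)
  then show ?thesis using nn_integral_diag[of "\<lambda>x. t *\<^sub>R x" "\<lambda>_. t" f] assms by simp
qed

end

section \<open>Moments of powers of the distance to the unit sphere\<close>

lemma nn_integral_powr_shift:
  assumes a: "a > (-1::real)" and c: "c \<le> 1"
  shows "(\<integral>\<^sup>+t. indicator {c<..1} t * ennreal ((t - c) powr a) \<partial>lborel) = ennreal ((1 - c) powr (a + 1) / (a + 1))"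
proof -
  have "((\<lambda>x. if x \<in> {0..1-c} then x powr a else 0) has_integral ((1 - c) powr (a + 1) / (a + 1))) UNIV"
    using has_integral_powr_from_0[OF a, of "1 - c"] c by (subst has_integral_restrict_UNIV) simp
  then have "(\<integral>\<^sup>+x. ennreal (if x \<in> {0..1-c} then x powr a else 0) \<partial>lborel) = ennreal ((1 - c) powr (a + 1) / (a + 1))"
    by (intro nn_integral_has_integral_lborel) auto
  moreover have "(\<integral>\<^sup>+t. indicator {c<..1} t * ennreal ((t - c) powr a) \<partial>lborel) =
     (\<integral>\<^sup>+x. ennreal (if x \<in> {0..1-c} then x powr a else 0) \<partial>lborel)"
  proof (subst nn_integral_real_affine[where c = 1 and t = c])
    show "ennreal \<bar>1\<bar> * (\<integral>\<^sup>+x. indicator {c<..1} (c + 1 * x) * ennreal ((c + 1 * x - c) powr a) \<partial>lborel) =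
      (\<integral>\<^sup>+x. ennreal (if x \<in> {0..1-c} then x powr a else 0) \<partial>lborel)"
      by (auto intro!: nn_integral_cong simp: indicator_def)
  qed auto
  ultimately show ?thesis by simp
qed

text \<open>Unnormalised density on the unit ball; after a substitution it is the law of a single
  column of the matrix ball.\<close>

definition ball_weight :: "real \<Rightarrow> 'a::euclidean_space \<Rightarrow> ennreal" where
  "ball_weight a y = indicator (ball 0 1) y * ennreal ((1 - (norm y)\<^sup>2) powr a)"

lemma ball_weight_measurable [measurable]: "ball_weight a \<in> borel_measurable borel"
proof -
  have [measurable]: "ball 0 1 \<in> sets (borel :: 'a measure)" by simp
  show ?thesis unfolding ball_weight_def by measurable
qed

lemma ennreal_eq_diffI:
  assumes "X + ennreal y = ennreal c" "0 \<le> y" shows "X = ennreal (c - y)"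
  using assms by (metis ennreal_add_diff_cancel_right ennreal_minus ennreal_neq_top)

context frame
begin

lemma measurable_leb [measurable (raw)]: "f \<in> borel_measurable borel \<Longrightarrow> f \<in> borel_measurable leb"
  by (simp add: measurable_cong_sets[OF sets_L refl])

lemma nn_integral_ball_weight_scaled:
  assumes t: "t > 0"
  shows "(\<integral>\<^sup>+y. indicator {y. (norm y)\<^sup>2 < t} y * ennreal ((t - (norm y)\<^sup>2) powr a) \<partial>leb) =
     ennreal (t powr (a + real (card I) / 2)) * (\<integral>\<^sup>+y. ball_weight a y \<partial>leb)"
proof -
  have eq: "indicator {y. (norm y)\<^sup>2 < t} y * ennreal ((t - (norm y)\<^sup>2) powr a) =
     ennreal (t powr a) * ball_weight a ((1 / sqrt t) *\<^sub>R y)" for y :: 'a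
  proof (cases "(norm y)\<^sup>2 < t")
    case True
    have n: "(norm ((1 / sqrt t) *\<^sub>R y))\<^sup>2 = (norm y)\<^sup>2 / t" using t by (simp add: power_divide)
    then have "(norm ((1 / sqrt t) *\<^sub>R y))\<^sup>2 < 1\<^sup>2" using True t by simp
    then have "norm ((1 / sqrt t) *\<^sub>R y) < 1" by (rule power2_less_imp_less) simp
    moreover have "t powr a * (1 - (norm y)\<^sup>2 / t) powr a = (t - (norm y)\<^sup>2) powr a"
    proof -
      have "t * (1 - (norm y)\<^sup>2 / t) = t - (norm y)\<^sup>2" "0 \<le> 1 - (norm y)\<^sup>2 / t"
        using t True by (auto simp: field_simps)
      then show ?thesis using t by (metis less_imp_le powr_mult)
    qed
    ultimately show ?thesis using True t unfolding ball_weight_def n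
      by (simp add: ennreal_mult'[symmetric])
  next
    case False
    have "\<not> norm ((1 / sqrt t) *\<^sub>R y) < 1"
    proof
      assume "norm ((1 / sqrt t) *\<^sub>R y) < 1"
      then have "norm y < sqrt t" using t by (simp add: field_simps)
      then have "(norm y)\<^sup>2 < (sqrt t)\<^sup>2" by (intro power_strict_mono) auto
      then show False using False t by simp
    qed
    then show ?thesis using False by (simp add: ball_weight_def)
  qed
  have "(\<integral>\<^sup>+y. indicator {y. (norm y)\<^sup>2 < t} y * ennreal ((t - (norm y)\<^sup>2) powr a) \<partial>leb) =
     ennreal (t powr a) * (\<integral>\<^sup>+y. ball_weight a ((1 / sqrt t) *\<^sub>R y) \<partial>leb)"
    unfolding eq by (rule nn_integral_cmult) measurable
  also have "\<dots> = ennreal (t powr a) * (ennreal ((1 / sqrt t) powr - real (card I)) * (\<integral>\<^sup>+y. ball_weight a y \<partial>leb))"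
    using t by (subst nn_integral_scale) auto
  also have "(1 / sqrt t) powr - real (card I) = t powr (real (card I) / 2)"
    using t by (simp add: powr_half_sqrt[symmetric] powr_divide powr_powr powr_minus)
  finally show ?thesis using t by (simp add: powr_add ennreal_mult' mult.assoc)
qed

text \<open>Write (1 - |y|^2)^(a+1) / (a+1) as the integral of (t - |y|^2)^a over t from |y|^2 to 1
  and exchange the integrals. Scaling in y leaves the integral of t^(a + m/2) over the unit
  interval, m = \<open>card I\<close>. This takes the place of polar coordinates and Beta
  functions.\<close>

lemma nn_integral_ball_weight_Suc:
  assumes a: "a > -1"
  shows "(\<integral>\<^sup>+y. ball_weight (a + 1) y \<partial>leb) =
     ennreal ((a + 1) / (a + 1 + real (card I) / 2)) * (\<integral>\<^sup>+y. ball_weight a y \<partial>leb)"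
proof -
  interpret P: pair_sigma_finite leb lborel ..
  define g where "g = (\<lambda>(y::'a) t. indicator {..1} t * (indicator {y. (norm y)\<^sup>2 < t} y * ennreal ((t - (norm y)\<^sup>2) powr a)))"
  have "(\<lambda>p. g (fst p) (snd p)) \<in> borel_measurable (borel \<Otimes>\<^sub>M borel)"
    unfolding g_def indicator_def by measurable
  then have [measurable]: "(\<lambda>(y, t). g y t) \<in> borel_measurable (leb \<Otimes>\<^sub>M lborel)"
    by (simp add: measurable_cong_sets[OF sets_pair_measure_cong[OF sets_L sets_lborel] refl] case_prod_beta')
  have in1: "(\<integral>\<^sup>+t. g y t \<partial>lborel) = ennreal (1 / (a + 1)) * ball_weight (a + 1) y" for y
  proof -
    have "g y t = indicator {(norm y)\<^sup>2<..1} t * ennreal ((t - (norm y)\<^sup>2) powr a)" for t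
      by (auto simp: g_def indicator_def)
    then have *: "(\<integral>\<^sup>+t. g y t \<partial>lborel) = (\<integral>\<^sup>+t. indicator {(norm y)\<^sup>2<..1} t * ennreal ((t - (norm y)\<^sup>2) powr a) \<partial>lborel)"
      by simp
    show ?thesis
    proof (cases "norm y < 1")
      case True
      then have "(norm y)\<^sup>2 < 1" by (simp add: abs_square_less_1)
      then show ?thesis using True a unfolding *
        by (subst nn_integral_powr_shift) (auto simp: ball_weight_def ennreal_mult'[symmetric])
    next
      case False
      then have "{(norm y)\<^sup>2<..1} = {}" by (auto simp: not_less intro: order_trans one_le_power)
      then show ?thesis using False unfolding * by (simp add: ball_weight_def)
    qed
  qed
  have "ennreal (1 / (a + 1)) * (\<integral>\<^sup>+y. ball_weight (a + 1) y \<partial>leb) = (\<integral>\<^sup>+y. (\<integral>\<^sup>+t. g y t \<partial>lborel) \<partial>leb)"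
    unfolding in1 by (rule nn_integral_cmult[symmetric]) measurable
  also have "\<dots> = (\<integral>\<^sup>+t. (\<integral>\<^sup>+y. g y t \<partial>leb) \<partial>lborel)" by (rule P.Fubini'[symmetric]) measurable
  also have "\<dots> = (\<integral>\<^sup>+t. indicator {0<..1} t * ennreal ((t - 0) powr (a + real (card I) / 2)) * (\<integral>\<^sup>+y. ball_weight a y \<partial>leb) \<partial>lborel)"
  proof (rule nn_integral_cong)
    fix t :: real
    have "(\<integral>\<^sup>+y. g y t \<partial>leb) = indicator {..1} t * (\<integral>\<^sup>+y. indicator {y. (norm y)\<^sup>2 < t} y * ennreal ((t - (norm y)\<^sup>2) powr a) \<partial>leb)"
      unfolding g_def indicator_def by (rule nn_integral_cmult) measurable
    also have "\<dots> = indicator {0<..1} t * ennreal ((t - 0) powr (a + real (card I) / 2)) * (\<integral>\<^sup>+y. ball_weight a y \<partial>leb)"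
    proof (cases "t > 0")
      case True
      then show ?thesis by (subst nn_integral_ball_weight_scaled) (auto simp: indicator_def)
    next
      case False
      then have "{y::'a. (norm y)\<^sup>2 < t} = {}" by (auto simp: not_less intro: order_trans)
      then show ?thesis using False by simp
    qed
    finally show "(\<integral>\<^sup>+y. g y t \<partial>leb) = \<dots>" .
  qed
  also have "\<dots> = (\<integral>\<^sup>+t. indicator {0<..1} t * ennreal ((t - 0) powr (a + real (card I) / 2)) \<partial>lborel) * (\<integral>\<^sup>+y. ball_weight a y \<partial>leb)"
    by (rule nn_integral_multc) measurable
  also have "\<dots> = ennreal (1 / (a + real (card I) / 2 + 1)) * (\<integral>\<^sup>+y. ball_weight a y \<partial>leb)"
    using a by (subst nn_integral_powr_shift) (auto intro: less_le_trans)
  finally have "ennreal (a + 1) * (ennreal (1 / (a + 1)) * (\<integral>\<^sup>+y. ball_weight (a + 1) y \<partial>leb)) =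
    ennreal (a + 1) * (ennreal (1 / (a + real (card I) / 2 + 1)) * (\<integral>\<^sup>+y. ball_weight a y \<partial>leb))" by simp
  moreover have "a + real (card I) / 2 + 1 = a + 1 + real (card I) / 2" by simp
  ultimately show ?thesis using a by (simp add: mult.assoc[symmetric] ennreal_mult'[symmetric] del: add_divide_distrib)
qed

text \<open>For negative a the weight is unbounded near the sphere. At a + 1 it is at most 1, and
  the recursion links the two integrals by a positive factor.\<close>

lemma nn_integral_ball_weight_finite:
  assumes a: "a > -1"
  shows "(\<integral>\<^sup>+y. ball_weight a y \<partial>leb) < \<infinity>"
proof -
  have "(\<integral>\<^sup>+y. ball_weight (a + 1) y \<partial>leb) \<le> (\<integral>\<^sup>+y. indicator (ball 0 1) y \<partial>leb)"
  proof (rule nn_integral_mono)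
    fix y :: 'a
    have "(1 - (norm y)\<^sup>2) powr (a + 1) \<le> 1 powr (a + 1)" if "norm y < 1"
      using that a by (intro powr_mono2) (auto simp: abs_square_le_1)
    then show "ball_weight (a + 1) y \<le> indicator (ball 0 1) y"
      by (auto simp: ball_weight_def indicator_def)
  qed
  also have "\<dots> < \<infinity>" using emeasure_ball_ne_top[of 1] by (simp add: less_top)
  finally have *: "(\<integral>\<^sup>+y. ball_weight (a + 1) y \<partial>leb) < \<infinity>" .
  have "0 < (a + 1) / (a + 1 + real (card I) / 2)" using a by (simp add: add_pos_nonneg)
  then show ?thesis using * unfolding nn_integral_ball_weight_Suc[OF a]
    by (auto simp: ennreal_mult_less_top)
qed

lemma nn_integral_ball_weight_pos: "(\<integral>\<^sup>+y. ball_weight a y \<partial>leb) > 0"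
proof (rule ccontr)
  assume "\<not> ?thesis"
  then have "AE y in leb. ball_weight a y = 0" by (subst nn_integral_0_iff_AE[symmetric]) auto
  then have "AE y in leb. y \<notin> ball 0 1"
  proof eventually_elim
    fix y :: 'a assume *: "ball_weight a y = 0"
    show "y \<notin> ball 0 1"
    proof
      assume y: "y \<in> ball 0 1"
      then have "(norm y)\<^sup>2 < 1" by (simp add: abs_square_less_1)
      then show False using * y by (auto simp: ball_weight_def)
    qed
  qed
  then have "emeasure leb (ball 0 1) = 0" by (subst (asm) AE_iff_measurable[of "ball 0 1"]) auto
  then show False using emeasure_ball_ne_0[of 1] by simp
qed

text \<open>On the ball, |y|^2 times the weight at a is the difference of the weights at a and a +
  1, and 1 - (a+1) / (a+1+m/2) = m / (m+2+2a). The difference is first written as a sum, since the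
  integrals live in \<open>ennreal\<close>.\<close>

lemma nn_integral_ball_weight_norm:
  assumes a: "a > -1"
  shows "(\<integral>\<^sup>+y. ennreal ((norm y)\<^sup>2) * ball_weight a y \<partial>leb) =
     ennreal (real (card I) / (real (card I) + 2 + 2 * a)) * (\<integral>\<^sup>+y. ball_weight a y \<partial>leb)"
proof -
  let ?m = "real (card I)" and ?Z = "\<integral>\<^sup>+y. ball_weight a y \<partial>leb"
  obtain z where z: "?Z = ennreal z" "0 \<le> z"
    using nn_integral_ball_weight_finite[OF a] by (cases ?Z) auto
  have "(\<integral>\<^sup>+y. ennreal ((norm y)\<^sup>2) * ball_weight a y \<partial>leb) + (\<integral>\<^sup>+y. ball_weight (a + 1) y \<partial>leb) =
     (\<integral>\<^sup>+y. ennreal ((norm y)\<^sup>2) * ball_weight a y + ball_weight (a + 1) y \<partial>leb)"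
    by (rule nn_integral_add[symmetric]) measurable
  also have "\<dots> = ?Z"
  proof (rule nn_integral_cong)
    fix y :: 'a
    show "ennreal ((norm y)\<^sup>2) * ball_weight a y + ball_weight (a + 1) y = ball_weight a y"
    proof (cases "norm y < 1")
      case True
      then have "(norm y)\<^sup>2 < 1" by (simp add: abs_square_less_1)
      then have "(norm y)\<^sup>2 * (1 - (norm y)\<^sup>2) powr a + (1 - (norm y)\<^sup>2) powr (a + 1) = (1 - (norm y)\<^sup>2) powr a"
        by (simp add: powr_add algebra_simps)
      then show ?thesis using True
        by (simp add: ball_weight_def ennreal_mult'[symmetric] ennreal_plus[symmetric] del: ennreal_plus)
    qed (simp add: ball_weight_def)
  qed
  finally have *: "(\<integral>\<^sup>+y. ennreal ((norm y)\<^sup>2) * ball_weight a y \<partial>leb) + ennreal ((a + 1) / (a + 1 + ?m / 2) * z) = ennreal z"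
    using a by (simp add: nn_integral_ball_weight_Suc z ennreal_mult'[symmetric])
  have K: "?m + 2 + 2 * a > 0" using a by (intro add_nonneg_pos[of ?m "2 + 2 * a", simplified add.assoc[symmetric]]) auto
  have "(\<integral>\<^sup>+y. ennreal ((norm y)\<^sup>2) * ball_weight a y \<partial>leb) = ennreal (z - (a + 1) / (a + 1 + ?m / 2) * z)"
    using a z by (intro ennreal_eq_diffI[OF *]) auto
  also have "z - (a + 1) / (a + 1 + ?m / 2) * z = ?m / (?m + 2 + 2 * a) * z"
    using K by (simp add: field_simps)
  finally show ?thesis using K by (simp add: z ennreal_mult'[symmetric])
qed

text \<open>The reflection in the hyperplane orthogonal to c - c' is an isometry of F that exchanges
  c and c' and leaves the weight, a function of |y|, unchanged.\<close>

lemma nn_integral_reflect: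
  assumes "c \<in> F" "c' \<in> F" "norm c = norm c'"
  shows "(\<integral>\<^sup>+y. ennreal ((c \<bullet> y)\<^sup>2) * ball_weight a y \<partial>leb) = (\<integral>\<^sup>+y. ennreal ((c' \<bullet> y)\<^sup>2) * ball_weight a y \<partial>leb)"
proof (cases "c = c'")
  case False
  define w where "w = c - c'"
  define T where "T y = y - (2 * (w \<bullet> y) / (w \<bullet> w)) *\<^sub>R w" for y
  have w: "w \<bullet> w \<noteq> 0" using False by (simp add: w_def)
  have wF: "w \<in> F" using assms subspace_F by (simp add: w_def subspace_diff)
  have lin: "linear T" unfolding T_def by (auto simp: linear_iff algebra_simps inner_simps add_divide_distrib scaleR_add_left)
  have ip: "T x \<bullet> T y = x \<bullet> y" for x y
    using w by (simp add: T_def inner_simps inner_commute field_simps)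
  have TT: "T (T y) = y" for y
    using w by (simp add: T_def inner_simps algebra_simps field_simps)
  have TF: "T y \<in> F" if "y \<in> F" for y
    unfolding T_def using that wF subspace_F by (intro subspace_diff subspace_scale)
  have "T ` F = F" using TF TT by (auto intro: image_eqI[of _ T, OF TT[symmetric]])
  moreover have "norm (T y) = norm y" for y by (simp add: norm_eq_sqrt_inner ip)
  moreover have "c \<bullet> T y = c' \<bullet> y" for y
  proof -
    have "c \<bullet> c = c' \<bullet> c'" using assms by (simp add: norm_eq_sqrt_inner)
    then have "w \<bullet> w = 2 * (w \<bullet> c)" by (simp add: w_def inner_simps inner_commute)
    then have "T c = c - w" using w by (simp add: T_def)
    then have "T c = c'" by (simp add: w_def)
    then show ?thesis using ip[of "T c" y] TT by (metis ip)
  qed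
  ultimately show ?thesis
    using nn_integral_isometry[OF lin, of "\<lambda>y. ennreal ((c \<bullet> y)\<^sup>2) * ball_weight a y"]
    by (simp add: ball_weight_def indicator_def)
qed simp

text \<open>By reflection all unit directions have the same second moment, and over an orthonormal
  basis these moments add up to that of |y|^2, so each is the m-th part of it.\<close>

lemma nn_integral_ball_weight_inner:
  assumes a: "a > -1" and c: "c \<in> F" and I0: "I \<noteq> {}"
  shows "(\<integral>\<^sup>+y. ennreal ((c \<bullet> y)\<^sup>2) * ball_weight a y \<partial>leb) =
     ennreal ((norm c)\<^sup>2 / (real (card I) + 2 + 2 * a)) * (\<integral>\<^sup>+y. ball_weight a y \<partial>leb)"
proof -
  define u where "u i = e i /\<^sub>R norm (e i)" for i
  have u: "u i \<in> F" "norm (u i) = 1" if "i \<in> I" for i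
    using that nz subspace_F by (simp_all add: u_def e_in_F subspace_scale)
  obtain i where i: "i \<in> I" using I0 by blast
  define Q where "Q = (\<integral>\<^sup>+y. ennreal ((u i \<bullet> y)\<^sup>2) * ball_weight a y \<partial>leb)"
  have m: "real (card I) > 0" using I0 I by (simp add: card_gt_0_iff)
  have "of_nat (card I) * Q = (\<Sum>j\<in>I. \<integral>\<^sup>+y. ennreal ((u j \<bullet> y)\<^sup>2) * ball_weight a y \<partial>leb)"
  proof -
    have "(\<integral>\<^sup>+y. ennreal ((u j \<bullet> y)\<^sup>2) * ball_weight a y \<partial>leb) = Q" if "j \<in> I" for j
      unfolding Q_def using u that i by (intro nn_integral_reflect) auto
    then show ?thesis by simp
  qed
  also have "\<dots> = (\<integral>\<^sup>+y. (\<Sum>j\<in>I. ennreal ((u j \<bullet> y)\<^sup>2) * ball_weight a y) \<partial>leb)"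
    by (rule nn_integral_sum[symmetric]) measurable
  also have "\<dots> = (\<integral>\<^sup>+y. ennreal ((norm y)\<^sup>2) * ball_weight a y \<partial>leb)"
    by (rule nn_integral_cong_AE, use AE_V in eventually_elim)
      (simp add: sum_distrib_right[symmetric] sum_ennreal parseval[symmetric] u_def)
  finally have "of_nat (card I) * Q = ennreal (real (card I) / (real (card I) + 2 + 2 * a)) * (\<integral>\<^sup>+y. ball_weight a y \<partial>leb)"
    using nn_integral_ball_weight_norm[OF a] by simp
  then have "ennreal (1 / real (card I)) * (ennreal (real (card I)) * Q) =
     ennreal (1 / real (card I)) * (ennreal (real (card I) / (real (card I) + 2 + 2 * a)) * (\<integral>\<^sup>+y. ball_weight a y \<partial>leb))"
    by (simp add: ennreal_of_nat_eq_real_of_nat)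
  then have Q: "Q = ennreal (1 / (real (card I) + 2 + 2 * a)) * (\<integral>\<^sup>+y. ball_weight a y \<partial>leb)"
    using m a by (simp add: mult.assoc[symmetric] ennreal_mult'[symmetric])
  have "(\<integral>\<^sup>+y. ennreal ((c \<bullet> y)\<^sup>2) * ball_weight a y \<partial>leb) = (\<integral>\<^sup>+y. ennreal (((norm c *\<^sub>R u i) \<bullet> y)\<^sup>2) * ball_weight a y \<partial>leb)"
    using c u[OF i] subspace_F by (intro nn_integral_reflect) (auto simp: subspace_scale)
  also have "\<dots> = (\<integral>\<^sup>+y. ennreal ((norm c)\<^sup>2) * (ennreal ((u i \<bullet> y)\<^sup>2) * ball_weight a y) \<partial>leb)"
    by (simp add: power_mult_distrib ennreal_mult' mult.assoc)
  also have "\<dots> = ennreal ((norm c)\<^sup>2) * Q" unfolding Q_def by (rule nn_integral_cmult) measurable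
  finally show ?thesis unfolding Q by (simp add: mult.assoc[symmetric] ennreal_mult'[symmetric])
qed

text \<open>Averaging over y and - y removes the cross term without leaving nonnegative integrals.
  The constant p is carried along because the other columns of a matrix contribute a fixed summand
  to the inner product.\<close>

lemma nn_integral_ball_moment:
  assumes a: "a > -1" and c: "c \<in> F" and I0: "I \<noteq> {}"
  shows "(\<integral>\<^sup>+y. ennreal ((p + c \<bullet> y)\<^sup>2) * ball_weight a y \<partial>leb) =
     ennreal (p\<^sup>2 + (norm c)\<^sup>2 / (real (card I) + 2 + 2 * a)) * (\<integral>\<^sup>+y. ball_weight a y \<partial>leb)"
proof -
  let ?f = "\<lambda>s y. ennreal ((p + s * (c \<bullet> y))\<^sup>2) * ball_weight a y"
  have sub: "uminus ` F = F" using subspace_neg[OF subspace_F] by (force intro: image_eqI[of _ uminus])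
  have "(\<integral>\<^sup>+y. ?f 1 (- y) \<partial>leb) = (\<integral>\<^sup>+y. ?f 1 y \<partial>leb)"
    using sub by (intro nn_integral_isometry) (auto simp: linear_iff)
  then have "(\<integral>\<^sup>+y. ?f (- 1) y \<partial>leb) = (\<integral>\<^sup>+y. ?f 1 y \<partial>leb)"
    by (simp add: ball_weight_def indicator_def)
  then have "2 * (\<integral>\<^sup>+y. ?f 1 y \<partial>leb) = (\<integral>\<^sup>+y. ?f 1 y \<partial>leb) + (\<integral>\<^sup>+y. ?f (- 1) y \<partial>leb)"
    by (simp add: mult_2)
  also have "\<dots> = (\<integral>\<^sup>+y. ?f 1 y + ?f (- 1) y \<partial>leb)"
    by (rule nn_integral_add[symmetric]) measurable
  also have "\<dots> = (\<integral>\<^sup>+y. 2 * (ennreal (p\<^sup>2) * ball_weight a y + ennreal ((c \<bullet> y)\<^sup>2) * ball_weight a y) \<partial>leb)"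
  proof (rule nn_integral_cong)
    fix y :: 'a
    have "?f 1 y + ?f (- 1) y = ennreal ((p + c \<bullet> y)\<^sup>2 + (p - c \<bullet> y)\<^sup>2) * ball_weight a y"
      by (simp add: distrib_right)
    also have "(p + c \<bullet> y)\<^sup>2 + (p - c \<bullet> y)\<^sup>2 = 2 * (p\<^sup>2 + (c \<bullet> y)\<^sup>2)"
      by (simp add: power2_eq_square algebra_simps)
    also have "ennreal \<dots> = 2 * (ennreal (p\<^sup>2) + ennreal ((c \<bullet> y)\<^sup>2))" by (simp add: ennreal_mult')
    finally show "?f 1 y + ?f (- 1) y = 2 * (ennreal (p\<^sup>2) * ball_weight a y + ennreal ((c \<bullet> y)\<^sup>2) * ball_weight a y)"
      by (simp add: distrib_right mult.assoc distrib_left)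
  qed
  also have "\<dots> = 2 * ((\<integral>\<^sup>+y. ennreal (p\<^sup>2) * ball_weight a y \<partial>leb) + (\<integral>\<^sup>+y. ennreal ((c \<bullet> y)\<^sup>2) * ball_weight a y \<partial>leb))"
    by (simp add: nn_integral_cmult nn_integral_add)
  also have "\<dots> = 2 * (ennreal (p\<^sup>2 + (norm c)\<^sup>2 / (real (card I) + 2 + 2 * a)) * (\<integral>\<^sup>+y. ball_weight a y \<partial>leb))"
    using a by (subst nn_integral_ball_weight_inner[OF a c I0])
      (simp add: nn_integral_cmult distrib_right[symmetric] ennreal_plus[symmetric] add_nonneg_nonneg del: ennreal_plus)
  finally show ?thesis by (simp add: ennreal_mult_cancel_left)
qed

end

section \<open>Column-wise integration over the matrix ball\<close>

definition mat_unit :: "'q::finite \<times> 'q \<times> 4 \<Rightarrow> 'q mat" where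
  "mat_unit = (\<lambda>(i, j, k). axis i (axis j (axis k 1)))"

lemma mat_unit_nth: "mat_unit (i, j, k) $ a $ b $ c = (if a = i \<and> b = j \<and> c = k then 1 else 0)"
  by (simp add: mat_unit_def axis_def)

lemma inner_mat_unit: "mat_unit p \<bullet> mat_unit r = (if p = r then 1 else 0)"
  by (cases p; cases r) (auto simp: mat_unit_def inner_axis_axis)

lemma (in frame) nn_integral_leb_Un:
  assumes IJ: "I = A \<union> B" "A \<inter> B = {}" and f [measurable]: "f \<in> borel_measurable borel"
  shows "(\<integral>\<^sup>+x. f x \<partial>leb) = (\<integral>\<^sup>+x. (\<integral>\<^sup>+y. f (x + y) \<partial>frame.leb B e) \<partial>frame.leb A e)"
proof -
  interpret A: frame A e using IJ I nz orth by unfold_locales auto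
  interpret B: frame B e using IJ I nz orth by unfold_locales auto
  have m: "comb (merge A B (x, y)) = A.comb x + B.comb y" for x y
  proof -
    have "(\<Sum>i\<in>A. merge A B (x, y) i *\<^sub>R e i) = (\<Sum>i\<in>A. x i *\<^sub>R e i)"
      by (rule sum.cong) (auto simp: merge_def)
    moreover have "(\<Sum>i\<in>B. merge A B (x, y) i *\<^sub>R e i) = (\<Sum>i\<in>B. y i *\<^sub>R e i)"
      using IJ by (intro sum.cong) (auto simp: merge_def)
    ultimately show ?thesis
      unfolding comb_def A.comb_def B.comb_def unfolding IJ(1) using IJ(2) A.I B.I by (simp add: sum.union_disjoint)
  qed
  have mm: "(\<lambda>x. f (comb x)) \<in> borel_measurable (PiM (A \<union> B) (\<lambda>_. lborel))"
    using measurable_compose[OF measurable_comb f] unfolding IJ(1)[symmetric] .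
  have "(\<integral>\<^sup>+x. f x \<partial>leb) = (\<integral>\<^sup>+x. f (comb x) \<partial>PiM (A \<union> B) (\<lambda>_. lborel))"
    unfolding leb_def IJ(1)[symmetric] by (rule nn_integral_distr) simp_all
  also have "\<dots> = (\<integral>\<^sup>+x. (\<integral>\<^sup>+y. f (comb (merge A B (x, y))) \<partial>PiM B (\<lambda>_. lborel)) \<partial>PiM A (\<lambda>_. lborel))"
    using IJ A.I B.I mm by (intro product_nn_integral_fold)
  also have "\<dots> = (\<integral>\<^sup>+x. (\<integral>\<^sup>+y. f (A.comb x + y) \<partial>B.leb) \<partial>PiM A (\<lambda>_. lborel))"
    unfolding m B.leb_def by (subst nn_integral_distr) auto
  also have "\<dots> = (\<integral>\<^sup>+x. (\<integral>\<^sup>+y. f (x + y) \<partial>B.leb) \<partial>A.leb)"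
  proof -
    have "(\<lambda>p. f (fst p + snd p)) \<in> borel_measurable (borel \<Otimes>\<^sub>M borel)" by measurable
    then have "(\<lambda>(x, y). f (x + y)) \<in> borel_measurable (borel \<Otimes>\<^sub>M B.leb)"
      by (simp add: measurable_cong_sets[OF sets_pair_measure_cong[OF refl B.sets_L] refl] case_prod_beta')
    then have "(\<lambda>x. \<integral>\<^sup>+y. f (x + y) \<partial>B.leb) \<in> borel_measurable borel"
      by (rule B.borel_measurable_nn_integral)
    then show ?thesis unfolding A.leb_def by (subst nn_integral_distr) auto
  qed
  finally show ?thesis .
qed

context field_dim
begin

definition col_idx :: "'q::finite set \<Rightarrow> ('q \<times> 'q \<times> 4) set" where
  "col_idx S = {(i, j, k). j \<in> S \<and> k \<in> comps d}"

definition col_space :: "'q::finite set \<Rightarrow> 'q mat set" where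
  "col_space S = {x. In_M d x \<and> (\<forall>i j. j \<notin> S \<longrightarrow> x$i$j = 0)}"

definition col_leb :: "'q::finite set \<Rightarrow> 'q mat measure" where
  "col_leb S = frame.leb (col_idx S) mat_unit"

lemma col_idx_eq: "col_idx S = UNIV \<times> S \<times> comps d" by (auto simp: col_idx_def)

lemma card_col_idx: "card (col_idx (S :: 'q::finite set)) = CARD('q) * (card S * d)"
  by (simp add: col_idx_eq card_cartesian_product card_comps)

lemma frame_col: "frame (col_idx S) mat_unit"
proof
  show "mat_unit p \<noteq> 0" for p :: "'a \<times> 'a \<times> 4" by (metis inner_mat_unit inner_zero_left zero_neq_one)
qed (simp_all add: inner_mat_unit)

lemma comb_col: "frame.comb (col_idx S) mat_unit f $ i $ j $ k = (if j \<in> S \<and> k \<in> comps d then f (i, j, k) else 0)"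
proof -
  interpret frame "col_idx S" mat_unit by (rule frame_col)
  have "comb f $ i $ j $ k = (\<Sum>p\<in>col_idx S. f p * (mat_unit p $ i $ j $ k))"
    by (simp add: comb_def)
  also have "\<dots> = (\<Sum>p\<in>col_idx S. if p = (i, j, k) then f p else 0)"
    by (intro sum.cong refl) (auto simp: mat_unit_nth split: if_splits)
  also have "\<dots> = (if (i, j, k) \<in> col_idx S then f (i, j, k) else 0)" using I by simp
  finally show ?thesis by (simp add: col_idx_def)
qed

lemma F_col: "frame.F (col_idx S) mat_unit = col_space S"
proof -
  interpret frame "col_idx S" mat_unit by (rule frame_col)
  have "x \<in> range comb" if "x \<in> col_space S" for x
    by (rule image_eqI[of _ _ "\<lambda>(i, j, k). x$i$j$k"])
      (use that in \<open>auto simp: vec_eq_iff comb_col col_space_def In_M_def\<close>)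
  then show ?thesis by (auto simp: F_def col_space_def In_M_def comb_col vec_eq_iff)
qed

lemma lebM_eq: "(lebM d :: 'q::finite mat measure) = col_leb UNIV"
proof -
  interpret frame "col_idx (UNIV :: 'q set)" mat_unit by (rule frame_col)
  have "(\<chi> i j k. if k \<in> comps d then f (i,j,k) else 0) = comb f" for f
    by (simp add: vec_eq_iff comb_col)
  moreover have "{(i::'q, j::'q, k). k \<in> comps d} = col_idx UNIV" by (simp add: col_idx_def)
  ultimately show ?thesis by (simp add: lebM_def col_leb_def leb_def)
qed

text \<open>\<open>Delta\<close> is a definite description that is controlled on the cone only. The
  extension by zero is Borel, and \<open>OmegaQ d\<close> becomes the set where it is
  positive.\<close>

definition Delta_psd :: "'q::finite mat \<Rightarrow> real" where
  "Delta_psd x = (if x \<in> PiQ d then Delta d x else 0)"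

lemma Delta_psd_measurable [measurable]: "Delta_psd \<in> borel_measurable borel"
proof -
  have "(\<lambda>x. if x \<in> PiQ d then Delta d x else 0) \<in> borel_measurable borel"
    by (intro borel_measurable_continuous_on_if continuous_on_Delta continuous_on_const borel_closed closed_PiQ)
  then show ?thesis by (simp add: Delta_psd_def[abs_def])
qed

lemma OmegaQ_eq: "OmegaQ d = {x. Delta_psd x > 0}"
  by (auto simp: OmegaQ_iff_Delta Delta_psd_def split: if_splits)

lemma OmegaQ_borel [measurable]: "OmegaQ d \<in> sets borel"
  unfolding OmegaQ_eq by measurable

text \<open>The indicator of the open cone is part of the function, so that densities on the ball
  and on the cone are integrated over the whole space.\<close>

definition Delta_powr :: "real \<Rightarrow> 'q::finite mat \<Rightarrow> real" where
  "Delta_powr a x = (if x \<in> OmegaQ d then Delta d x powr a else 0)"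

lemma Delta_powr_eq: "Delta_powr a x = (if Delta_psd x > 0 then Delta_psd x powr a else 0)"
  unfolding Delta_powr_def OmegaQ_eq by (auto simp: Delta_psd_def split: if_splits)

lemma Delta_powr_measurable [measurable]: "Delta_powr a \<in> borel_measurable borel"
  unfolding Delta_powr_eq[abs_def] by measurable

lemma Delta_powr_nonneg: "0 \<le> Delta_powr a x" by (simp add: Delta_powr_def)

lemma OmegaQ_add: "x \<in> OmegaQ d \<Longrightarrow> y \<in> PiQ d \<Longrightarrow> x + y \<in> OmegaQ d"
proof -
  assume x: "x \<in> OmegaQ d" and y: "y \<in> PiQ d"
  then obtain e where e: "e > 0" "\<And>m. In_M d m \<Longrightarrow> e * (norm m)\<^sup>2 \<le> m \<bullet> mmul x m" and xH: "x \<in> Herm d"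
    unfolding OmegaQ_iff by blast
  have "e * (norm m)\<^sup>2 \<le> m \<bullet> mmul (x + y) m" if "In_M d m" for m
    using e(2)[OF that] PiQ_nonneg[OF y that] by (simp add: inner_simps)
  then show ?thesis unfolding OmegaQ_iff using e(1) xH y by auto
qed

lemma OmegaQ_sqrt:
  assumes "(x::'q::finite mat) \<in> OmegaQ d"
  obtains u s h where "unitary d u" "\<And>i. 0 < s i" "h = mmul u (mmul (rdiag s) (madj u))"
    "h \<in> PiQ d" "mmul h h = x" "Delta d x = (\<Prod>i\<in>UNIV. s i)\<^sup>2"
    "In_M d (mmul u (mmul (rdiag (\<lambda>i. 1 / s i)) (madj u)))"
    "mmul h (mmul u (mmul (rdiag (\<lambda>i. 1 / s i)) (madj u))) = mid"
    "mmul (mmul u (mmul (rdiag (\<lambda>i. 1 / s i)) (madj u))) h = mid"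
proof -
  have "x \<in> PiQ d" "Delta d x > 0" using assms by (auto simp: OmegaQ_iff_Delta)
  then obtain u l where u: "unitary d u" "\<And>i. 0 \<le> l i" "x = mmul u (mmul (rdiag l) (madj u))"
    by (metis spectral_psd)
  then have p: "(\<Prod>i\<in>UNIV. l i) \<noteq> 0" using \<open>Delta d x > 0\<close> Delta_spectral[of u l] by (metis less_irrefl)
  have "l i \<noteq> 0" for i using p prod_zero[of UNIV l] by (metis UNIV_I finite)
  then have l: "\<And>i. 0 < l i" using u(2) by (metis less_eq_real_def)
  define s where "s i = sqrt (l i)" for i
  have s: "0 < s i" "s i * s i = l i" for i using l[of i] by (simp_all add: s_def)
  let ?h = "mmul u (mmul (rdiag s) (madj u))" and ?g = "mmul u (mmul (rdiag (\<lambda>i. 1 / s i)) (madj u))"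
  have ss: "mmul ?h ?h = x"
    using u s by (simp add: mmul_assoc unitary_cancel) (simp add: mmul_assoc[symmetric] rdiag_mmul)
  have one: "s i * (1 / s i) = 1" "(1 / s i) * s i = 1" for i using s(1)[of i] by simp_all
  have "mmul ?h ?g = mmul u (mmul (mmul (rdiag s) (rdiag (\<lambda>i. 1 / s i))) (madj u))"
    "mmul ?g ?h = mmul u (mmul (mmul (rdiag (\<lambda>i. 1 / s i)) (rdiag s)) (madj u))"
    using u by (simp_all add: mmul_assoc unitary_cancel)
  then have inv: "mmul ?h ?g = mid" "mmul ?g ?h = mid"
    using u by (simp_all only: rdiag_mmul one rdiag_one mmul_mid unitary_right)
  have "Delta d x = (\<Prod>i\<in>UNIV. s i)\<^sup>2"
    unfolding u(3) Delta_spectral[OF u(1,2)] by (simp add: s(2)[symmetric] power2_eq_square prod.distrib)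
  moreover have "?h \<in> PiQ d" using u s by (simp add: conj_unitary_iff PiQ_rdiag less_imp_le)
  ultimately show ?thesis using that[OF u(1) s(1) refl _ ss _ _ inv] u by simp
qed

lemma retr_mmul_madj: "retr (mmul y (madj y)) = (norm y)\<^sup>2"
  using inner_eq_retr[of y y] by (simp add: retr_mmul_commute[of y] power2_norm_eq_inner)

text \<open>X = \<open>mmul y (madj y)\<close> satisfies X^2 = n X with n = |y|^2, so its
  eigenvalues are 0 or n, and its trace n allows exactly one eigenvalue n if n is not zero. Thus I -
  X has determinant 1 - n: for a single column the matrix ball is the Euclidean ball.\<close>

lemma rank_one:
  fixes y :: "'q::finite mat"
  assumes y: "y \<in> col_space {l}"
  shows "norm y < 1 \<Longrightarrow> mid - mmul y (madj y) \<in> OmegaQ d"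
    and "norm y < 1 \<Longrightarrow> Delta d (mid - mmul y (madj y)) = 1 - (norm y)\<^sup>2"
    and "mid - mmul y (madj y) \<in> OmegaQ d \<Longrightarrow> norm y < 1"
proof -
  have yM: "In_M d y" and yl: "\<And>i j. j \<noteq> l \<Longrightarrow> y$i$j = 0" using y by (auto simp: col_space_def)
  define n where "n = (norm y)\<^sup>2"
  let ?X = "mmul y (madj y)"
  have yy: "mmul (mmul y (madj y)) y = n *\<^sub>R y"
  proof -
    have "(\<Sum>i\<in>UNIV. qmul (qconj (y$i$l)) (y$i$l)) = n *\<^sub>R qone"
    proof -
      have "(\<Sum>k\<in>UNIV. (norm (y$i$k))\<^sup>2) = (norm (y$i$l))\<^sup>2" for i
        by (subst sum.remove[of _ l]) (auto simp: yl)
      then show ?thesis by (simp add: n_def norm_mat_sq qmul_qconj_self scaleR_sum_left)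
    qed
    then have "mmul (madj y) y $ j $ k = (if j = l \<and> k = l then n *\<^sub>R qone else 0)" for j k
      by (cases "j = l"; cases "k = l") (auto simp: mmul_nth yl)
    then have "mmul y (mmul (madj y) y) $ i $ k = n *\<^sub>R y $ i $ k" for i k
      using yl[of k i] by (subst mmul_nth, cases "k = l") (auto simp: if_distrib[of "qmul _"] cong: if_cong)
    then show ?thesis by (simp add: mmul_assoc mat_eq_iff)
  qed
  have X: "?X \<in> PiQ d" using yM by (rule PiQ_mmul_madj)
  obtain u t where u: "unitary d u" "\<And>i. 0 \<le> t i" "?X = mmul u (mmul (rdiag t) (madj u))"
    using X by (metis spectral_psd)
  have tn: "t i = 0 \<or> t i = n" for i
  proof -
    have XX: "mmul ?X ?X = n *\<^sub>R ?X" using yy by (simp add: mmul_assoc[symmetric])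
    have "mmul (madj u) (mmul ?X u) = rdiag t" unfolding u(3) using u by (simp add: mmul_assoc unitary_cancel unitary_left)
    moreover have "mmul (madj u) (mmul (mmul ?X ?X) u) = rdiag (\<lambda>i. t i * t i)"
      unfolding u(3) using u by (simp add: mmul_assoc unitary_cancel unitary_left rdiag_mmul)
    ultimately have "rdiag (\<lambda>i. t i * t i) = n *\<^sub>R rdiag t" unfolding XX by (metis mmul_linear_simps(5,6))
    then have "(rdiag (\<lambda>i. t i * t i) $ i $ i) $ 0 = (n *\<^sub>R rdiag t) $ i $ i $ 0" by simp
    then show ?thesis by (simp add: rdiag_nth)
  qed
  have tr: "(\<Sum>i\<in>UNIV. t i) = n"
    using retr_mmul_madj[of y] u by (simp add: u(3) retr_conj_unitary retr_rdiag n_def)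
  have eq: "mid - ?X = mmul u (mmul (rdiag (\<lambda>i. 1 - t i)) (madj u))"
    unfolding u(3) rdiag_linear rdiag_one using u by (simp add: unitary_right)
  have pr: "(\<Prod>i\<in>UNIV. 1 - t i) = 1 - n"
  proof (cases "n = 0")
    case True
    then show ?thesis using tn by (metis (no_types, lifting) diff_zero prod.neutral)
  next
    case False
    have "(\<Sum>i\<in>UNIV. t i) = (\<Sum>i\<in>{i. t i = n}. n)"
      using tn by (intro sum.mono_neutral_cong_right) auto
    then have "real (card {i. t i = n}) * n = n" using tr by simp
    then have "card {i. t i = n} = 1" using False by simp
    then obtain j where j: "{i. t i = n} = {j}" by (auto simp: card_1_singleton_iff)
    have "(\<Prod>i\<in>UNIV. 1 - t i) = (\<Prod>i\<in>{j}. 1 - n)"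
      using j tn by (intro prod.mono_neutral_cong_right) auto
    then show ?thesis by simp
  qed
  {
    assume "norm y < 1"
    then have n1: "n < 1" by (simp add: n_def abs_square_less_1)
    have "0 < 1 - t i" for i using tn[of i] n1 by auto
    then show "mid - ?X \<in> OmegaQ d" unfolding eq
      using u by (intro OmegaQ_conj[where h = "madj u"] rdiag_OmegaQ) (auto simp: unitary_right)
    show "Delta d (mid - ?X) = 1 - (norm y)\<^sup>2"
      using \<open>\<And>i. 0 < 1 - t i\<close> u unfolding eq by (subst Delta_spectral) (auto simp: pr n_def less_imp_le)
  }
  assume O: "mid - ?X \<in> OmegaQ d"
  show "norm y < 1"
  proof -
    have P: "mid - ?X \<in> PiQ d" using O by simp
    then have "\<And>i. 0 \<le> 1 - t i" unfolding eq using u by (simp add: conj_unitary_iff PiQ_rdiag)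
    then have "Delta d (mid - ?X) = 1 - n" unfolding eq using u by (subst Delta_spectral) (auto simp: pr)
    then have "(norm y)\<^sup>2 < 1\<^sup>2" using O by (simp add: OmegaQ_iff_Delta n_def)
    then show ?thesis by (rule power2_less_imp_less) simp
  qed
qed

text \<open>Left multiplication by h acts on a column as a unitary map, a scaling of row i by s i,
  and another unitary map. Each row of the column has d real coordinates, whence the exponent
  d.\<close>

lemma nn_integral_col_mmul:
  fixes f :: "'q::finite mat \<Rightarrow> ennreal"
  assumes u: "unitary d u" and s: "\<And>i. 0 < s i" and h: "h = mmul u (mmul (rdiag s) (madj u))"
    and f: "f \<in> borel_measurable borel"
  shows "(\<integral>\<^sup>+y. f (mmul h y) \<partial>col_leb {l}) = ennreal ((\<Prod>i\<in>UNIV. 1 / s i) ^ d) * (\<integral>\<^sup>+y. f y \<partial>col_leb {l})"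
proof -
  interpret frame "col_idx {l}" mat_unit by (rule frame_col)
  have iso: "(\<integral>\<^sup>+y. g (mmul w y) \<partial>leb) = (\<integral>\<^sup>+y. g y \<partial>leb)"
    if w: "unitary d w" and g: "g \<in> borel_measurable borel" for w :: "'q mat" and g :: "'q mat \<Rightarrow> ennreal"
  proof (rule nn_integral_isometry[OF _ _ _ g])
    have 1: "mmul x m \<in> F" if "In_M d x" "m \<in> F" for x m
      using that by (auto simp: F_col col_space_def mmul_nth)
    then have "m \<in> mmul w ` F" if "m \<in> F" for m
      using that w by (intro image_eqI[of _ _ "mmul (madj w) m"]) (auto simp: unitary_cancel)
    then show "mmul w ` F = F" using 1 w by auto
    show "norm (mmul w x) = norm x" for x
      using w by (simp add: norm_eq_sqrt_inner inner_mmul_left unitary_cancel)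
  qed (simp add: linear_iff)
  have ua: "unitary d (madj u)" using u unitary_right[OF u] by (simp add: unitary_def)
  have lin: "linear (mmul x)" for x :: "'q mat" by (simp add: linear_iff)
  have [measurable]: "(\<lambda>y. f (mmul x y)) \<in> borel_measurable borel" for x
    using measurable_compose[OF linear_borel[OF lin] f] .
  have "(\<integral>\<^sup>+y. f (mmul h y) \<partial>leb) = (\<integral>\<^sup>+y. f (mmul (mmul u (rdiag s)) (mmul (madj u) y)) \<partial>leb)"
    by (simp add: h mmul_assoc)
  also have "\<dots> = (\<integral>\<^sup>+y. f (mmul (mmul u (rdiag s)) y) \<partial>leb)"
    by (rule iso[OF ua]) measurable
  also have "\<dots> = (\<integral>\<^sup>+y. f (mmul u (mmul (rdiag s) y)) \<partial>leb)" by (simp add: mmul_assoc)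
  also have "\<dots> = ennreal (\<Prod>p\<in>col_idx {l}. 1 / s (fst p)) * (\<integral>\<^sup>+y. f (mmul u y) \<partial>leb)"
    using s by (intro nn_integral_diag lin) (auto simp: vec_eq_iff rdiag_mmul_nth mat_unit_nth)
  also have "(\<Prod>p\<in>col_idx {l}. 1 / s (fst p)) = (\<Prod>i\<in>UNIV. \<Prod>r\<in>{l} \<times> comps d. 1 / s i)"
    unfolding col_idx_eq prod.cartesian_product by (rule prod.cong) auto
  also have "\<dots> = (\<Prod>i\<in>UNIV. 1 / s i) ^ d"
    by (simp add: card_cartesian_product card_comps prod_power_distrib power_one_over prod_dividef)
  also have "(\<integral>\<^sup>+y. f (mmul u y) \<partial>leb) = (\<integral>\<^sup>+y. f y \<partial>leb)" by (rule iso[OF u f])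
  finally show ?thesis by (simp add: col_leb_def)
qed

text \<open>One column is integrated out by the substitution \<open>w = (I - v v\<^sup>*)\<^sup>1\<^sup>/\<^sup>2 y\<close>.\<close>

lemma nn_integral_column:
  fixes v :: "'q::finite mat"
  assumes a: "a > -1" and vM: "In_M d v" and b: "b \<in> col_space {l}"
  shows "(\<integral>\<^sup>+w. ennreal ((p + b \<bullet> w)\<^sup>2 * Delta_powr a (mid - mmul v (madj v) - mmul w (madj w))) \<partial>col_leb {l}) =
    ennreal ((p\<^sup>2 + ((norm b)\<^sup>2 - (norm (mmul (madj v) b))\<^sup>2) / (real (d * CARD('q)) + 2 + 2 * a))
       * Delta_powr (a + real d / 2) (mid - mmul v (madj v)))
      * (\<integral>\<^sup>+y. ball_weight a y \<partial>col_leb {l})"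
    (is "?lhs = _")
proof -
  interpret frame "col_idx {l}" mat_unit by (rule frame_col)
  let ?A = "mid - mmul v (madj v)"
  have AE: "AE w in col_leb {l}. w \<in> col_space {l}"
    using AE_V unfolding col_leb_def F_col .
  show ?thesis
  proof (cases "?A \<in> OmegaQ d")
    case False
    \<comment> \<open>If \<open>?A\<close> is not positive definite, neither is anything obtained
      from it by subtracting a semidefinite matrix, so both sides vanish.\<close>
    have "Delta_powr a (?A - mmul w (madj w)) = 0" if "w \<in> col_space {l}" for w
    proof -
      have "mmul w (madj w) \<in> PiQ d" using that by (intro PiQ_mmul_madj) (simp add: col_space_def)
      then have "?A - mmul w (madj w) \<notin> OmegaQ d" using OmegaQ_add[of "?A - mmul w (madj w)" "mmul w (madj w)"] False by auto
      then show ?thesis by (simp add: Delta_powr_def)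
    qed
    then have "?lhs = (\<integral>\<^sup>+w. 0 \<partial>col_leb {l})"
      by (intro nn_integral_cong_AE) (use AE in eventually_elim, simp)
    then show ?thesis using False by (simp add: Delta_powr_def)
  next
    case True
    then obtain u s h g where u: "unitary d u" "\<And>i. 0 < s i" "h = mmul u (mmul (rdiag s) (madj u))"
      "h \<in> PiQ d" "mmul h h = ?A" "Delta d ?A = (\<Prod>i\<in>UNIV. s i)\<^sup>2"
      and g: "In_M d g" "mmul h g = mid" "mmul g h = mid"
      by (metis OmegaQ_sqrt)
    have hH: "madj h = h" "In_M d h" using u(4) by simp_all
    define P where "P = (\<Prod>i\<in>UNIV. s i)"
    have P: "P > 0" unfolding P_def using u(2) by (intro prod_pos) auto
    define f where "f w = ennreal ((p + b \<bullet> w)\<^sup>2 * Delta_powr a (?A - mmul w (madj w)))" for w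
    have [measurable]: "f \<in> borel_measurable borel"
    proof -
      have [measurable]: "(\<lambda>w. ?A - mmul w (madj w)) \<in> borel_measurable borel"
        by (intro borel_measurable_continuous_onI continuous_intros)
      show ?thesis unfolding f_def by measurable
    qed
    have sub: "(\<integral>\<^sup>+y. f (mmul h y) \<partial>leb) = ennreal ((1 / P) ^ d) * ?lhs"
      using nn_integral_col_mmul[OF u(1-3), of f l] by (simp add: f_def[symmetric] col_leb_def P_def prod_dividef)
    have fh: "f (mmul h y) = ennreal (Delta d ?A powr a) * (ennreal ((p + mmul h b \<bullet> y)\<^sup>2) * ball_weight a y)"
      if y: "y \<in> F" for y
    proof -
      have y': "y \<in> col_space {l}" using y by (simp add: F_col)
      \<comment> \<open>With w = h y the argument becomes a conjugate of I -
        \<open>mmul y (madj y)\<close> by h, so \<open>Delta\<close> splits off the factor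
        \<open>Delta d ?A\<close> and the rest depends on |y| only.\<close>
      have z: "?A - mmul (mmul h y) (madj (mmul h y)) = mmul h (mmul (mid - mmul y (madj y)) (madj h))"
        using u(5) by (simp add: hH mmul_assoc)
      have conj_inv: "mmul g (mmul (mmul h (mmul x (madj h))) (madj g)) = x" for x
      proof -
        have "mmul (madj h) (madj g) = mid" using g(3) by (metis madj_simps(1) madj_simps(8))
        then have "mmul g (mmul (mmul h (mmul x (madj h))) (madj g)) = mmul (mmul g h) x" by (simp add: mmul_assoc)
        then show ?thesis by (simp add: g)
      qed
      have D: "Delta_powr a (?A - mmul (mmul h y) (madj (mmul h y))) =
         Delta d ?A powr a * (if norm y < 1 then (1 - (norm y)\<^sup>2) powr a else 0)"
      proof (cases "norm y < 1")
        case True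
        have O: "mid - mmul y (madj y) \<in> OmegaQ d" and De: "Delta d (mid - mmul y (madj y)) = 1 - (norm y)\<^sup>2"
          using rank_one[OF y'] True by auto
        have "mmul h (mmul (mid - mmul y (madj y)) (madj h)) \<in> OmegaQ d"
          using OmegaQ_conj[OF hH(2) g(1,2) O] .
        moreover have "Delta d (mmul h (mmul (mid - mmul y (madj y)) (madj h))) = Delta d ?A * (1 - (norm y)\<^sup>2)"
          using Delta_conj[OF hH(2), of "mid - mmul y (madj y)"] O De u(5) by (simp add: hH)
        ultimately show ?thesis unfolding z using True u(6) by (simp add: Delta_powr_def powr_mult abs_square_le_1)
      next
        case False
        have "mmul h (mmul (mid - mmul y (madj y)) (madj h)) \<notin> OmegaQ d"
          using OmegaQ_conj[OF g(1) hH(2) g(3), of "mmul h (mmul (mid - mmul y (madj y)) (madj h))"]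
            rank_one(3)[OF y'] False unfolding conj_inv by blast
        then show ?thesis unfolding z using False by (simp add: Delta_powr_def)
      qed
      have "b \<bullet> mmul h y = mmul h b \<bullet> y" by (simp add: inner_mmul_left hH)
      then show ?thesis unfolding f_def D
        by (simp add: ball_weight_def ennreal_mult'[symmetric] mult_ac)
    qed
    have hb: "mmul h b \<in> F" using b hH by (auto simp: F_col col_space_def mmul_nth)
    have nhb: "(norm (mmul h b))\<^sup>2 = (norm b)\<^sup>2 - (norm (mmul (madj v) b))\<^sup>2"
    proof -
      have "(norm (mmul h b))\<^sup>2 = b \<bullet> mmul ?A b"
        unfolding u(5)[symmetric] by (simp add: power2_norm_eq_inner inner_mmul_left hH mmul_assoc)
      also have "\<dots> = b \<bullet> b - b \<bullet> mmul (mmul v (madj v)) b" by (simp add: inner_simps)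
      finally show ?thesis by (simp add: power2_norm_eq_inner mmul_assoc inner_mmul_left)
    qed
    have K: "real (card (col_idx {l})) = real (d * CARD('q))" by (simp add: card_col_idx)
    have ne: "col_idx {l} \<noteq> {}" using zero_in_comps by (auto simp: col_idx_def)
    have "ennreal ((1 / P) ^ d) * ?lhs = (\<integral>\<^sup>+y. ennreal (Delta d ?A powr a) * (ennreal ((p + mmul h b \<bullet> y)\<^sup>2) * ball_weight a y) \<partial>leb)"
      unfolding sub[symmetric] by (rule nn_integral_cong_AE) (use AE_V in eventually_elim, simp add: fh)
    also have "\<dots> = ennreal (Delta d ?A powr a) * (\<integral>\<^sup>+y. ennreal ((p + mmul h b \<bullet> y)\<^sup>2) * ball_weight a y \<partial>leb)"
      by (rule nn_integral_cmult) measurable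
    also have "(\<integral>\<^sup>+y. ennreal ((p + mmul h b \<bullet> y)\<^sup>2) * ball_weight a y \<partial>leb) =
       ennreal (p\<^sup>2 + (norm (mmul h b))\<^sup>2 / (real (d * CARD('q)) + 2 + 2 * a)) * (\<integral>\<^sup>+y. ball_weight a y \<partial>leb)"
      unfolding K[symmetric] by (rule nn_integral_ball_moment[OF a hb ne])
    finally have eq: "ennreal ((1 / P) ^ d) * ?lhs =
      ennreal (Delta d ?A powr a) * (ennreal (p\<^sup>2 + (norm (mmul h b))\<^sup>2 / (real (d * CARD('q)) + 2 + 2 * a)) * (\<integral>\<^sup>+y. ball_weight a y \<partial>leb))" .
    let ?c = "p\<^sup>2 + (norm (mmul h b))\<^sup>2 / (real (d * CARD('q)) + 2 + 2 * a)"
    have one: "ennreal (P ^ d) * ennreal ((1 / P) ^ d) = 1"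
      using P by (simp add: ennreal_mult'[symmetric] power_one_over)
    \<comment> \<open>The substitution w = h y contributes P^d, where P^2 =
      \<open>Delta d ?A\<close>. It raises the exponent left for the remaining columns from a to a +
      d/2.\<close>
    have Pd: "P ^ d = Delta d ?A powr (real d / 2)"
    proof -
      have "Delta d ?A powr (real d / 2) = (P powr 2) powr (real d / 2)"
        using P unfolding u(6) P_def[symmetric] by simp
      also have "\<dots> = P powr real d" unfolding powr_powr by simp
      finally show ?thesis using P by (simp add: powr_realpow)
    qed
    have Dp: "Delta_powr (a + real d / 2) ?A = Delta d ?A powr a * Delta d ?A powr (real d / 2)"
      using True by (simp add: Delta_powr_def powr_add)
    have "0 \<le> real (d * CARD('q)) + 2 + 2 * a" using a of_nat_0_le_iff[of "d * CARD('q)"] by linarith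
    then have c: "0 \<le> ?c" by (simp only: add_nonneg_nonneg divide_nonneg_nonneg zero_le_power2)
    have "?lhs = ennreal (P ^ d) * (ennreal ((1 / P) ^ d) * ?lhs)"
      by (simp only: mult.assoc[symmetric] one mult_1_left)
    also have "\<dots> = ennreal (P ^ d * (Delta d ?A powr a * ?c)) * (\<integral>\<^sup>+y. ball_weight a y \<partial>leb)"
      unfolding eq using P c by (simp add: ennreal_mult' mult.assoc)
    also have "P ^ d * (Delta d ?A powr a * ?c) = ?c * Delta_powr (a + real d / 2) ?A"
      unfolding Pd Dp by (simp only: mult_ac)
    finally show ?thesis unfolding nhb by (simp only: col_leb_def)
  qed
qed

lemma col_space_disjoint:
  assumes "x \<in> col_space S" "y \<in> col_space T" "S \<inter> T = {}"
  shows "mmul x (madj y) = 0" "x \<bullet> y = 0"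
proof -
  have z: "x$i$j = 0 \<or> y$k$j = 0" for i j k
  proof -
    have "j \<notin> S \<or> j \<notin> T" using assms(3) by blast
    then show ?thesis using assms by (auto simp: col_space_def)
  qed
  then have "qmul (x$i$j) (qconj (y$k$j)) = 0" for i j k by (metis qconj_simps(6) qmul_linear_simps(7,8))
  then show "mmul x (madj y) = 0" by (simp add: mat_eq_iff mmul_nth)
  have "x$i$j \<bullet> y$i$j = 0" for i j using z[of i j i] by auto
  then show "x \<bullet> y = 0" by (simp add: inner_mat)
qed

text \<open>The real coordinates of \<open>mmul (madj v) b\<close> are linear functionals of v,
  given by matrices that carry the column of b, multiplied by a unit scalar, in column j. The
  quadratic term left by integrating out one column thus becomes a sum of squares of linear
  functionals, which the induction hypothesis of \<open>column_moments\<close> evaluates.\<close>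

lemma norm_madj_mmul_col:
  fixes v :: "'q::finite mat"
  assumes v: "v \<in> col_space S" and b: "b \<in> col_space {l}"
  obtains c where "\<And>j k. j \<in> S \<Longrightarrow> k \<in> comps d \<Longrightarrow> c j k \<in> col_space S \<and> norm (c j k) = norm b"
  and "\<And>v. v \<in> col_space S \<Longrightarrow> (norm (mmul (madj v) b))\<^sup>2 = (\<Sum>j\<in>S. \<Sum>k\<in>comps d. (c j k \<bullet> v)\<^sup>2)"
proof -
  define c :: "'q \<Rightarrow> 4 \<Rightarrow> 'q mat" where
    "c j k = (\<chi> i j'. if j' = j then qmul (b$i$l) (qconj (axis k 1)) else 0)" for j k
  have bM: "In_M d b" and bl: "\<And>i j. j \<noteq> l \<Longrightarrow> b$i$j = 0" using b by (auto simp: col_space_def)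
  have nb: "(norm b)\<^sup>2 = (\<Sum>i\<in>UNIV. (norm (b$i$l))\<^sup>2)"
  proof -
    have "(\<Sum>k\<in>UNIV. (norm (b$i$k))\<^sup>2) = (norm (b$i$l))\<^sup>2" for i
      by (subst sum.remove[of _ l]) (auto simp: bl)
    then show ?thesis by (simp add: norm_mat_sq)
  qed
  have nq: "norm (qconj p) = norm p" for p
    by (simp add: norm_eq_sqrt_inner inner_scal)
  have "c j k \<in> col_space S \<and> norm (c j k) = norm b" if "j \<in> S" "k \<in> comps d" for j k
  proof
    have "qmul (b$i$l) (qconj (axis k 1)) $ n = 0" if n: "n \<notin> comps d" for i n
      using bM n \<open>k \<in> comps d\<close> by (intro qmul_comps[OF _ _ n]) (auto simp: In_M_def axis_def)
    then show "c j k \<in> col_space S" using that by (auto simp: col_space_def In_M_def c_def)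
    have "(\<Sum>j'\<in>UNIV. (norm (c j k$i$j'))\<^sup>2) = (norm (b$i$l))\<^sup>2" for i
      by (subst sum.remove[of _ j]) (auto simp: c_def norm_qmul nq)
    then have "(norm (c j k))\<^sup>2 = (norm b)\<^sup>2" by (simp add: norm_mat_sq[of "c j k"] nb)
    then show "norm (c j k) = norm b" by simp
  qed
  moreover have "(norm (mmul (madj v) b))\<^sup>2 = (\<Sum>j\<in>S. \<Sum>k\<in>comps d. (c j k \<bullet> v)\<^sup>2)" if v: "v \<in> col_space S" for v
  proof -
    let ?m = "mmul (madj v) b"
    have "In_M d ?m" using v bM by (simp add: col_space_def)
    then have mk: "?m$j$l$k = 0" if "k \<notin> comps d" for j k using that by (simp add: In_M_def)
    have m0: "?m$j$j' = 0" if "j' \<noteq> l" for j j' using bl[OF that] by (simp add: mmul_nth)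
    have mS: "?m$j$l = 0" if "j \<notin> S" for j using v that by (simp add: mmul_nth col_space_def)
    have cv: "c j k \<bullet> v = ?m$j$l$k" for j k
    proof -
      have "c j k \<bullet> v = (\<Sum>i\<in>UNIV. qmul (b$i$l) (qconj (axis k 1)) \<bullet> v$i$j)"
        unfolding inner_mat by (intro sum.cong refl, subst sum.remove[of _ j]) (auto simp: c_def)
      also have "\<dots> = (\<Sum>i\<in>UNIV. qmul (qconj (v$i$j)) (b$i$l) \<bullet> axis k 1)"
      proof (rule sum.cong[OF refl])
        fix i
        have "qmul (b$i$l) (qconj (axis k 1)) \<bullet> v$i$j = b$i$l \<bullet> qmul (v$i$j) (axis k 1)"
          by (simp only: inner_qmul_right qconj_simps)
        also have "\<dots> = qmul (qconj (v$i$j)) (b$i$l) \<bullet> axis k 1"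
          by (simp only: inner_qmul_left qconj_simps)
        finally show "qmul (b$i$l) (qconj (axis k 1)) \<bullet> v$i$j = qmul (qconj (v$i$j)) (b$i$l) \<bullet> axis k 1" .
      qed
      also have "\<dots> = ?m$j$l \<bullet> axis k 1" by (simp only: mmul_nth madj_nth inner_sum_left)
      finally show ?thesis by (simp only: cart_eq_inner_axis)
    qed
    have "(norm ?m)\<^sup>2 = (\<Sum>j\<in>UNIV. (norm (?m$j$l))\<^sup>2)"
      unfolding norm_mat_sq[of ?m] by (intro sum.cong refl, subst sum.remove[of _ l]) (auto simp: m0)
    also have "\<dots> = (\<Sum>j\<in>S. (norm (?m$j$l))\<^sup>2)"
      by (intro sum.mono_neutral_right) (auto simp: mS)
    also have "\<dots> = (\<Sum>j\<in>S. \<Sum>k\<in>comps d. (?m$j$l$k)\<^sup>2)"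
    proof (rule sum.cong[OF refl])
      fix j
      have "(norm (?m$j$l))\<^sup>2 = (\<Sum>k\<in>UNIV. (?m$j$l$k)\<^sup>2)"
        by (subst power2_norm_eq_inner) (simp add: inner_vec_def power2_eq_square)
      also have "\<dots> = (\<Sum>k\<in>comps d. (?m$j$l$k)\<^sup>2)"
        by (intro sum.mono_neutral_right) (auto simp: mk)
      finally show "(norm (?m$j$l))\<^sup>2 = (\<Sum>k\<in>comps d. (?m$j$l$k)\<^sup>2)" .
    qed
    finally show ?thesis by (simp only: cv)
  qed
  ultimately show ?thesis using that by blast
qed

lemma mid_OmegaQ [simp]: "mid \<in> OmegaQ d"
  unfolding rdiag_one[symmetric] by (rule rdiag_OmegaQ) simp

lemma Delta_powr_col_measurable [measurable]: "(\<lambda>v. Delta_powr a (mid - mmul v (madj v))) \<in> borel_measurable borel"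
proof -
  have [measurable]: "(\<lambda>w::'q::finite mat. mid - mmul w (madj w)) \<in> borel_measurable borel"
    by (intro borel_measurable_continuous_onI continuous_intros)
  show ?thesis by measurable
qed

text \<open>Induction on the set of columns. The exponent a is quantified in the claim because
  removing a column replaces it by a + d/2. The denominator is invariant under the passage from (a,
  \<open>insert l S\<close>) to (a + d/2, S), so the same factor appears in front of every
  coordinate of b: the covariance is isotropic although the density is not a function of
  |v|.\<close>

lemma column_moments:
  fixes S :: "'q::finite set"
  shows "finite S \<Longrightarrow> \<forall>a>-1. \<exists>Z>0. \<forall>p. \<forall>b\<in>col_space S.
    (\<integral>\<^sup>+v. ennreal ((p + b \<bullet> v)\<^sup>2 * Delta_powr a (mid - mmul v (madj v))) \<partial>col_leb S) =
      ennreal ((p\<^sup>2 + (norm b)\<^sup>2 / (2 * a + 2 - real d + real (d * CARD('q)) + real (d * card S))) * Z)"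
proof (induction S rule: finite_induct)
  case empty
  interpret frame "col_idx ({}::'q set)" mat_unit by (rule frame_col)
  \<comment> \<open>With no columns left the measure is the point mass at 0, and Z = 1.\<close>
  have e: "col_idx ({}::'q set) = {}" by (simp add: col_idx_def)
  have c0: "comb f = 0" for f unfolding comb_def unfolding e by simp
  have "(\<integral>\<^sup>+v. f v \<partial>col_leb ({}::'q set)) = f 0" if "f \<in> borel_measurable borel" for f
  proof -
    have "(\<integral>\<^sup>+v. f v \<partial>leb) = (\<integral>\<^sup>+x. f (comb x) \<partial>PiM (col_idx ({}::'q set)) (\<lambda>_. lborel))"
      unfolding leb_def using that by (intro nn_integral_distr) auto
    also have "\<dots> = f 0" unfolding c0 unfolding e by (simp add: space_PiM_empty emeasure_PiM_empty)
    finally show ?thesis by (simp only: col_leb_def)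
  qed
  moreover have "Delta_powr a (mid :: 'q mat) = 1" for a by (simp add: Delta_powr_def)
  moreover have "b = 0" if "b \<in> col_space ({}::'q set)" for b using that by (simp add: col_space_def mat_eq_iff)
  moreover have "(\<lambda>v. ennreal ((p + b \<bullet> v)\<^sup>2 * Delta_powr a (mid - mmul v (madj v)))) \<in> borel_measurable borel"
    for p a and b :: "'q mat" by measurable
  ultimately show ?case by (intro allI impI exI[of _ 1]) (metis (no_types, lifting) add.right_neutral diff_zero
      divide_eq_0_iff inner_zero_left mmul_linear_simps(7) mult.right_neutral norm_zero power_zero_numeral zero_less_one)
next
  case (insert l S)
  show ?case
  proof (intro allI impI)
    fix a :: real assume a: "a > -1"
    define a' where "a' = a + real d / 2"
    have a': "a' > -1" using a by (simp add: a'_def add_pos_nonneg less_le_trans)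
    define K where "K = 2 * a + 2 - real d + real (d * CARD('q)) + real (d * card (insert l S))"
    define K1 where "K1 = real (d * CARD('q)) + 2 + 2 * a"
    have K: "K = K1 + real d * real (card S)" using insert.hyps by (simp add: K_def K1_def algebra_simps)
    have K': "2 * a' + 2 - real d + real (d * CARD('q)) + real (d * card S) = K"
      by (simp add: K K1_def a'_def algebra_simps)
    have K1: "K1 > 0" unfolding K1_def using a by (simp add: add_nonneg_pos add.assoc)
    then have Kpos: "K > 0" by (simp add: K add_pos_nonneg)
    obtain Z where Z: "Z > 0" and IH: "\<And>p b. b \<in> col_space S \<Longrightarrow>
       (\<integral>\<^sup>+v. ennreal ((p + b \<bullet> v)\<^sup>2 * Delta_powr a' (mid - mmul v (madj v))) \<partial>col_leb S) =
        ennreal ((p\<^sup>2 + (norm b)\<^sup>2 / K) * Z)"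
      using insert.IH a' unfolding K'[symmetric] by blast
    interpret L: frame "col_idx {l}" mat_unit by (rule frame_col)
    interpret S: frame "col_idx S" mat_unit by (rule frame_col)
    interpret SL: frame "col_idx (insert l S)" mat_unit by (rule frame_col)
    obtain B where B: "B > 0" "(\<integral>\<^sup>+y. ball_weight a y \<partial>col_leb {l}) = ennreal B"
      using L.nn_integral_ball_weight_finite[OF a] L.nn_integral_ball_weight_pos[of a]
      unfolding col_leb_def by (cases "\<integral>\<^sup>+y. ball_weight a y \<partial>L.leb") auto
    have "(\<integral>\<^sup>+v. ennreal ((p + b \<bullet> v)\<^sup>2 * Delta_powr a (mid - mmul v (madj v))) \<partial>col_leb (insert l S)) =
      ennreal ((p\<^sup>2 + (norm b)\<^sup>2 / K) * (Z * B))" if b: "b \<in> col_space (insert l S)" for p b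
    proof -
      define b1 :: "'q mat" where "b1 = (\<chi> i j. if j = l then 0 else b$i$j)"
      define b2 :: "'q mat" where "b2 = (\<chi> i j. if j = l then b$i$j else 0)"
      have bb: "b = b1 + b2" by (simp add: b1_def b2_def mat_eq_iff)
      have b1: "b1 \<in> col_space S" and b2: "b2 \<in> col_space {l}"
        using b by (auto simp: b1_def b2_def col_space_def In_M_def)
      have dis: "S \<inter> {l} = {}" "{l} \<inter> S = {}" using insert.hyps by auto
      have nb: "(norm b)\<^sup>2 = (norm b1)\<^sup>2 + (norm b2)\<^sup>2"
        using col_space_disjoint(2)[OF b1 b2 dis(1)] by (simp add: bb power2_norm_eq_inner inner_simps inner_commute)
      define W where "W v = Delta_powr a' (mid - mmul v (madj v))" for v :: "'q mat"
      have W0: "W v \<ge> 0" for v by (simp add: W_def Delta_powr_nonneg)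
      have [measurable]: "W \<in> borel_measurable borel" unfolding W_def by measurable
      define n where "n = (norm b2)\<^sup>2"
      define m where "m v = (norm (mmul (madj v) b2))\<^sup>2" for v
      have [measurable]: "m \<in> borel_measurable borel" unfolding m_def
        by (intro borel_measurable_continuous_onI continuous_intros)
      \<comment> \<open>Where the density is positive v is a contraction, so the coefficient n - m v
        left by the removed column is nonnegative.\<close>
      have mn: "m v \<le> n" if "W v \<noteq> 0" "v \<in> col_space S" for v
      proof -
        have "mid - mmul v (madj v) \<in> PiQ d" using that by (auto simp: W_def Delta_powr_def split: if_splits)
        then have "0 \<le> b2 \<bullet> mmul (mid - mmul v (madj v)) b2" using b2 by (intro PiQ_nonneg) (auto simp: col_space_def)
        then show ?thesis by (simp add: m_def n_def power2_norm_eq_inner inner_simps inner_mmul_left mmul_assoc)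
      qed
      have AES: "AE v in col_leb S. v \<in> col_space S" using S.AE_V unfolding col_leb_def F_col .
      have AEL: "AE v in col_leb {l}. v \<in> col_space {l}" using L.AE_V unfolding col_leb_def F_col .
      have ms: "f \<in> borel_measurable (col_leb S)" if "f \<in> borel_measurable borel" for f :: "'q mat \<Rightarrow> ennreal"
        using that unfolding col_leb_def by (rule S.measurable_leb)
      define T where "T = (\<integral>\<^sup>+v. ennreal (((p + b1 \<bullet> v)\<^sup>2 + (n - m v) / K1) * W v) \<partial>col_leb S)"
      have "(\<integral>\<^sup>+v. ennreal ((p + b \<bullet> v)\<^sup>2 * Delta_powr a (mid - mmul v (madj v))) \<partial>col_leb (insert l S)) =
        (\<integral>\<^sup>+v. (\<integral>\<^sup>+w. ennreal ((p + b \<bullet> (v + w))\<^sup>2 * Delta_powr a (mid - mmul (v + w) (madj (v + w)))) \<partial>col_leb {l}) \<partial>col_leb S)"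
        unfolding col_leb_def using dis by (intro SL.nn_integral_leb_Un) (auto simp: col_idx_def)
      also have "\<dots> = (\<integral>\<^sup>+v. ennreal (((p + b1 \<bullet> v)\<^sup>2 + (n - m v) / K1) * W v) * ennreal B \<partial>col_leb S)"
      proof (rule nn_integral_cong_AE, use AES in eventually_elim)
        fix v assume v: "v \<in> col_space S"
        have "(\<integral>\<^sup>+w. ennreal ((p + b \<bullet> (v + w))\<^sup>2 * Delta_powr a (mid - mmul (v + w) (madj (v + w)))) \<partial>col_leb {l}) =
          (\<integral>\<^sup>+w. ennreal (((p + b1 \<bullet> v) + b2 \<bullet> w)\<^sup>2 * Delta_powr a (mid - mmul v (madj v) - mmul w (madj w))) \<partial>col_leb {l})"
        proof (rule nn_integral_cong_AE, use AEL in eventually_elim)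
          fix w assume w: "w \<in> col_space {l}"
          have "b \<bullet> (v + w) = b1 \<bullet> v + b2 \<bullet> w"
            using col_space_disjoint(2)[OF b1 w dis(1)] col_space_disjoint(2)[OF v b2 dis(1)]
            by (simp add: bb inner_simps inner_commute)
          moreover have "mid - mmul (v + w) (madj (v + w)) = mid - mmul v (madj v) - mmul w (madj w)"
            using col_space_disjoint(1)[OF v w dis(1)] col_space_disjoint(1)[OF w v dis(2)] by simp
          ultimately show "ennreal ((p + b \<bullet> (v + w))\<^sup>2 * Delta_powr a (mid - mmul (v + w) (madj (v + w)))) =
            ennreal (((p + b1 \<bullet> v) + b2 \<bullet> w)\<^sup>2 * Delta_powr a (mid - mmul v (madj v) - mmul w (madj w)))"
            by (simp only: add.assoc)
        qed
        also have "\<dots> = ennreal (((p + b1 \<bullet> v)\<^sup>2 + (n - m v) / K1) * W v) * ennreal B"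
          using v by (subst nn_integral_column[OF a _ b2])
            (simp_all add: col_space_def B(2) K1_def n_def m_def W_def a'_def)
        finally show "(\<integral>\<^sup>+w. ennreal ((p + b \<bullet> (v + w))\<^sup>2 * Delta_powr a (mid - mmul (v + w) (madj (v + w)))) \<partial>col_leb {l}) =
          ennreal (((p + b1 \<bullet> v)\<^sup>2 + (n - m v) / K1) * W v) * ennreal B" .
      qed
      also have "\<dots> = T * ennreal B" unfolding T_def by (rule nn_integral_multc) (rule ms, measurable)
      finally have main: "(\<integral>\<^sup>+v. ennreal ((p + b \<bullet> v)\<^sup>2 * Delta_powr a (mid - mmul v (madj v))) \<partial>col_leb (insert l S)) = T * ennreal B" .
      have IH1: "(\<integral>\<^sup>+v. ennreal ((p + b1 \<bullet> v)\<^sup>2 * W v) \<partial>col_leb S) = ennreal ((p\<^sup>2 + (norm b1)\<^sup>2 / K) * Z)"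
        unfolding W_def by (rule IH[OF b1])
      have IH0: "(\<integral>\<^sup>+v. ennreal (W v) \<partial>col_leb S) = ennreal Z"
        using IH[of 0 1] by (simp add: W_def col_space_def)
      have IHm: "(\<integral>\<^sup>+v. ennreal (m v * W v) \<partial>col_leb S) = ennreal (real d * real (card S) * (n / K * Z))"
      proof -
        obtain c where c: "\<And>j k. j \<in> S \<Longrightarrow> k \<in> comps d \<Longrightarrow> c j k \<in> col_space S \<and> norm (c j k) = norm b2"
          and mc: "\<And>v. v \<in> col_space S \<Longrightarrow> m v = (\<Sum>j\<in>S. \<Sum>k\<in>comps d. (c j k \<bullet> v)\<^sup>2)"
          using norm_madj_mmul_col[OF b1 b2] unfolding m_def by metis
        have "(\<integral>\<^sup>+v. ennreal (m v * W v) \<partial>col_leb S) =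
          (\<integral>\<^sup>+v. (\<Sum>j\<in>S. \<Sum>k\<in>comps d. ennreal ((0 + c j k \<bullet> v)\<^sup>2 * W v)) \<partial>col_leb S)"
          by (rule nn_integral_cong_AE, use AES in eventually_elim)
            (simp add: mc sum_distrib_right sum_ennreal W0 sum_nonneg)
        also have "\<dots> = (\<Sum>j\<in>S. \<integral>\<^sup>+v. (\<Sum>k\<in>comps d. ennreal ((0 + c j k \<bullet> v)\<^sup>2 * W v)) \<partial>col_leb S)"
          by (rule nn_integral_sum) (rule ms, measurable)
        also have "\<dots> = (\<Sum>j\<in>S. \<Sum>k\<in>comps d. \<integral>\<^sup>+v. ennreal ((0 + c j k \<bullet> v)\<^sup>2 * W v) \<partial>col_leb S)"
          by (intro sum.cong refl nn_integral_sum) (rule ms, measurable)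
        also have "\<dots> = (\<Sum>j\<in>S. \<Sum>k\<in>comps d. ennreal (n / K * Z))"
        proof (intro sum.cong refl)
          fix j k assume jk: "j \<in> S" "k \<in> comps d"
          have "(\<integral>\<^sup>+v. ennreal ((0 + c j k \<bullet> v)\<^sup>2 * W v) \<partial>col_leb S) = ennreal ((0\<^sup>2 + (norm (c j k))\<^sup>2 / K) * Z)"
            unfolding W_def using c[OF jk] by (intro IH) blast
          then show "(\<integral>\<^sup>+v. ennreal ((0 + c j k \<bullet> v)\<^sup>2 * W v) \<partial>col_leb S) = ennreal (n / K * Z)"
            using c[OF jk] by (simp add: n_def)
        qed
        also have "\<dots> = ennreal (\<Sum>j\<in>S. \<Sum>k\<in>comps d. n / K * Z)"
          using Kpos Z by (simp add: sum_ennreal n_def sum_nonneg del: sum_constant)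
        also have "(\<Sum>j\<in>S. \<Sum>k\<in>comps d. n / K * Z) = real d * real (card S) * (n / K * Z)"
          by (simp add: card_comps)
        finally show ?thesis .
      qed
      \<comment> \<open>The negative summand - m v / K1 is moved to the other side, since
        subtraction in \<open>ennreal\<close> is truncated.\<close>
      have "T + ennreal (1 / K1) * (\<integral>\<^sup>+v. ennreal (m v * W v) \<partial>col_leb S) =
        (\<integral>\<^sup>+v. ennreal (((p + b1 \<bullet> v)\<^sup>2 + (n - m v) / K1) * W v) + ennreal (1 / K1) * ennreal (m v * W v) \<partial>col_leb S)"
        unfolding T_def by (subst nn_integral_add) (auto intro!: ms nn_integral_cmult[symmetric])
      also have "\<dots> = (\<integral>\<^sup>+v. ennreal ((p + b1 \<bullet> v)\<^sup>2 * W v) + ennreal (n / K1) * ennreal (W v) \<partial>col_leb S)"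
      proof (rule nn_integral_cong_AE, use AES in eventually_elim)
        fix v assume v: "v \<in> col_space S"
        have p1: "0 \<le> ((p + b1 \<bullet> v)\<^sup>2 + (n - m v) / K1) * W v"
          using mn[OF _ v] K1 W0[of v] by (cases "W v = 0") auto
        have "((p + b1 \<bullet> v)\<^sup>2 + (n - m v) / K1) * W v + (1 / K1) * (m v * W v) =
          (p + b1 \<bullet> v)\<^sup>2 * W v + (n / K1) * W v"
          by (simp add: algebra_simps diff_divide_distrib)
        moreover have "0 \<le> (1 / K1) * (m v * W v)" "0 \<le> (n / K1) * W v" "0 \<le> (p + b1 \<bullet> v)\<^sup>2 * W v"
          using K1 W0[of v] by (auto simp: m_def n_def)
        ultimately have "ennreal (((p + b1 \<bullet> v)\<^sup>2 + (n - m v) / K1) * W v) + ennreal ((1 / K1) * (m v * W v)) =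
           ennreal ((p + b1 \<bullet> v)\<^sup>2 * W v) + ennreal ((n / K1) * W v)"
          using p1 by (metis ennreal_plus)
        moreover have e1: "ennreal ((1 / K1) * (m v * W v)) = ennreal (1 / K1) * ennreal (m v * W v)"
          using K1 by (intro ennreal_mult') simp
        moreover have e2: "ennreal ((n / K1) * W v) = ennreal (n / K1) * ennreal (W v)"
          using K1 by (intro ennreal_mult') (simp add: n_def)
        ultimately show "ennreal (((p + b1 \<bullet> v)\<^sup>2 + (n - m v) / K1) * W v) + ennreal (1 / K1) * ennreal (m v * W v) =
          ennreal ((p + b1 \<bullet> v)\<^sup>2 * W v) + ennreal (n / K1) * ennreal (W v)"
          by (simp only: e1 e2)
      qed
      also have "\<dots> = (\<integral>\<^sup>+v. ennreal ((p + b1 \<bullet> v)\<^sup>2 * W v) \<partial>col_leb S) + ennreal (n / K1) * (\<integral>\<^sup>+v. ennreal (W v) \<partial>col_leb S)"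
        by (subst nn_integral_add) (auto intro!: ms nn_integral_cmult)
      finally have "T + ennreal (1 / K1) * ennreal (real d * real (card S) * (n / K * Z)) =
        ennreal ((p\<^sup>2 + (norm b1)\<^sup>2 / K) * Z) + ennreal (n / K1) * ennreal Z" by (simp only: IH1 IH0 IHm)
      then have "T + ennreal (1 / K1 * (real d * real (card S) * (n / K * Z))) = ennreal ((p\<^sup>2 + (norm b1)\<^sup>2 / K) * Z + n / K1 * Z)"
        using K1 Kpos Z by (simp add: ennreal_mult'[symmetric] ennreal_plus[symmetric] n_def add_nonneg_nonneg del: ennreal_plus)
      then have "T = ennreal ((p\<^sup>2 + (norm b1)\<^sup>2 / K) * Z + n / K1 * Z - 1 / K1 * (real d * real (card S) * (n / K * Z)))"
        using K1 Kpos Z by (intro ennreal_eq_diffI) (auto simp: n_def)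
      also have "(p\<^sup>2 + (norm b1)\<^sup>2 / K) * Z + n / K1 * Z - 1 / K1 * (real d * real (card S) * (n / K * Z)) = (p\<^sup>2 + (norm b)\<^sup>2 / K) * Z"
      proof -
        \<comment> \<open>As K - K1 = d |S|, the new column gets n (1 - d |S| / K) / K1 = n / K, the
          same denominator as the old ones.\<close>
        have "n / K1 * Z - 1 / K1 * (real d * real (card S) * (n / K * Z)) = n * Z * (1 / K1 * (1 - real d * real (card S) / K))"
          by (simp add: algebra_simps)
        also have "1 - real d * real (card S) / K = K1 / K" using Kpos K by (simp add: field_simps)
        finally show ?thesis using K1 by (simp add: nb n_def[symmetric] algebra_simps add_divide_distrib)
      qed
      finally show ?thesis unfolding main using Kpos Z B
        by (simp add: ennreal_mult'[symmetric] add_nonneg_nonneg mult.assoc)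
    qed
    then show "\<exists>Z>0. \<forall>p. \<forall>b\<in>col_space (insert l S).
       (\<integral>\<^sup>+v. ennreal ((p + b \<bullet> v)\<^sup>2 * Delta_powr a (mid - mmul v (madj v))) \<partial>col_leb (insert l S)) =
       ennreal ((p\<^sup>2 + (norm b)\<^sup>2 / (2 * a + 2 - real d + real (d * CARD('q)) + real (d * card (insert l S)))) * Z)"
      unfolding K_def[symmetric] using Z B by (intro exI[of _ "Z * B"]) simp
  qed
qed

end

section \<open>The law of the random contraction\<close>

context field_dim
begin

text \<open>Uniform form of |v m| < |m|. The bound \<open>e \<le> 1\<close> keeps 1 - e nonnegative,
  on which the case \<open>mmul (madj v) m = 0\<close> of the passage to the adjoint relies.\<close>

lemma contraction_iff:
  assumes "In_M d v" shows "mid - mmul (madj v) v \<in> OmegaQ d \<longleftrightarrow>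
    (\<exists>e>0. e \<le> 1 \<and> (\<forall>m. In_M d m \<longrightarrow> (norm (mmul v m))\<^sup>2 \<le> (1 - e) * (norm m)\<^sup>2))"
proof -
  have eq: "m \<bullet> mmul (mid - mmul (madj v) v) m = (norm m)\<^sup>2 - (norm (mmul v m))\<^sup>2" for m
    by (simp add: inner_simps power2_norm_eq_inner inner_mmul_left mmul_assoc)
  have "mid - mmul (madj v) v \<in> Herm d" unfolding Herm_def using assms by simp
  then have "mid - mmul (madj v) v \<in> OmegaQ d \<longleftrightarrow>
    (\<exists>e>0. \<forall>m. In_M d m \<longrightarrow> e * (norm m)\<^sup>2 \<le> (norm m)\<^sup>2 - (norm (mmul v m))\<^sup>2)"
    unfolding OmegaQ_iff eq by blast
  also have "\<dots> \<longleftrightarrow> (\<exists>e>0. e \<le> 1 \<and> (\<forall>m. In_M d m \<longrightarrow> (norm (mmul v m))\<^sup>2 \<le> (1 - e) * (norm m)\<^sup>2))"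
  proof
    assume "\<exists>e>0. \<forall>m. In_M d m \<longrightarrow> e * (norm m)\<^sup>2 \<le> (norm m)\<^sup>2 - (norm (mmul v m))\<^sup>2"
    then obtain e where e: "e > 0" "\<And>m. In_M d m \<Longrightarrow> e * (norm m)\<^sup>2 \<le> (norm m)\<^sup>2 - (norm (mmul v m))\<^sup>2" by blast
    have "(norm (mmul v m))\<^sup>2 \<le> (1 - min e 1) * (norm m)\<^sup>2" if "In_M d m" for m
    proof -
      have "min e 1 * (norm m)\<^sup>2 \<le> e * (norm m)\<^sup>2" by (intro mult_right_mono) auto
      then show ?thesis using e(2)[OF that] by (simp add: algebra_simps)
    qed
    then show "\<exists>e>0. e \<le> 1 \<and> (\<forall>m. In_M d m \<longrightarrow> (norm (mmul v m))\<^sup>2 \<le> (1 - e) * (norm m)\<^sup>2)"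
      using e(1) by (intro exI[of _ "min e 1"]) auto
  next
    assume "\<exists>e>0. e \<le> 1 \<and> (\<forall>m. In_M d m \<longrightarrow> (norm (mmul v m))\<^sup>2 \<le> (1 - e) * (norm m)\<^sup>2)"
    then show "\<exists>e>0. \<forall>m. In_M d m \<longrightarrow> e * (norm m)\<^sup>2 \<le> (norm m)\<^sup>2 - (norm (mmul v m))\<^sup>2"
      by (auto simp: algebra_simps intro: exI)
  qed
  finally show ?thesis .
qed

text \<open>An operator and its adjoint have the same norm: for w = \<open>mmul (madj v) m\<close>,
  |w|^2 is the inner product of m with v w and so at most |m| |v w|. This reconciles the ball,
  defined through \<open>mmul (madj v) v\<close>, with the density, written with
  \<open>mmul v (madj v)\<close>.\<close>

lemma contraction_madj:
  assumes "In_M d v" "mid - mmul (madj v) v \<in> OmegaQ d"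
  shows "mid - mmul v (madj v) \<in> OmegaQ d"
proof -
  obtain e where e: "e > 0" "e \<le> 1" and le: "\<And>m. In_M d m \<Longrightarrow> (norm (mmul v m))\<^sup>2 \<le> (1 - e) * (norm m)\<^sup>2"
    using assms contraction_iff by blast
  have "(norm (mmul (madj v) m))\<^sup>2 \<le> (1 - e) * (norm m)\<^sup>2" if m: "In_M d m" for m
  proof (cases "norm (mmul (madj v) m) = 0")
    case False
    let ?w = "mmul (madj v) m"
    have "(norm ?w)\<^sup>2 = m \<bullet> mmul v ?w" by (simp add: power2_norm_eq_inner inner_mmul_left)
    also have "\<dots> \<le> norm m * norm (mmul v ?w)" by (rule norm_cauchy_schwarz)
    finally have "((norm ?w)\<^sup>2)\<^sup>2 \<le> (norm m * norm (mmul v ?w))\<^sup>2" by (intro power_mono) auto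
    also have "\<dots> \<le> (norm m)\<^sup>2 * ((1 - e) * (norm ?w)\<^sup>2)"
      unfolding power_mult_distrib using le[of ?w] m assms by (intro mult_left_mono) auto
    finally have "(norm ?w)\<^sup>2 * (norm ?w)\<^sup>2 \<le> ((1 - e) * (norm m)\<^sup>2) * (norm ?w)\<^sup>2"
      by (simp add: power2_eq_square mult_ac)
    then show ?thesis by (rule mult_right_le_imp_le) (use False in simp)
  qed (use e in simp)
  then show ?thesis using contraction_iff[of "madj v"] assms(1) e by auto
qed

lemma Dset_iff: "v \<in> Dset d \<longleftrightarrow> In_M d v \<and> mid - mmul v (madj v) \<in> OmegaQ d"
  unfolding Dset_def using contraction_madj[of v] contraction_madj[of "madj v"] by auto

lemma Dset_norm_le: "v \<in> Dset d \<Longrightarrow> (norm v)\<^sup>2 \<le> retr (mid :: 'q mat)" for v :: "'q::finite mat"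
proof -
  assume "v \<in> Dset d"
  then have "mid - mmul v (madj v) \<in> PiQ d" by (simp add: Dset_iff)
  from norm_le_retr[OF this] have "0 \<le> retr (mid - mmul v (madj v))" by (meson norm_ge_zero order_trans)
  then show ?thesis using retr_mmul_madj[of v] by (simp add: retr_eq_inner inner_simps)
qed

lemma Dset_contract: "v \<in> Dset d \<Longrightarrow> In_M d m \<Longrightarrow> norm (mmul v m) \<le> norm m"
proof -
  assume v: "v \<in> Dset d" and m: "In_M d m"
  then have "mid - mmul (madj v) v \<in> PiQ d" by (simp add: Dset_def)
  from PiQ_nonneg[OF this m] have "(norm (mmul v m))\<^sup>2 \<le> (norm m)\<^sup>2"
    by (simp add: inner_simps power2_norm_eq_inner inner_mmul_left mmul_assoc)
  then show ?thesis by (rule power2_le_imp_le) simp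
qed

definition conv_sq :: "'q::finite mat \<Rightarrow> 'q mat \<Rightarrow> 'q mat \<Rightarrow> 'q mat" where
  "conv_sq r s v = mmul r r + mmul s s + mmul s (mmul v r) + mmul r (mmul (madj v) s)"

lemma conv_sq_inner:
  assumes "r \<in> Herm d" "s \<in> Herm d"
  shows "m \<bullet> mmul (conv_sq r s v) m = (norm (mmul r m))\<^sup>2 + (norm (mmul s m))\<^sup>2 + 2 * (mmul v (mmul r m) \<bullet> mmul s m)"
proof -
  have "m \<bullet> mmul (mmul s (mmul v r)) m = mmul v (mmul r m) \<bullet> mmul s m"
    using assms by (simp add: mmul_assoc inner_mmul_left[of s] inner_commute)
  moreover have "m \<bullet> mmul (mmul r (mmul (madj v) s)) m = mmul v (mmul r m) \<bullet> mmul s m"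
    using assms by (simp add: mmul_assoc inner_mmul_left)
  moreover have "m \<bullet> mmul (mmul r r) m = (norm (mmul r m))\<^sup>2" "m \<bullet> mmul (mmul s s) m = (norm (mmul s m))\<^sup>2"
    using assms by (simp_all add: mmul_assoc inner_mmul_left power2_norm_eq_inner)
  ultimately show ?thesis by (simp add: conv_sq_def inner_simps)
qed

lemma conv_sq_Herm: "r \<in> Herm d \<Longrightarrow> s \<in> Herm d \<Longrightarrow> In_M d v \<Longrightarrow> conv_sq r s v \<in> Herm d"
proof -
  assume "r \<in> Herm d" "s \<in> Herm d" "In_M d v"
  then have "In_M d (conv_sq r s v)" "madj (conv_sq r s v) = conv_sq r s v"
    by (simp_all add: conv_sq_def mmul_assoc)
  then show ?thesis unfolding Herm_def by simp
qed

text \<open>The mixed term is at most 2 |r m| |s m| since v is a contraction, and this is at most c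
  |r m|^2 + |s m|^2 / c. With c = 1 the argument of the root is seen to be semidefinite; with c =
  1/2 half of r^2 is kept, which secures decay in the one-step expansion.\<close>

lemma conv_sq_lower:
  assumes rs: "r \<in> Herm d" "s \<in> Herm d" and v: "v \<in> Dset d" and c: "0 < c"
  shows "conv_sq r s v - ((1 - c) *\<^sub>R mmul r r - (1 / c - 1) *\<^sub>R mmul s s) \<in> PiQ d"
  unfolding PiQ_iff
proof safe
  have vM: "In_M d v" using v by (simp add: Dset_def)
  show "conv_sq r s v - ((1 - c) *\<^sub>R mmul r r - (1 / c - 1) *\<^sub>R mmul s s) \<in> Herm d"
    using conv_sq_Herm[OF rs vM] PiQ_square[OF rs(1)] PiQ_square[OF rs(2)] by simp
  fix m :: "'a mat" assume m: "In_M d m"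
  let ?x = "norm (mmul r m)" and ?y = "norm (mmul s m)"
  have "norm (mmul v (mmul r m)) \<le> ?x" using Dset_contract[OF v] rs m by simp
  then have "\<bar>mmul v (mmul r m) \<bullet> mmul s m\<bar> \<le> ?x * ?y"
    by (meson Cauchy_Schwarz_ineq2 mult_right_mono norm_ge_zero order_trans)
  moreover have "0 \<le> (sqrt c * ?x - ?y / sqrt c)\<^sup>2" by simp
  then have "2 * (?x * ?y) \<le> c * ?x\<^sup>2 + ?y\<^sup>2 / c"
    using c by (simp add: power2_diff power_mult_distrib power_divide)
  ultimately have "0 \<le> c * ?x\<^sup>2 + ?y\<^sup>2 / c + 2 * (mmul v (mmul r m) \<bullet> mmul s m)" by linarith
  moreover have "m \<bullet> mmul (mmul r r) m = ?x\<^sup>2" "m \<bullet> mmul (mmul s s) m = ?y\<^sup>2"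
    using rs by (simp_all add: mmul_assoc inner_mmul_left power2_norm_eq_inner)
  ultimately show "0 \<le> m \<bullet> mmul (conv_sq r s v - ((1 - c) *\<^sub>R mmul r r - (1 / c - 1) *\<^sub>R mmul s s)) m"
    by (simp add: inner_simps conv_sq_inner[OF rs] algebra_simps)
qed

lemma conv_sq_PiQ:
  assumes "r \<in> Herm d" "s \<in> Herm d" "v \<in> Dset d" shows "conv_sq r s v \<in> PiQ d"
  using conv_sq_lower[OF assms, of 1] by simp

text \<open>Total version of the root with values in the cone everywhere, so that it is measurable
  into \<open>PiS d\<close>.\<close>

definition psqrt :: "'q::finite mat \<Rightarrow> 'q mat" where
  "psqrt x = (if x \<in> PiQ d then msqrt d x else 0)"

lemma PiQ_borel [measurable]: "PiQ d \<in> sets borel" using closed_PiQ by (rule borel_closed)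

lemma psqrt_PiQ [simp]: "psqrt x \<in> PiQ d" by (simp add: psqrt_def)

lemma space_PiS: "space (PiS d) = PiQ d" by (simp add: PiS_def space_restrict_space)

lemma psqrt_borel: "psqrt \<in> borel_measurable borel"
  unfolding psqrt_def[abs_def]
  by (intro borel_measurable_continuous_on_if continuous_on_msqrt continuous_on_const PiQ_borel)

lemma psqrt_measurable [measurable]: "psqrt \<in> measurable borel (PiS d)"
  unfolding PiS_def by (rule measurable_restrict_space2) (auto simp: psqrt_borel)

text \<open>Off the cone no s qualifies, as the square of a cone element lies in the cone; so the
  description denotes one fixed value there.\<close>

lemma msqrt_borel: "msqrt d \<in> borel_measurable borel"
proof -
  have "msqrt d x = (THE s. False)" if "x \<notin> PiQ d" for x :: "'a mat"
  proof -
    have "(\<lambda>s. s \<in> PiQ d \<and> mmul s s = x) = (\<lambda>s. False)"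
      using that PiQ_square PiQ_Herm by blast
    then show ?thesis by (simp add: msqrt_def)
  qed
  then have "msqrt d = (\<lambda>x::'a mat. if x \<in> PiQ d then msqrt d x else (THE s. False))" by auto
  moreover have "(\<lambda>x::'a mat. if x \<in> PiQ d then msqrt d x else (THE s. False)) \<in> borel_measurable borel"
    by (intro borel_measurable_continuous_on_if continuous_on_msqrt continuous_on_const PiQ_borel)
  ultimately show ?thesis by simp
qed

lemma sets_PiS_borel: "A \<in> sets (PiS d) \<Longrightarrow> A \<in> sets borel"
  unfolding PiS_def by (subst (asm) sets_restrict_space_iff) auto

text \<open>The given measures are formed with \<open>msqrt\<close>, which may leave the cone on a
  null set and then is no measurable map into \<open>PiS d\<close>. As \<open>distr\<close> depends
  only on the masses of preimages, these are compared set by set.\<close>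

lemma distr_msqrt:
  fixes X :: "'b \<Rightarrow> 'q::finite mat"
  assumes X: "X \<in> borel_measurable M" and AE: "AE v in M. X v \<in> PiQ d"
  shows "distr M (PiS d) (\<lambda>v. msqrt d (X v)) = distr M (PiS d) (\<lambda>v. psqrt (X v))"
  unfolding distr_def
proof (rule measure_of_eq[OF sets.space_closed])
  fix A assume "A \<in> sigma_sets (space (PiS d)) (sets (PiS d :: 'q mat measure))"
  then have A: "A \<in> sets (PiS d)" by (simp add: sets.sigma_sets_eq)
  then have A': "A \<in> sets borel" by (rule sets_PiS_borel)
  have 1: "(\<lambda>v. msqrt d (X v)) \<in> borel_measurable M" by (rule measurable_compose[OF X msqrt_borel])
  have 2: "(\<lambda>v. psqrt (X v)) \<in> borel_measurable M" by (rule measurable_compose[OF X psqrt_borel])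
  show "emeasure M ((\<lambda>v. msqrt d (X v)) -` A \<inter> space M) = emeasure M ((\<lambda>v. psqrt (X v)) -` A \<inter> space M)"
    by (rule emeasure_eq_AE) (use AE measurable_sets[OF 1 A'] measurable_sets[OF 2 A'] in \<open>auto simp: psqrt_def elim!: eventually_mono\<close>)
qed

end

locale wishart_setting = field_dim +
  fixes \<mu> :: real and ty :: "'q::finite itself"
  assumes mu: "\<mu> > rho d TYPE('q) - 1"
begin

lemma mu_pos: "\<mu> > 0"
proof -
  have "real CARD('q) \<ge> 1" by (simp add: Suc_le_eq)
  then have "real CARD('q) - 1 / 2 > 0" by linarith
  moreover have "real d > 0" using d by auto
  ultimately have "real d * (real CARD('q) - 1 / 2) > 0" by (rule mult_pos_pos[rotated])
  then show ?thesis using mu by (simp add: rho_def)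
qed

lemma kappa_moments:
  "kappa d \<mu> TYPE('q) > 0"
  "(b::'q mat) \<in> {x. In_M d x} \<Longrightarrow>
    (\<integral>\<^sup>+v. ennreal ((p + b \<bullet> v)\<^sup>2 * Delta_powr (\<mu> - rho d TYPE('q)) (mid - mmul v (madj v))) \<partial>lebM d) =
      ennreal ((p\<^sup>2 + (norm b)\<^sup>2 / (2 * \<mu>)) * kappa d \<mu> TYPE('q))"
proof -
  interpret frame "col_idx (UNIV::'q set)" mat_unit by (rule frame_col)
  have cs: "col_space (UNIV :: 'q set) = {x. In_M d x}" by (simp add: col_space_def)
  have "(\<mu> - rho d TYPE('q)) > -1" using mu by simp
  then obtain Z where Z: "Z > 0" and m: "\<And>p b. b \<in> col_space (UNIV::'q set) \<Longrightarrow>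
    (\<integral>\<^sup>+v. ennreal ((p + b \<bullet> v)\<^sup>2 * Delta_powr (\<mu> - rho d TYPE('q)) (mid - mmul v (madj v))) \<partial>col_leb UNIV) =
      ennreal ((p\<^sup>2 + (norm b)\<^sup>2 / (2 * (\<mu> - rho d TYPE('q)) + 2 - real d + real (d * CARD('q)) + real (d * card (UNIV::'q set)))) * Z)"
    using column_moments[OF finite[of "UNIV::'q set"]] by blast
  \<comment> \<open>This is where rho = d (q - 1/2) + 1 enters: with all q columns the denominator
    is exactly 2 \<mu>.\<close>
  have K: "2 * (\<mu> - rho d TYPE('q)) + 2 - real d + real (d * CARD('q)) + real (d * card (UNIV::'q set)) = 2 * \<mu>"
    by (simp add: rho_def algebra_simps)
  have AE: "AE v in lebM d. In_M d (v::'q mat)"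
    using AE_V unfolding lebM_eq col_leb_def F_col cs by simp
  have m0: "(\<integral>\<^sup>+v. ennreal (Delta_powr (\<mu> - rho d TYPE('q)) (mid - mmul v (madj v))) \<partial>(lebM d :: 'q mat measure)) = ennreal Z"
    using m[of 0 1] by (simp add: cs lebM_eq)
  have "kappa d \<mu> TYPE('q) = Z"
  proof -
    have mb: "(\<lambda>v::'q mat. Delta_powr (\<mu> - rho d TYPE('q)) (mid - mmul (madj v) v)) \<in> borel_measurable borel"
      by (rule measurable_compose[OF _ Delta_powr_measurable])
        (intro borel_measurable_continuous_onI continuous_intros)
    \<comment> \<open>\<open>kappa\<close> is written with \<open>mmul (madj v) v\<close>; the
      isometry \<open>madj\<close> exchanges it with \<open>mmul v (madj v)\<close>.\<close>
    have "(\<integral>\<^sup>+v. ennreal (Delta_powr (\<mu> - rho d TYPE('q)) (mid - mmul (madj v) v)) \<partial>(lebM d :: 'q mat measure)) = ennreal Z"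
      unfolding m0[symmetric] lebM_eq col_leb_def
    proof (subst nn_integral_isometry[of madj "\<lambda>v. ennreal (Delta_powr (\<mu> - rho d TYPE('q)) (mid - mmul v (madj v)))", symmetric])
      show "madj ` F = F" unfolding F_col cs
        by (auto intro!: image_eqI[of _ madj "madj _"])
    qed (auto simp: linear_madj)
    moreover have "(\<integral>\<^sup>+v. ennreal (Delta_powr (\<mu> - rho d TYPE('q)) (mid - mmul (madj v) v)) \<partial>(lebM d :: 'q mat measure)) =
       (\<integral>\<^sup>+v. ennreal (indicator {v. In_M d v} v *\<^sub>R Delta_powr (\<mu> - rho d TYPE('q)) (mid - mmul (madj v) v)) \<partial>(lebM d :: 'q mat measure))"
      by (rule nn_integral_cong_AE) (use AE in eventually_elim, simp)
    ultimately have nn: "(\<integral>\<^sup>+v. ennreal (indicator {v. In_M d v} v *\<^sub>R Delta_powr (\<mu> - rho d TYPE('q)) (mid - mmul (madj v) v)) \<partial>(lebM d :: 'q mat measure)) = ennreal Z" by simp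
    have "kappa d \<mu> TYPE('q) = (\<integral>v. indicator {v::'q mat. In_M d v} v *\<^sub>R Delta_powr (\<mu> - rho d TYPE('q)) (mid - mmul (madj v) v) \<partial>lebM d)"
      unfolding kappa_def set_lebesgue_integral_def
      by (intro Bochner_Integration.integral_cong) (auto simp: Delta_powr_def Dset_def indicator_def)
    also have "\<dots> = enn2real (ennreal Z)"
      unfolding nn[symmetric]
    proof (rule integral_eq_nn_integral)
      have [measurable]: "{v::'q mat. In_M d v} \<in> sets borel" by (rule borel_closed[OF closed_In_M])
      note mb [measurable]
      have "(\<lambda>v::'q mat. indicator {v. In_M d v} v *\<^sub>R Delta_powr (\<mu> - rho d TYPE('q)) (mid - mmul (madj v) v)) \<in> borel_measurable borel"
        by measurable
      then show "(\<lambda>v::'q mat. indicator {v. In_M d v} v *\<^sub>R Delta_powr (\<mu> - rho d TYPE('q)) (mid - mmul (madj v) v)) \<in> borel_measurable (lebM d)"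
        unfolding lebM_eq col_leb_def by (rule measurable_leb)
    qed (simp add: Delta_powr_nonneg)
    finally show ?thesis using Z by simp
  qed
  then show "kappa d \<mu> TYPE('q) > 0" "(b::'q mat) \<in> {x. In_M d x} \<Longrightarrow>
    (\<integral>\<^sup>+v. ennreal ((p + b \<bullet> v)\<^sup>2 * Delta_powr (\<mu> - rho d TYPE('q)) (mid - mmul v (madj v))) \<partial>lebM d) =
      ennreal ((p\<^sup>2 + (norm b)\<^sup>2 / (2 * \<mu>)) * kappa d \<mu> TYPE('q))"
    using Z m[of b p, unfolded K] by (simp_all add: cs lebM_eq)
qed

definition vlaw :: "'q mat measure" where
  "vlaw = density (lebM d) (\<lambda>v. ennreal (indicator (Dset d) v *
         Delta d (mid - mmul v (madj v)) powr (\<mu> - rho d TYPE('q)) / kappa d \<mu> TYPE('q)))"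

lemma sets_lebM [simp, measurable_cong]: "sets (lebM d) = sets borel" by (simp add: lebM_def)

lemma sets_vlaw [simp, measurable_cong]: "sets vlaw = sets borel" by (simp add: vlaw_def)

lemma space_vlaw [simp]: "space vlaw = UNIV" using sets_eq_imp_space_eq[OF sets_vlaw] by simp

lemma Dset_borel [measurable]: "(Dset d :: 'q mat set) \<in> sets borel"
proof -
  have "(\<lambda>v::'q mat. mid - mmul v (madj v)) \<in> borel_measurable borel"
    by (intro borel_measurable_continuous_onI continuous_intros)
  from measurable_sets_borel[OF this OmegaQ_borel]
  have "(\<lambda>v::'q mat. mid - mmul v (madj v)) -` OmegaQ d \<in> sets borel" .
  then have "{v. In_M d v} \<inter> (\<lambda>v::'q mat. mid - mmul v (madj v)) -` OmegaQ d \<in> sets borel"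
    using closed_In_M by (intro sets.Int) (auto intro: borel_closed)
  moreover have "Dset d = {v. In_M d v} \<inter> (\<lambda>v::'q mat. mid - mmul v (madj v)) -` OmegaQ d"
    by (auto simp: Dset_iff)
  ultimately show ?thesis by simp
qed

lemma vlaw_eq: "vlaw = density (lebM d) (\<lambda>v. ennreal (indicator (Dset d) v *
   (Delta_powr (\<mu> - rho d TYPE('q)) (mid - mmul v (madj v)) / kappa d \<mu> TYPE('q))))"
  unfolding vlaw_def by (rule arg_cong[where f = "density _"], rule ext) (auto simp: Dset_iff Delta_powr_def indicator_def)

lemma vlaw_density_measurable [measurable]: "(\<lambda>v::'q mat. ennreal (indicator (Dset d) v *
   (Delta_powr (\<mu> - rho d TYPE('q)) (mid - mmul v (madj v)) / kappa d \<mu> TYPE('q)))) \<in> borel_measurable (lebM d)"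
  by measurable

lemma AE_vlaw: "AE v in vlaw. v \<in> Dset d"
  unfolding vlaw_eq by (subst AE_density) (auto simp: indicator_def)

lemma vlaw_moment:
  assumes b: "In_M d b"
  shows "(\<integral>\<^sup>+v. ennreal ((p + b \<bullet> v)\<^sup>2) \<partial>vlaw) = ennreal (p\<^sup>2 + (norm b)\<^sup>2 / (2 * \<mu>))"
proof -
  let ?k = "kappa d \<mu> TYPE('q)"
  have meas: "(\<lambda>v::'q mat. ennreal ((p + b \<bullet> v)\<^sup>2)) \<in> borel_measurable (lebM d)"
    "(\<lambda>v::'q mat. ennreal ((p + b \<bullet> v)\<^sup>2 * Delta_powr (\<mu> - rho d TYPE('q)) (mid - mmul v (madj v)))) \<in> borel_measurable (lebM d)"
    by measurable
  interpret frame "col_idx (UNIV::'q set)" mat_unit by (rule frame_col)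
  have AE: "AE v in lebM d. In_M d (v::'q mat)"
    using AE_V unfolding lebM_eq col_leb_def F_col by (simp add: col_space_def)
  have k: "?k > 0" by (rule kappa_moments)
  have "(\<integral>\<^sup>+v. ennreal ((p + b \<bullet> v)\<^sup>2) \<partial>vlaw) =
     (\<integral>\<^sup>+v. ennreal (indicator (Dset d) v * (Delta_powr (\<mu> - rho d TYPE('q)) (mid - mmul v (madj v)) / ?k)) * ennreal ((p + b \<bullet> v)\<^sup>2) \<partial>lebM d)"
    unfolding vlaw_eq by (rule nn_integral_density[OF vlaw_density_measurable meas(1)])
  also have "\<dots> = (\<integral>\<^sup>+v. ennreal (1 / ?k) * ennreal ((p + b \<bullet> v)\<^sup>2 * Delta_powr (\<mu> - rho d TYPE('q)) (mid - mmul v (madj v))) \<partial>lebM d)"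
    by (rule nn_integral_cong_AE, use AE in eventually_elim)
      (use k in \<open>auto simp: ennreal_mult'[symmetric] ennreal_mult''[symmetric] Delta_powr_def Dset_iff indicator_def mult.commute\<close>)
  also have "\<dots> = ennreal (1 / ?k) * ennreal ((p\<^sup>2 + (norm b)\<^sup>2 / (2 * \<mu>)) * ?k)"
    using b by (subst nn_integral_cmult[OF meas(2)]) (simp add: kappa_moments)
  also have "\<dots> = ennreal (p\<^sup>2 + (norm b)\<^sup>2 / (2 * \<mu>))"
    using k mu_pos by (simp add: ennreal_mult'[symmetric])
  finally show ?thesis .
qed

sublocale V: prob_space vlaw
proof
  show "emeasure vlaw (space vlaw) = 1" using vlaw_moment[of 0 1] by simp
qed

lemma integrable_vlaw_inner: "integrable vlaw (\<lambda>v. b \<bullet> v)"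
proof (rule V.integrable_const_bound[where B = "norm b * sqrt (retr (mid :: 'q mat))"])
  show "AE v in vlaw. norm (b \<bullet> v) \<le> norm b * sqrt (retr (mid :: 'q mat))"
  proof (use AE_vlaw in eventually_elim)
    fix v :: "'q mat" assume "v \<in> Dset d"
    then have "norm v \<le> sqrt (retr (mid :: 'q mat))" by (intro real_le_rsqrt Dset_norm_le)
    then have "norm b * norm v \<le> norm b * sqrt (retr (mid :: 'q mat))" by (rule mult_left_mono) simp
    then show "norm (b \<bullet> v) \<le> norm b * sqrt (retr (mid :: 'q mat))"
      using Cauchy_Schwarz_ineq2[of b v] by simp
  qed
qed measurable

lemma vlaw_sq:
  assumes b: "In_M d b"
  shows "integrable vlaw (\<lambda>v. (p + b \<bullet> v)\<^sup>2)" "(\<integral>v. (p + b \<bullet> v)\<^sup>2 \<partial>vlaw) = p\<^sup>2 + (norm b)\<^sup>2 / (2 * \<mu>)"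
proof -
  show "integrable vlaw (\<lambda>v. (p + b \<bullet> v)\<^sup>2)"
    by (rule integrableI_nonneg) (auto simp: vlaw_moment[OF b])
  show "(\<integral>v. (p + b \<bullet> v)\<^sup>2 \<partial>vlaw) = p\<^sup>2 + (norm b)\<^sup>2 / (2 * \<mu>)"
    using mu_pos by (subst integral_eq_nn_integral) (auto simp: vlaw_moment[OF b] simp del: ennreal_plus)
qed

text \<open>Polarisation: (1 + x)^2 - (x - 1)^2 = 4 x, and the second moments at p = 1 and p = -1
  agree.\<close>

lemma vlaw_mean:
  assumes b: "In_M d b" shows "(\<integral>v. b \<bullet> v \<partial>vlaw) = 0"
proof -
  have "(\<integral>v. (1 + b \<bullet> v)\<^sup>2 - (-1 + b \<bullet> v)\<^sup>2 \<partial>vlaw) = 0"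
    using vlaw_sq[OF b, of 1] vlaw_sq[OF b, of "-1"] by (subst Bochner_Integration.integral_diff) simp_all
  moreover have "(1 + b \<bullet> v)\<^sup>2 - (-1 + b \<bullet> v)\<^sup>2 = 4 * (b \<bullet> v)" for v by (simp add: power2_eq_square algebra_simps)
  ultimately show ?thesis by simp
qed

end

section \<open>The convolution as an image measure\<close>

context wishart_setting
begin

lemma PiS_borel: "(\<lambda>x. x) \<in> measurable (PiS d) borel"
  unfolding PiS_def by (rule measurable_restrict_space1) simp

lemma measurable_PiS: "f \<in> borel_measurable borel \<Longrightarrow> f \<in> measurable (PiS d) borel"
  unfolding PiS_def by (rule measurable_restrict_space1)

lemma psqrt_conv_measurable:
  "(\<lambda>p. psqrt (conv_sq (fst p) (fst (snd p)) (snd (snd p)))) \<in> measurable (PiS d \<Otimes>\<^sub>M (PiS d \<Otimes>\<^sub>M vlaw)) (PiS d)"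
proof -
  have 1: "(\<lambda>p::'q mat \<times> 'q mat \<times> 'q mat. conv_sq (fst p) (fst (snd p)) (snd (snd p))) \<in> borel_measurable (borel \<Otimes>\<^sub>M (borel \<Otimes>\<^sub>M borel))"
    unfolding borel_prod conv_sq_def by (intro borel_measurable_continuous_onI continuous_intros)
  have vid: "(\<lambda>x. x) \<in> measurable vlaw borel" by (rule measurable_ident_sets) simp
  have 2: "(\<lambda>p. (fst p, fst (snd p), snd (snd p))) \<in> measurable (PiS d \<Otimes>\<^sub>M (PiS d \<Otimes>\<^sub>M vlaw)) (borel \<Otimes>\<^sub>M (borel \<Otimes>\<^sub>M borel))"
    by (intro measurable_Pair measurable_compose[OF measurable_fst PiS_borel]
        measurable_compose[OF measurable_snd measurable_compose[OF measurable_fst PiS_borel]]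
        measurable_compose[OF measurable_snd measurable_compose[OF measurable_snd vid]])
  show ?thesis using measurable_compose[OF measurable_compose[OF 2 1] psqrt_measurable] by simp
qed

definition kern :: "'q mat \<Rightarrow> 'q mat \<Rightarrow> 'q mat measure" where
  "kern r s = distr vlaw (PiS d) (\<lambda>v. psqrt (conv_sq r s v))"

lemma conv_sq_measurable [measurable]: "conv_sq r s \<in> borel_measurable borel" for r s :: "'q mat"
  unfolding conv_sq_def[abs_def] by (intro borel_measurable_continuous_onI continuous_intros)

lemma pconv_eq_kern:
  assumes "r \<in> PiQ d" "s \<in> PiQ d" shows "pconv d \<mu> r s = kern r s"
proof -
  have "pconv d \<mu> r s = distr vlaw (PiS d) (\<lambda>v. msqrt d (conv_sq r s v))"
    by (simp add: pconv_def vlaw_def conv_sq_def)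
  also have "\<dots> = kern r s" unfolding kern_def
  proof (rule distr_msqrt)
    show "AE v in vlaw. conv_sq r s v \<in> PiQ d"
      using AE_vlaw by eventually_elim (use assms in \<open>simp add: conv_sq_PiQ\<close>)
    have "conv_sq r s \<in> borel_measurable vlaw" by measurable
    then show "(\<lambda>v. conv_sq r s v) \<in> borel_measurable vlaw" by simp
  qed
  finally show ?thesis .
qed

lemma kern_measurable: "(\<lambda>p. kern (fst p) (snd p)) \<in> measurable (PiS d \<Otimes>\<^sub>M PiS d) (subprob_algebra (PiS d))"
  unfolding kern_def
proof (rule measurable_distr2[where M = vlaw])
  have "(\<lambda>q. (fst (fst q), snd (fst q), snd q)) \<in> measurable ((PiS d \<Otimes>\<^sub>M PiS d) \<Otimes>\<^sub>M vlaw) (PiS d \<Otimes>\<^sub>M (PiS d \<Otimes>\<^sub>M vlaw))"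
    by measurable
  from measurable_compose[OF this psqrt_conv_measurable]
  show "(\<lambda>(p, v). psqrt (conv_sq (fst p) (snd p) v)) \<in> measurable ((PiS d \<Otimes>\<^sub>M PiS d) \<Otimes>\<^sub>M vlaw) (PiS d)"
    by (simp add: case_prod_beta')
  show "(\<lambda>p. vlaw) \<in> measurable (PiS d \<Otimes>\<^sub>M PiS d) (subprob_algebra vlaw)"
    by (intro measurable_const) (simp add: space_subprob_algebra V.subprob_space_axioms)
qed

definition law_on :: "'q mat measure \<Rightarrow> bool" where
  "law_on M \<longleftrightarrow> prob_space M \<and> sets M = sets (PiS d)"

lemma law_onD: "law_on M \<Longrightarrow> prob_space M" "law_on M \<Longrightarrow> sets M = sets (PiS d)" "law_on M \<Longrightarrow> space M = PiQ d"
  using sets_eq_imp_space_eq[of M "PiS d"] by (auto simp: law_on_def space_PiS)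

definition joint :: "'q mat measure \<Rightarrow> 'q mat measure \<Rightarrow> ('q mat \<times> 'q mat \<times> 'q mat) measure" where
  "joint M N = M \<Otimes>\<^sub>M (N \<Otimes>\<^sub>M vlaw)"

lemma sets_joint:
  assumes "law_on M" "law_on N"
  shows "sets (joint M N) = sets (PiS d \<Otimes>\<^sub>M (PiS d \<Otimes>\<^sub>M vlaw))"
  unfolding joint_def using assms by (intro sets_pair_measure_cong) (auto simp: law_onD)

lemma psqrt_conv_joint:
  assumes "law_on M" "law_on N"
  shows "(\<lambda>p. psqrt (conv_sq (fst p) (fst (snd p)) (snd (snd p)))) \<in> measurable (joint M N) (PiS d)"
  using psqrt_conv_measurable measurable_cong_sets[OF sets_joint[OF assms] refl] by blast

lemma joint_nn_integral:
  assumes M: "law_on M" and N: "law_on N" and f: "f \<in> borel_measurable (joint M N)"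
  shows "(\<integral>\<^sup>+p. f p \<partial>joint M N) = (\<integral>\<^sup>+r. (\<integral>\<^sup>+s. (\<integral>\<^sup>+v. f (r, s, v) \<partial>vlaw) \<partial>N) \<partial>M)"
proof -
  interpret M: prob_space M using M by (rule law_onD)
  interpret N: prob_space N using N by (rule law_onD)
  interpret NV: pair_prob_space N vlaw ..
  have f': "f \<in> borel_measurable (M \<Otimes>\<^sub>M (N \<Otimes>\<^sub>M vlaw))" using f by (simp add: joint_def)
  have "(\<integral>\<^sup>+p. f p \<partial>joint M N) = (\<integral>\<^sup>+r. (\<integral>\<^sup>+q. f (r, q) \<partial>(N \<Otimes>\<^sub>M vlaw)) \<partial>M)"
    unfolding joint_def using f' by (subst NV.nn_integral_fst[symmetric]) auto
  also have "\<dots> = (\<integral>\<^sup>+r. (\<integral>\<^sup>+s. (\<integral>\<^sup>+v. f (r, s, v) \<partial>vlaw) \<partial>N) \<partial>M)"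
  proof (rule nn_integral_cong)
    fix r assume "r \<in> space M"
    then have "(\<lambda>q. f (r, q)) \<in> borel_measurable (N \<Otimes>\<^sub>M vlaw)" using f' by (rule measurable_Pair2[rotated])
    then show "(\<integral>\<^sup>+q. f (r, q) \<partial>(N \<Otimes>\<^sub>M vlaw)) = (\<integral>\<^sup>+s. (\<integral>\<^sup>+v. f (r, s, v) \<partial>vlaw) \<partial>N)"
      by (subst V.nn_integral_fst[symmetric]) auto
  qed
  finally show ?thesis .
qed

text \<open>The convolution of two laws is the law of the root of \<open>conv_sq r s v\<close> for
  independent r, s, v. Fubini for a product measure can then replace the nested binds. The laws live
  on the cone, where \<open>pconv\<close> agrees with \<open>kern\<close>.\<close>

lemma mconv_eq:
  assumes M: "law_on M" and N: "law_on N"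
  shows "mconv d \<mu> M N = distr (joint M N) (PiS d) (\<lambda>p. psqrt (conv_sq (fst p) (fst (snd p)) (snd (snd p))))"
proof -
  interpret M: prob_space M using M by (rule law_onD)
  interpret N: prob_space N using N by (rule law_onD)
  note sM = law_onD(2,3)[OF M] and sN = law_onD(2,3)[OF N]
  have N': "N \<in> space (subprob_algebra N)" by (simp add: space_subprob_algebra N.subprob_space_axioms)
  have kN: "kern r \<in> measurable N (subprob_algebra (PiS d))" if "r \<in> PiQ d" for r
  proof -
    have "(\<lambda>s. (r, s)) \<in> measurable (PiS d) (PiS d \<Otimes>\<^sub>M PiS d)"
      using that by (intro measurable_Pair1') (simp add: space_PiS)
    from measurable_compose[OF this kern_measurable] show ?thesis
      by (simp add: measurable_cong_sets[OF sN(1) refl])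
  qed
  have kM: "(\<lambda>r. N \<bind> kern r) \<in> measurable M (subprob_algebra (PiS d))"
  proof (rule measurable_bind)
    show "(\<lambda>r. N) \<in> measurable M (subprob_algebra N)" using N' by (rule measurable_const)
    show "(\<lambda>x. kern (fst x) (snd x)) \<in> measurable (M \<Otimes>\<^sub>M N) (subprob_algebra (PiS d))"
      using kern_measurable measurable_cong_sets[OF sets_pair_measure_cong[OF sM(1) sN(1)] refl] by blast
  qed
  have "mconv d \<mu> M N = M \<bind> (\<lambda>r. N \<bind> kern r)"
    unfolding mconv_def
    by (intro bind_cong refl) (auto simp: sM sN pconv_eq_kern intro!: bind_cong)
  also have "\<dots> = distr (joint M N) (PiS d) (\<lambda>p. psqrt (conv_sq (fst p) (fst (snd p)) (snd (snd p))))"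
  proof (rule measure_eqI)
    have sb: "sets (M \<bind> (\<lambda>r. N \<bind> kern r)) = sets (PiS d)"
      by (rule sets_bind[OF sets_kernel[OF kM] M.not_empty])
    then show "sets (M \<bind> (\<lambda>r. N \<bind> kern r)) =
      sets (distr (joint M N) (PiS d) (\<lambda>p. psqrt (conv_sq (fst p) (fst (snd p)) (snd (snd p)))))" by simp
    fix A assume "A \<in> sets (M \<bind> (\<lambda>r. N \<bind> kern r))"
    then have A: "A \<in> sets (PiS d)" by (simp add: sb)
    note pj = psqrt_conv_joint[OF M N]
    have ind: "(\<lambda>p. indicator A (psqrt (conv_sq (fst p) (fst (snd p)) (snd (snd p)))) :: ennreal) \<in> borel_measurable (joint M N)"
      using pj A by measurable
    have "emeasure (M \<bind> (\<lambda>r. N \<bind> kern r)) A = (\<integral>\<^sup>+r. emeasure (N \<bind> kern r) A \<partial>M)"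
      using M.not_empty kM A by (rule emeasure_bind)
    also have "\<dots> = (\<integral>\<^sup>+r. (\<integral>\<^sup>+s. emeasure (kern r s) A \<partial>N) \<partial>M)"
      using N.not_empty kN A by (intro nn_integral_cong emeasure_bind) (auto simp: sM)
    also have "\<dots> = (\<integral>\<^sup>+r. (\<integral>\<^sup>+s. (\<integral>\<^sup>+v. indicator A (psqrt (conv_sq r s v)) \<partial>vlaw) \<partial>N) \<partial>M)"
    proof -
      have "emeasure (kern r s) A = (\<integral>\<^sup>+v. indicator A (psqrt (conv_sq r s v)) \<partial>vlaw)" for r s
      proof -
        have m: "(\<lambda>v. psqrt (conv_sq r s v)) \<in> measurable vlaw (PiS d)" by measurable
        have "emeasure (kern r s) A = (\<integral>\<^sup>+x. indicator A x \<partial>kern r s)" using A by (simp add: kern_def)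
        also have "\<dots> = (\<integral>\<^sup>+v. indicator A (psqrt (conv_sq r s v)) \<partial>vlaw)"
          unfolding kern_def using m A by (intro nn_integral_distr) auto
        finally show ?thesis .
      qed
      then show ?thesis by simp
    qed
    also have "\<dots> = (\<integral>\<^sup>+p. indicator A (psqrt (conv_sq (fst p) (fst (snd p)) (snd (snd p)))) \<partial>joint M N)"
      by (subst joint_nn_integral[OF M N ind]) simp
    also have "\<dots> = emeasure (distr (joint M N) (PiS d) (\<lambda>p. psqrt (conv_sq (fst p) (fst (snd p)) (snd (snd p))))) A"
      using A by (subst nn_integral_distr[OF pj, symmetric]) auto
    finally show "emeasure (M \<bind> (\<lambda>r. N \<bind> kern r)) A =
      emeasure (distr (joint M N) (PiS d) (\<lambda>p. psqrt (conv_sq (fst p) (fst (snd p)) (snd (snd p))))) A" .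
  qed
  finally show ?thesis .
qed

lemma prob_space_joint: "law_on M \<Longrightarrow> law_on N \<Longrightarrow> prob_space (joint M N)"
  unfolding joint_def by (intro prob_space_pair law_onD V.prob_space_axioms)

lemma law_on_mconv:
  assumes "law_on M" "law_on N" shows "law_on (mconv d \<mu> M N)"
  unfolding mconv_eq[OF assms] law_on_def
  using prob_space.prob_space_distr[OF prob_space_joint[OF assms] psqrt_conv_joint[OF assms]] by simp

lemma law_on_return: "law_on (return (PiS d) 0)"
  unfolding law_on_def by (simp add: prob_space_return space_PiS)

lemma law_on_convpow: "law_on \<nu> \<Longrightarrow> law_on (convpow d \<mu> \<nu> n)"
  by (induction n) (auto simp: law_on_return law_on_mconv)

lemma mconv_nn_integral:
  assumes M: "law_on M" and N: "law_on N" and f: "f \<in> borel_measurable (PiS d)"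
  shows "(\<integral>\<^sup>+x. f x \<partial>mconv d \<mu> M N) = (\<integral>\<^sup>+r. (\<integral>\<^sup>+s. (\<integral>\<^sup>+v. f (psqrt (conv_sq r s v)) \<partial>vlaw) \<partial>N) \<partial>M)"
  unfolding mconv_eq[OF M N] using measurable_compose[OF psqrt_conv_joint[OF M N] f] f
  by (subst nn_integral_distr[OF psqrt_conv_joint[OF M N]]) (simp_all add: joint_nn_integral[OF M N])

lemma mconv_integral:
  fixes f :: "'q mat \<Rightarrow> real"
  assumes M: "law_on M" and N: "law_on N" and f: "f \<in> borel_measurable (PiS d)" and B: "\<And>r. r \<in> PiQ d \<Longrightarrow> \<bar>f r\<bar> \<le> B"
  shows "(\<integral>x. f x \<partial>mconv d \<mu> M N) = (\<integral>r. (\<integral>s. (\<integral>v. f (psqrt (conv_sq r s v)) \<partial>vlaw) \<partial>N) \<partial>M)"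
    and "integrable M (\<lambda>r. \<integral>s. (\<integral>v. f (psqrt (conv_sq r s v)) \<partial>vlaw) \<partial>N)"
    and "\<And>r. r \<in> PiQ d \<Longrightarrow> integrable N (\<lambda>s. \<integral>v. f (psqrt (conv_sq r s v)) \<partial>vlaw)"
proof -
  interpret M: prob_space M using M by (rule law_onD)
  interpret N: prob_space N using N by (rule law_onD)
  interpret NV: pair_prob_space N vlaw ..
  interpret MNV: pair_prob_space M "N \<Otimes>\<^sub>M vlaw" ..
  let ?g = "\<lambda>p. f (psqrt (conv_sq (fst p) (fst (snd p)) (snd (snd p))))"
  have g: "?g \<in> borel_measurable (M \<Otimes>\<^sub>M (N \<Otimes>\<^sub>M vlaw))"
    using measurable_compose[OF psqrt_conv_joint[OF M N] f] by (simp add: joint_def)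
  have int: "integrable (M \<Otimes>\<^sub>M (N \<Otimes>\<^sub>M vlaw)) ?g"
    by (rule MNV.integrable_const_bound[where B = B]) (use g B in auto)
  have int2: "integrable (N \<Otimes>\<^sub>M vlaw) (\<lambda>q. f (psqrt (conv_sq r (fst q) (snd q))))" if "r \<in> PiQ d" for r
  proof (rule NV.integrable_const_bound[where B = B])
    have "r \<in> space M" using that law_onD[OF M] by simp
    from measurable_Pair2[OF g this] show "(\<lambda>q. f (psqrt (conv_sq r (fst q) (snd q)))) \<in> borel_measurable (N \<Otimes>\<^sub>M vlaw)" by simp
  qed (use B in auto)
  have in2: "(\<integral>q. f (psqrt (conv_sq r (fst q) (snd q))) \<partial>(N \<Otimes>\<^sub>M vlaw)) = (\<integral>s. (\<integral>v. f (psqrt (conv_sq r s v)) \<partial>vlaw) \<partial>N)" if "r \<in> PiQ d" for r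
    using NV.integral_fst'[OF int2[OF that]] by simp
  have i1: "integrable M (\<lambda>r. \<integral>q. f (psqrt (conv_sq r (fst q) (snd q))) \<partial>(N \<Otimes>\<^sub>M vlaw))"
    using MNV.integrable_fst'[OF int] by simp
  then show "integrable M (\<lambda>r. \<integral>s. (\<integral>v. f (psqrt (conv_sq r s v)) \<partial>vlaw) \<partial>N)"
    by (rule Bochner_Integration.integrable_cong[OF refl, THEN iffD1, rotated]) (use law_onD[OF M] in2 in simp)
  show "integrable N (\<lambda>s. \<integral>v. f (psqrt (conv_sq r s v)) \<partial>vlaw)" if "r \<in> PiQ d" for r
    using NV.integrable_fst'[OF int2[OF that]] by simp
  have "(\<integral>x. f x \<partial>mconv d \<mu> M N) = (\<integral>p. ?g p \<partial>(M \<Otimes>\<^sub>M (N \<Otimes>\<^sub>M vlaw)))"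
    unfolding mconv_eq[OF M N] using psqrt_conv_joint[OF M N] f by (subst integral_distr) (auto simp: joint_def)
  also have "\<dots> = (\<integral>r. (\<integral>q. f (psqrt (conv_sq r (fst q) (snd q))) \<partial>(N \<Otimes>\<^sub>M vlaw)) \<partial>M)"
    using MNV.integral_fst'[OF int] by simp
  also have "\<dots> = (\<integral>r. (\<integral>s. (\<integral>v. f (psqrt (conv_sq r s v)) \<partial>vlaw) \<partial>N) \<partial>M)"
    by (rule Bochner_Integration.integral_cong) (use law_onD[OF M] in2 in auto)
  finally show "(\<integral>x. f x \<partial>mconv d \<mu> M N) = (\<integral>r. (\<integral>s. (\<integral>v. f (psqrt (conv_sq r s v)) \<partial>vlaw) \<partial>N) \<partial>M)" .
qed

section \<open>Scaling and second moments\<close>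

lemma Tmap_scale: "0 \<le> c \<Longrightarrow> r \<in> PiQ d \<Longrightarrow> Tmap d (c *\<^sub>R mid) r = c *\<^sub>R r"
  unfolding Tmap_def by (rule msqrt_eqI) (simp_all add: mmul_assoc)

lemma scale_measurable: "0 \<le> c \<Longrightarrow> (\<lambda>r. c *\<^sub>R r) \<in> measurable (PiS d) (PiS d)"
  by (subst (2) PiS_def, rule measurable_restrict_space2)
    (auto simp: space_PiS intro!: measurable_PiS)

lemma Tmeas_scale:
  assumes "law_on M" "0 \<le> c" shows "Tmeas d (c *\<^sub>R mid) M = distr M (PiS d) (\<lambda>r. c *\<^sub>R r)"
  unfolding Tmeas_def using assms by (intro distr_cong) (auto simp: law_onD Tmap_scale)

lemma measurable_law: "law_on M \<Longrightarrow> f \<in> measurable (PiS d) N \<Longrightarrow> f \<in> measurable M N"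
  using measurable_cong_sets[OF law_onD(2) refl] by blast

lemma law_on_scale: "law_on M \<Longrightarrow> 0 \<le> c \<Longrightarrow> law_on (distr M (PiS d) (\<lambda>r. c *\<^sub>R r))"
  unfolding law_on_def[of "distr M (PiS d) (\<lambda>r. c *\<^sub>R r)"]
  using prob_space.prob_space_distr[OF law_onD(1) measurable_law[OF _ scale_measurable]] by simp

text \<open>\<open>conv_sq\<close> is homogeneous of degree two in r and s jointly, and the cone is
  invariant under positive scaling, so the case split inside \<open>psqrt\<close> is the same on
  both sides.\<close>

lemma psqrt_scale: "0 < c \<Longrightarrow> psqrt (conv_sq (c *\<^sub>R r) (c *\<^sub>R s) v) = c *\<^sub>R psqrt (conv_sq r s v)"
  for r s v :: "'q mat"
proof -
  assume c: "0 < c"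
  have eq: "conv_sq (c *\<^sub>R r) (c *\<^sub>R s) v = (c * c) *\<^sub>R conv_sq r s v"
    by (simp add: conv_sq_def scaleR_add_right)
  show ?thesis
  proof (cases "conv_sq r s v \<in> PiQ d")
    case True
    then have "msqrt d ((c * c) *\<^sub>R conv_sq r s v) = c *\<^sub>R msqrt d (conv_sq r s v)"
      using c by (intro msqrt_eqI) auto
    then show ?thesis using True c by (simp add: psqrt_def eq)
  next
    case False
    have "(c * c) *\<^sub>R conv_sq r s v \<notin> PiQ d"
    proof
      assume "(c * c) *\<^sub>R conv_sq r s v \<in> PiQ d"
      from PiQ_simps(3)[OF this, of "1 / (c * c)"] show False using False c by simp
    qed
    then show ?thesis using False by (simp add: psqrt_def eq)
  qed
qed

text \<open>Scaling commutes pointwise with the root of \<open>conv_sq\<close>, and the product of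
  the scaled laws is the image of the product under a map that leaves v alone.\<close>

lemma scale_mconv:
  assumes M: "law_on M" and N: "law_on N" and c: "0 < c"
  shows "distr (mconv d \<mu> M N) (PiS d) (\<lambda>r. c *\<^sub>R r) =
     mconv d \<mu> (distr M (PiS d) (\<lambda>r. c *\<^sub>R r)) (distr N (PiS d) (\<lambda>r. c *\<^sub>R r))"
proof (rule measure_eqI)
  let ?T = "\<lambda>M. distr M (PiS d) (\<lambda>r. c *\<^sub>R r)"
  have M': "law_on (?T M)" and N': "law_on (?T N)" using M N c by (auto intro: law_on_scale)
  show "sets (?T (mconv d \<mu> M N)) = sets (mconv d \<mu> (?T M) (?T N))"
    using law_onD(2)[OF law_on_mconv[OF M' N']] by simp
  have sc: "(\<lambda>r. c *\<^sub>R r) \<in> measurable (PiS d) (PiS d)" using c by (simp add: scale_measurable)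
  fix A assume "A \<in> sets (?T (mconv d \<mu> M N))"
  then have A: "A \<in> sets (PiS d)" by simp
  have i1: "(indicator A :: 'q mat \<Rightarrow> ennreal) \<in> borel_measurable (PiS d)" using A by simp
  have i2: "(\<lambda>r. indicator A (c *\<^sub>R r) :: ennreal) \<in> borel_measurable (PiS d)"
    using measurable_compose[OF sc i1] .
  have "emeasure (?T (mconv d \<mu> M N)) A = (\<integral>\<^sup>+x. indicator A (c *\<^sub>R x) \<partial>mconv d \<mu> M N)"
  proof -
    have "emeasure (?T (mconv d \<mu> M N)) A = (\<integral>\<^sup>+x. indicator A x \<partial>?T (mconv d \<mu> M N))" using A by simp
    then show ?thesis using i1 by (subst (asm) nn_integral_distr[OF measurable_law[OF law_on_mconv[OF M N] sc]]) simp_all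
  qed
  also have "\<dots> = (\<integral>\<^sup>+r. (\<integral>\<^sup>+s. (\<integral>\<^sup>+v. indicator A (psqrt (conv_sq (c *\<^sub>R r) (c *\<^sub>R s) v)) \<partial>vlaw) \<partial>N) \<partial>M)"
    by (simp add: mconv_nn_integral[OF M N i2] psqrt_scale[OF c])
  also have "\<dots> = (\<integral>\<^sup>+p. indicator A (psqrt (conv_sq (c *\<^sub>R fst p) (c *\<^sub>R fst (snd p)) (snd (snd p)))) \<partial>joint M N)"
  proof (subst joint_nn_integral[OF M N])
    have "(\<lambda>p. c *\<^sub>R psqrt (conv_sq (fst p) (fst (snd p)) (snd (snd p)))) \<in> measurable (joint M N) (PiS d)"
      using measurable_compose[OF psqrt_conv_joint[OF M N] sc] .
    from measurable_compose[OF this i1]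
    show "(\<lambda>p. indicator A (psqrt (conv_sq (c *\<^sub>R fst p) (c *\<^sub>R fst (snd p)) (snd (snd p)))) :: ennreal) \<in> borel_measurable (joint M N)"
      by (simp add: psqrt_scale[OF c])
  qed simp
  also have "\<dots> = (\<integral>\<^sup>+p. indicator A (psqrt (conv_sq (fst p) (fst (snd p)) (snd (snd p)))) \<partial>joint (?T M) (?T N))"
  proof -
    interpret M: prob_space M using M by (rule law_onD)
    interpret N: prob_space N using N by (rule law_onD)
    have scM: "(\<lambda>r. c *\<^sub>R r) \<in> measurable M (PiS d)" and scN: "(\<lambda>r. c *\<^sub>R r) \<in> measurable N (PiS d)"
      using measurable_law sc M N by auto
    have sf: "sigma_finite_measure (distr (N \<Otimes>\<^sub>M vlaw) (PiS d \<Otimes>\<^sub>M vlaw) (\<lambda>(s, v). (c *\<^sub>R s, v)))"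
    proof -
      interpret NV: pair_prob_space N vlaw ..
      have "(\<lambda>(s, v). (c *\<^sub>R s, v)) \<in> measurable (N \<Otimes>\<^sub>M vlaw) (PiS d \<Otimes>\<^sub>M vlaw)"
        using scN by (auto simp: case_prod_beta' intro!: measurable_Pair measurable_compose[OF measurable_fst])
      from NV.prob_space_distr[OF this] show ?thesis by (rule prob_space_imp_sigma_finite)
    qed
    have vid: "distr vlaw vlaw (\<lambda>v. v) = vlaw" by (rule distr_id)
    have 1: "?T N \<Otimes>\<^sub>M vlaw = distr (N \<Otimes>\<^sub>M vlaw) (PiS d \<Otimes>\<^sub>M vlaw) (\<lambda>(s, v). (c *\<^sub>R s, v))"
      using pair_measure_distr[OF scN measurable_ident[of vlaw, unfolded id_def]] by (simp add: vid V.sigma_finite_measure_axioms)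
    have snv: "(\<lambda>(s, v). (c *\<^sub>R s, v)) \<in> measurable (N \<Otimes>\<^sub>M vlaw) (PiS d \<Otimes>\<^sub>M vlaw)"
      using scN by (auto simp: case_prod_beta' intro!: measurable_Pair measurable_compose[OF measurable_fst])
    have "joint (?T M) (?T N) = distr (joint M N) (PiS d \<Otimes>\<^sub>M (PiS d \<Otimes>\<^sub>M vlaw)) (\<lambda>(r, q). (c *\<^sub>R r, case q of (s, v) \<Rightarrow> (c *\<^sub>R s, v)))"
      unfolding joint_def 1 by (rule pair_measure_distr[OF scM snv sf])
    moreover have "(\<lambda>(r, q). (c *\<^sub>R r, case q of (s, v) \<Rightarrow> (c *\<^sub>R s, v))) \<in> measurable (joint M N) (PiS d \<Otimes>\<^sub>M (PiS d \<Otimes>\<^sub>M vlaw))"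
      unfolding joint_def case_prod_beta'[of "\<lambda>r q. (c *\<^sub>R r, case q of (s, v) \<Rightarrow> (c *\<^sub>R s, v))"]
      by (rule measurable_Pair[OF measurable_compose[OF measurable_fst scM] measurable_compose[OF measurable_snd snv]])
    moreover have "(\<lambda>p. indicator A (psqrt (conv_sq (fst p) (fst (snd p)) (snd (snd p)))) :: ennreal) \<in> borel_measurable (PiS d \<Otimes>\<^sub>M (PiS d \<Otimes>\<^sub>M vlaw))"
      using measurable_compose[OF psqrt_conv_measurable i1] .
    ultimately show ?thesis by (simp add: nn_integral_distr case_prod_beta')
  qed
  also have "\<dots> = emeasure (mconv d \<mu> (?T M) (?T N)) A"
    unfolding mconv_eq[OF M' N'] using A i1
    by (subst nn_integral_distr[OF psqrt_conv_joint[OF M' N'], symmetric]) auto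
  finally show "emeasure (?T (mconv d \<mu> M N)) A = emeasure (mconv d \<mu> (?T M) (?T N)) A" .
qed

lemma Tmeas_convpow:
  assumes "law_on \<nu>" "0 < c"
  shows "Tmeas d (c *\<^sub>R mid) (convpow d \<mu> \<nu> n) = convpow d \<mu> (Tmeas d (c *\<^sub>R mid) \<nu>) n"
proof (induction n)
  case 0
  show ?case using assms scale_measurable[of c]
    by (simp add: Tmeas_scale law_on_return less_imp_le) (subst distr_return, auto simp: space_PiS)
next
  case (Suc n)
  then show ?case using assms
    by (simp add: Tmeas_scale law_on_mconv law_on_convpow scale_mconv less_imp_le)
qed

text \<open>The squared norm of a root is the trace of its argument, which is affine in v, and v has
  mean zero. Second moments therefore add under convolution.\<close>

lemma vlaw_norm_sq:
  assumes r: "r \<in> PiQ d" and s: "s \<in> PiQ d"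
  shows "(\<integral>\<^sup>+v. ennreal ((norm (psqrt (conv_sq r s v)))\<^sup>2) \<partial>vlaw) = ennreal ((norm r)\<^sup>2 + (norm s)\<^sup>2)"
proof -
  define b where "b = 2 *\<^sub>R mmul s r"
  have b: "In_M d b" using r s by (simp add: b_def)
  have eq: "AE v in vlaw. (norm (psqrt (conv_sq r s v)))\<^sup>2 = (norm r)\<^sup>2 + (norm s)\<^sup>2 + b \<bullet> v"
  proof (use AE_vlaw in eventually_elim)
    fix v :: "'q mat" assume v: "v \<in> Dset d"
    then have X: "conv_sq r s v \<in> PiQ d" using r s by (simp add: conv_sq_PiQ)
    have "(norm (psqrt (conv_sq r s v)))\<^sup>2 = retr (conv_sq r s v)"
      using X norm_sq_eq_retr[of "psqrt (conv_sq r s v)"] by (simp add: psqrt_def)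
    also have "\<dots> = mid \<bullet> mmul (conv_sq r s v) mid" by (simp add: retr_eq_inner)
    also have "\<dots> = (norm r)\<^sup>2 + (norm s)\<^sup>2 + 2 * (mmul v r \<bullet> s)"
      using r s by (subst conv_sq_inner) auto
    also have "mmul v r \<bullet> s = mmul s r \<bullet> v"
      using r inner_mmul_right[of v r s] by (simp add: inner_commute)
    finally show "(norm (psqrt (conv_sq r s v)))\<^sup>2 = (norm r)\<^sup>2 + (norm s)\<^sup>2 + b \<bullet> v" by (simp add: b_def)
  qed
  then have nn: "AE v in vlaw. 0 \<le> (norm r)\<^sup>2 + (norm s)\<^sup>2 + b \<bullet> v"
    by eventually_elim (metis zero_le_power2)
  have int: "integrable vlaw (\<lambda>v. (norm r)\<^sup>2 + (norm s)\<^sup>2 + b \<bullet> v)"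
    by (intro Bochner_Integration.integrable_add integrable_vlaw_inner) simp_all
  have "(\<integral>\<^sup>+v. ennreal ((norm (psqrt (conv_sq r s v)))\<^sup>2) \<partial>vlaw) = (\<integral>\<^sup>+v. ennreal ((norm r)\<^sup>2 + (norm s)\<^sup>2 + b \<bullet> v) \<partial>vlaw)"
    by (rule nn_integral_cong_AE) (use eq in eventually_elim, simp)
  also have "\<dots> = ennreal (\<integral>v. (norm r)\<^sup>2 + (norm s)\<^sup>2 + b \<bullet> v \<partial>vlaw)"
    using nn_integral_eq_integral[OF int nn] .
  also have "(\<integral>v. (norm r)\<^sup>2 + (norm s)\<^sup>2 + b \<bullet> v \<partial>vlaw) = (norm r)\<^sup>2 + (norm s)\<^sup>2"
    using vlaw_mean[OF b] integrable_vlaw_inner[of b] V.prob_space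
    by (subst Bochner_Integration.integral_add) auto
  finally show ?thesis .
qed

lemma norm_sq_measurable: "(\<lambda>r. ennreal ((norm r)\<^sup>2)) \<in> borel_measurable (PiS d)"
  by (rule measurable_PiS) measurable

lemma convpow_second_moment:
  assumes \<nu>: "law_on \<nu>"
  shows "(\<integral>\<^sup>+r. ennreal ((norm r)\<^sup>2) \<partial>convpow d \<mu> \<nu> n) = of_nat n * (\<integral>\<^sup>+r. ennreal ((norm r)\<^sup>2) \<partial>\<nu>)"
proof (induction n)
  case 0
  then show ?case using nn_integral_return[OF _ norm_sq_measurable, of 0] by (simp add: space_PiS)
next
  case (Suc n)
  let ?M = "convpow d \<mu> \<nu> n" and ?f = "\<lambda>r::'q mat. ennreal ((norm r)\<^sup>2)"
  have M: "law_on ?M" using \<nu> by (rule law_on_convpow)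
  interpret M: prob_space ?M using M by (rule law_onD)
  interpret N: prob_space \<nu> using \<nu> by (rule law_onD)
  have fM: "?f \<in> borel_measurable ?M" and fN: "?f \<in> borel_measurable \<nu>"
    by (rule measurable_law[OF M norm_sq_measurable], rule measurable_law[OF \<nu> norm_sq_measurable])
  have "(\<integral>\<^sup>+r. ?f r \<partial>convpow d \<mu> \<nu> (Suc n)) = (\<integral>\<^sup>+r. (\<integral>\<^sup>+s. (\<integral>\<^sup>+v. ?f (psqrt (conv_sq r s v)) \<partial>vlaw) \<partial>\<nu>) \<partial>?M)"
    using mconv_nn_integral[OF M \<nu> norm_sq_measurable] by simp
  also have "\<dots> = (\<integral>\<^sup>+r. (\<integral>\<^sup>+s. ?f r + ?f s \<partial>\<nu>) \<partial>?M)"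
    using law_onD(3)[OF M] law_onD(3)[OF \<nu>] by (intro nn_integral_cong) (simp add: vlaw_norm_sq)
  also have "\<dots> = (\<integral>\<^sup>+r. ?f r + (\<integral>\<^sup>+s. ?f s \<partial>\<nu>) \<partial>?M)"
    using fN by (intro nn_integral_cong) (simp add: nn_integral_add N.emeasure_space_1)
  also have "\<dots> = (\<integral>\<^sup>+r. ?f r \<partial>?M) + (\<integral>\<^sup>+s. ?f s \<partial>\<nu>)"
    using fM by (simp add: nn_integral_add M.emeasure_space_1)
  also have "\<dots> = of_nat (Suc n) * (\<integral>\<^sup>+s. ?f s \<partial>\<nu>)" by (simp add: Suc distrib_right add.commute)
  finally show ?case .
qed

end

section \<open>The one-step expansion\<close>

text \<open>Lagrange remainder with an intermediate point between 0 and x. The factor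
  \<open>max 1 (exp x)\<close> covers both signs and is later absorbed by a decaying
  exponential.\<close>

lemma exp_taylor2: "\<bar>exp x - (1 + x + x\<^sup>2 / 2)\<bar> \<le> \<bar>x\<bar> ^ 3 * max 1 (exp (x::real))"
proof -
  have ex: "\<exists>t. exp x = (\<Sum>m<3. exp 0 / fact m * x ^ m) + exp t / fact 3 * x ^ 3 \<and> exp t \<le> max 1 (exp x)"
  proof (cases x "0::real" rule: linorder_cases)
    case less
    have "\<exists>t>x. t < 0 \<and> exp x = (\<Sum>m<3. exp 0 / fact m * x ^ m) + exp t / fact 3 * x ^ 3"
      using less by (intro Maclaurin_minus) (auto intro!: derivative_eq_intros)
    then show ?thesis by (metis exp_le_cancel_iff exp_zero less_imp_le max.coboundedI1)
  next
    case equal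
    then show ?thesis by (intro exI[of _ 0]) (simp add: eval_nat_numeral)
  next
    case greater
    have "\<exists>t>0. t < x \<and> exp x = (\<Sum>m<3. exp 0 / fact m * x ^ m) + exp t / fact 3 * x ^ 3"
      using greater by (intro Maclaurin) (auto intro!: derivative_eq_intros)
    then show ?thesis by (metis exp_le_cancel_iff less_imp_le max.coboundedI2)
  qed
  moreover have "(\<Sum>m<3. exp 0 / fact m * x ^ m) = 1 + x + x\<^sup>2 / 2" "fact 3 = (6::real)"
    by (simp_all add: eval_nat_numeral)
  ultimately obtain t where t: "exp x = (1 + x + x\<^sup>2 / 2) + exp t / 6 * x ^ 3" "exp t \<le> max 1 (exp x)"
    by (metis (no_types, lifting))
  then have "\<bar>exp x - (1 + x + x\<^sup>2 / 2)\<bar> = exp t / 6 * \<bar>x\<bar> ^ 3" by (simp add: abs_mult power_abs)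
  also have "\<dots> \<le> max 1 (exp x) * \<bar>x\<bar> ^ 3" using t(2) by (intro mult_right_mono) auto
  finally show ?thesis by (simp add: mult.commute)
qed

text \<open>Third power of y \<le> exp y at y = (1 + p) / 6; hence 216 = 6^3.\<close>

lemma cube_exp_bound: "0 \<le> p \<Longrightarrow> (1 + p) ^ 3 * exp (- p / 2) \<le> 216 * exp (1 / 2 :: real)"
proof -
  assume p: "0 \<le> p"
  have "(1 + p) / 6 \<le> exp ((1 + p) / 6)" using exp_ge_add_one_self[of "(1 + p) / 6"] by linarith
  then have "((1 + p) / 6) ^ 3 \<le> exp ((1 + p) / 6) ^ 3" using p by (intro power_mono) auto
  also have "exp ((1 + p) / 6) ^ 3 = exp ((1 + p) / 2)" by (simp add: exp_of_nat_mult[symmetric])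
  finally have "(1 + p) ^ 3 \<le> 216 * exp ((1 + p) / 2)" by (simp add: power_divide)
  then have "(1 + p) ^ 3 * exp (- p / 2) \<le> 216 * exp ((1 + p) / 2) * exp (- p / 2)"
    by (intro mult_right_mono) auto
  also have "\<dots> = 216 * exp (1 / 2)" by (simp add: exp_add[symmetric] field_simps)
  finally show ?thesis .
qed

text \<open>Square of y \<le> exp y at y = (1 + p) / 2; hence 4 = 2^2.\<close>

lemma square_exp_bound: "0 \<le> p \<Longrightarrow> (1 + p) ^ 2 * exp (- p) \<le> 4 * exp (1 :: real)"
proof -
  assume p: "0 \<le> p"
  have "(1 + p) / 2 \<le> exp ((1 + p) / 2)" using exp_ge_add_one_self[of "(1 + p) / 2"] by linarith
  then have "((1 + p) / 2) ^ 2 \<le> exp ((1 + p) / 2) ^ 2" using p by (intro power_mono) auto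
  also have "exp ((1 + p) / 2) ^ 2 = exp (1 + p)" by (simp add: exp_of_nat_mult[symmetric])
  finally have "(1 + p) ^ 2 \<le> 4 * exp (1 + p)" by (simp add: power_divide)
  then have "(1 + p) ^ 2 * exp (- p) \<le> 4 * exp (1 + p) * exp (- p)" by (intro mult_right_mono) auto
  also have "\<dots> = 4 * exp 1" by (simp add: exp_add[symmetric])
  finally show ?thesis .
qed

context field_dim
begin

lemma inner_PiQ_nonneg: "A \<in> PiQ d \<Longrightarrow> P \<in> PiQ d \<Longrightarrow> 0 \<le> A \<bullet> P" for A P :: "'q::finite mat"
proof -
  assume A: "A \<in> PiQ d" and P: "P \<in> PiQ d"
  have "A \<bullet> P = mmul (msqrt d A) (msqrt d A) \<bullet> P" using A by simp
  also have "\<dots> = msqrt d A \<bullet> mmul P (msqrt d A)" using A by (subst inner_mmul_right) simp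
  finally show ?thesis using PiQ_nonneg[OF P, of "msqrt d A"] A by simp
qed

lemma inner_square:
  fixes A r :: "'q::finite mat"
  assumes "A \<in> PiQ d" "r \<in> Herm d" shows "A \<bullet> mmul r r = (norm (mmul (msqrt d A) r))\<^sup>2"
proof -
  have "A \<bullet> mmul r r = mmul (msqrt d A) (msqrt d A) \<bullet> mmul r r" using assms by simp
  also have "\<dots> = msqrt d A \<bullet> mmul (msqrt d A) (mmul r r)" using assms by (subst inner_mmul_left) simp
  also have "\<dots> = mmul (msqrt d A) r \<bullet> mmul (msqrt d A) r"
    using assms by (simp add: inner_mmul_right[of "msqrt d A" r] mmul_assoc)
  finally show ?thesis by (simp add: power2_norm_eq_inner)
qed

lemma retr_PiQ_nonneg: "A \<in> PiQ d \<Longrightarrow> 0 \<le> retr A" for A :: "'q::finite mat"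
  using norm_le_retr[of A] norm_ge_zero[of A] by linarith

lemma inner_conv_sq:
  assumes A: "A \<in> Herm d" and r: "r \<in> Herm d" and s: "s \<in> Herm d"
  shows "A \<bullet> conv_sq r s v = A \<bullet> mmul r r + A \<bullet> mmul s s + 2 * (mmul s (mmul A r) \<bullet> v)"
proof -
  have e: "mmul s (mmul v r) \<bullet> A = v \<bullet> mmul s (mmul A r)"
    using r s by (simp add: inner_mmul_left[of s] inner_mmul_right[of v] mmul_assoc)
  have "A \<bullet> mmul r (mmul (madj v) s) = madj A \<bullet> madj (mmul r (mmul (madj v) s))" by (rule inner_madj[symmetric])
  also have "\<dots> = A \<bullet> mmul s (mmul v r)" using A r s by (simp add: mmul_assoc)
  finally show ?thesis using e by (simp add: conv_sq_def inner_simps inner_commute)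
qed

end

context wishart_setting
begin

text \<open>The exponent is - (p + z), where z = y + 2 B . v is affine in v with mean y and second
  moment y^2 + 2 |B|^2 / \<mu>. The second order expansion in z gives the main term; y^2 is of order
  |s|^4 and goes into the error. The difficulty is uniformity in r: |B|^2 is of order p |s|^2, so
  all terms are weighed against a decaying exponential of p. Because of
  \<open>min (norm s) 1\<close> the cubic estimate is asked for small s only.\<close>

lemma one_step_vlaw:
  fixes A r s :: "'q mat"
  assumes A: "A \<in> PiQ d" "retr A \<le> L" and r: "r \<in> PiQ d" and s: "s \<in> PiQ d"
  defines "w \<equiv> sqrt (retr (mid :: 'q mat))"
  shows "\<bar>(\<integral>v. exp (- (A \<bullet> conv_sq r s v)) \<partial>vlaw) -
      exp (- (A \<bullet> mmul r r)) * (1 - A \<bullet> mmul s s + (norm (mmul s (mmul A r)))\<^sup>2 / \<mu>)\<bar>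
    \<le> (2 + L + L / \<mu> + L\<^sup>2 + (L + 2 * w * sqrt L) ^ 3 * exp L * (216 * exp (1 / 2))) * ((norm s)\<^sup>2 * min (norm s) 1)"
proof -
  define p where "p = A \<bullet> mmul r r"
  define y where "y = A \<bullet> mmul s s"
  define B where "B = mmul s (mmul A r)"
  define T where "T = exp (- p) * (1 - y + (norm B)\<^sup>2 / \<mu>)"
  define E where "E = (\<integral>v. exp (- (A \<bullet> conv_sq r s v)) \<partial>vlaw)"
  let ?n = "norm s"
  have BM: "In_M d B" using A r s by (simp add: B_def)
  have L0: "0 \<le> L" using A retr_PiQ_nonneg[OF A(1)] by linarith
  have w0: "0 \<le> w" unfolding w_def by (simp add: retr_PiQ_nonneg)
  let ?a = "msqrt d A"
  have na: "norm ?a \<le> sqrt L"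
    using norm_sq_eq_retr[of ?a] A by (intro real_le_rsqrt) simp
  have p: "p = (norm (mmul ?a r))\<^sup>2" "y = (norm (mmul ?a s))\<^sup>2"
    unfolding p_def y_def using A r s by (simp_all add: inner_square)
  have p0: "0 \<le> p" "0 \<le> y" by (simp_all add: p)
  have y: "y \<le> L * ?n\<^sup>2"
  proof -
    have "norm (mmul ?a s) \<le> sqrt L * ?n"
      by (rule order_trans[OF norm_mmul]) (intro mult_right_mono na, simp)
    then have "(norm (mmul ?a s))\<^sup>2 \<le> (sqrt L * ?n)\<^sup>2" by (intro power_mono) auto
    then show ?thesis using L0 by (simp add: p power_mult_distrib)
  qed
  have nB: "norm B \<le> ?n * (sqrt L * sqrt p)"
  proof -
    have "B = mmul s (mmul ?a (mmul ?a r))" using A by (simp add: B_def mmul_assoc[symmetric])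
    then have "norm B \<le> ?n * norm (mmul ?a (mmul ?a r))" by (metis norm_mmul)
    also have "\<dots> \<le> ?n * (norm ?a * norm (mmul ?a r))" by (intro mult_left_mono norm_mmul) simp
    also have "\<dots> \<le> ?n * (sqrt L * norm (mmul ?a r))" by (intro mult_left_mono mult_right_mono na) auto
    finally show ?thesis by (simp add: p)
  qed
  have nB2: "(norm B)\<^sup>2 \<le> ?n\<^sup>2 * (L * p)"
  proof -
    have "(norm B)\<^sup>2 \<le> (?n * (sqrt L * sqrt p))\<^sup>2" using nB by (intro power_mono) auto
    then show ?thesis using L0 p0 by (simp add: power_mult_distrib)
  qed
  define z where "z v = y + 2 * (B \<bullet> v)" for v
  have conv: "A \<bullet> conv_sq r s v = p + z v" for v
    using A r s by (simp add: inner_conv_sq p_def y_def z_def B_def)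
  have X0: "0 \<le> p + z v" if "v \<in> Dset d" for v
    unfolding conv[symmetric] using A r s that by (intro inner_PiQ_nonneg conv_sq_PiQ) auto
  \<comment> \<open>Case c = 1/2 of \<open>conv_sq_lower\<close>: half of p survives whatever v is,
    and it absorbs the polynomial growth in p.\<close>
  have lower: "p / 2 - y \<le> p + z v" if v: "v \<in> Dset d" for v
  proof -
    have "0 \<le> A \<bullet> (conv_sq r s v - ((1 - 1/2) *\<^sub>R mmul r r - (1 / (1/2) - 1) *\<^sub>R mmul s s))"
      using A r s v by (intro inner_PiQ_nonneg conv_sq_lower) auto
    then show ?thesis by (simp add: inner_simps conv p_def[symmetric] y_def[symmetric])
  qed
  have AE1: "AE v in vlaw. 0 \<le> p + z v" using AE_vlaw by eventually_elim (rule X0)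
  have meas: "(\<lambda>v. exp (- (p + z v))) \<in> borel_measurable vlaw" unfolding z_def by measurable
  have intE: "integrable vlaw (\<lambda>v. exp (- (p + z v)))"
    by (rule V.integrable_const_bound[where B = 1, OF _ meas], use AE1 in eventually_elim) simp
  have E: "E = (\<integral>v. exp (- (p + z v)) \<partial>vlaw)" by (simp add: E_def conv)
  have E01: "0 \<le> E" "E \<le> 1"
  proof -
    show "0 \<le> E" unfolding E by (rule integral_nonneg_AE) simp
    have "E \<le> (\<integral>v. 1 \<partial>vlaw)" unfolding E
      by (rule integral_mono_AE[OF intE], simp, use AE1 in eventually_elim) simp
    then show "E \<le> 1" using V.prob_space by simp
  qed
  define c where "c = L + 2 * w * sqrt L"
  have c0: "0 \<le> c" using L0 w0 by (simp add: c_def)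
  define K where "K = 2 + L + L / \<mu> + L\<^sup>2 + c ^ 3 * exp L * (216 * exp (1 / 2))"
  have "\<bar>E - T\<bar> \<le> K * (?n\<^sup>2 * min ?n 1)"
  proof (cases "?n \<le> 1")
    \<comment> \<open>For |s| > 1 no cancellation is used: both terms are bounded by a constant plus
      a multiple of |s|^2, and the constant is at most that constant times |s|^2.\<close>
    case False
    have pe: "p * exp (- p) \<le> 1"
    proof -
      have "p \<le> exp p" using exp_ge_add_one_self[of p] by linarith
      then show ?thesis by (simp add: exp_minus field_simps)
    qed
    have e1: "exp (- p) \<le> 1" using p0 by simp
    have "\<bar>T\<bar> \<le> exp (- p) * (1 + y + (norm B)\<^sup>2 / \<mu>)"
      unfolding T_def abs_mult using p0 mu_pos by (intro mult_mono) (auto simp: abs_le_iff field_simps)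
    also have "\<dots> = exp (- p) * (1 + y) + exp (- p) * (norm B)\<^sup>2 / \<mu>" by (simp add: algebra_simps)
    also have "exp (- p) * (1 + y) \<le> 1 * (1 + L * ?n\<^sup>2)" using e1 y p0 by (intro mult_mono) auto
    also have "exp (- p) * (norm B)\<^sup>2 / \<mu> \<le> L * ?n\<^sup>2 / \<mu>"
    proof (rule divide_right_mono)
      have "exp (- p) * (norm B)\<^sup>2 \<le> exp (- p) * (?n\<^sup>2 * (L * p))" using nB2 by (rule mult_left_mono) simp
      also have "\<dots> = (L * ?n\<^sup>2) * (p * exp (- p))" by simp
      also have "\<dots> \<le> (L * ?n\<^sup>2) * 1" using pe L0 by (intro mult_left_mono) auto
      finally show "exp (- p) * (norm B)\<^sup>2 \<le> L * ?n\<^sup>2" by simp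
    qed (use mu_pos in simp)
    finally have "\<bar>T\<bar> \<le> 1 + L * ?n\<^sup>2 + L * ?n\<^sup>2 / \<mu>" by simp
    then have "\<bar>E - T\<bar> \<le> 2 + L * ?n\<^sup>2 + L * ?n\<^sup>2 / \<mu>" using E01 by linarith
    also have "\<dots> \<le> 2 * ?n\<^sup>2 + L * ?n\<^sup>2 + L * ?n\<^sup>2 / \<mu>" using False by (simp add: one_le_power)
    also have "\<dots> = (2 + L + L / \<mu>) * ?n\<^sup>2" by (simp add: algebra_simps)
    also have "\<dots> \<le> K * ?n\<^sup>2" unfolding K_def using c0 by (intro mult_right_mono) auto
    finally show ?thesis using False by simp
  next
    case True
    define R where "R v = exp (- (p + z v)) - exp (- p) * (1 - z v + (z v)\<^sup>2 / 2)" for v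
    have Rb: "\<bar>R v\<bar> \<le> ?n ^ 3 * (c ^ 3 * exp L * (216 * exp (1 / 2)))" if v: "v \<in> Dset d" for v
    proof -
      have Rv: "R v = exp (- p) * (exp (- z v) - (1 + (- z v) + (- z v)\<^sup>2 / 2))"
      proof -
        have "exp (- (p + z v)) = exp (- p) * exp (- z v)" by (simp add: exp_add[symmetric])
        then show ?thesis by (simp add: R_def algebra_simps)
      qed
      have "norm v \<le> w" unfolding w_def by (intro real_le_rsqrt Dset_norm_le v)
      then have "\<bar>B \<bullet> v\<bar> \<le> (?n * (sqrt L * sqrt p)) * w"
        by (meson Cauchy_Schwarz_ineq2 mult_mono nB norm_ge_zero order_trans)
      then have "\<bar>z v\<bar> \<le> L * ?n\<^sup>2 + 2 * ((?n * (sqrt L * sqrt p)) * w)"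
        unfolding z_def using y p0 by linarith
      also have "\<dots> \<le> L * ?n + 2 * ((?n * (sqrt L * sqrt p)) * w)"
        using True L0 by (intro add_right_mono mult_left_mono) (auto simp: power2_eq_square intro: mult_left_le_one_le)
      also have "\<dots> = ?n * (L + 2 * w * sqrt L * sqrt p)" by (simp add: algebra_simps)
      also have "\<dots> \<le> ?n * (c * (1 + p))"
      proof (rule mult_left_mono)
        have "sqrt p \<le> 1 + p" using p0 by (intro real_le_lsqrt) (auto simp: power2_eq_square algebra_simps)
        then have "2 * w * sqrt L * sqrt p \<le> 2 * w * sqrt L * (1 + p)" using w0 L0 by (intro mult_left_mono) auto
        moreover have "L * 1 \<le> L * (1 + p)" using L0 p0 by (intro mult_left_mono) auto
        ultimately show "L + 2 * w * sqrt L * sqrt p \<le> c * (1 + p)" by (simp add: c_def algebra_simps)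
      qed simp
      finally have zb: "\<bar>z v\<bar> \<le> ?n * (c * (1 + p))" .
      have "\<bar>R v\<bar> \<le> exp (- p) * (\<bar>- z v\<bar> ^ 3 * max 1 (exp (- z v)))"
        unfolding Rv abs_mult using exp_taylor2[of "- z v"] by (simp add: mult_left_mono)
      also have "\<dots> = \<bar>z v\<bar> ^ 3 * (exp (- p) * max 1 (exp (- z v)))" by simp
      also have "\<dots> \<le> (?n * (c * (1 + p))) ^ 3 * (exp L * exp (- p / 2))"
      proof (rule mult_mono)
        have "y \<le> L" using y True L0 by (meson mult_left_le norm_ge_zero order_trans power_le_one)
        \<comment> \<open>Multiplied out, one alternative is exp (- p) and the other exp (- (p +
          z)); by the lower bound and y \<le> L both are at most exp (L - p / 2).\<close>
        have "exp (- p) * max 1 (exp (- z v)) = max (exp (- p)) (exp (- (p + z v)))"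
          by (auto simp: max_def exp_add[symmetric] mult_le_cancel_left1 split: if_splits)
        also have "\<dots> \<le> exp (L - p / 2)"
          using lower[OF v] \<open>y \<le> L\<close> p0 L0 by auto
        finally show "exp (- p) * max 1 (exp (- z v)) \<le> exp L * exp (- p / 2)" by (simp add: exp_add[symmetric])
      qed (use zb c0 p0 in \<open>auto intro!: power_mono\<close>)
      also have "\<dots> = ?n ^ 3 * (c ^ 3 * exp L * ((1 + p) ^ 3 * exp (- p / 2)))" by (simp add: power_mult_distrib)
      also have "\<dots> \<le> ?n ^ 3 * (c ^ 3 * exp L * (216 * exp (1 / 2)))"
        using cube_exp_bound[OF p0(1)] c0 by (intro mult_left_mono) auto
      finally show ?thesis .
    qed
    have zi: "integrable vlaw z" unfolding z_def by (intro Bochner_Integration.integrable_add integrable_mult_right integrable_vlaw_inner) simp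
    have zz: "(z v)\<^sup>2 = (y + (2 *\<^sub>R B) \<bullet> v)\<^sup>2" for v by (simp add: z_def)
    have B2: "In_M d (2 *\<^sub>R B)" using BM by simp
    have zzi: "integrable vlaw (\<lambda>v. (z v)\<^sup>2)" unfolding zz by (rule vlaw_sq[OF B2])
    have Ez: "(\<integral>v. z v \<partial>vlaw) = y"
      unfolding z_def using vlaw_mean[OF BM] integrable_vlaw_inner[of B] V.prob_space
      by (subst Bochner_Integration.integral_add) auto
    have Ezz: "(\<integral>v. (z v)\<^sup>2 \<partial>vlaw) = y\<^sup>2 + 2 * (norm B)\<^sup>2 / \<mu>"
      unfolding zz vlaw_sq(2)[OF B2] using mu_pos by (simp add: power_mult_distrib field_simps)
    have i3: "integrable vlaw (\<lambda>v. exp (- p) * (1 - z v + (z v)\<^sup>2 / 2))"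
      using zi zzi by (intro integrable_mult_right Bochner_Integration.integrable_add Bochner_Integration.integrable_diff integrable_divide) auto
    have "(\<integral>v. exp (- p) * (1 - z v + (z v)\<^sup>2 / 2) \<partial>vlaw) = exp (- p) * (1 - y + (y\<^sup>2 + 2 * (norm B)\<^sup>2 / \<mu>) / 2)"
    proof -
      have "(\<integral>v. 1 - z v + (z v)\<^sup>2 / 2 \<partial>vlaw) = (\<integral>v. 1 - z v \<partial>vlaw) + (\<integral>v. (z v)\<^sup>2 / 2 \<partial>vlaw)"
        using zi zzi by (intro Bochner_Integration.integral_add) auto
      also have "(\<integral>v. 1 - z v \<partial>vlaw) = 1 - y"
        using zi Ez V.prob_space by (subst Bochner_Integration.integral_diff) auto
      finally show ?thesis using Ezz by simp
    qed
    also have "\<dots> = T + exp (- p) * y\<^sup>2 / 2" by (simp add: T_def algebra_simps add_divide_distrib)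
    finally have ET: "E - T = (\<integral>v. R v \<partial>vlaw) + exp (- p) * y\<^sup>2 / 2"
      unfolding R_def E using intE i3 by (subst Bochner_Integration.integral_diff) auto
    have Ri: "integrable vlaw R" unfolding R_def using intE i3 by (rule Bochner_Integration.integrable_diff)
    have "\<bar>\<integral>v. R v \<partial>vlaw\<bar> \<le> ?n ^ 3 * (c ^ 3 * exp L * (216 * exp (1 / 2)))"
    proof -
      have "\<bar>\<integral>v. R v \<partial>vlaw\<bar> \<le> (\<integral>v. \<bar>R v\<bar> \<partial>vlaw)" by (rule integral_abs_bound)
      also have "\<dots> \<le> (\<integral>v. ?n ^ 3 * (c ^ 3 * exp L * (216 * exp (1 / 2))) \<partial>vlaw)"
        by (rule integral_mono_AE) (use Ri AE_vlaw Rb in \<open>auto elim!: eventually_mono\<close>)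
      finally show ?thesis using V.prob_space by simp
    qed
    moreover have "exp (- p) * y\<^sup>2 / 2 \<le> ?n ^ 3 * L\<^sup>2"
    proof -
      have "y\<^sup>2 \<le> (L * ?n\<^sup>2)\<^sup>2" using y p0 by (intro power_mono) auto
      also have "\<dots> = ?n ^ 4 * L\<^sup>2" by (simp add: power_mult_distrib)
      also have "\<dots> \<le> ?n ^ 3 * L\<^sup>2" using True by (intro mult_right_mono power_decreasing) auto
      finally have "y\<^sup>2 \<le> ?n ^ 3 * L\<^sup>2" .
      moreover have "exp (- p) * y\<^sup>2 \<le> 1 * y\<^sup>2" using p0 by (intro mult_right_mono) auto
      moreover have "0 \<le> exp (- p) * y\<^sup>2" by simp
      ultimately show ?thesis by linarith
    qed
    moreover have "0 \<le> exp (- p) * y\<^sup>2 / 2" by simp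
    ultimately have "\<bar>E - T\<bar> \<le> ?n ^ 3 * (L\<^sup>2 + c ^ 3 * exp L * (216 * exp (1 / 2)))"
      unfolding ET distrib_left by linarith
    also have "\<dots> \<le> ?n ^ 3 * K" unfolding K_def using L0 mu_pos by (intro mult_left_mono) auto
    also have "\<dots> = K * (?n\<^sup>2 * min ?n 1)" using True by (simp add: power3_eq_cube power2_eq_square)
    finally show ?thesis .
  qed
  then show ?thesis unfolding E_def T_def K_def c_def p_def y_def B_def .
qed

end

section \<open>Convergence of Laplace transforms\<close>

text \<open>Taylor bound in time for the heat flow, uniform in the X i, which will be the diagonal
  entries of a conjugate of r^2. With f the logarithm of the flow, the second derivative is exp f
  (f'' + f'^2). Both f' and f'' are at most C (1 + S) in absolute value and exp f is at most exp (-
  S), so \<open>square_exp_bound\<close> removes S.\<close>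

lemma exp_sum_taylor:
  fixes l X :: "'i::finite \<Rightarrow> real"
  assumes l: "\<And>i. 0 \<le> l i" and X: "\<And>i. 0 \<le> X i" and m: "0 \<le> m"
    and t: "0 \<le> t" "0 < e" "t + e \<le> 1"
  defines "C \<equiv> (\<Sum>i\<in>UNIV. 2 * m * l i + 4 * m * (l i)\<^sup>2 + (2 * l i + 8 * (l i)\<^sup>2) * (1 + 2 * l i))"
  shows "\<bar>exp (\<Sum>i\<in>UNIV. - m * ln (1 + 2 * (t + e) * l i) - X i / (1 + 2 * (t + e) * l i))
     - exp (\<Sum>i\<in>UNIV. - m * ln (1 + 2 * t * l i) - X i / (1 + 2 * t * l i)) *
        (1 + e * (\<Sum>i\<in>UNIV. - 2 * m * l i / (1 + 2 * t * l i) + 2 * l i * X i / (1 + 2 * t * l i)\<^sup>2))\<bar>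
     \<le> (C + C\<^sup>2) * (4 * exp 1) * e\<^sup>2"
proof -
  define f where "f t = (\<Sum>i\<in>UNIV. - m * ln (1 + 2 * t * l i) - X i / (1 + 2 * t * l i))" for t
  define f1 where "f1 t = (\<Sum>i\<in>UNIV. - 2 * m * l i / (1 + 2 * t * l i) + 2 * l i * X i / (1 + 2 * t * l i)\<^sup>2)" for t
  define f2 where "f2 t = (\<Sum>i\<in>UNIV. 4 * m * (l i)\<^sup>2 / (1 + 2 * t * l i)\<^sup>2 - 8 * (l i)\<^sup>2 * X i / (1 + 2 * t * l i) ^ 3)" for t
  have p: "1 \<le> 1 + 2 * t * l i" if "0 \<le> t" for t i using that l[of i] by simp
  have p': "0 < 1 + 2 * t * l i" if "0 \<le> t" for t i using p[OF that, of i] by linarith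
  have d1: "DERIV f t :> f1 t" if t: "0 \<le> t" for t
    unfolding f_def[abs_def] f1_def
  proof (rule DERIV_sum)
    fix i
    show "DERIV (\<lambda>t. - m * ln (1 + 2 * t * l i) - X i / (1 + 2 * t * l i)) t :>
      - 2 * m * l i / (1 + 2 * t * l i) + 2 * l i * X i / (1 + 2 * t * l i)\<^sup>2"
      using p'[OF t, of i] by (auto intro!: derivative_eq_intros simp: power2_eq_square mult_ac)
  qed
  have d2: "DERIV f1 t :> f2 t" if t: "0 \<le> t" for t
    unfolding f1_def[abs_def] f2_def
  proof (rule DERIV_sum)
    fix i
    show "DERIV (\<lambda>t. - 2 * m * l i / (1 + 2 * t * l i) + 2 * l i * X i / (1 + 2 * t * l i)\<^sup>2) t :>
      4 * m * (l i)\<^sup>2 / (1 + 2 * t * l i)\<^sup>2 - 8 * (l i)\<^sup>2 * X i / (1 + 2 * t * l i) ^ 3"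
      unfolding divide_inverse power_inverse[symmetric]
      using p'[OF t, of i] by (auto intro!: derivative_eq_intros simp: eval_nat_numeral algebra_simps)
  qed
  have g1: "DERIV (\<lambda>t. exp (f t)) t :> exp (f t) * f1 t" if "0 \<le> t" for t
    using d1[OF that] by (auto intro!: derivative_eq_intros)
  have g2: "DERIV (\<lambda>t. exp (f t) * f1 t) t :> exp (f t) * (f2 t + (f1 t)\<^sup>2)" if "0 \<le> t" for t
    using d1[OF that] d2[OF that] by (auto intro!: derivative_eq_intros simp: power2_eq_square algebra_simps)
  \<comment> \<open>On the unit time interval 1 + 2 t l i is at most 1 + 2 l i, so S bounds the
    decaying exponent from below, while each X i is at most (1 + 2 l i) S.\<close>
  define S where "S = (\<Sum>i\<in>UNIV. X i / (1 + 2 * l i))"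
  have S0: "0 \<le> S" unfolding S_def using X l by (intro sum_nonneg divide_nonneg_nonneg) (auto simp: add_nonneg_nonneg)
  have XS: "X i \<le> (1 + 2 * l i) * S" for i
  proof -
    have "X i / (1 + 2 * l i) \<le> S" unfolding S_def
      using X l by (intro member_le_sum) (auto intro!: divide_nonneg_nonneg add_nonneg_nonneg)
    then show ?thesis using l[of i] by (simp add: field_simps add_pos_nonneg)
  qed
  have C0: "0 \<le> C" unfolding C_def using l m by (intro sum_nonneg) (auto intro!: add_nonneg_nonneg mult_nonneg_nonneg)
  have div_le: "a / b ^ n \<le> a" if "0 \<le> a" "1 \<le> b" for a b :: real and n
    using that by (simp add: divide_le_eq mult_le_cancel_left1 one_le_power less_le_trans[OF zero_less_one])
  have b1: "\<bar>f1 t\<bar> \<le> C * (1 + S)" if t: "0 \<le> t" for t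
  proof -
    have "\<bar>f1 t\<bar> \<le> (\<Sum>i\<in>UNIV. (2 * m * l i + 4 * m * (l i)\<^sup>2 + (2 * l i + 8 * (l i)\<^sup>2) * (1 + 2 * l i)) * (1 + S))"
      unfolding f1_def
    proof (rule order_trans[OF sum_abs sum_mono])
      fix i
      have a1: "2 * m * l i / (1 + 2 * t * l i) \<le> 2 * m * l i" using div_le[OF _ p[OF t], of "2 * m * l i" i 1] l m by simp
      have a2: "2 * l i * X i / (1 + 2 * t * l i)\<^sup>2 \<le> 2 * l i * X i" using div_le[OF _ p[OF t], of "2 * l i * X i" i 2] l X by simp
      have n1: "0 \<le> 2 * m * l i / (1 + 2 * t * l i)" "0 \<le> 2 * l i * X i / (1 + 2 * t * l i)\<^sup>2"
        using l m X p'[OF t, of i] by (auto intro!: divide_nonneg_nonneg)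
      have "\<bar>- 2 * m * l i / (1 + 2 * t * l i) + 2 * l i * X i / (1 + 2 * t * l i)\<^sup>2\<bar> \<le> 2 * m * l i + 2 * l i * X i"
        using a1 a2 n1 by (simp add: abs_le_iff)
      also have "\<dots> \<le> 2 * m * l i + 2 * l i * ((1 + 2 * l i) * S)"
        using XS[of i] l[of i] by (intro add_left_mono mult_left_mono) auto
      also have "\<dots> \<le> (2 * m * l i + 4 * m * (l i)\<^sup>2 + (2 * l i + 8 * (l i)\<^sup>2) * (1 + 2 * l i)) * (1 + S)"
        using l[of i] m S0 by (simp add: algebra_simps)
      finally show "\<bar>- 2 * m * l i / (1 + 2 * t * l i) + 2 * l i * X i / (1 + 2 * t * l i)\<^sup>2\<bar> \<le> \<dots>" .
    qed
    then show ?thesis by (simp add: C_def sum_distrib_right)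
  qed
  have b2: "\<bar>f2 t\<bar> \<le> C * (1 + S)" if t: "0 \<le> t" for t
  proof -
    have "\<bar>f2 t\<bar> \<le> (\<Sum>i\<in>UNIV. (2 * m * l i + 4 * m * (l i)\<^sup>2 + (2 * l i + 8 * (l i)\<^sup>2) * (1 + 2 * l i)) * (1 + S))"
      unfolding f2_def
    proof (rule order_trans[OF sum_abs sum_mono])
      fix i
      have a1: "4 * m * (l i)\<^sup>2 / (1 + 2 * t * l i)\<^sup>2 \<le> 4 * m * (l i)\<^sup>2" using div_le[OF _ p[OF t], of "4 * m * (l i)\<^sup>2" i 2] m by simp
      have a2: "8 * (l i)\<^sup>2 * X i / (1 + 2 * t * l i) ^ 3 \<le> 8 * (l i)\<^sup>2 * X i" using div_le[OF _ p[OF t], of "8 * (l i)\<^sup>2 * X i" i 3] X by simp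
      have n1: "0 \<le> 4 * m * (l i)\<^sup>2 / (1 + 2 * t * l i)\<^sup>2" "0 \<le> 8 * (l i)\<^sup>2 * X i / (1 + 2 * t * l i) ^ 3"
        using m X p'[OF t, of i] by (auto intro!: divide_nonneg_nonneg)
      have "\<bar>4 * m * (l i)\<^sup>2 / (1 + 2 * t * l i)\<^sup>2 - 8 * (l i)\<^sup>2 * X i / (1 + 2 * t * l i) ^ 3\<bar> \<le> 4 * m * (l i)\<^sup>2 + 8 * (l i)\<^sup>2 * X i"
        using a1 a2 n1 by (simp add: abs_le_iff)
      also have "\<dots> \<le> 4 * m * (l i)\<^sup>2 + 8 * (l i)\<^sup>2 * ((1 + 2 * l i) * S)"
        using XS[of i] by (intro add_left_mono mult_left_mono) auto
      also have "\<dots> \<le> (2 * m * l i + 4 * m * (l i)\<^sup>2 + (2 * l i + 8 * (l i)\<^sup>2) * (1 + 2 * l i)) * (1 + S)"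
        using l[of i] m S0 by (simp add: algebra_simps)
      finally show "\<bar>4 * m * (l i)\<^sup>2 / (1 + 2 * t * l i)\<^sup>2 - 8 * (l i)\<^sup>2 * X i / (1 + 2 * t * l i) ^ 3\<bar> \<le> \<dots>" .
    qed
    then show ?thesis by (simp add: C_def sum_distrib_right)
  qed
  have gb: "exp (f t) \<le> exp (- S)" if t: "0 \<le> t" "t \<le> 1" for t
  proof -
    have "f t \<le> (\<Sum>i\<in>UNIV. - (X i / (1 + 2 * l i)))"
      unfolding f_def
    proof (rule sum_mono)
      fix i
      have "0 \<le> ln (1 + 2 * t * l i)" using p[OF t(1), of i] by simp
      then have "0 \<le> m * ln (1 + 2 * t * l i)" using m by (rule mult_nonneg_nonneg[rotated])
      moreover have "X i / (1 + 2 * l i) \<le> X i / (1 + 2 * t * l i)"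
        using t l[of i] X[of i] p'[OF t(1), of i] by (intro divide_left_mono) (auto simp: mult_left_le_one_le add_pos_nonneg)
      ultimately show "- m * ln (1 + 2 * t * l i) - X i / (1 + 2 * t * l i) \<le> - (X i / (1 + 2 * l i))"
        by simp
    qed
    then show ?thesis by (simp add: S_def sum_negf)
  qed
  have hb: "\<bar>exp (f t) * (f2 t + (f1 t)\<^sup>2)\<bar> \<le> (C + C\<^sup>2) * (4 * exp 1)" if t: "0 \<le> t" "t \<le> 1" for t
  proof -
    have "\<bar>f2 t + (f1 t)\<^sup>2\<bar> \<le> C * (1 + S) + (C * (1 + S))\<^sup>2"
    proof -
      have "(f1 t)\<^sup>2 \<le> (C * (1 + S))\<^sup>2" using power_mono[OF b1[OF t(1)], of 2] by simp
      then show ?thesis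
        using b2[OF t(1)] zero_le_power2[of "f1 t"] zero_le_power2[of "C * (1 + S)"] by linarith
    qed
    also have "\<dots> \<le> C * (1 + S)\<^sup>2 + C\<^sup>2 * (1 + S)\<^sup>2"
      using C0 S0 self_le_power[of "1 + S" 2] by (simp add: power_mult_distrib mult_left_mono)
    finally have "\<bar>f2 t + (f1 t)\<^sup>2\<bar> \<le> (C + C\<^sup>2) * (1 + S)\<^sup>2" by (simp add: distrib_right)
    then have "exp (f t) * \<bar>f2 t + (f1 t)\<^sup>2\<bar> \<le> exp (- S) * ((C + C\<^sup>2) * (1 + S)\<^sup>2)"
      using gb[OF t] by (intro mult_mono) auto
    also have "\<dots> = (C + C\<^sup>2) * ((1 + S)\<^sup>2 * exp (- S))" by simp
    also have "\<dots> \<le> (C + C\<^sup>2) * (4 * exp 1)" using square_exp_bound[OF S0] C0 by (intro mult_left_mono) auto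
    finally show ?thesis by (simp add: abs_mult)
  qed
  \<comment> \<open>The mean value theorem twice, for exp f and then for its derivative: the error
    is e (u - t) times a second derivative, and u - t is at most e.\<close>
  obtain u where u: "t < u" "u < t + e" "exp (f (t + e)) - exp (f t) = (t + e - t) * (exp (f u) * f1 u)"
    using MVT2[of t "t + e" "\<lambda>t. exp (f t)" "\<lambda>t. exp (f t) * f1 t"] t g1 by auto
  obtain v where v: "t < v" "v < u" "exp (f u) * f1 u - exp (f t) * f1 t = (u - t) * (exp (f v) * (f2 v + (f1 v)\<^sup>2))"
    using MVT2[of t u "\<lambda>t. exp (f t) * f1 t" "\<lambda>t. exp (f t) * (f2 t + (f1 t)\<^sup>2)"] t u g2 by auto
  have "exp (f (t + e)) - exp (f t) * (1 + e * f1 t) = (exp (f (t + e)) - exp (f t)) - e * (exp (f t) * f1 t)"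
    by (simp add: algebra_simps)
  also have "\<dots> = e * (exp (f u) * f1 u - exp (f t) * f1 t)" using u(3) by (simp add: algebra_simps)
  also have "\<dots> = e * ((u - t) * (exp (f v) * (f2 v + (f1 v)\<^sup>2)))" using v(3) by simp
  finally have "\<bar>exp (f (t + e)) - exp (f t) * (1 + e * f1 t)\<bar> = e * ((u - t) * \<bar>exp (f v) * (f2 v + (f1 v)\<^sup>2)\<bar>)"
    using t u by (simp add: abs_mult)
  also have "\<dots> \<le> e * (e * ((C + C\<^sup>2) * (4 * exp 1)))"
    using t u v hb[of v] by (intro mult_left_mono mult_mono) auto
  finally show ?thesis unfolding f_def f1_def by (simp add: power2_eq_square mult_ac)
qed

context field_dim
begin

lemma inner_rdiag: "rdiag g \<bullet> P = (\<Sum>i\<in>UNIV. g i * P$i$i$0)" for P :: "'q::finite mat"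
proof -
  have *: "qone \<bullet> p = p$0" for p by (simp add: inner_scal)
  have "(\<Sum>j\<in>UNIV. rdiag g $i$j \<bullet> P$i$j) = g i * P$i$i$0" for i
    by (subst sum.remove[of _ i]) (auto simp: rdiag_nth *)
  then show ?thesis by (simp add: inner_mat)
qed

lemma PiQ_diag_nonneg: "P \<in> PiQ d \<Longrightarrow> 0 \<le> P$i$i$0" for P :: "'q::finite mat"
proof -
  assume P: "P \<in> PiQ d"
  have "0 \<le> rdiag (\<lambda>j. if j = i then 1 else 0) \<bullet> P" using P by (intro inner_PiQ_nonneg) (auto simp: PiQ_rdiag)
  also have "\<dots> = P$i$i$0" unfolding inner_rdiag by (subst sum.remove[of _ i]) auto
  finally show ?thesis .
qed

end

locale clt_setting = wishart_setting d \<mu> ty for d \<mu> and ty :: "'q::finite itself" +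
  fixes \<nu> :: "'q mat measure"
  assumes nu: "law_on \<nu>" and sq_int: "integrable \<nu> (\<lambda>r. (norm r)\<^sup>2)"
begin

definition "Y = (\<integral>r. mmul r r \<partial>\<nu>)"

sublocale N: prob_space \<nu> using nu by (rule law_onD)

lemma nu_measurable: "f \<in> borel_measurable borel \<Longrightarrow> f \<in> borel_measurable \<nu>"
  by (intro measurable_law[OF nu] measurable_PiS)

lemma sq_integrable: "integrable \<nu> (\<lambda>r. mmul r r)"
proof (rule Bochner_Integration.integrable_bound[OF sq_int])
  show "(\<lambda>r. mmul r r) \<in> borel_measurable \<nu>"
    by (intro nu_measurable borel_measurable_continuous_onI continuous_intros)
  show "AE r in \<nu>. norm (mmul r r) \<le> norm ((norm r)\<^sup>2)"
    using norm_mmul by (auto simp: power2_eq_square)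
qed

lemma Y_linear:
  assumes "linear (T :: 'q mat \<Rightarrow> real)"
  shows "integrable \<nu> (\<lambda>r. T (mmul r r))" "(\<integral>r. T (mmul r r) \<partial>\<nu>) = T Y"
proof -
  have "bounded_linear T" using assms linear_conv_bounded_linear by blast
  then show "integrable \<nu> (\<lambda>r. T (mmul r r))" "(\<integral>r. T (mmul r r) \<partial>\<nu>) = T Y"
    unfolding Y_def using sq_integrable by (auto intro: integrable_bounded_linear integral_bounded_linear)
qed

lemma Y_PiQ: "Y \<in> PiQ d"
  unfolding PiQ_iff
proof safe
  have sp: "r \<in> space \<nu> \<Longrightarrow> mmul r r \<in> PiQ d" for r using law_onD[OF nu] by (auto intro: PiQ_square)
  show "Y \<in> Herm d"
  proof -
    have "madj Y = (\<integral>r. madj (mmul r r) \<partial>\<nu>)"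
      unfolding Y_def using sq_integrable by (rule integral_bounded_linear[OF bounded_linear_madj, symmetric])
    also have "\<dots> = Y" unfolding Y_def
      using Herm_D(2)[OF PiQ_Herm[OF sp]] by (intro Bochner_Integration.integral_cong refl)
    finally have 1: "madj Y = Y" .
    have "Y$i$j$k = 0" if k: "k \<notin> comps d" for i j k
    proof -
      have "linear (\<lambda>x::'q mat. x$i$j$k)" by (simp add: linear_iff)
      then have "Y$i$j$k = (\<integral>r. mmul r r$i$j$k \<partial>\<nu>)" by (rule Y_linear(2)[symmetric])
      also have "\<dots> = (\<integral>r. 0 \<partial>\<nu>)"
      proof (rule Bochner_Integration.integral_cong[OF refl])
        fix r assume "r \<in> space \<nu>"
        then have "In_M d (mmul r r)" using sp by simp
        then show "mmul r r$i$j$k = 0" using k by (simp add: In_M_def)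
      qed
      finally show ?thesis by simp
    qed
    then have "In_M d Y" by (simp add: In_M_def)
    with 1 show ?thesis unfolding Herm_def by simp
  qed
  fix m :: "'q mat" assume m: "In_M d m"
  have "linear (\<lambda>x. m \<bullet> mmul x m)" by (simp add: linear_iff inner_simps)
  then have "m \<bullet> mmul Y m = (\<integral>r. m \<bullet> mmul (mmul r r) m \<partial>\<nu>)" by (rule Y_linear(2)[symmetric])
  also have "0 \<le> \<dots>" using sp m by (intro integral_nonneg_AE) (auto intro!: AE_I2 PiQ_nonneg)
  finally show "0 \<le> m \<bullet> mmul Y m" .
qed

text \<open>Lindeberg functional: it tends to 0 with c by dominated convergence with majorant |s|^2,
  so that finite second moments suffice.\<close>

definition "tail c = (\<integral>s. (norm s)\<^sup>2 * min (c * norm s) 1 \<partial>\<nu>)"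

lemma tail_le: "0 \<le> c \<Longrightarrow> norm ((norm s)\<^sup>2 * min (c * norm s) 1) \<le> (norm s)\<^sup>2" for s :: "'q mat"
  using mult_left_mono[of "min (c * norm s) 1" 1 "(norm s)\<^sup>2"] by (simp add: abs_mult)

lemma tail_integrable: "0 \<le> c \<Longrightarrow> integrable \<nu> (\<lambda>s. (norm s)\<^sup>2 * min (c * norm s) 1)"
  by (rule Bochner_Integration.integrable_bound[OF sq_int]) (use tail_le in \<open>auto intro!: nu_measurable\<close>)

lemma tail_tendsto: "(\<lambda>n. tail (1 / sqrt (real n))) \<longlonglongrightarrow> 0"
proof -
  have "(\<lambda>n. \<integral>s. (norm s)\<^sup>2 * min (1 / sqrt (real n) * norm s) 1 \<partial>\<nu>) \<longlonglongrightarrow> (\<integral>s. 0 \<partial>\<nu>)"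
  proof (rule integral_dominated_convergence[where w = "\<lambda>s. (norm s)\<^sup>2"])
    show "AE s in \<nu>. (\<lambda>n. (norm s)\<^sup>2 * min (1 / sqrt (real n) * norm s) 1) \<longlonglongrightarrow> 0"
    proof (rule AE_I2)
      fix s :: "'q mat"
      have "(\<lambda>n. 1 / sqrt (real n)) \<longlonglongrightarrow> 0"
        by (intro tendsto_divide_0[OF tendsto_const] filterlim_at_top_imp_at_infinity
            filterlim_compose[OF sqrt_at_top filterlim_real_sequentially])
      then have "(\<lambda>n. (norm s)\<^sup>2 * min (1 / sqrt (real n) * norm s) 1) \<longlonglongrightarrow> (norm s)\<^sup>2 * min (0 * norm s) 1"
        by (intro tendsto_intros)
      then show "(\<lambda>n. (norm s)\<^sup>2 * min (1 / sqrt (real n) * norm s) 1) \<longlonglongrightarrow> 0" by simp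
    qed
    show "AE s in \<nu>. norm ((norm s)\<^sup>2 * min (1 / sqrt (real n) * norm s) 1) \<le> (norm s)\<^sup>2" for n
      by (intro AE_I2 tail_le) simp
  qed (auto intro!: nu_measurable sq_int)
  then show ?thesis by (simp add: tail_def)
qed

abbreviation "nuc c \<equiv> distr \<nu> (PiS d) (\<lambda>r. c *\<^sub>R r)"

definition "stepK L = (2 + L + L / \<mu> + L\<^sup>2 + (L + 2 * sqrt (retr (mid :: 'q mat)) * sqrt L) ^ 3 * exp L * (216 * exp (1 / 2)))"

lemma exp_inner_measurable: "(\<lambda>r. exp (- (A \<bullet> mmul r r))) \<in> borel_measurable (PiS d)" for A :: "'q mat"
  by (intro measurable_PiS borel_measurable_continuous_onI continuous_intros)

lemma exp_inner_le_1: "A \<in> PiQ d \<Longrightarrow> r \<in> PiQ d \<Longrightarrow> \<bar>exp (- (A \<bullet> mmul r r))\<bar> \<le> 1" for A r :: "'q mat"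
  using inner_PiQ_nonneg[of A "mmul r r"] PiQ_square[of r] by simp

lemma psqrt_exp:
  assumes "r \<in> PiQ d" "s \<in> PiQ d"
  shows "(\<integral>v. exp (- (A \<bullet> mmul (psqrt (conv_sq r s v)) (psqrt (conv_sq r s v)))) \<partial>vlaw) =
    (\<integral>v. exp (- (A \<bullet> conv_sq r s v)) \<partial>vlaw)"
proof (rule integral_cong_AE)
  have m: "psqrt \<in> borel_measurable borel" "conv_sq r s \<in> borel_measurable borel"
    by (auto intro: psqrt_borel)
  have e: "(\<lambda>x. exp (- (A \<bullet> mmul x x))) \<in> borel_measurable borel" "(\<lambda>x. exp (- (A \<bullet> x))) \<in> borel_measurable borel"
    by (intro borel_measurable_continuous_onI continuous_intros)+
  show "(\<lambda>v. exp (- (A \<bullet> mmul (psqrt (conv_sq r s v)) (psqrt (conv_sq r s v))))) \<in> borel_measurable vlaw"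
    using measurable_compose[OF measurable_compose[OF m(2,1)] e(1)] by (simp add: measurable_cong_sets[OF sets_vlaw refl])
  show "(\<lambda>v. exp (- (A \<bullet> conv_sq r s v))) \<in> borel_measurable vlaw"
    using measurable_compose[OF m(2) e(2)] by (simp add: measurable_cong_sets[OF sets_vlaw refl])
  show "AE v in vlaw. exp (- (A \<bullet> mmul (psqrt (conv_sq r s v)) (psqrt (conv_sq r s v)))) = exp (- (A \<bullet> conv_sq r s v))"
    using AE_vlaw by eventually_elim (use assms in \<open>simp add: psqrt_def conv_sq_PiQ\<close>)
qed

text \<open>The main term of the expansion is affine in s^2, so integration over s leaves only the
  second moment matrix \<open>Y\<close>; the error scales to c^2 \<open>tail c\<close>.\<close>

lemma one_step_law:
  assumes A: "A \<in> PiQ d" "retr A \<le> L" and r: "r \<in> PiQ d" and c: "0 < c"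
  shows "\<bar>(\<integral>s. (\<integral>v. exp (- (A \<bullet> mmul (psqrt (conv_sq r s v)) (psqrt (conv_sq r s v)))) \<partial>vlaw) \<partial>nuc c) -
     exp (- (A \<bullet> mmul r r)) * (1 - c\<^sup>2 * (A \<bullet> Y) + c\<^sup>2 * (mmul A r \<bullet> mmul Y (mmul A r)) / \<mu>)\<bar> \<le> stepK L * c\<^sup>2 * tail c"
proof -
  let ?F = "\<lambda>s. \<integral>v. exp (- (A \<bullet> mmul (psqrt (conv_sq r s v)) (psqrt (conv_sq r s v)))) \<partial>vlaw"
  let ?p = "exp (- (A \<bullet> mmul r r))"
  have nuc: "law_on (nuc c)" using nu c by (intro law_on_scale) auto
  have Fi: "integrable (nuc c) ?F"
    using mconv_integral(3)[OF nuc nuc exp_inner_measurable exp_inner_le_1[OF A(1)] r] by simp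
  have sc: "(\<lambda>r. c *\<^sub>R r) \<in> measurable \<nu> (PiS d)" using c by (intro measurable_law[OF nu] scale_measurable) auto
  have Fi': "integrable \<nu> (\<lambda>s. ?F (c *\<^sub>R s))"
    using integrable_distr[OF sc Fi] .
  have FI: "(\<integral>s. ?F s \<partial>nuc c) = (\<integral>s. ?F (c *\<^sub>R s) \<partial>\<nu>)"
    using Fi by (intro integral_distr[OF sc]) (auto dest: borel_measurable_integrable)
  define G where "G s = ?p * (1 - A \<bullet> mmul (c *\<^sub>R s) (c *\<^sub>R s) + (norm (mmul (c *\<^sub>R s) (mmul A r)))\<^sup>2 / \<mu>)" for s
  have l1: "linear (\<lambda>x. A \<bullet> x)" and l2: "linear (\<lambda>x. mmul A r \<bullet> mmul x (mmul A r))"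
    by (simp_all add: linear_iff inner_simps)
  have Geq: "G s = ?p * (1 - c\<^sup>2 * (A \<bullet> mmul s s) + c\<^sup>2 * (mmul A r \<bullet> mmul (mmul s s) (mmul A r)) / \<mu>)" if s: "s \<in> PiQ d" for s
  proof -
    have "(norm (mmul s (mmul A r)))\<^sup>2 = mmul A r \<bullet> mmul (mmul s s) (mmul A r)"
      using s by (simp add: power2_norm_eq_inner inner_mmul_left[of s] mmul_assoc)
    then show ?thesis by (simp add: G_def power2_eq_square mult_ac power_mult_distrib)
  qed
  have spn: "space \<nu> = PiQ d" using nu by (rule law_onD)
  have i1: "integrable \<nu> (\<lambda>s. c\<^sup>2 * (A \<bullet> mmul s s))" using Y_linear(1)[OF l1] by simp
  have i2: "integrable \<nu> (\<lambda>s. c\<^sup>2 * (mmul A r \<bullet> mmul (mmul s s) (mmul A r)) / \<mu>)"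
    using Y_linear(1)[OF l2] by (intro integrable_divide integrable_mult_right)
  have i3: "integrable \<nu> (\<lambda>s. ?p * (1 - c\<^sup>2 * (A \<bullet> mmul s s) + c\<^sup>2 * (mmul A r \<bullet> mmul (mmul s s) (mmul A r)) / \<mu>))"
    using i1 i2 by (intro integrable_mult_right Bochner_Integration.integrable_add Bochner_Integration.integrable_diff) auto
  have Gi: "integrable \<nu> G"
    using i3 by (rule Bochner_Integration.integrable_cong[OF refl, THEN iffD2, rotated]) (use Geq spn in simp)
  have "(\<integral>s. G s \<partial>\<nu>) = (\<integral>s. ?p * (1 - c\<^sup>2 * (A \<bullet> mmul s s) + c\<^sup>2 * (mmul A r \<bullet> mmul (mmul s s) (mmul A r)) / \<mu>) \<partial>\<nu>)"
    by (rule Bochner_Integration.integral_cong[OF refl]) (use Geq spn in simp)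
  also have "\<dots> = ?p * (\<integral>s. 1 - c\<^sup>2 * (A \<bullet> mmul s s) + c\<^sup>2 * (mmul A r \<bullet> mmul (mmul s s) (mmul A r)) / \<mu> \<partial>\<nu>)" by simp
  also have "(\<integral>s. 1 - c\<^sup>2 * (A \<bullet> mmul s s) + c\<^sup>2 * (mmul A r \<bullet> mmul (mmul s s) (mmul A r)) / \<mu> \<partial>\<nu>) =
     (\<integral>s. 1 - c\<^sup>2 * (A \<bullet> mmul s s) \<partial>\<nu>) + (\<integral>s. c\<^sup>2 * (mmul A r \<bullet> mmul (mmul s s) (mmul A r)) / \<mu> \<partial>\<nu>)"
    using i1 i2 by (intro Bochner_Integration.integral_add) auto
  also have "(\<integral>s. 1 - c\<^sup>2 * (A \<bullet> mmul s s) \<partial>\<nu>) = 1 - c\<^sup>2 * (A \<bullet> Y)"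
    using i1 Y_linear(2)[OF l1] N.prob_space by (subst Bochner_Integration.integral_diff) auto
  also have "(\<integral>s. c\<^sup>2 * (mmul A r \<bullet> mmul (mmul s s) (mmul A r)) / \<mu> \<partial>\<nu>) = c\<^sup>2 * (mmul A r \<bullet> mmul Y (mmul A r)) / \<mu>"
    using Y_linear(2)[OF l2] by simp
  finally have GI: "(\<integral>s. G s \<partial>\<nu>) = ?p * (1 - c\<^sup>2 * (A \<bullet> Y) + c\<^sup>2 * (mmul A r \<bullet> mmul Y (mmul A r)) / \<mu>)" .
  have "\<bar>(\<integral>s. ?F (c *\<^sub>R s) \<partial>\<nu>) - (\<integral>s. G s \<partial>\<nu>)\<bar> = \<bar>\<integral>s. ?F (c *\<^sub>R s) - G s \<partial>\<nu>\<bar>"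
    using Fi' Gi by (subst Bochner_Integration.integral_diff) auto
  also have "\<dots> \<le> (\<integral>s. \<bar>?F (c *\<^sub>R s) - G s\<bar> \<partial>\<nu>)" by (rule integral_abs_bound)
  also have "\<dots> \<le> (\<integral>s. stepK L * c\<^sup>2 * ((norm s)\<^sup>2 * min (c * norm s) 1) \<partial>\<nu>)"
  proof (rule integral_mono)
    show "integrable \<nu> (\<lambda>s. \<bar>?F (c *\<^sub>R s) - G s\<bar>)" using Fi' Gi by auto
    show "integrable \<nu> (\<lambda>s. stepK L * c\<^sup>2 * ((norm s)\<^sup>2 * min (c * norm s) 1))" using tail_integrable[of c] c by simp
    fix s assume "s \<in> space \<nu>"
    then have s: "c *\<^sub>R s \<in> PiQ d" using c by (simp add: spn)
    have "\<bar>?F (c *\<^sub>R s) - G s\<bar> \<le> stepK L * ((norm (c *\<^sub>R s))\<^sup>2 * min (norm (c *\<^sub>R s)) 1)"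
      unfolding psqrt_exp[OF r s] G_def stepK_def by (rule one_step_vlaw[OF A r s])
    also have "\<dots> = stepK L * c\<^sup>2 * ((norm s)\<^sup>2 * min (c * norm s) 1)" using c by (simp add: power_mult_distrib)
    finally show "\<bar>?F (c *\<^sub>R s) - G s\<bar> \<le> \<dots>" .
  qed
  also have "\<dots> = stepK L * c\<^sup>2 * tail c" by (simp add: tail_def)
  finally show ?thesis unfolding FI GI .
qed

end

text \<open>The Laplace parameter is \<open>mmul (madj k) k\<close>, and its factor k is chosen so
  that it also diagonalises \<open>Y\<close>. The heat flow then becomes explicit in l and diagonal
  entries, with no matrix inverse to differentiate.\<close>

locale laplace_setting = clt_setting d \<mu> ty \<nu> for d \<mu> and ty :: "'q::finite itself" and \<nu> +
  fixes k :: "'q mat" and l :: "'q \<Rightarrow> real"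
  assumes k: "In_M d k" and l: "\<And>i. 0 \<le> l i" and kY: "mmul k (mmul Y (madj k)) = (2 * \<mu>) *\<^sub>R rdiag l"
begin

definition "gf t i = 1 / (1 + 2 * t * l i)"
definition "At t = mmul (madj k) (mmul (rdiag (gf t)) k)"
definition "Xf r i = (mmul k (mmul (mmul r r) (madj k)))$i$i$0"
definition "Cf t = exp (\<Sum>i\<in>UNIV. - \<mu> * ln (1 + 2 * t * l i))"
text \<open>The flow runs from the Laplace kernel \<open>hf 0\<close> to the limit value
  \<open>hf 1 0\<close>. \<open>Cf t\<close> is the product of the 1 + 2 t l i, raised to the power
  - \<mu>.\<close>

definition "hf t r = Cf t * exp (- (At t \<bullet> mmul r r))"

lemma gf: "0 \<le> t \<Longrightarrow> 0 \<le> gf t i \<and> gf t i \<le> 1"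
  using l[of i] by (simp add: gf_def add_nonneg_nonneg add_pos_nonneg)

lemma At_inner: "At t \<bullet> P = rdiag (gf t) \<bullet> mmul k (mmul P (madj k))"
  by (simp add: At_def inner_mmul_left[of "madj k"] inner_mmul_right[of "rdiag (gf t)"] mmul_assoc)

lemma At_PiQ: "0 \<le> t \<Longrightarrow> At t \<in> PiQ d"
  using PiQ_conj[of "madj k" "rdiag (gf t)"] k gf by (simp add: At_def PiQ_rdiag)

lemma At_retr: "0 \<le> t \<Longrightarrow> retr (At t) \<le> retr (mmul k (madj k))"
proof -
  assume t: "0 \<le> t"
  have "retr (At t) = rdiag (gf t) \<bullet> mmul k (madj k)" using At_inner[of t mid] by (simp add: retr_eq_inner inner_commute)
  also have "\<dots> \<le> rdiag (\<lambda>i. 1) \<bullet> mmul k (madj k)"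
    unfolding inner_rdiag using gf[OF t] PiQ_diag_nonneg[OF PiQ_mmul_madj[OF k]]
    by (intro sum_mono mult_right_mono) auto
  finally show ?thesis by (simp add: rdiag_one retr_eq_inner)
qed

lemma Xf_nonneg: "r \<in> PiQ d \<Longrightarrow> 0 \<le> Xf r i"
  unfolding Xf_def using k by (intro PiQ_diag_nonneg PiQ_conj PiQ_square) auto

lemma At_square: "At t \<bullet> mmul r r = (\<Sum>i\<in>UNIV. Xf r i / (1 + 2 * t * l i))"
  by (simp add: At_inner inner_rdiag Xf_def gf_def)

lemma At_Y: "At t \<bullet> Y = (\<Sum>i\<in>UNIV. 2 * \<mu> * l i / (1 + 2 * t * l i))"
  unfolding At_inner kY by (simp add: inner_rdiag rdiag_nth gf_def sum_distrib_left mult_ac)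

lemma At_Y_At:
  assumes r: "r \<in> PiQ d"
  shows "mmul (At t) r \<bullet> mmul Y (mmul (At t) r) = (\<Sum>i\<in>UNIV. 2 * \<mu> * l i * Xf r i / (1 + 2 * t * l i)\<^sup>2)"
proof -
  let ?m = "mmul (rdiag (gf t)) (mmul k r)"
  have "mmul (At t) r \<bullet> mmul Y (mmul (At t) r) = ?m \<bullet> mmul (mmul k (mmul Y (madj k))) ?m"
    by (simp add: At_def mmul_assoc inner_mmul_left[of "madj k"])
  also have "\<dots> = 2 * \<mu> * (mmul (rdiag l) ?m \<bullet> ?m)" unfolding kY by (simp add: inner_commute)
  also have "mmul (rdiag l) ?m \<bullet> ?m = rdiag l \<bullet> mmul ?m (madj ?m)" by (rule inner_mmul_right)
  also have "mmul ?m (madj ?m) = mmul (rdiag (gf t)) (mmul (mmul k (mmul (mmul r r) (madj k))) (rdiag (gf t)))"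
    using r by (simp add: mmul_assoc)
  also have "rdiag l \<bullet> \<dots> = (\<Sum>i\<in>UNIV. l i * (gf t i * (gf t i * Xf r i)))"
    by (simp add: inner_rdiag rdiag_mmul_nth mmul_rdiag_nth Xf_def mult.assoc)
  finally show ?thesis by (simp add: sum_distrib_left gf_def power2_eq_square mult_ac)
qed

lemma hf_eq: "hf t r = exp (\<Sum>i\<in>UNIV. - \<mu> * ln (1 + 2 * t * l i) - Xf r i / (1 + 2 * t * l i))"
  by (simp add: hf_def Cf_def At_square exp_add[symmetric] sum_subtractf exp_diff exp_minus field_simps)

lemma Cf_le_1: "0 \<le> t \<Longrightarrow> Cf t \<le> 1"
proof -
  assume t: "0 \<le> t"
  have "0 \<le> \<mu> * ln (1 + 2 * t * l i)" for i using l[of i] t mu_pos by (intro mult_nonneg_nonneg ln_ge_zero) auto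
  then have "(\<Sum>i\<in>UNIV. - \<mu> * ln (1 + 2 * t * l i)) \<le> 0" by (intro sum_nonpos) simp
  then show ?thesis by (simp add: Cf_def)
qed

lemma hf_bound: "0 \<le> t \<Longrightarrow> r \<in> PiQ d \<Longrightarrow> \<bar>hf t r\<bar> \<le> 1"
  using mult_mono[OF Cf_le_1 exp_inner_le_1[OF At_PiQ], of t t r] by (simp add: hf_def abs_mult Cf_def)

lemma hf_measurable: "hf t \<in> borel_measurable (PiS d)"
  unfolding hf_def[abs_def] by (intro borel_measurable_times exp_inner_measurable) simp

definition "L0 = retr (mmul k (madj k))"
definition "tayC = (\<Sum>i\<in>UNIV. 2 * \<mu> * l i + 4 * \<mu> * (l i)\<^sup>2 + (2 * l i + 8 * (l i)\<^sup>2) * (1 + 2 * l i))"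
text \<open>Error of one step. With c^2 = 1/n both summands are o(1/n), so the sum of n of them
  still vanishes in the limit.\<close>

definition "err c = stepK L0 * c\<^sup>2 * tail c + (tayC + tayC\<^sup>2) * (4 * exp 1) * (c\<^sup>2)\<^sup>2"

lemma one_step:
  assumes r: "r \<in> PiQ d" and t: "0 \<le> t" "0 < c" "t + c\<^sup>2 \<le> 1"
  shows "\<bar>(\<integral>s. (\<integral>v. hf t (psqrt (conv_sq r s v)) \<partial>vlaw) \<partial>nuc c) - hf (t + c\<^sup>2) r\<bar> \<le> err c"
proof -
  let ?E = "\<integral>s. (\<integral>v. exp (- (At t \<bullet> mmul (psqrt (conv_sq r s v)) (psqrt (conv_sq r s v)))) \<partial>vlaw) \<partial>nuc c"
  let ?T = "exp (- (At t \<bullet> mmul r r)) * (1 - c\<^sup>2 * (At t \<bullet> Y) + c\<^sup>2 * (mmul (At t) r \<bullet> mmul Y (mmul (At t) r)) / \<mu>)"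
  have C: "0 \<le> Cf t" "Cf t \<le> 1" using Cf_le_1[OF t(1)] by (auto simp: Cf_def)
  have 1: "\<bar>?E - ?T\<bar> \<le> stepK L0 * c\<^sup>2 * tail c"
    unfolding L0_def by (rule one_step_law[OF At_PiQ[OF t(1)] At_retr[OF t(1)] r t(2)])
  have "\<bar>Cf t * ?E - Cf t * ?T\<bar> = Cf t * \<bar>?E - ?T\<bar>" using C by (simp add: right_diff_distrib[symmetric] abs_mult)
  also have "\<dots> \<le> 1 * \<bar>?E - ?T\<bar>" using C by (intro mult_right_mono) auto
  also have "\<dots> \<le> stepK L0 * c\<^sup>2 * tail c" using 1 by (simp only: mult_1_left)
  finally have 2: "\<bar>Cf t * ?E - Cf t * ?T\<bar> \<le> stepK L0 * c\<^sup>2 * tail c" .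
  have 3: "(\<integral>s. (\<integral>v. hf t (psqrt (conv_sq r s v)) \<partial>vlaw) \<partial>nuc c) = Cf t * ?E" by (simp add: hf_def)
  \<comment> \<open>The first order coefficients match: the term with \<open>Y\<close> alone is the
    logarithmic time derivative of \<open>Cf\<close>, and the term divided by \<mu> is that of the
    exponential. This is what dictates the form of the flow.\<close>
  have "Cf t * ?T = hf t r * (1 + c\<^sup>2 * (\<Sum>i\<in>UNIV. - 2 * \<mu> * l i / (1 + 2 * t * l i) + 2 * l i * Xf r i / (1 + 2 * t * l i)\<^sup>2))"
  proof -
    have "(mmul (At t) r \<bullet> mmul Y (mmul (At t) r)) / \<mu> = (\<Sum>i\<in>UNIV. 2 * l i * Xf r i / (1 + 2 * t * l i)\<^sup>2)"
      unfolding At_Y_At[OF r] sum_divide_distrib using mu_pos by (intro sum.cong refl) simp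
    moreover have "- (At t \<bullet> Y) = (\<Sum>i\<in>UNIV. - 2 * \<mu> * l i / (1 + 2 * t * l i))"
      unfolding At_Y by (simp add: sum_negf[symmetric])
    ultimately have "(\<Sum>i\<in>UNIV. - 2 * \<mu> * l i / (1 + 2 * t * l i) + 2 * l i * Xf r i / (1 + 2 * t * l i)\<^sup>2) =
      - (At t \<bullet> Y) + (mmul (At t) r \<bullet> mmul Y (mmul (At t) r)) / \<mu>" by (simp only: sum.distrib)
    then show ?thesis by (simp only: hf_def) (simp add: algebra_simps)
  qed
  moreover have "\<bar>hf (t + c\<^sup>2) r - hf t r * (1 + c\<^sup>2 * (\<Sum>i\<in>UNIV. - 2 * \<mu> * l i / (1 + 2 * t * l i) + 2 * l i * Xf r i / (1 + 2 * t * l i)\<^sup>2))\<bar>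
     \<le> (tayC + tayC\<^sup>2) * (4 * exp 1) * (c\<^sup>2)\<^sup>2"
    unfolding hf_eq tayC_def using t mu_pos l Xf_nonneg[OF r] by (intro exp_sum_taylor) auto
  ultimately show ?thesis using 2 unfolding 3 err_def by linarith
qed

text \<open>The last factor of the convolution power is traded for a time step c^2, hence t is
  arbitrary in the induction. After all steps only the point mass at 0 remains, which evaluates the
  flow at r = 0.\<close>

lemma telescope:
  assumes c: "0 < c"
  shows "0 \<le> t \<Longrightarrow> t + real j * c\<^sup>2 \<le> 1 \<Longrightarrow>
    \<bar>(\<integral>r. hf t r \<partial>convpow d \<mu> (nuc c) j) - hf (t + real j * c\<^sup>2) 0\<bar> \<le> real j * err c"
proof (induction j arbitrary: t)
  case 0
  have "(\<integral>r. hf t r \<partial>return (PiS d) 0) = hf t 0"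
    by (intro integral_return) (auto simp: space_PiS hf_measurable)
  then show ?case by simp
next
  case (Suc j)
  let ?P = "convpow d \<mu> (nuc c) j"
  have nuc: "law_on (nuc c)" using nu c by (intro law_on_scale) auto
  have P: "law_on ?P" using nuc by (rule law_on_convpow)
  interpret P: prob_space ?P using P by (rule law_onD)
  let ?F = "\<lambda>r. \<integral>s. (\<integral>v. hf t (psqrt (conv_sq r s v)) \<partial>vlaw) \<partial>nuc c"
  have tc: "0 \<le> t + c\<^sup>2" using Suc.prems c by simp
  have le: "t + c\<^sup>2 + real j * c\<^sup>2 \<le> 1" "t + c\<^sup>2 \<le> 1"
    using Suc.prems(2) by (auto simp: algebra_simps) (smt (verit) mult_nonneg_nonneg of_nat_0_le_iff zero_le_power2)
  note mi = mconv_integral[OF P nuc hf_measurable hf_bound[OF Suc.prems(1)]]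
  have hi: "integrable ?P (hf (t + c\<^sup>2))"
    by (rule P.integrable_const_bound[where B = 1])
      (use hf_bound[OF tc] law_onD(3)[OF P] measurable_law[OF P hf_measurable] in auto)
  have "\<bar>(\<integral>r. hf t r \<partial>convpow d \<mu> (nuc c) (Suc j)) - (\<integral>r. hf (t + c\<^sup>2) r \<partial>?P)\<bar> = \<bar>\<integral>r. ?F r - hf (t + c\<^sup>2) r \<partial>?P\<bar>"
    using mi hi by (subst Bochner_Integration.integral_diff) auto
  also have "\<dots> \<le> (\<integral>r. \<bar>?F r - hf (t + c\<^sup>2) r\<bar> \<partial>?P)" by (rule integral_abs_bound)
  also have "\<dots> \<le> (\<integral>r. err c \<partial>?P)"
    using mi(2) hi one_step[OF _ Suc.prems(1) c le(2)] law_onD(3)[OF P] by (intro integral_mono) auto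
  also have "\<dots> = err c" using P.prob_space by simp
  finally have 1: "\<bar>(\<integral>r. hf t r \<partial>convpow d \<mu> (nuc c) (Suc j)) - (\<integral>r. hf (t + c\<^sup>2) r \<partial>?P)\<bar> \<le> err c" .
  have 2: "\<bar>(\<integral>r. hf (t + c\<^sup>2) r \<partial>?P) - hf (t + c\<^sup>2 + real j * c\<^sup>2) 0\<bar> \<le> real j * err c"
    by (rule Suc.IH[OF tc le(1)])
  have "t + real (Suc j) * c\<^sup>2 = t + c\<^sup>2 + real j * c\<^sup>2" by (simp add: algebra_simps)
  then show ?case using 1 2 by (simp add: algebra_simps)
qed

lemma laplace_limit:
  "(\<lambda>n. \<integral>r. exp (- (mmul (madj k) k \<bullet> mmul r r)) \<partial>convpow d \<mu> (nuc (1 / sqrt (real n))) n) \<longlonglongrightarrow>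
     exp (\<Sum>i\<in>UNIV. - \<mu> * ln (1 + 2 * l i))"
proof -
  let ?c = "\<lambda>n. 1 / sqrt (real n)"
  have h0: "hf 0 r = exp (- (mmul (madj k) k \<bullet> mmul r r))" for r
  proof -
    have "gf 0 = (\<lambda>i. 1)" by (rule ext) (simp add: gf_def)
    then show ?thesis by (simp add: hf_def Cf_def At_def rdiag_one)
  qed
  have h1: "hf 1 0 = exp (\<Sum>i\<in>UNIV. - \<mu> * ln (1 + 2 * l i))" by (simp add: hf_def Cf_def)
  have b: "\<bar>(\<integral>r. hf 0 r \<partial>convpow d \<mu> (nuc (?c n)) n) - hf 1 0\<bar> \<le>
     stepK L0 * tail (?c n) + (tayC + tayC\<^sup>2) * (4 * exp 1) * (1 / real n)" if n: "n > 0" for n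
  proof -
    \<comment> \<open>n steps of size 1/n take the flow exactly from time 0 to time 1.\<close>
    have c2: "(?c n)\<^sup>2 = 1 / real n" using n by (simp add: power_divide)
    have "\<bar>(\<integral>r. hf 0 r \<partial>convpow d \<mu> (nuc (?c n)) n) - hf (0 + real n * (?c n)\<^sup>2) 0\<bar> \<le> real n * err (?c n)"
      using n by (intro telescope) (auto simp: c2)
    moreover have "real n * err (?c n) = stepK L0 * tail (?c n) + (tayC + tayC\<^sup>2) * (4 * exp 1) * (1 / real n)"
      unfolding err_def c2 using n by (simp add: field_simps power2_eq_square)
    ultimately show ?thesis using n by (simp add: c2)
  qed
  have "(\<lambda>n. stepK L0 * tail (?c n) + (tayC + tayC\<^sup>2) * (4 * exp 1) * (1 / real n)) \<longlonglongrightarrow>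
     stepK L0 * 0 + (tayC + tayC\<^sup>2) * (4 * exp 1) * 0"
    by (rule tendsto_add[OF tendsto_mult[OF tendsto_const tail_tendsto] tendsto_mult[OF tendsto_const lim_1_over_n]])
  then have lim: "(\<lambda>n. stepK L0 * tail (?c n) + (tayC + tayC\<^sup>2) * (4 * exp 1) * (1 / real n)) \<longlonglongrightarrow> 0"
    by (simp only: mult_zero_right add_0)
  have "(\<lambda>n. (\<integral>r. hf 0 r \<partial>convpow d \<mu> (nuc (?c n)) n) - hf 1 0) \<longlonglongrightarrow> 0"
  proof (rule Lim_null_comparison[OF _ lim], rule eventually_sequentiallyI[of 1])
    fix n :: nat assume "1 \<le> n"
    then show "norm ((\<integral>r. hf 0 r \<partial>convpow d \<mu> (nuc (?c n)) n) - hf 1 0) \<le>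
      stepK L0 * tail (?c n) + (tayC + tayC\<^sup>2) * (4 * exp 1) * (1 / real n)"
      unfolding real_norm_def by (intro b) simp
  qed
  then have "(\<lambda>n. \<integral>r. hf 0 r \<partial>convpow d \<mu> (nuc (?c n)) n) \<longlonglongrightarrow> hf 1 0" by (rule LIM_zero_cancel)
  then show ?thesis unfolding h0 h1 .
qed

end

section \<open>Lebesgue measure on Hermitian matrices\<close>

lemma qord_inj: "qord i = qord j \<longleftrightarrow> i = (j::'q::finite)"
  unfolding qord_def using inj_on_to_nat_on[of "UNIV :: 'q set"] by (auto simp: inj_on_def countable_finite)

context field_dim
begin

definition herm_idx :: "('q::finite \<times> 'q \<times> 4) set" where
  "herm_idx = {(i,j,k). (i = j \<and> k = 0) \<or> (qord i < qord j \<and> k \<in> comps d)}"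

text \<open>Coordinate vectors of the diagonal and of the entries above it, with the conjugate entry
  below filled in: sign + for the real component, sign - for the imaginary ones.\<close>

definition herm_unit :: "'q::finite \<times> 'q \<times> 4 \<Rightarrow> 'q mat" where
  "herm_unit = (\<lambda>(i, j, k). if i = j then mat_unit (i, i, 0)
     else mat_unit (i, j, k) + (if k = 0 then 1 else -1) *\<^sub>R mat_unit (j, i, k))"

lemma frame_herm: "frame herm_idx (herm_unit :: _ \<Rightarrow> 'q::finite mat)"
proof
  show "finite (herm_idx :: ('q \<times> 'q \<times> 4) set)" by simp
  fix p r :: "'q \<times> 'q \<times> 4"
  show "herm_unit p \<bullet> herm_unit r = 0" if "p \<in> herm_idx" "r \<in> herm_idx" "p \<noteq> r"
  proof (cases p; cases r)
    fix i j k i' j' k' assume pr: "p = (i, j, k)" "r = (i', j', k')"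
    then show ?thesis using that
      by (auto simp: herm_idx_def herm_unit_def inner_simps inner_mat_unit)
  qed
  show "herm_unit p \<noteq> 0" if "p \<in> herm_idx"
  proof (cases p)
    fix i j k assume p: "p = (i, j, k)"
    have "herm_unit p \<bullet> mat_unit (i, j, k) = 1" using that
      by (auto simp: p herm_idx_def herm_unit_def inner_simps inner_mat_unit)
    then show ?thesis by (metis inner_zero_left zero_neq_one)
  qed
qed

lemma comb_herm:
  "frame.comb herm_idx herm_unit f = (\<chi> i j. if i = j then (\<chi> k. if k = 0 then f (i,i,0) else 0)
                 else if qord i < qord j then (\<chi> k. if k \<in> comps d then f (i,j,k) else 0)
                 else qconj (\<chi> k. if k \<in> comps d then f (j,i,k) else 0))" (is "_ = ?R")
proof -
  interpret frame "herm_idx :: ('a \<times> 'a \<times> 4) set" herm_unit by (rule frame_herm)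
  have sd: "(\<Sum>p\<in>herm_idx. f p * (if p = p0 then s else 0)) = (if p0 \<in> herm_idx then f p0 * s else 0)" for p0 and s :: real
    using I by (simp add: if_distrib[of "(*) _"] cong: if_cong)
  have "comb f $ a $ b $ c = ?R $ a $ b $ c" for a b c
  proof -
    have "comb f $ a $ b $ c = (\<Sum>p\<in>herm_idx. f p * (herm_unit p $ a $ b $ c))" by (simp add: comb_def)
    also have "\<dots> = ?R $ a $ b $ c"
    proof (cases "qord a" "qord b" rule: linorder_cases)
      case equal
      then have ab: "a = b" by (simp add: qord_inj)
      have "(\<Sum>p\<in>herm_idx. f p * (herm_unit p $ a $ b $ c)) = (\<Sum>p\<in>herm_idx. f p * (if p = (a, a, c) then (if c = 0 then 1 else 0) else 0))"
        by (intro sum.cong refl) (auto simp: ab herm_idx_def herm_unit_def mat_unit_nth split: if_splits)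
      then show ?thesis unfolding sd by (auto simp: ab herm_idx_def)
    next
      case less
      then have ab: "a \<noteq> b" by auto
      have "(\<Sum>p\<in>herm_idx. f p * (herm_unit p $ a $ b $ c)) = (\<Sum>p\<in>herm_idx. f p * (if p = (a, b, c) then 1 else 0))"
        using less by (intro sum.cong refl) (auto simp: herm_idx_def herm_unit_def mat_unit_nth split: if_splits)
      then show ?thesis unfolding sd using less ab by (auto simp: herm_idx_def)
    next
      case greater
      then have ab: "a \<noteq> b" by auto
      have "(\<Sum>p\<in>herm_idx. f p * (herm_unit p $ a $ b $ c)) = (\<Sum>p\<in>herm_idx. f p * (if p = (b, a, c) then (if c = 0 then 1 else -1) else 0))"
        using greater by (intro sum.cong refl) (auto simp: herm_idx_def herm_unit_def mat_unit_nth split: if_splits)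
      then show ?thesis unfolding sd using greater ab zero_in_comps by (auto simp: herm_idx_def)
    qed
    finally show ?thesis .
  qed
  then show ?thesis by (simp add: vec_eq_iff)
qed

lemma lebH_eq: "(lebH d :: 'q::finite mat measure) = frame.leb herm_idx herm_unit"
proof -
  interpret frame "herm_idx :: ('q \<times> 'q \<times> 4) set" herm_unit by (rule frame_herm)
  show ?thesis unfolding lebH_def leb_def herm_idx_def[symmetric] comb_herm[abs_def, symmetric] by (simp only: eta_contract_eq)
qed

lemma F_herm: "frame.F herm_idx herm_unit = (Herm d :: 'q::finite mat set)"
proof -
  interpret frame "herm_idx :: ('q \<times> 'q \<times> 4) set" herm_unit by (rule frame_herm)
  have "comb f \<in> Herm d" for f
  proof -
    have "In_M d (comb f)" using zero_in_comps by (auto simp: In_M_def comb_herm)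
    moreover have "madj (comb f) = comb f"
      unfolding mat_eq_iff
    proof (intro allI)
      fix i j
      show "madj (comb f)$i$j = comb f$i$j"
        by (cases "qord i" "qord j" rule: linorder_cases) (auto simp: comb_herm qord_inj vec_eq_iff)
    qed
    ultimately show ?thesis unfolding Herm_def by simp
  qed
  moreover have "x \<in> range comb" if x: "x \<in> Herm d" for x :: "'q mat"
  proof (rule image_eqI)
    have xa: "x$i$j = qconj (x$j$i)" for i j using arg_cong[OF Herm_D(2)[OF x], of "\<lambda>y. y$i$j"] by simp
    have x0: "k \<notin> comps d \<Longrightarrow> x$i$j$k = 0" for i j k using Herm_D(1)[OF x] by (simp add: In_M_def)
    show "x = comb (\<lambda>(i,j,k). x$i$j$k)"
      unfolding vec_eq_iff
    proof (intro allI)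
      fix i j k
      show "x$i$j$k = comb (\<lambda>(i,j,k). x$i$j$k)$i$j$k"
      proof (cases "qord i" "qord j" rule: linorder_cases)
        case equal
        then have "i = j" by (simp add: qord_inj)
        moreover have "x$i$i$k = 0" if "k \<noteq> 0" using arg_cong[OF xa[of i i], of "\<lambda>y. y$k"] that by simp
        ultimately show ?thesis by (auto simp: comb_herm)
      next
        case less
        then show ?thesis using x0[of k i j] by (auto simp: comb_herm)
      next
        case greater
        then show ?thesis using x0[of k j i] arg_cong[OF xa[of i j], of "\<lambda>y. y$k"] zero_in_comps by (auto simp: comb_herm)
      qed
    qed
  qed simp
  ultimately show ?thesis by (auto simp: F_def)
qed

text \<open>Bookkeeping for scaling entry (i, j) by g i g j. Each index is met twice in its own
  diagonal entry and d times with each of the q - 1 other indices.\<close>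

lemma prod_herm_idx:
  fixes g :: "'q::finite \<Rightarrow> real"
  shows "(\<Prod>p\<in>herm_idx. g (fst p) * g (fst (snd p))) = (\<Prod>i\<in>UNIV. g i) ^ (2 + d * (CARD('q) - 1))"
proof -
  let ?D = "(\<lambda>i::'q. (i, i, 0::4)) ` UNIV"
  let ?O = "{p::'q \<times> 'q. qord (fst p) < qord (snd p)}"
  let ?U = "(\<lambda>((i, j), k). (i, j, k)) ` (?O \<times> comps d)"
  have split: "herm_idx = ?D \<union> ?U" by (auto simp: herm_idx_def image_iff)
  have dis: "?D \<inter> ?U = {}" by auto
  have "(\<Prod>p\<in>herm_idx. g (fst p) * g (fst (snd p))) = (\<Prod>p\<in>?D. g (fst p) * g (fst (snd p))) * (\<Prod>p\<in>?U. g (fst p) * g (fst (snd p)))"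
    unfolding split using dis by (intro prod.union_disjoint) auto
  also have "(\<Prod>p\<in>?D. g (fst p) * g (fst (snd p))) = (\<Prod>i\<in>UNIV. g i) ^ 2"
    by (subst prod.reindex) (auto simp: inj_on_def power2_eq_square prod.distrib)
  also have "(\<Prod>p\<in>?U. g (fst p) * g (fst (snd p))) = (\<Prod>q\<in>?O \<times> comps d. g (fst (fst q)) * g (snd (fst q)))"
    by (subst prod.reindex) (auto simp: inj_on_def case_prod_beta)
  also have "\<dots> = (\<Prod>p\<in>?O. \<Prod>k\<in>comps d. g (fst p) * g (snd p))"
    by (subst prod.cartesian_product) (auto simp: case_prod_beta)
  also have "\<dots> = (\<Prod>p\<in>?O. g (fst p) * g (snd p)) ^ d" by (simp add: card_comps prod_power_distrib)
  also have "(\<Prod>p\<in>?O. g (fst p) * g (snd p)) = (\<Prod>i\<in>UNIV. g i) ^ (CARD('q) - 1)"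
  proof -
    let ?O' = "{p::'q \<times> 'q. qord (snd p) < qord (fst p)}"
    have "(\<Prod>p\<in>?O. g (snd p)) = (\<Prod>p\<in>?O'. g (fst p))"
      by (rule prod.reindex_bij_witness[of _ prod.swap prod.swap]) auto
    then have "(\<Prod>p\<in>?O. g (fst p) * g (snd p)) = (\<Prod>p\<in>?O. g (fst p)) * (\<Prod>p\<in>?O'. g (fst p))"
      by (simp add: prod.distrib)
    also have "\<dots> = (\<Prod>p\<in>?O \<union> ?O'. g (fst p))" by (intro prod.union_disjoint[symmetric]) auto
    also have "?O \<union> ?O' = Sigma UNIV (\<lambda>i. UNIV - {i})" by (auto simp: qord_inj neq_iff[symmetric])
    also have "(\<Prod>p\<in>Sigma UNIV (\<lambda>i. UNIV - {i}). g (fst p)) = (\<Prod>i\<in>UNIV. \<Prod>j\<in>UNIV - {i}. g i)"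
      by (subst prod.Sigma) (auto simp: case_prod_beta)
    also have "\<dots> = (\<Prod>i\<in>UNIV. g i) ^ (CARD('q) - 1)" by (simp add: card_Diff_singleton prod_power_distrib)
    finally show ?thesis .
  qed
  finally show ?thesis by (simp only: power_add mult.commute[of d] power_mult)
qed

text \<open>The count is read off from the product formula by putting every g i = 2 and comparing
  powers of two.\<close>

lemma card_herm_idx: "real (card (herm_idx :: ('q::finite \<times> 'q \<times> 4) set)) = n0 d TYPE('q)"
proof -
  have "real CARD('q) * real (2 + d * (CARD('q) - 1)) = 2 * real (card (herm_idx :: ('q \<times> 'q \<times> 4) set))"
  proof -
    have "(\<Prod>p\<in>(herm_idx :: ('q \<times> 'q \<times> 4) set). 2 * (2::real)) = (\<Prod>i\<in>(UNIV::'q set). 2) ^ (2 + d * (CARD('q) - 1))"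
      using prod_herm_idx[of "\<lambda>i::'q. 2"] by simp
    then have "(2 * (2::real)) ^ card (herm_idx :: ('q \<times> 'q \<times> 4) set) = (2 ^ CARD('q)) ^ (2 + d * (CARD('q) - 1))"
      by (simp only: prod_constant)
    then have "(2::real) ^ (2 * card (herm_idx :: ('q \<times> 'q \<times> 4) set)) = 2 ^ (CARD('q) * (2 + d * (CARD('q) - 1)))"
      by (simp only: power_mult power2_eq_square)
    then have "2 * card (herm_idx :: ('q \<times> 'q \<times> 4) set) = CARD('q) * (2 + d * (CARD('q) - 1))"
      by (subst (asm) power_inject_exp) auto
    then show ?thesis by (metis of_nat_mult of_nat_numeral)
  qed
  moreover have "real (CARD('q) - 1) = real CARD('q) - 1" by (simp add: of_nat_diff Suc_le_eq)
  ultimately show ?thesis by (simp add: n0_def algebra_simps diff_divide_distrib)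
qed

text \<open>The unitary part is an isometry of the Hermitian matrices, and the diagonal part
  multiplies each coordinate vector by g i g j. The exponent is 2 + d (q - 1) = 2 \<open>n0\<close>
  / q.\<close>

lemma nn_integral_lebH_conj:
  fixes f :: "'q::finite mat \<Rightarrow> ennreal"
  assumes w: "unitary d w" and g: "\<And>i. 0 < g i" and f: "f \<in> borel_measurable borel"
  defines "M \<equiv> mmul w (rdiag g)"
  shows "(\<integral>\<^sup>+x. f (mmul M (mmul x (madj M))) \<partial>lebH d) =
     ennreal ((\<Prod>i\<in>UNIV. g i) powr (- 2 * n0 d TYPE('q) / real CARD('q))) * (\<integral>\<^sup>+x. f x \<partial>lebH d)"
proof -
  interpret frame "herm_idx :: ('q \<times> 'q \<times> 4) set" herm_unit by (rule frame_herm)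
  have lin: "linear (\<lambda>x. mmul M (mmul x (madj M)))" for M :: "'q mat" by (simp add: linear_iff)
  have fm: "(\<lambda>x. f (mmul w (mmul x (madj w)))) \<in> borel_measurable borel"
    using measurable_compose[OF linear_borel[OF lin] f] .
  have "(\<integral>\<^sup>+x. f (mmul M (mmul x (madj M))) \<partial>leb) =
    (\<integral>\<^sup>+x. f (mmul w (mmul (mmul (rdiag g) (mmul x (madj (rdiag g)))) (madj w))) \<partial>leb)"
    by (simp add: M_def mmul_assoc)
  also have "\<dots> = ennreal (\<Prod>p\<in>herm_idx. 1 / (g (fst p) * g (fst (snd p)))) * (\<integral>\<^sup>+x. f (mmul w (mmul x (madj w))) \<partial>leb)"
  proof (rule nn_integral_diag[OF lin _ _ fm])
    fix p :: "'q \<times> 'q \<times> 4"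
    show "0 < g (fst p) * g (fst (snd p))" using g by simp
    show "mmul (rdiag g) (mmul (herm_unit p) (madj (rdiag g))) = (g (fst p) * g (fst (snd p))) *\<^sub>R herm_unit p"
      by (cases p) (auto simp: vec_eq_iff rdiag_mmul_nth mmul_rdiag_nth herm_unit_def mat_unit_nth)
  qed
  also have "(\<integral>\<^sup>+x. f (mmul w (mmul x (madj w))) \<partial>leb) = (\<integral>\<^sup>+x. f x \<partial>leb)"
  proof (rule nn_integral_isometry[OF lin _ _ f])
    show "(\<lambda>x. mmul w (mmul x (madj w))) ` F = F"
    proof
      show "F \<subseteq> (\<lambda>x. mmul w (mmul x (madj w))) ` F"
      proof
        fix x assume "x \<in> F"
        then show "x \<in> (\<lambda>x. mmul w (mmul x (madj w))) ` F"
          using w Herm_simps(7)[of "madj w" x] unfolding F_herm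
          by (intro image_eqI[of _ _ "mmul (madj w) (mmul x w)"]) (auto simp: mmul_assoc unitary_cancel unitary_right)
      qed
    qed (use w in \<open>auto simp: F_herm\<close>)
    show "norm (mmul w (mmul x (madj w))) = norm x" for x
    proof -
      have "mmul w (mmul x (madj w)) \<bullet> mmul w (mmul x (madj w)) = x \<bullet> x"
        using w by (simp add: inner_mmul_left[of w] unitary_cancel inner_mmul_right[of x] mmul_assoc unitary_left)
      then show ?thesis by (simp add: norm_eq_sqrt_inner)
    qed
  qed
  also have "(\<Prod>p\<in>herm_idx. 1 / (g (fst p) * g (fst (snd p)))) = (\<Prod>i\<in>UNIV. g i) powr (- 2 * n0 d TYPE('q) / real CARD('q))"
  proof -
    have G: "0 < (\<Prod>i\<in>UNIV. g i)" using g by (intro prod_pos) auto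
    have e: "2 * n0 d TYPE('q) / real CARD('q) = real (2 + d * (CARD('q) - 1))"
    proof -
      have "real (CARD('q) - 1) = real CARD('q) - 1" by (simp add: of_nat_diff Suc_le_eq)
      then show ?thesis by (simp add: n0_def field_simps)
    qed
    have "(\<Prod>p\<in>herm_idx. 1 / (g (fst p) * g (fst (snd p)))) = 1 / (\<Prod>i\<in>UNIV. g i) ^ (2 + d * (CARD('q) - 1))"
      unfolding prod_herm_idx[symmetric] by (simp add: prod_dividef)
    also have "\<dots> = (\<Prod>i\<in>UNIV. g i) powr - real (2 + d * (CARD('q) - 1))"
      using G unfolding powr_minus powr_realpow[OF G] by (simp add: divide_inverse)
    finally show ?thesis using e by simp
  qed
  finally show ?thesis by (simp only: lebH_eq)
qed

end

section \<open>The cone Gamma integral\<close>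

context wishart_setting
begin

definition "\<beta> = \<mu> - n0 d TYPE('q) / real CARD('q)"

text \<open>\<open>GammaOmega\<close> as a nonnegative integral, which has a meaning before
  finiteness is known.\<close>

definition "gam = (\<integral>\<^sup>+x. ennreal (Delta_powr \<beta> x * exp (- retr x)) \<partial>(lebH d :: 'q mat measure))"

lemma sets_lebH [simp, measurable_cong]: "sets (lebH d) = sets borel" by (simp add: lebH_def)

lemma retr_borel [measurable]: "(retr :: 'q mat \<Rightarrow> real) \<in> borel_measurable borel"
  by (intro borel_measurable_continuous_onI continuous_on_retr)

text \<open>Consequently \<beta> is nonnegative unless d q = 1, the only case in which the density
  may be unbounded near the boundary of the cone.\<close>

lemma beta_gt: "\<beta> > real (d * CARD('q)) / 2 - 1"
proof -
  have "n0 d TYPE('q) / real CARD('q) = 1 + real d / 2 * (real CARD('q) - 1)" by (simp add: n0_def field_simps)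
  then show ?thesis using mu by (simp add: \<beta>_def rho_def algebra_simps diff_divide_distrib)
qed

lemma Delta_le_retr:
  assumes x: "(x::'q mat) \<in> PiQ d" shows "Delta d x \<le> retr x ^ CARD('q)"
proof -
  obtain u l where u: "unitary d u" "\<And>i. 0 \<le> l i" "x = mmul u (mmul (rdiag l) (madj u))"
    using x by (metis spectral_psd)
  have "l i \<le> (\<Sum>i\<in>UNIV. l i)" for i using u(2) by (intro member_le_sum) auto
  then have "(\<Prod>i\<in>UNIV. l i) \<le> (\<Prod>i\<in>(UNIV::'q set). (\<Sum>i\<in>UNIV. l i))" using u(2) by (intro prod_mono) auto
  then show ?thesis using u by (simp add: Delta_spectral retr_conj_unitary retr_rdiag)
qed

lemma Delta_powr_scale:
  assumes t: "0 < t"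
  shows "Delta_powr b (t *\<^sub>R (x::'q mat)) = t powr (real CARD('q) * b) * Delta_powr b x"
proof -
  have sc: "t *\<^sub>R x = mmul (sqrt t *\<^sub>R mid) (mmul x (madj (sqrt t *\<^sub>R mid)))" using t by (simp add: mmul_assoc)
  have P: "y \<in> PiQ d \<Longrightarrow> Delta d (t *\<^sub>R y) = t ^ CARD('q) * Delta d y" if "0 < t" for t and y :: "'q mat"
  proof -
    assume y: "y \<in> PiQ d"
    have "Delta d (t *\<^sub>R y) = Delta d (mmul (sqrt t *\<^sub>R mid) (mmul y (madj (sqrt t *\<^sub>R mid))))" using that by (simp add: mmul_assoc)
    also have "\<dots> = Delta d (mmul (sqrt t *\<^sub>R mid) (madj (sqrt t *\<^sub>R mid :: 'q mat))) * Delta d y"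
      using y by (intro Delta_conj) auto
    also have "mmul (sqrt t *\<^sub>R mid) (madj (sqrt t *\<^sub>R mid :: 'q mat)) = rdiag (\<lambda>i. t * 1)"
      unfolding rdiag_linear rdiag_one using that by simp
    also have "Delta d (rdiag (\<lambda>i::'q. t * 1)) = t ^ CARD('q)" using that by (subst Delta_rdiag) auto
    finally show ?thesis .
  qed
  have iff: "t *\<^sub>R x \<in> PiQ d \<longleftrightarrow> x \<in> PiQ d"
  proof
    assume "t *\<^sub>R x \<in> PiQ d"
    from PiQ_simps(3)[OF this, of "1 / t"] show "x \<in> PiQ d" using t by simp
  qed (use t in simp)
  show ?thesis
  proof (cases "x \<in> OmegaQ d")
    case True
    then have "t *\<^sub>R x \<in> OmegaQ d" using t P[OF t, of x] iff unfolding OmegaQ_iff_Delta by simp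
    moreover have "(t ^ CARD('q)) powr b = t powr (real CARD('q) * b)"
      unfolding powr_realpow[OF t, symmetric] powr_powr ..
    ultimately show ?thesis using True t P[OF t, of x] Delta_nonneg[of x]
      by (simp add: Delta_powr_def powr_mult)
  next
    case False
    then have "t *\<^sub>R x \<notin> OmegaQ d"
      using t iff P[OF t, of x] unfolding OmegaQ_iff_Delta by (metis zero_less_mult_pos zero_less_power)
    then show ?thesis using False by (simp add: Delta_powr_def)
  qed
qed

text \<open>For d q at least 2 the density is at most 1 on this bounded region. For d = q = 1 the
  cone is a half-line, and r^\<beta> with \<beta> > -1 is compared with the ball weight centred at
  the identity, through 1 - (1 - r)^2 = r (2 - r).\<close>

lemma gam_unit_finite:
  "(\<integral>\<^sup>+x. indicator {x. retr x < 1} x * ennreal (Delta_powr \<beta> x) \<partial>(lebH d :: 'q mat measure)) < \<infinity>"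
proof (cases "2 \<le> d * CARD('q)")
  case True
  interpret frame "herm_idx :: ('q \<times> 'q \<times> 4) set" herm_unit by (rule frame_herm)
  have "2 \<le> real (d * CARD('q))" using True by linarith
  then have b: "0 \<le> \<beta>" using beta_gt by linarith
  have "(\<integral>\<^sup>+x. indicator {x. retr x < 1} x * ennreal (Delta_powr \<beta> x) \<partial>leb) \<le> (\<integral>\<^sup>+x. indicator (cball 0 1) x \<partial>leb)"
  proof (rule nn_integral_mono)
    fix x :: "'q mat"
    show "indicator {x. retr x < 1} x * ennreal (Delta_powr \<beta> x) \<le> indicator (cball 0 1) x"
    proof (cases "x \<in> OmegaQ d \<and> retr x < 1")
      case True
      then have x: "x \<in> PiQ d" "retr x < 1" by auto
      have "Delta d x \<le> 1" using Delta_le_retr[OF x(1)] x(2) retr_PiQ_nonneg[OF x(1)] by (meson less_imp_le order_trans power_le_one)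
      then have "Delta d x powr \<beta> \<le> 1 powr \<beta>" using Delta_nonneg[OF x(1)] b by (intro powr_mono2) auto
      moreover have "norm x \<le> 1" using norm_le_retr[OF x(1)] x(2) by linarith
      ultimately show ?thesis using True by (simp add: Delta_powr_def)
    qed (auto simp: Delta_powr_def)
  qed
  also have "\<dots> < \<infinity>" using fin[of 1] by simp
  finally show ?thesis by (simp only: lebH_eq)
next
  case False
  interpret frame "herm_idx :: ('q \<times> 'q \<times> 4) set" herm_unit by (rule frame_herm)
  have "CARD('q) \<le> d * CARD('q)" using d by auto
  then have "CARD('q) < 2" using False by linarith
  moreover have "0 < CARD('q)" by (rule zero_less_card_finite)
  ultimately have q1: "CARD('q) = 1" by linarith
  then have d1: "d = 1" using False d by auto
  have b: "\<beta> > -1" using beta_gt q1 d1 by simp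
  obtain i0 :: 'q where i0: "UNIV = {i0}" using q1 by (auto simp: card_1_singleton_iff)
  then have eq0: "i = i0" for i by blast
  have xm: "x = retr x *\<^sub>R mid" if "x \<in> Herm d" for x :: "'q mat"
  proof -
    have "x$i0$i0$k = 0" if "k \<noteq> 0" for k using Herm_D(1)[OF \<open>x \<in> Herm d\<close>] that d1 by (simp add: In_M_def comps_def)
    then have "x$i0$i0 = (x$i0$i0$0) *\<^sub>R qone" by (auto simp: vec_eq_iff)
    moreover have "retr x = x$i0$i0$0" unfolding retr_def i0 by simp
    ultimately have "x$i0$i0 = (retr x *\<^sub>R mid)$i0$i0" by (simp add: mid_nth)
    then show ?thesis unfolding mat_eq_iff by (metis eq0)
  qed
  have rm: "retr (mid :: 'q mat) = 1" unfolding retr_def i0 by (simp add: mid_nth)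
  have nm: "norm (mid :: 'q mat) = 1"
    using norm_sq_eq_retr[of "mid :: 'q mat"] rm by (simp add: power2_eq_1_iff norm_ge_zero) (smt (verit) norm_ge_zero)
  \<comment> \<open>The constant pays for replacing r by r (2 - r), which is at most 2 r, under a
    nonpositive power; \<open>min \<beta> 0\<close> treats both signs of \<beta> at once.\<close>
  define C where "C = max 1 (2 powr (- \<beta>))"
  have "(\<integral>\<^sup>+x. indicator {x. retr x < 1} x * ennreal (Delta_powr \<beta> x) \<partial>leb) \<le> (\<integral>\<^sup>+x. ennreal C * ball_weight (min \<beta> 0) (- mid + x) \<partial>leb)"
  proof (rule nn_integral_mono_AE, use AE_V in eventually_elim)
    fix x :: "'q mat" assume "x \<in> F"
    then have xH: "x \<in> Herm d" by (simp add: F_herm)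
    show "indicator {x. retr x < 1} x * ennreal (Delta_powr \<beta> x) \<le> ennreal C * ball_weight (min \<beta> 0) (- mid + x)"
    proof (cases "x \<in> OmegaQ d \<and> retr x < 1")
      case True
      define r where "r = retr x"
      have D: "Delta d x = r"
      proof -
        have "0 \<le> r" using True by (simp add: r_def retr_PiQ_nonneg)
        moreover have "x = rdiag (\<lambda>i. r * 1)" unfolding rdiag_linear rdiag_one r_def by (rule xm[OF xH])
        ultimately show ?thesis using Delta_rdiag[of "\<lambda>i::'q. r * 1"] by (simp add: i0)
      qed
      then have r0: "0 < r" "r < 1" using True by (auto simp: OmegaQ_iff_Delta r_def)
      have nx: "norm (- mid + x) = 1 - r"
      proof -
        have "- mid + x = (r - 1) *\<^sub>R mid" by (subst xm[OF xH]) (simp add: r_def algebra_simps)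
        then show ?thesis using r0 nm by simp
      qed
      let ?b = "min \<beta> 0"
      have w: "1 - (1 - r)\<^sup>2 = r * (2 - r)" by (simp add: power2_eq_square algebra_simps)
      have p1: "0 < r * (2 - r)" "r * (2 - r) \<le> 2 * r" using r0 by auto
      have "r powr \<beta> \<le> r powr ?b" using r0 by (intro powr_mono') auto
      also have "\<dots> = 2 powr (- ?b) * (2 * r) powr ?b" using r0 by (simp add: powr_mult powr_minus field_simps)
      also have "\<dots> \<le> C * (r * (2 - r)) powr ?b"
      proof (rule mult_mono)
        show "2 powr (- ?b) \<le> C" by (auto simp: C_def min_def)
        show "(2 * r) powr ?b \<le> (r * (2 - r)) powr ?b" using p1 by (intro powr_mono2') auto
      qed (auto simp: C_def)
      finally have "r powr \<beta> \<le> C * (r * (2 - r)) powr ?b" .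
      moreover have "ball_weight ?b (- mid + x) = ennreal ((r * (2 - r)) powr ?b)"
      proof -
        have "- mid + x \<in> ball 0 1" using nx r0 by simp
        then show ?thesis unfolding ball_weight_def nx w by (simp only: indicator_simps mult_1_left)
      qed
      moreover have "0 \<le> C" by (simp add: C_def)
      moreover have "indicator {x. retr x < 1} x * ennreal (Delta_powr \<beta> x) = ennreal (r powr \<beta>)"
        using True D by (simp add: Delta_powr_def)
      ultimately show ?thesis by (simp add: ennreal_mult'[symmetric])
    qed (auto simp: Delta_powr_def)
  qed
  also have "\<dots> = ennreal C * (\<integral>\<^sup>+x. ball_weight (min \<beta> 0) (- mid + x) \<partial>leb)"
    by (rule nn_integral_cmult) measurable
  also have "(\<integral>\<^sup>+x. ball_weight (min \<beta> 0) (- mid + x) \<partial>leb) = (\<integral>\<^sup>+x. ball_weight (min \<beta> 0) x \<partial>leb)"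
    using subspace_neg[OF subspace_Herm, of mid] by (intro nn_integral_trans) (auto simp: F_herm)
  also have "ennreal C * \<dots> < \<infinity>"
    using nn_integral_ball_weight_finite[of "min \<beta> 0"] b by (auto simp: ennreal_mult_less_top)
  finally show ?thesis by (simp only: lebH_eq)
qed

end

section \<open>Laplace transform of the Wishart distribution\<close>

lemma nn_integral_exp_tail: "(\<integral>\<^sup>+t. indicator {c..} t * ennreal (exp (- t)) \<partial>lborel) = ennreal (exp (- c :: real))"
proof -
  have "(\<integral>\<^sup>+t. ennreal (exp (- t)) * indicator {c..} t \<partial>lborel) = ennreal (0 - (- exp (- c)))"
  proof (rule nn_integral_FTC_atLeast[where F = "\<lambda>t. - exp (- t)"])
    show "((\<lambda>t::real. - exp (- t)) \<longlongrightarrow> 0) at_top"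
      using tendsto_minus[OF filterlim_compose[OF exp_at_bot filterlim_uminus_at_bot_at_top]] by simp
  qed (auto intro!: derivative_eq_intros)
  then show ?thesis by (simp add: mult.commute)
qed

lemma nn_integral_Gamma_finite:
  assumes "s > 0" shows "(\<integral>\<^sup>+t. indicator {0<..} t * ennreal (exp (- t) * t powr s) \<partial>lborel) < \<infinity>"
proof -
  have "((\<lambda>t. t powr (s + 1 - 1) / exp t) has_integral Gamma (s + 1)) {0..}"
    using assms by (intro Gamma_integral_real) auto
  then have "((\<lambda>t. if t \<in> {0..} then t powr s / exp t else 0) has_integral Gamma (s + 1)) UNIV"
    by (subst has_integral_restrict_UNIV) simp
  then have "(\<integral>\<^sup>+t. ennreal (if t \<in> {0..} then t powr s / exp t else 0) \<partial>lborel) = ennreal (Gamma (s + 1))"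
    by (intro nn_integral_has_integral_lborel) auto
  moreover have "(\<integral>\<^sup>+t. indicator {0<..} t * ennreal (exp (- t) * t powr s) \<partial>lborel) \<le>
     (\<integral>\<^sup>+t. ennreal (if t \<in> {0..} then t powr s / exp t else 0) \<partial>lborel)"
    by (intro nn_integral_mono) (auto simp: indicator_def exp_minus field_simps)
  ultimately show ?thesis by (auto intro: le_less_trans)
qed

context wishart_setting
begin

lemma retr_OmegaQ_pos: "(x::'q mat) \<in> OmegaQ d \<Longrightarrow> 0 < retr x"
proof -
  assume x: "x \<in> OmegaQ d"
  then have "0 < Delta d x" using OmegaQ_iff_Delta by blast
  then have "0 < retr x ^ CARD('q)" using Delta_le_retr[of x] x by simp
  then show ?thesis using retr_PiQ_nonneg[of x] x by (cases "retr x = 0") (auto simp: less_le)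
qed

text \<open>Layer cake: exp (- tr x) is the integral of exp (- t) over t above tr x. Exchanging the
  integrals and rescaling x reduces the claim to the region tr x < 1 times a Gamma integral in t
  with exponent q \<beta> + \<open>n0\<close> = q \<mu>.\<close>

lemma gam_finite: "gam < \<infinity>"
proof -
  interpret frame "herm_idx :: ('q \<times> 'q \<times> 4) set" herm_unit by (rule frame_herm)
  interpret P: pair_sigma_finite leb lborel ..
  let ?s = "real CARD('q) * \<beta> + n0 d TYPE('q)"
  have s: "?s > 0"
  proof -
    have "?s = real CARD('q) * \<mu>" by (simp add: \<beta>_def field_simps)
    then show ?thesis using mu_pos by simp
  qed
  define Z1 where "Z1 = (\<integral>\<^sup>+x. indicator {x. retr x < 1} x * ennreal (Delta_powr \<beta> x) \<partial>leb)"
  have Z1: "Z1 < \<infinity>" using gam_unit_finite unfolding Z1_def lebH_eq .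
  have ind: "{x::'q mat. retr x < 1} \<in> sets borel" by measurable
  have f1: "(\<lambda>x::'q mat. indicator {x. retr x < 1} x * ennreal (Delta_powr \<beta> x)) \<in> borel_measurable borel"
    using ind by measurable
  define g where "g = (\<lambda>(x::'q mat) t. ennreal (Delta_powr \<beta> x) * (indicator {retr x..} t * ennreal (exp (- t))))"
  have "(\<lambda>p. g (fst p) (snd p)) \<in> borel_measurable (borel \<Otimes>\<^sub>M borel)"
    unfolding g_def indicator_def atLeast_iff by measurable
  then have gm: "(\<lambda>(x, t). g x t) \<in> borel_measurable (leb \<Otimes>\<^sub>M lborel)"
    by (simp add: measurable_cong_sets[OF sets_pair_measure_cong[OF sets_L sets_lborel] refl] case_prod_beta')
  have "gam = (\<integral>\<^sup>+x. (\<integral>\<^sup>+t. g x t \<partial>lborel) \<partial>leb)"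
    unfolding gam_def lebH_eq
  proof (rule nn_integral_cong)
    fix x :: "'q mat"
    have "(\<integral>\<^sup>+t. g x t \<partial>lborel) = ennreal (Delta_powr \<beta> x) * (\<integral>\<^sup>+t. indicator {retr x..} t * ennreal (exp (- t)) \<partial>lborel)"
      unfolding g_def by (rule nn_integral_cmult) measurable
    then show "ennreal (Delta_powr \<beta> x * exp (- retr x)) = (\<integral>\<^sup>+t. g x t \<partial>lborel)"
      by (simp add: nn_integral_exp_tail ennreal_mult' Delta_powr_nonneg)
  qed
  also have "\<dots> = (\<integral>\<^sup>+t. (\<integral>\<^sup>+x. g x t \<partial>leb) \<partial>lborel)" by (rule P.Fubini'[symmetric, OF gm])
  also have "\<dots> \<le> (\<integral>\<^sup>+t. indicator {0<..} t * ennreal (exp (- t) * t powr ?s) * (ennreal (2 powr ?s) * Z1) \<partial>lborel)"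
  proof (rule nn_integral_mono)
    fix t :: real
    show "(\<integral>\<^sup>+x. g x t \<partial>leb) \<le> indicator {0<..} t * ennreal (exp (- t) * t powr ?s) * (ennreal (2 powr ?s) * Z1)"
    proof (cases "0 < t")
      case False
      have "g x t = 0" for x
      proof (cases "x \<in> OmegaQ d")
        case True
        then show ?thesis using retr_OmegaQ_pos[OF True] False by (simp add: g_def)
      qed (simp add: g_def Delta_powr_def)
      then show ?thesis by simp
    next
      case True
      \<comment> \<open>The factor 2 sends tr x \<le> t strictly inside the open region tr x <
        1.\<close>
      let ?c = "1 / (2 * t)"
      let ?f = "\<lambda>x::'q mat. indicator {x. retr x < 1} x * ennreal (Delta_powr \<beta> x)"
      have c: "0 < ?c" using True by simp
      have le: "g x t \<le> ennreal (exp (- t) * (2 * t) powr (real CARD('q) * \<beta>)) * ?f (?c *\<^sub>R x)" for x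
      proof (cases "retr x \<le> t")
        case rt: True
        have "retr (?c *\<^sub>R x) < 1" using rt True by (simp add: retr_eq_inner divide_simps)
        moreover have "Delta_powr \<beta> x = (2 * t) powr (real CARD('q) * \<beta>) * Delta_powr \<beta> (?c *\<^sub>R x)"
          using True Delta_powr_scale[of "2 * t" \<beta> "?c *\<^sub>R x"] by simp
        ultimately show ?thesis using rt by (simp add: g_def ennreal_mult'[symmetric] ennreal_mult''[symmetric] mult_ac)
      next
        case False
        then show ?thesis by (simp add: g_def)
      qed
      have "(\<integral>\<^sup>+x. g x t \<partial>leb) \<le> (\<integral>\<^sup>+x. ennreal (exp (- t) * (2 * t) powr (real CARD('q) * \<beta>)) * ?f (?c *\<^sub>R x) \<partial>leb)"
        by (rule nn_integral_mono) (rule le)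
      also have "\<dots> = ennreal (exp (- t) * (2 * t) powr (real CARD('q) * \<beta>)) * (\<integral>\<^sup>+x. ?f (?c *\<^sub>R x) \<partial>leb)"
      proof (rule nn_integral_cmult)
        have "(\<lambda>x::'q mat. ?c *\<^sub>R x) \<in> borel_measurable borel" by measurable
        from measurable_compose[OF this f1] show "(\<lambda>x. ?f (?c *\<^sub>R x)) \<in> borel_measurable leb" by (rule measurable_leb)
      qed
      also have "(\<integral>\<^sup>+x. ?f (?c *\<^sub>R x) \<partial>leb) = ennreal (?c powr - real (card (herm_idx :: ('q \<times> 'q \<times> 4) set))) * Z1"
        unfolding Z1_def by (rule nn_integral_scale[OF c f1])
      also have "?c powr - real (card (herm_idx :: ('q \<times> 'q \<times> 4) set)) = (2 * t) powr n0 d TYPE('q)"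
        using True unfolding card_herm_idx by (simp add: powr_minus powr_divide)
      also have "ennreal (exp (- t) * (2 * t) powr (real CARD('q) * \<beta>)) * (ennreal ((2 * t) powr n0 d TYPE('q)) * Z1) =
         ennreal (exp (- t) * t powr ?s) * (ennreal (2 powr ?s) * Z1)"
      proof -
        have "exp (- t) * (2 * t) powr (real CARD('q) * \<beta>) * (2 * t) powr n0 d TYPE('q) = exp (- t) * t powr ?s * 2 powr ?s"
        proof -
          have "(2 * t) powr (real CARD('q) * \<beta>) * (2 * t) powr n0 d TYPE('q) = (2 * t) powr ?s" by (rule powr_add[symmetric])
          also have "\<dots> = t powr ?s * 2 powr ?s" using True by (simp add: powr_mult)
          finally show ?thesis by (simp only: mult.assoc)
        qed
        then have "ennreal (exp (- t) * (2 * t) powr (real CARD('q) * \<beta>)) * ennreal ((2 * t) powr n0 d TYPE('q)) =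
          ennreal (exp (- t) * t powr ?s) * ennreal (2 powr ?s)"
          by (simp add: ennreal_mult''[symmetric])
        then show ?thesis by (simp only: mult.assoc[symmetric])
      qed
      finally show ?thesis using True by simp
    qed
  qed
  also have "\<dots> = (\<integral>\<^sup>+t. indicator {0<..} t * ennreal (exp (- t) * t powr ?s) \<partial>lborel) * (ennreal (2 powr ?s) * Z1)"
    by (rule nn_integral_multc) measurable
  also have "\<dots> < \<infinity>" using nn_integral_Gamma_finite[OF s] Z1 by (simp add: ennreal_mult_less_top)
  finally show ?thesis .
qed

text \<open>A zero integral would make the open cone a null set, but it contains a ball of Hermitian
  matrices about the identity.\<close>

lemma gam_pos: "0 < gam"
proof (rule ccontr)
  interpret frame "herm_idx :: ('q \<times> 'q \<times> 4) set" herm_unit by (rule frame_herm)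
  have fm: "(\<lambda>x::'q mat. ennreal (Delta_powr \<beta> x * exp (- retr x))) \<in> borel_measurable leb"
    by (rule measurable_leb) measurable
  assume "\<not> 0 < gam"
  then have "AE x in leb. ennreal (Delta_powr \<beta> x * exp (- retr x)) = 0"
    using nn_integral_0_iff_AE[OF fm] by (simp add: gam_def lebH_eq)
  then have AE0: "AE x in leb. x \<notin> OmegaQ d"
  proof eventually_elim
    fix x :: "'q mat" assume *: "ennreal (Delta_powr \<beta> x * exp (- retr x)) = 0"
    show "x \<notin> OmegaQ d"
    proof
      assume x: "x \<in> OmegaQ d"
      then have "0 < Delta d x" using OmegaQ_iff_Delta by blast
      then have "0 < Delta_powr \<beta> x * exp (- retr x)" using x by (simp add: Delta_powr_def)
      then show False using * by (simp add: ennreal_eq_0_iff)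
    qed
  qed
  have "(mid :: 'q mat) \<in> OmegaQ d" by simp
  then obtain e where e: "e > 0" "\<And>y. y \<in> Herm d \<Longrightarrow> dist y (mid :: 'q mat) < e \<Longrightarrow> y \<in> PiQ d"
    unfolding OmegaQ_def by blast
  have half: "y \<in> OmegaQ d" if y: "y \<in> Herm d" "dist y (mid :: 'q mat) < e / 2" for y
    unfolding OmegaQ_def
  proof (intro CollectI conjI exI[of _ "e / 2"] ballI impI)
    show "y \<in> PiQ d" using y e by (intro e(2)) auto
    show "z \<in> PiQ d" if "z \<in> Herm d" "dist z y < e / 2" for z
      using that y dist_triangle[of z mid y] by (intro e(2)) auto
  qed (use e in simp)
  have "AE x in leb. x \<notin> ball mid (e / 2)"
    using AE0 AE_V unfolding F_herm
    by eventually_elim (use half in \<open>auto simp: dist_commute\<close>)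
  then have "emeasure leb (ball mid (e / 2)) = 0" by (subst (asm) AE_iff_measurable[of "ball mid (e / 2)"]) auto
  moreover have "emeasure leb (ball mid (e / 2)) = emeasure leb (ball 0 (e / 2))"
  proof -
    have bb: "ball mid (e / 2) \<in> sets (borel :: 'q mat measure)" by simp
    have "emeasure leb (ball mid (e / 2)) = (\<integral>\<^sup>+x. indicator (ball mid (e / 2)) x \<partial>leb)" by simp
    also have "\<dots> = (\<integral>\<^sup>+x. indicator (ball mid (e / 2)) (mid + x) \<partial>leb)"
      by (rule nn_integral_trans[symmetric]) (auto simp: F_herm intro!: borel_measurable_indicator bb)
    also have "\<dots> = (\<integral>\<^sup>+x. indicator (ball 0 (e / 2)) x \<partial>leb)"
      by (intro nn_integral_cong) (auto simp: indicator_def dist_norm)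
    finally show ?thesis by simp
  qed
  ultimately show False using emeasure_ball_ne_0[of "e / 2"] e by simp
qed

lemma GammaOmega_eq: "0 < GammaOmega d \<mu> TYPE('q)" "gam = ennreal (GammaOmega d \<mu> TYPE('q))"
proof -
  have "GammaOmega d \<mu> TYPE('q) = (\<integral>x. Delta_powr \<beta> x * exp (- retr x) \<partial>(lebH d :: 'q mat measure))"
    unfolding GammaOmega_def set_lebesgue_integral_def
    by (intro Bochner_Integration.integral_cong) (auto simp: Delta_powr_def indicator_def \<beta>_def)
  also have "\<dots> = enn2real gam"
    unfolding gam_def by (rule integral_eq_nn_integral) (auto simp: Delta_powr_nonneg)
  finally have "GammaOmega d \<mu> TYPE('q) = enn2real gam" .
  then show "0 < GammaOmega d \<mu> TYPE('q)" "gam = ennreal (GammaOmega d \<mu> TYPE('q))"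
    using gam_pos gam_finite by (auto simp: enn2real_positive_iff)
qed

text \<open>M is built so that it carries the form b + I/2 to the identity; substituting
  \<open>mmul M (mmul x (madj M))\<close> for x turns the exponent into - tr x. The density
  contributes G^(2 \<beta>) and the measure G^(2 \<open>n0\<close> / q), together G^(2 \<mu>), where
  G^2 is the inverse of the product of the l i + 1/2.\<close>

lemma cone_laplace:
  assumes w: "unitary d (w::'q mat)" and l: "\<And>i. 0 \<le> l i" and b: "b = mmul w (mmul (rdiag l) (madj w))"
  shows "(\<integral>\<^sup>+x. ennreal (Delta_powr \<beta> x * exp (- (b \<bullet> x + retr x / 2))) \<partial>lebH d) =
    ennreal ((\<Prod>i\<in>UNIV. l i + 1 / 2) powr (- \<mu>)) * gam"
proof -
  define g where "g i = 1 / sqrt (l i + 1 / 2)" for i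
  have lp: "0 < l i + 1 / 2" for i using l[of i] by simp
  have g: "0 < g i" "g i * g i * (l i + 1 / 2) = 1" for i using lp[of i] by (simp_all add: g_def)
  define M where "M = mmul w (rdiag g)"
  define M' where "M' = mmul (rdiag (\<lambda>i. 1 / g i)) (madj w)"
  define G where "G = (\<Prod>i\<in>UNIV. g i)"
  have G: "0 < G" unfolding G_def using g by (intro prod_pos) auto
  have MM: "In_M d M" "In_M d M'" using w by (auto simp: M_def M'_def)
  have one: "(\<lambda>i. g i * (1 / g i)) = (\<lambda>i. 1)" "(\<lambda>i. 1 / g i * g i) = (\<lambda>i. 1)" using g(1) by (auto simp: less_imp_neq[THEN not_sym])
  have M1: "mmul M M' = mid"
  proof -
    have "mmul M M' = mmul w (mmul (mmul (rdiag g) (rdiag (\<lambda>i. 1 / g i))) (madj w))" by (simp add: M_def M'_def mmul_assoc)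
    then show ?thesis using w by (simp only: rdiag_mmul one rdiag_one mmul_mid unitary_right)
  qed
  then have M2: "mmul M' M = mid" by (rule mmul_left_right_inverse)
  have D: "Delta d (mmul M (madj M)) = G\<^sup>2"
  proof -
    have "mmul M (madj M) = mmul w (mmul (rdiag (\<lambda>i. g i * g i)) (madj w))"
      unfolding rdiag_mmul[symmetric] by (simp add: M_def mmul_assoc)
    then show ?thesis using w g by (simp add: Delta_spectral G_def power2_eq_square prod.distrib)
  qed
  let ?f = "\<lambda>x::'q mat. ennreal (Delta_powr \<beta> x * exp (- (b \<bullet> x + retr x / 2)))"
  have f: "?f \<in> borel_measurable borel" by measurable
  have tr: "b \<bullet> mmul M (mmul x (madj M)) + retr (mmul M (mmul x (madj M))) / 2 = retr x" for x
  proof -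
    have bb: "b + (1 / 2) *\<^sub>R mid = mmul w (mmul (rdiag (\<lambda>i. l i + 1 / 2 * 1)) (madj w))"
      unfolding b rdiag_linear rdiag_one using w by (simp add: unitary_right)
    have "mmul (madj M) (mmul (b + (1 / 2) *\<^sub>R mid) M) = mmul (rdiag g) (mmul (rdiag (\<lambda>i. l i + 1 / 2 * 1)) (rdiag g))"
      unfolding bb M_def using w by (simp add: mmul_assoc unitary_cancel unitary_left)
    also have "\<dots> = rdiag (\<lambda>i. 1)" unfolding rdiag_mmul using g(2) by (simp add: mult_ac)
    finally have e: "mmul (madj M) (mmul (b + (1 / 2) *\<^sub>R mid) M) = mid" by (simp only: rdiag_one)
    have "(b + (1 / 2) *\<^sub>R mid) \<bullet> mmul M (mmul x (madj M)) = mmul M (mmul x (madj M)) \<bullet> (b + (1 / 2) *\<^sub>R mid)" by (rule inner_commute)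
    also have "\<dots> = x \<bullet> mmul (madj M) (mmul (b + (1 / 2) *\<^sub>R mid) M)"
      by (simp only: inner_mmul_left[of M] inner_mmul_right[of x] madj_simps mmul_assoc)
    also have "\<dots> = retr x" unfolding e by (simp add: retr_eq_inner inner_commute)
    finally show ?thesis by (simp add: inner_simps retr_eq_inner)
  qed
  have Dp: "Delta_powr \<beta> (mmul M (mmul x (madj M))) = G powr (2 * \<beta>) * Delta_powr \<beta> x" for x
  proof (cases "x \<in> OmegaQ d")
    case True
    have "mmul M (mmul x (madj M)) \<in> OmegaQ d" by (rule OmegaQ_conj[OF MM M1 True])
    moreover have "Delta d (mmul M (mmul x (madj M))) = G\<^sup>2 * Delta d x" using Delta_conj[OF MM(1), of x] True D by simp
    moreover have "(G\<^sup>2) powr \<beta> = G powr (2 * \<beta>)"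
    proof -
      have "(G powr 2) powr \<beta> = G powr (2 * \<beta>)" by (rule powr_powr)
      then show ?thesis using G by simp
    qed
    ultimately show ?thesis using True Delta_nonneg[of x] by (simp add: Delta_powr_def powr_mult)
  next
    case False
    have "mmul M (mmul x (madj M)) \<notin> OmegaQ d"
    proof
      assume O: "mmul M (mmul x (madj M)) \<in> OmegaQ d"
      have M3: "mmul (madj M) (madj M') = mid" using M2 by (metis madj_simps(1) madj_simps(8))
      have "mmul M' (mmul (mmul M (mmul x (madj M))) (madj M')) \<in> OmegaQ d" by (rule OmegaQ_conj[OF MM(2,1) M2 O])
      also have "mmul M' (mmul (mmul M (mmul x (madj M))) (madj M')) = mmul (mmul M' M) (mmul x (mmul (madj M) (madj M')))"
        by (simp only: mmul_assoc)
      finally show False using False by (simp add: M2 M3)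
    qed
    then show ?thesis using False by (simp add: Delta_powr_def)
  qed
  have "(\<integral>\<^sup>+x. ?f (mmul M (mmul x (madj M))) \<partial>lebH d) = (\<integral>\<^sup>+x. ennreal (G powr (2 * \<beta>)) * ennreal (Delta_powr \<beta> x * exp (- retr x)) \<partial>(lebH d :: 'q mat measure))"
    unfolding tr Dp by (intro nn_integral_cong) (simp add: ennreal_mult'[symmetric] mult.assoc)
  also have "\<dots> = ennreal (G powr (2 * \<beta>)) * gam" unfolding gam_def by (rule nn_integral_cmult) measurable
  finally have "ennreal (G powr (- 2 * n0 d TYPE('q) / real CARD('q))) * (\<integral>\<^sup>+x. ?f x \<partial>lebH d) = ennreal (G powr (2 * \<beta>)) * gam"
    using nn_integral_lebH_conj[OF w g(1) f] by (simp add: M_def G_def)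
  note main = this
  have one': "ennreal (G powr (2 * n0 d TYPE('q) / real CARD('q))) * ennreal (G powr (- 2 * n0 d TYPE('q) / real CARD('q))) = 1"
    using G by (simp add: ennreal_mult'[symmetric] powr_add[symmetric])
  have two: "ennreal (G powr (2 * n0 d TYPE('q) / real CARD('q))) * ennreal (G powr (2 * \<beta>)) = ennreal (G powr (2 * \<mu>))"
    by (simp add: ennreal_mult'[symmetric] powr_add[symmetric] \<beta>_def algebra_simps)
  define P where "P = (\<Prod>i\<in>UNIV. l i + 1 / 2)"
  have three: "G powr (2 * \<mu>) = P powr (- \<mu>)"
  proof -
    have pp: "0 < P" unfolding P_def using lp by (intro prod_pos) auto
    have "G\<^sup>2 * P = 1"
      unfolding G_def P_def power2_eq_square prod.distrib[symmetric] using g(2) by simp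
    then have GP: "G\<^sup>2 = 1 / P" using pp by (metis less_irrefl nonzero_eq_divide_eq)
    have "G powr (2 * \<mu>) = (G powr 2) powr \<mu>" by (rule powr_powr[symmetric])
    also have "G powr 2 = 1 / P" using G GP by simp
    also have "(1 / P) powr \<mu> = P powr (- \<mu>)" using pp by (simp add: powr_divide powr_minus_divide)
    finally show ?thesis .
  qed
  have "(\<integral>\<^sup>+x. ?f x \<partial>lebH d) = ennreal (G powr (2 * n0 d TYPE('q) / real CARD('q))) * (ennreal (G powr (- 2 * n0 d TYPE('q) / real CARD('q))) * (\<integral>\<^sup>+x. ?f x \<partial>lebH d))"
    by (simp only: mult.assoc[symmetric] one' mult_1_left)
  also have "\<dots> = ennreal (G powr (2 * \<mu>)) * gam" unfolding main by (simp only: mult.assoc[symmetric] two)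
  finally show ?thesis unfolding three P_def .
qed

text \<open>What remains of the Haar and Gaussian constants once the powers of \<open>pi\<close>
  cancel.\<close>

definition "wconst = 2 powr (- real CARD('q) * \<mu>) / GammaOmega d \<mu> TYPE('q)"

lemma haar_eq: "haar d \<mu> = distr (density (lebH d) (\<lambda>r. ennreal (pi powr (real CARD('q) * \<mu>) / GammaOmega d \<mu> TYPE('q) * Delta_powr \<beta> r)))
   (PiS d) (psqrt :: 'q mat \<Rightarrow> _)"
proof -
  let ?D = "density (lebH d) (\<lambda>r::'q mat. ennreal (pi powr (real CARD('q) * \<mu>) / GammaOmega d \<mu> TYPE('q) * Delta_powr \<beta> r))"
  have "haar d \<mu> = distr ?D (PiS d) (\<lambda>v. msqrt d v)"
    unfolding haar_def by (intro arg_cong2[where f = "\<lambda>a b. distr (density (lebH d) a) (PiS d) b"] ext)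
      (auto simp: Delta_powr_def indicator_def \<beta>_def)
  also have "\<dots> = distr ?D (PiS d) (\<lambda>v. psqrt v)"
  proof (rule distr_msqrt)
    show "(\<lambda>v. v) \<in> borel_measurable ?D" by (rule measurable_ident_sets) simp
    have m: "(\<lambda>r::'q mat. ennreal (pi powr (real CARD('q) * \<mu>) / GammaOmega d \<mu> TYPE('q) * Delta_powr \<beta> r)) \<in> borel_measurable (lebH d)"
      by measurable
    show "AE v in ?D. v \<in> PiQ d"
      by (subst AE_density[OF m]) (auto simp: Delta_powr_def intro!: AE_I2 split: if_splits)
  qed
  finally show ?thesis .
qed

lemma wishart_nn_integral:
  assumes f: "f \<in> borel_measurable (PiS d)"
  shows "(\<integral>\<^sup>+r. f r \<partial>wishart d \<mu>) = (\<integral>\<^sup>+x. ennreal wconst * ennreal (Delta_powr \<beta> x * exp (- retr x / 2)) * f (psqrt (x::'q mat)) \<partial>lebH d)"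
proof -
  let ?k = "pi powr (real CARD('q) * \<mu>) / GammaOmega d \<mu> TYPE('q)"
  let ?D = "density (lebH d) (\<lambda>r::'q mat. ennreal (?k * Delta_powr \<beta> r))"
  let ?e = "\<lambda>r::'q mat. ennreal ((2 * pi) powr (- real CARD('q) * \<mu>) * exp (- retr (mmul r r) / 2))"
  have m: "(\<lambda>r::'q mat. ennreal (?k * Delta_powr \<beta> r)) \<in> borel_measurable (lebH d)" by measurable
  have sh: "sets (haar d \<mu> :: 'q mat measure) = sets (PiS d)" by (simp add: haar_eq)
  have "(\<lambda>r::'q mat. retr (mmul r r)) \<in> borel_measurable borel"
    unfolding retr_eq_inner by (intro borel_measurable_continuous_onI continuous_intros)
  then have "?e \<in> borel_measurable borel" by measurable
  then have e: "?e \<in> borel_measurable (PiS d)" by (rule measurable_PiS)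
  have ef: "(\<lambda>r. ?e r * f r) \<in> borel_measurable (PiS d)" using e f by (rule borel_measurable_times_ennreal)
  have ps: "psqrt \<in> measurable ?D (PiS d)" by measurable
  have e': "?e \<in> borel_measurable (haar d \<mu>)" and f': "f \<in> borel_measurable (haar d \<mu>)"
    using e f measurable_cong_sets[OF sh refl] by blast+
  have "(\<integral>\<^sup>+r. f r \<partial>wishart d \<mu>) = (\<integral>\<^sup>+r. ?e r * f r \<partial>haar d \<mu>)"
    unfolding wishart_def by (rule nn_integral_density[OF e' f'])
  also have "\<dots> = (\<integral>\<^sup>+x. ?e (psqrt x) * f (psqrt x) \<partial>?D)"
  proof -
    have "(\<lambda>r. ?e r * f r) \<in> borel_measurable (distr ?D (PiS d) psqrt)"
      using ef measurable_cong_sets[OF sets_distr[of ?D "PiS d" psqrt] refl] by blast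
    from nn_integral_distr[OF ps this] show ?thesis by (simp only: haar_eq)
  qed
  also have "\<dots> = (\<integral>\<^sup>+x. ennreal (?k * Delta_powr \<beta> x) * (?e (psqrt x) * f (psqrt x)) \<partial>lebH d)"
  proof (rule nn_integral_density[OF m])
    show "(\<lambda>x. ?e (psqrt x) * f (psqrt x)) \<in> borel_measurable (lebH d)"
      using measurable_compose[OF psqrt_measurable ef] measurable_cong_sets[OF sets_lebH refl] by blast
  qed
  also have "\<dots> = (\<integral>\<^sup>+x. ennreal wconst * ennreal (Delta_powr \<beta> x * exp (- retr x / 2)) * f (psqrt x) \<partial>lebH d)"
  proof (rule nn_integral_cong)
    fix x :: "'q mat"
    show "ennreal (?k * Delta_powr \<beta> x) * (?e (psqrt x) * f (psqrt x)) = ennreal wconst * ennreal (Delta_powr \<beta> x * exp (- retr x / 2)) * f (psqrt x)"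
    proof (cases "x \<in> OmegaQ d")
      case True
      then have x: "mmul (psqrt x) (psqrt x) = x" by (simp add: psqrt_def)
      define D E c1 c2 where "D = Delta_powr \<beta> x" and "E = exp (- retr x / 2)"
        and "c1 = (2 * pi) powr (- real CARD('q) * \<mu>)" and "c2 = ?k"
      have D0: "0 \<le> D" by (simp add: D_def Delta_powr_nonneg)
      have k: "c2 * c1 = wconst"
      proof -
        have 1: "(2 * pi) powr (- real CARD('q) * \<mu>) = 2 powr (- real CARD('q) * \<mu>) * pi powr (- real CARD('q) * \<mu>)"
          by (rule powr_mult)
        have 2: "pi powr (real CARD('q) * \<mu>) * pi powr (- real CARD('q) * \<mu>) = 1"
          unfolding powr_add[symmetric] by simp
        have "A / g * (T * B) = T * (A * B) / g" for A B T g :: real by simp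
        then have "c2 * c1 = 2 powr (- real CARD('q) * \<mu>) * (pi powr (real CARD('q) * \<mu>) * pi powr (- real CARD('q) * \<mu>)) / GammaOmega d \<mu> TYPE('q)"
          unfolding c1_def c2_def 1 .
        then show ?thesis unfolding 2 wconst_def by (simp only: mult_1_right)
      qed
      have c1: "0 \<le> c1" by (simp add: c1_def)
      have "ennreal (c2 * D) * ennreal (c1 * E) = ennreal (c2 * D * (c1 * E))"
        using c1 by (intro ennreal_mult''[symmetric]) (simp add: E_def)
      also have "c2 * D * (c1 * E) = wconst * (D * E)" unfolding k[symmetric] by (simp only: mult_ac)
      also have "ennreal \<dots> = ennreal wconst * ennreal (D * E)"
        using D0 by (intro ennreal_mult'') (simp add: E_def)
      finally have "ennreal (?k * Delta_powr \<beta> x) * ?e (psqrt x) = ennreal wconst * ennreal (Delta_powr \<beta> x * exp (- retr x / 2))"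
        unfolding x D_def E_def c1_def c2_def .
      then show ?thesis by (simp only: mult.assoc[symmetric])
    qed (simp add: Delta_powr_def)
  qed
  finally show ?thesis .
qed

lemma wishart_laplace:
  assumes w: "unitary d (w::'q mat)" and l: "\<And>i. 0 \<le> l i" and b: "b = mmul w (mmul (rdiag l) (madj w))"
  shows "(\<integral>\<^sup>+r. ennreal (exp (- (b \<bullet> mmul r r))) \<partial>wishart d \<mu>) = ennreal ((\<Prod>i\<in>UNIV. 1 + 2 * l i) powr (- \<mu>))"
proof -
  have fm: "(\<lambda>r::'q mat. ennreal (exp (- (b \<bullet> mmul r r)))) \<in> borel_measurable (PiS d)"
    by (rule measurable_PiS, rule measurable_compose[OF _ measurable_ennreal])
      (intro borel_measurable_continuous_onI continuous_intros)
  have c: "0 \<le> wconst" using GammaOmega_eq(1) by (simp add: wconst_def)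
  have "(\<integral>\<^sup>+r. ennreal (exp (- (b \<bullet> mmul r r))) \<partial>wishart d \<mu>) =
    (\<integral>\<^sup>+x. ennreal wconst * ennreal (Delta_powr \<beta> x * exp (- (b \<bullet> x + retr x / 2))) \<partial>(lebH d :: 'q mat measure))"
    unfolding wishart_nn_integral[OF fm]
  proof (rule nn_integral_cong)
    fix x :: "'q mat"
    show "ennreal wconst * ennreal (Delta_powr \<beta> x * exp (- retr x / 2)) * ennreal (exp (- (b \<bullet> mmul (psqrt x) (psqrt x)))) =
      ennreal wconst * ennreal (Delta_powr \<beta> x * exp (- (b \<bullet> x + retr x / 2)))"
    proof (cases "x \<in> OmegaQ d")
      case True
      then have "mmul (psqrt x) (psqrt x) = x" by (simp add: psqrt_def)
      moreover have "exp (- retr x / 2) * exp (- (b \<bullet> x)) = exp (- (b \<bullet> x + retr x / 2))" by (simp add: exp_add[symmetric])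
      ultimately show ?thesis by (simp add: mult.assoc ennreal_mult''[symmetric])
    qed (simp add: Delta_powr_def)
  qed
  also have "\<dots> = ennreal wconst * (ennreal ((\<Prod>i\<in>UNIV. l i + 1 / 2) powr (- \<mu>)) * gam)"
    unfolding cone_laplace[OF w l b, symmetric] by (rule nn_integral_cmult) measurable
  also have "\<dots> = ennreal (2 powr (- real CARD('q) * \<mu>) * (\<Prod>i\<in>UNIV. l i + 1 / 2) powr (- \<mu>))"
    unfolding GammaOmega_eq(2) wconst_def using GammaOmega_eq(1) by (simp add: ennreal_mult'[symmetric] ennreal_mult''[symmetric])
  also have "2 powr (- real CARD('q) * \<mu>) * (\<Prod>i\<in>UNIV. l i + 1 / 2) powr (- \<mu>) = (\<Prod>i\<in>UNIV. 1 + 2 * l i) powr (- \<mu>)"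
  proof -
    have e: "(\<Prod>i\<in>UNIV. 1 + 2 * l i) = 2 ^ CARD('q) * (\<Prod>i\<in>UNIV. l i + 1 / 2)"
    proof -
      have "(\<Prod>i\<in>UNIV. 1 + 2 * l i) = (\<Prod>i\<in>UNIV. 2 * (l i + 1 / 2))" by (simp add: algebra_simps)
      then show ?thesis by (simp only: prod.distrib prod_constant)
    qed
    have "(2 ^ CARD('q)) powr (- \<mu>) = (2::real) powr (- real CARD('q) * \<mu>)"
    proof -
      have "(2 powr real CARD('q)) powr (- \<mu>) = (2::real) powr (real CARD('q) * - \<mu>)" by (rule powr_powr)
      then show ?thesis by (simp add: powr_realpow)
    qed
    moreover have "0 \<le> (\<Prod>i\<in>UNIV. l i + 1 / 2)" using l by (intro prod_nonneg) (simp add: add_nonneg_nonneg)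
    ultimately show ?thesis unfolding e by (simp add: powr_mult)
  qed
  finally show ?thesis .
qed

text \<open>The total mass is the Laplace transform at 0.\<close>

lemma law_on_wishart: "law_on (wishart d \<mu> :: 'q mat measure)"
  unfolding law_on_def
proof
  have un: "unitary d (mid :: 'q mat)" by (simp add: unitary_def)
  have "(\<integral>\<^sup>+r. ennreal (exp (- ((0::'q mat) \<bullet> mmul r r))) \<partial>wishart d \<mu>) = ennreal ((\<Prod>i\<in>(UNIV::'q set). 1 + 2 * 0) powr (- \<mu>))"
    using un by (rule wishart_laplace) (auto simp: mat_eq_iff rdiag_nth)
  then have "emeasure (wishart d \<mu> :: 'q mat measure) (space (wishart d \<mu>)) = 1" by simp
  then show "prob_space (wishart d \<mu> :: 'q mat measure)" by (rule prob_spaceI)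
qed (simp add: wishart_def haar_eq)

end

section \<open>Laplace transforms determine weak convergence\<close>

lemma Basis_mat: "b \<in> (Basis :: 'q::finite mat set) \<Longrightarrow> \<exists>i j k. b = mat_unit (i, j, k)"
  unfolding Basis_vec_def mat_unit_def by auto

lemma inner_mat_unit_right: "x \<bullet> mat_unit (i, j, k) = x$i$j$k"
  by (simp add: mat_unit_def inner_axis)

context wishart_setting
begin

text \<open>Finite combinations of Laplace kernels. Products stay inside because parameters add and
  the cone is closed under addition, so this is an algebra containing the constants.\<close>

inductive expcomb :: "('q mat \<Rightarrow> real) \<Rightarrow> bool" where
  exp: "a \<in> PiQ d \<Longrightarrow> expcomb (\<lambda>r. c * exp (- (a \<bullet> mmul r r)))"
| add: "expcomb f \<Longrightarrow> expcomb g \<Longrightarrow> expcomb (\<lambda>r. f r + g r)"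

lemma expcomb_const: "expcomb (\<lambda>r. c)"
  using expcomb.exp[of 0 c] by simp

lemma expcomb_sum: "finite A \<Longrightarrow> (\<And>i. i \<in> A \<Longrightarrow> expcomb (f i)) \<Longrightarrow> expcomb (\<lambda>r. \<Sum>i\<in>A. f i r)"
  by (induction A rule: finite_induct) (auto intro: expcomb_const expcomb.add)

lemma expcomb_mult_exp: "expcomb g \<Longrightarrow> a \<in> PiQ d \<Longrightarrow> expcomb (\<lambda>r. c * exp (- (a \<bullet> mmul r r)) * g r)"
proof (induction rule: expcomb.induct)
  case (exp a' c')
  have "(\<lambda>r. c * exp (- (a \<bullet> mmul r r)) * (c' * exp (- (a' \<bullet> mmul r r)))) = (\<lambda>r. (c * c') * exp (- ((a + a') \<bullet> mmul r r)))"
    by (rule ext) (simp add: inner_simps exp_diff exp_minus field_simps)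
  then show ?case using exp by (simp only:) (intro expcomb.exp PiQ_simps)
next
  case (add f g)
  show ?case unfolding distrib_left by (rule expcomb.add[OF add.IH(1)[OF add.prems] add.IH(2)[OF add.prems]])
qed

lemma expcomb_mult: "expcomb f \<Longrightarrow> expcomb g \<Longrightarrow> expcomb (\<lambda>r. f r * g r)"
proof (induction rule: expcomb.induct)
  case (exp a c)
  then show ?case by (intro expcomb_mult_exp)
next
  case (add f1 f2)
  show ?case unfolding distrib_right by (rule expcomb.add[OF add.IH(1)[OF add.prems] add.IH(2)[OF add.prems]])
qed

lemma exp_integrable:
  assumes "law_on M" "a \<in> PiQ d" shows "integrable M (\<lambda>r. exp (- (a \<bullet> mmul r r)))"
proof -
  interpret prob_space M using assms by (intro law_onD)
  have "(\<lambda>r::'q mat. exp (- (a \<bullet> mmul r r))) \<in> borel_measurable (PiS d)"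
    by (intro measurable_PiS borel_measurable_continuous_onI continuous_intros)
  moreover have "exp (- (a \<bullet> mmul r r)) \<le> 1" if "r \<in> PiQ d" for r
    using inner_PiQ_nonneg[of a "mmul r r"] PiQ_square[of r] assms that by simp
  ultimately show ?thesis using assms
    by (intro integrable_const_bound[where B = 1]) (auto simp: law_onD intro!: AE_I2 measurable_law)
qed

lemma expcomb_integrable: "expcomb f \<Longrightarrow> law_on M \<Longrightarrow> integrable M f"
  by (induction rule: expcomb.induct) (auto simp: exp_integrable)

lemma expcomb_tendsto:
  assumes P: "\<And>n. law_on (P n)" and Q: "law_on Q"
    and lim: "\<And>a. a \<in> PiQ d \<Longrightarrow> (\<lambda>n. \<integral>r. exp (- (a \<bullet> mmul r r)) \<partial>P n) \<longlonglongrightarrow> (\<integral>r. exp (- (a \<bullet> mmul r r)) \<partial>Q)"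
  shows "expcomb f \<Longrightarrow> (\<lambda>n. \<integral>r. f r \<partial>P n) \<longlonglongrightarrow> (\<integral>r. f r \<partial>Q)"
proof (induction rule: expcomb.induct)
  case (exp a c)
  then show ?case using tendsto_mult[OF tendsto_const lim[of a], of c] by simp
next
  case (add f g)
  then show ?case using tendsto_add[OF add.IH] P Q by (simp add: expcomb_integrable)
qed

text \<open>A parameter in the cone for each basis matrix b: the Hermitian part of b has norm at
  most 1, so adding the identity makes it semidefinite. Basis directions outside the field are
  replaced by 0; Hermitian matrices over the field have coordinate 0 there.\<close>

definition "embA b = (1 / 2) *\<^sub>R ((if In_M d b then b else 0) + madj (if In_M d b then b else 0)) + (mid :: 'q mat)"

lemma embA_PiQ: assumes "b \<in> Basis" shows "embA b \<in> PiQ d"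
  unfolding PiQ_iff
proof safe
  define b' where "b' = (if In_M d b then b else 0)"
  have b': "In_M d b'" "norm b' \<le> 1" using assms by (auto simp: b'_def)
  define h where "h = (1 / 2) *\<^sub>R (b' + madj b')"
  have h: "h \<in> Herm d" unfolding Herm_def using b' by (simp add: h_def add.commute)
  have e: "embA b = h + mid" by (simp add: embA_def h_def b'_def)
  show "embA b \<in> Herm d" unfolding e using h by simp
  have "norm h \<le> 1"
  proof -
    have "norm h \<le> 1 / 2 * (norm b' + norm (madj b'))" 
      using norm_triangle_ineq[of b' "madj b'"] unfolding h_def by simp
    then show ?thesis using b' by simp
  qed
  fix m :: "'q mat"
  have "\<bar>m \<bullet> mmul h m\<bar> \<le> norm m * norm (mmul h m)" by (rule Cauchy_Schwarz_ineq2)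
  also have "\<dots> \<le> norm m * (norm h * norm m)" by (intro mult_left_mono norm_mmul) simp
  also have "\<dots> \<le> norm m * (1 * norm m)" using \<open>norm h \<le> 1\<close> by (intro mult_left_mono mult_right_mono) auto
  also have "\<dots> = m \<bullet> m" by (simp add: norm_eq_sqrt_inner)
  finally show "0 \<le> m \<bullet> mmul (embA b) m" unfolding e by (simp add: inner_simps)
qed

lemma embA_inner:
  assumes "b \<in> Basis" "y \<in> Herm d" shows "embA b \<bullet> y = b \<bullet> y + retr y"
proof -
  have "(if In_M d b then b else 0) \<bullet> y = b \<bullet> y"
  proof (cases "In_M d b")
    case False
    obtain i j k where b: "b = mat_unit (i, j, k)" using Basis_mat[OF assms(1)] by blast
    have "k \<notin> comps d" using False by (auto simp: b In_M_def mat_unit_nth split: if_splits)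
    then have "y$i$j$k = 0" using Herm_D(1)[OF assms(2)] by (simp add: In_M_def)
    then show ?thesis using False inner_mat_unit_right[of y i j k] by (simp add: b inner_commute)
  qed simp
  moreover have "madj x \<bullet> y = x \<bullet> y" for x using assms(2) by (simp add: inner_madj_left)
  ultimately show ?thesis by (simp add: embA_def inner_simps retr_eq_inner)
qed

text \<open>Every coordinate of y equals - tr y. Pairing with the identity, whose coordinates are
  nonnegative, gives tr y = - c tr y with c \<ge> 0, so the trace and then all coordinates
  vanish.\<close>

lemma embA_separates:
  assumes y: "y \<in> Herm d" and eq: "\<And>b. b \<in> Basis \<Longrightarrow> embA b \<bullet> y = 0" shows "y = 0"
proof -
  have by': "b \<bullet> y = - retr y" if "b \<in> Basis" for b using eq[OF that] embA_inner[OF that y] by simp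
  have "retr y = (\<Sum>b\<in>Basis. ((mid :: 'q mat) \<bullet> b) * (y \<bullet> b))" unfolding retr_eq_inner by (rule euclidean_inner)
  also have "\<dots> = (\<Sum>b\<in>Basis. ((mid :: 'q mat) \<bullet> b) * (- retr y))" by (intro sum.cong refl) (simp add: by' inner_commute[of y])
  also have "\<dots> = (\<Sum>b\<in>Basis. (mid :: 'q mat) \<bullet> b) * (- retr y)" by (rule sum_distrib_right[symmetric])
  finally have "retr y * (1 + (\<Sum>b\<in>Basis. (mid :: 'q mat) \<bullet> b)) = 0" by (simp add: algebra_simps)
  moreover have "0 \<le> (\<Sum>b\<in>Basis. (mid :: 'q mat) \<bullet> b)"
  proof (rule sum_nonneg)
    fix b :: "'q mat" assume "b \<in> Basis"
    then obtain i j k where b: "b = mat_unit (i, j, k)" using Basis_mat by blast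
    have "mid \<bullet> b = (mid :: 'q mat)$i$j$k" by (simp add: b inner_mat_unit_right)
    then show "0 \<le> (mid :: 'q mat) \<bullet> b" by (simp add: mid_nth)
  qed
  then have "1 + (\<Sum>b\<in>Basis. (mid :: 'q mat) \<bullet> b) \<noteq> 0" by linarith
  ultimately have ry: "retr y = 0" unfolding mult_eq_0_iff by blast
  have "y \<bullet> b = 0" if "b \<in> Basis" for b
    using by'[OF that] unfolding ry inner_commute[of b y] minus_zero .
  then show ?thesis using euclidean_all_zero_iff[of y] by blast
qed

text \<open>Embeds the cone into the unit cube with Laplace kernels as coordinates; polynomials in
  these coordinates are again combinations of Laplace kernels.\<close>

definition emb :: "'q mat \<Rightarrow> 'q mat" where
  "emb r = (\<Sum>b\<in>Basis. exp (- (embA b \<bullet> mmul r r)) *\<^sub>R b)"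

lemma emb_inner: "b \<in> Basis \<Longrightarrow> emb r \<bullet> b = exp (- (embA b \<bullet> mmul r r))"
  unfolding emb_def by simp

lemma emb_inj: "inj_on emb (PiQ d)"
proof (rule inj_onI)
  fix r s :: "'q mat" assume rs: "r \<in> PiQ d" "s \<in> PiQ d" and eq: "emb r = emb s"
  have "embA b \<bullet> (mmul r r - mmul s s) = 0" if "b \<in> Basis" for b
    using arg_cong[OF eq, of "\<lambda>x. x \<bullet> b"] emb_inner[OF that] by (simp add: inner_simps)
  moreover have "mmul r r - mmul s s \<in> Herm d" using rs by (intro Herm_simps(6) PiQ_Herm PiQ_square)
  ultimately have "mmul r r - mmul s s = 0" using embA_separates by blast
  then show "r = s" using PiQ_sqrt_unique[OF rs] by simp
qed

lemma emb_cont: "continuous_on A emb"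
  unfolding emb_def[abs_def] by (intro continuous_intros)

lemma emb_cube: "r \<in> PiQ d \<Longrightarrow> emb r \<in> cbox 0 One"
proof -
  assume r: "r \<in> PiQ d"
  have "0 \<le> embA b \<bullet> mmul r r" if "b \<in> Basis" for b
    using embA_PiQ[OF that] r by (intro inner_PiQ_nonneg PiQ_square) auto
  then show ?thesis by (simp add: mem_box emb_inner)
qed

lemma expcomb_poly: "real_polynomial_function g \<Longrightarrow> expcomb (\<lambda>r. g (emb r))"
proof (induction rule: real_polynomial_function.induct)
  case (linear f)
  then have l: "linear f" by (rule bounded_linear.linear)
  have "f (emb r) = (\<Sum>b\<in>Basis. f b * exp (- (embA b \<bullet> mmul r r)))" for r
    by (simp add: emb_def linear_sum[OF l] linear_cmul[OF l] mult.commute)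
  then show ?case using embA_PiQ by (simp only:) (intro expcomb_sum expcomb.exp finite_Basis)
next
  case (const c)
  show ?case by (rule expcomb_const)
qed (auto intro: expcomb.add expcomb_mult)

text \<open>The cone is not compact and f need not vanish at infinity, so f is matched on a large
  ball D only: it is carried to the compact image of D, extended to the whole space with the same
  bound, and approximated by a polynomial on the cube. Outside D the error, up to 2 K, is charged to
  the escaping mass.\<close>

lemma weak_conv_of_laplace:
  fixes P :: "nat \<Rightarrow> 'q mat measure"
  assumes P: "\<And>n. law_on (P n)" and Q: "law_on Q"
    and lim: "\<And>a. a \<in> PiQ d \<Longrightarrow> (\<lambda>n. \<integral>r. exp (- (a \<bullet> mmul r r)) \<partial>P n) \<longlonglongrightarrow> (\<integral>r. exp (- (a \<bullet> mmul r r)) \<partial>Q)"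
    and tight: "\<And>n. n \<ge> 1 \<Longrightarrow> (\<integral>\<^sup>+r. ennreal ((norm r)\<^sup>2) \<partial>P n) \<le> ennreal B"
  shows "weak_conv_Pi d P Q"
  unfolding weak_conv_Pi_def
proof (intro allI impI, elim conjE)
  fix f :: "'q mat \<Rightarrow> real"
  assume fc: "continuous_on (PiQ d) f" and fb: "bounded (f ` PiQ d)"
  obtain K where K: "K > 0" "\<And>r. r \<in> PiQ d \<Longrightarrow> \<bar>f r\<bar> \<le> K" using fb unfolding bounded_pos by auto
  have fm: "f \<in> borel_measurable (PiS d)" unfolding PiS_def by (rule borel_measurable_continuous_on_restrict[OF fc])
  \<comment> \<open>\<open>t R\<close> is 1 outside the ball of radius R and at most |r|^2 / R^2
    everywhere, so the second moments control its integral under \<open>P n\<close>; under Q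
    dominated convergence does.\<close>
  define t where "t R r = min 1 ((norm r)\<^sup>2 / R\<^sup>2)" for R and r :: "'q mat"
  have t01: "0 \<le> t R r" "t R r \<le> 1" for R r by (auto simp: t_def)
  have tm: "t R \<in> borel_measurable (PiS d)" for R unfolding t_def by (rule measurable_PiS) measurable
  have bnd: "integrable M g" if "law_on M" "g \<in> borel_measurable (PiS d)" "\<And>r. r \<in> PiQ d \<Longrightarrow> \<bar>g r\<bar> \<le> c" for M c and g :: "'q mat \<Rightarrow> real"
  proof -
    interpret prob_space M using that by (intro law_onD)
    show ?thesis using that by (intro integrable_const_bound[where B = c]) (auto simp: law_onD intro!: AE_I2 measurable_law)
  qed
  have tQ: "(\<lambda>m. \<integral>r. t (real m) r \<partial>Q) \<longlonglongrightarrow> 0"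
  proof -
    interpret prob_space Q using Q by (rule law_onD)
    have "(\<lambda>m. \<integral>r. t (real m) r \<partial>Q) \<longlonglongrightarrow> (\<integral>r. 0 \<partial>Q)"
    proof (rule integral_dominated_convergence[where w = "\<lambda>_. 1"])
      show "AE r in Q. (\<lambda>m. t (real m) r) \<longlonglongrightarrow> 0"
      proof (rule AE_I2)
        fix r :: "'q mat"
        have "(\<lambda>m. (norm r)\<^sup>2 * (1 / real m)\<^sup>2) \<longlonglongrightarrow> (norm r)\<^sup>2 * 0\<^sup>2" by (intro tendsto_intros lim_1_over_n)
        then have "(\<lambda>m. min 1 ((norm r)\<^sup>2 / (real m)\<^sup>2)) \<longlonglongrightarrow> min 1 0"
          by (intro tendsto_intros) (simp add: power_divide)
        then show "(\<lambda>m. t (real m) r) \<longlonglongrightarrow> 0" by (simp add: t_def)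
      qed
    qed (use t01 in \<open>auto intro!: measurable_law[OF Q] tm\<close>)
    then show ?thesis by simp
  qed
  have tP: "(\<integral>r. t R r \<partial>P n) \<le> max B 0 / R\<^sup>2" if "n \<ge> 1" "R > 0" for n R
  proof -
    have "integrable (P n) (t R)" 
    proof (rule bnd[OF P tm])
      show "\<bar>t R r\<bar> \<le> 1" for r using t01[of R r] by simp
    qed
    then have "ennreal (\<integral>r. t R r \<partial>P n) = (\<integral>\<^sup>+r. ennreal (t R r) \<partial>P n)"
      using t01 by (subst nn_integral_eq_integral) auto
    also have "\<dots> \<le> (\<integral>\<^sup>+r. ennreal (1 / R\<^sup>2) * ennreal ((norm r)\<^sup>2) \<partial>P n)"
      using that by (intro nn_integral_mono) (auto simp: ennreal_mult'[symmetric] t_def)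
    also have "\<dots> = ennreal (1 / R\<^sup>2) * (\<integral>\<^sup>+r. ennreal ((norm r)\<^sup>2) \<partial>P n)"
      by (rule nn_integral_cmult) (rule measurable_law[OF P norm_sq_measurable])
    also have "\<dots> \<le> ennreal (1 / R\<^sup>2) * ennreal B" using tight[OF that(1)] by (intro mult_left_mono) auto
    also have "\<dots> \<le> ennreal (max B 0 / R\<^sup>2)"
      using that by (cases "B \<ge> 0") (auto simp: ennreal_mult'[symmetric] ennreal_neg max_def)
    finally show ?thesis by (subst (asm) ennreal_le_iff) auto
  qed
  show "(\<lambda>n. \<integral>r. f r \<partial>P n) \<longlonglongrightarrow> (\<integral>r. f r \<partial>Q)"
  proof (rule LIMSEQ_I)
    fix e :: real assume e: "e > 0"
    \<comment> \<open>Five shares of e: escaping mass and polynomial error, each for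
      \<open>P n\<close> and for Q, and the convergence of the polynomial integrals.\<close>
    define h where "h = e / (5 * (2 * K + 1))"
    have h: "h > 0" using e K by (simp add: h_def)
    have hK: "2 * K * h \<le> e / 5" using e K unfolding h_def by (simp add: field_simps)
    have "(\<lambda>m. max B 0 / (real m)\<^sup>2) \<longlonglongrightarrow> 0"
    proof -
      have "(\<lambda>m. max B 0 * (1 / real m)\<^sup>2) \<longlonglongrightarrow> max B 0 * 0\<^sup>2" by (intro tendsto_intros lim_1_over_n)
      then show ?thesis by (simp add: power_divide)
    qed
    then have "eventually (\<lambda>m. max B 0 / (real m)\<^sup>2 < h) sequentially" using h by (rule order_tendstoD)
    moreover have "eventually (\<lambda>m. (\<integral>r. t (real m) r \<partial>Q) < h) sequentially" using tQ h by (rule order_tendstoD)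
    moreover have "eventually (\<lambda>m::nat. m > 0) sequentially" by (rule eventually_gt_at_top)
    ultimately have "eventually (\<lambda>m. max B 0 / (real m)\<^sup>2 < h \<and> (\<integral>r. t (real m) r \<partial>Q) < h \<and> m > 0) sequentially"
      by eventually_elim simp
    then obtain m :: nat where m: "max B 0 / (real m)\<^sup>2 < h" "(\<integral>r. t (real m) r \<partial>Q) < h" "m > 0"
      using eventually_happens' sequentially_bot by blast
    let ?R = "real m"
    define D where "D = PiQ d \<inter> cball (0::'q mat) ?R"
    have D: "compact D" unfolding D_def by (intro closed_Int_compact closed_PiQ) simp
    have injD: "inj_on emb D" using emb_inj by (rule inj_on_subset) (auto simp: D_def)
    define inv where "inv = the_inv_into D emb"
    have inv: "inv (emb r) = r" if "r \<in> D" for r unfolding inv_def using injD that by (rule the_inv_into_f_f)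
    have ci: "continuous_on (emb ` D) inv" by (rule continuous_on_inv[OF emb_cont D]) (simp add: inv)
    have invD: "inv ` (emb ` D) \<subseteq> PiQ d" using inv by (auto simp: D_def)
    have cg: "continuous_on (emb ` D) (\<lambda>x. f (inv x))"
      using continuous_on_compose2[OF fc ci invD] .
    have cl: "closedin (top_of_set UNIV) (emb ` D)"
      using compact_continuous_image[OF emb_cont D] by (simp add: compact_imp_closed)
    have fK: "norm (f (inv x)) \<le> K" if "x \<in> emb ` D" for x using K(2)[of "inv x"] invD that by auto
    have "\<exists>G. continuous_on UNIV G \<and> (\<forall>x\<in>emb ` D. G x = f (inv x)) \<and> (\<forall>x. norm (G x) \<le> K)"
      by (rule Tietze[OF cg cl order.strict_implies_order[OF K(1)] fK]) blast+
    then obtain G where G: "continuous_on UNIV G" "\<And>x. x \<in> emb ` D \<Longrightarrow> G x = f (inv x)" "\<And>x. norm (G x) \<le> K"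
      by blast
    have e5: "0 < e / 5" using e by simp
    obtain p where p: "real_polynomial_function p" "\<And>x. x \<in> cbox 0 (One :: 'q mat) \<Longrightarrow> \<bar>G x - p x\<bar> < e / 5"
      using Stone_Weierstrass_real_polynomial_function[OF compact_cbox continuous_on_subset[OF G(1) subset_UNIV] e5] by blast
    have ptw: "\<bar>f r - p (emb r)\<bar> \<le> 2 * K * t ?R r + e / 5" if r: "r \<in> PiQ d" for r
    proof -
      have 1: "\<bar>G (emb r) - p (emb r)\<bar> \<le> e / 5" using p(2)[OF emb_cube[OF r]] by simp
      have "\<bar>f r - G (emb r)\<bar> \<le> 2 * K * t ?R r"
      proof (cases "norm r \<le> ?R")
        case True
        then have "r \<in> D" using r by (simp add: D_def)
        then have "f r = G (emb r)" using G(2)[of "emb r"] inv by simp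
        then show ?thesis using K t01 by simp
      next
        case False
        then have "?R\<^sup>2 \<le> (norm r)\<^sup>2" by (intro power_mono) auto
        then have "t ?R r = 1" using m(3) by (simp add: t_def)
        moreover have "\<bar>f r\<bar> \<le> K" "\<bar>G (emb r)\<bar> \<le> K" using K(2)[OF r] G(3)[of "emb r"] by auto
        ultimately show ?thesis by simp
      qed
      then show ?thesis using 1 by linarith
    qed
    have ec: "expcomb (\<lambda>r. p (emb r))" by (rule expcomb_poly[OF p(1)])
    have est: "\<bar>(\<integral>r. f r \<partial>M) - (\<integral>r. p (emb r) \<partial>M)\<bar> \<le> 2 * K * (\<integral>r. t ?R r \<partial>M) + e / 5" if M: "law_on M" for M
    proof -
      interpret prob_space M using M by (rule law_onD)
      have fi: "integrable M f" using bnd[OF M fm K(2)] .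
      have ti: "integrable M (t ?R)" 
      proof (rule bnd[OF M tm])
        show "\<bar>t ?R r\<bar> \<le> 1" for r using t01[of ?R r] by simp
      qed
      have pi: "integrable M (\<lambda>r. p (emb r))" using expcomb_integrable[OF ec M] .
      have "\<bar>(\<integral>r. f r \<partial>M) - (\<integral>r. p (emb r) \<partial>M)\<bar> = \<bar>\<integral>r. f r - p (emb r) \<partial>M\<bar>" using fi pi by simp
      also have "\<dots> \<le> (\<integral>r. \<bar>f r - p (emb r)\<bar> \<partial>M)" by (rule integral_abs_bound)
      also have "\<dots> \<le> (\<integral>r. 2 * K * t ?R r + e / 5 \<partial>M)"
        using fi pi ti ptw law_onD(3)[OF M] by (intro integral_mono) auto
      also have "\<dots> = 2 * K * (\<integral>r. t ?R r \<partial>M) + e / 5" using ti prob_space by simp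
      finally show ?thesis .
    qed
    have "(\<lambda>n. \<integral>r. p (emb r) \<partial>P n) \<longlonglongrightarrow> (\<integral>r. p (emb r) \<partial>Q)"
      by (rule expcomb_tendsto[OF P Q lim ec])
    from LIMSEQ_D[OF this e5] obtain N
      where N: "\<And>n. n \<ge> N \<Longrightarrow> \<bar>(\<integral>r. p (emb r) \<partial>P n) - (\<integral>r. p (emb r) \<partial>Q)\<bar> < e / 5"
      unfolding real_norm_def by blast
    have "norm ((\<integral>r. f r \<partial>P n) - (\<integral>r. f r \<partial>Q)) < e" if n: "n \<ge> max N 1" for n
    proof -
      have "2 * K * (\<integral>r. t ?R r \<partial>P n) \<le> 2 * K * h"
        using tP[of n ?R] n m K by (intro mult_left_mono) auto
      then have 1: "\<bar>(\<integral>r. f r \<partial>P n) - (\<integral>r. p (emb r) \<partial>P n)\<bar> \<le> e / 5 + e / 5" using est[OF P, of n] hK by linarith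
      have "2 * K * (\<integral>r. t ?R r \<partial>Q) \<le> 2 * K * h" using m K by (intro mult_left_mono) auto
      then have 2: "\<bar>(\<integral>r. f r \<partial>Q) - (\<integral>r. p (emb r) \<partial>Q)\<bar> \<le> e / 5 + e / 5" using est[OF Q] hK by linarith
      have "N \<le> n" using n by simp
      then show ?thesis using 1 2 N[of n] unfolding real_norm_def by linarith
    qed
    then show "\<exists>no. \<forall>n\<ge>no. norm ((\<integral>r. f r \<partial>P n) - (\<integral>r. f r \<partial>Q)) < e" by blast
  qed
qed

end

section \<open>The Laplace transform of the limit law\<close>

context field_dim
begin

lemma Delta_one_plus_spectral:
  assumes w: "unitary d (w::'q::finite mat)" and l: "\<And>i. 0 \<le> l i"
  shows "Delta d (mid + 2 *\<^sub>R mmul w (mmul (rdiag l) (madj w))) = (\<Prod>i\<in>UNIV. 1 + 2 * l i)"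
proof -
  have "mid + 2 *\<^sub>R mmul w (mmul (rdiag l) (madj w)) = mmul w (mmul (rdiag (\<lambda>i. 1 + 2 * l i)) (madj w))"
    using unitary_right[OF w] by (simp add: rdiag_linear rdiag_one)
  then show ?thesis using Delta_spectral[OF w, of "\<lambda>i. 1 + 2 * l i"] l by (simp add: add_nonneg_nonneg)
qed

text \<open>For invertible G = s a the two matrices are similar, X G = G Z. The general case follows
  by adding e I to a and to s and letting e tend to 0 in the determinant of \<open>lmat\<close>,
  which is continuous everywhere.\<close>

lemma Delta_one_plus_commute:
  fixes a s :: "'q::finite mat"
  assumes a: "a \<in> PiQ d" and s: "s \<in> PiQ d"
  shows "Delta d (mid + 2 *\<^sub>R mmul s (mmul (mmul a a) s)) = Delta d (mid + 2 *\<^sub>R mmul a (mmul (mmul s s) a))"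
proof -
  define A S where "A e = a + e *\<^sub>R mid" and "S e = s + e *\<^sub>R mid" for e :: real
  define X Z where "X e = mid + 2 *\<^sub>R mmul (S e) (mmul (mmul (A e) (A e)) (S e))"
    and "Z e = mid + 2 *\<^sub>R mmul (A e) (mmul (mmul (S e) (S e)) (A e))" for e
  have nz: "det (lmat (x + e *\<^sub>R mid)) \<noteq> 0" if x: "x \<in> PiQ d" and e: "0 < e" for x :: "'q mat" and e
  proof -
    have "rdiag (\<lambda>_. e) = e *\<^sub>R (mid :: 'q mat)" using rdiag_linear(2)[of e "\<lambda>_. 1"] by (simp add: rdiag_one)
    then have "e *\<^sub>R (mid :: 'q mat) \<in> OmegaQ d" using rdiag_OmegaQ[of "\<lambda>_::'q. e"] e by simp
    then have "x + e *\<^sub>R mid \<in> OmegaQ d" unfolding add.commute[of x] by (rule OmegaQ_add[OF _ x])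
    then have "x + e *\<^sub>R mid \<in> PiQ d" "0 < Delta d (x + e *\<^sub>R mid)" unfolding OmegaQ_iff_Delta by blast+
    then show ?thesis using Delta_pow4[of "x + e *\<^sub>R mid"] by (metis less_irrefl zero_less_power)
  qed
  have eq: "det (lmat (X e)) - det (lmat (Z e)) = 0" if "e \<in> {0<..}" for e
  proof -
    define G where "G = mmul (S e) (A e)"
    have "mmul (X e) G = mmul G (Z e)" by (simp add: X_def Z_def G_def mmul_assoc)
    then have "det (lmat (X e)) * det (lmat G) = det (lmat G) * det (lmat (Z e))"
      by (simp only: det_lmat_mmul[symmetric])
    moreover have "det (lmat G) \<noteq> 0"
      using nz[OF a, of e] nz[OF s, of e] that
      unfolding G_def det_lmat_mmul by (simp add: A_def S_def)
    ultimately show ?thesis by simp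
  qed
  have "continuous_on (closure {0<..}) (\<lambda>e. det (lmat (X e)) - det (lmat (Z e)))"
    unfolding X_def Z_def A_def S_def
    by (intro continuous_on_diff continuous_on_compose2[OF continuous_on_det_lmat[of UNIV]] continuous_intros) auto
  from continuous_constant_on_closure[OF this eq, of 0] have "det (lmat (X 0)) = det (lmat (Z 0))" by simp
  then have d: "det (lmat (mid + 2 *\<^sub>R mmul s (mmul (mmul a a) s))) = det (lmat (mid + 2 *\<^sub>R mmul a (mmul (mmul s s) a)))"
    by (simp add: X_def Z_def A_def S_def)
  have P: "mid + 2 *\<^sub>R mmul x (mmul (mmul y y) x) \<in> PiQ d" if "x \<in> PiQ d" "y \<in> PiQ d" for x y :: "'q mat"
    using PiQ_conj[OF _ PiQ_square[of y], of x] that by simp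
  show ?thesis
    by (rule Delta_eqI[OF P[OF s a] Delta_nonneg[OF P[OF a s]]]) (simp only: Delta_pow4[OF P[OF a s]] d)
qed

lemma psqrt_square: "x \<in> PiQ d \<Longrightarrow> mmul (psqrt x) (psqrt x) = x" for x :: "'q::finite mat"
  by (simp add: psqrt_def)

end

context wishart_setting
begin

lemma conj_psqrt_measurable: "(\<lambda>r. psqrt (mmul s (mmul (mmul r r) s))) \<in> measurable (PiS d) (PiS d)" for s :: "'q mat"
  by (rule measurable_compose[OF _ psqrt_measurable])
    (intro measurable_PiS borel_measurable_continuous_onI continuous_intros)

lemma conj_square_PiQ: "s \<in> PiQ d \<Longrightarrow> r \<in> PiQ d \<Longrightarrow> mmul s (mmul (mmul r r) s) \<in> PiQ d" for s r :: "'q mat"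
  using PiQ_conj[OF _ PiQ_square[of r], of s] by simp

lemma wishart_sq_eq:
  assumes "s2 \<in> PiQ d"
  shows "wishart_sq d \<mu> s2 = distr (wishart d \<mu>) (PiS d) (\<lambda>r. psqrt (mmul (msqrt d s2) (mmul (mmul r r) (msqrt d (s2 :: 'q mat)))))"
  unfolding wishart_sq_def Tmeas_def
proof (rule distr_cong)
  fix r :: "'q mat" assume "r \<in> space (wishart d \<mu>)"
  then have r: "r \<in> PiQ d" using law_onD(3)[OF law_on_wishart] by simp
  have s: "msqrt d s2 \<in> PiQ d" using assms by simp
  show "Tmap d (msqrt d s2) r = psqrt (mmul (msqrt d s2) (mmul (mmul r r) (msqrt d s2)))"
    unfolding Tmap_def psqrt_def using conj_square_PiQ[OF s r] s by simp
qed simp_all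

lemma law_on_wishart_sq: "s2 \<in> PiQ d \<Longrightarrow> law_on (wishart_sq d \<mu> (s2 :: 'q mat))"
  using law_onD(1)[OF law_on_wishart] unfolding law_on_def
  by (auto simp: wishart_sq_eq intro!: prob_space.prob_space_distr measurable_law[OF law_on_wishart] conj_psqrt_measurable)

text \<open>Conjugation of r^2 by s moves to the parameter, which becomes s a s; the transform of
  the standard law is then evaluated at its eigenvalues.\<close>

lemma wishart_sq_laplace:
  fixes a s2 :: "'q mat"
  assumes a: "a \<in> PiQ d" and s2: "s2 \<in> PiQ d"
  defines "s \<equiv> msqrt d s2"
  shows "(\<integral>r. exp (- (a \<bullet> mmul r r)) \<partial>wishart_sq d \<mu> s2) = Delta d (mid + 2 *\<^sub>R mmul s (mmul a s)) powr (- \<mu>)"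
proof -
  have s: "s \<in> PiQ d" unfolding s_def using s2 by simp
  have b: "mmul s (mmul a s) \<in> PiQ d" using PiQ_conj[OF _ a, of s] s by simp
  then obtain w l where w: "unitary d w" "\<And>i. 0 \<le> l i" "mmul s (mmul a s) = mmul w (mmul (rdiag l) (madj w))"
    using spectral_psd by blast
  have em: "(\<lambda>r. exp (- (c \<bullet> mmul r r))) \<in> borel_measurable (PiS d)" for c :: "'q mat"
    by (intro measurable_PiS borel_measurable_continuous_onI continuous_intros)
  have "(\<integral>r. exp (- (a \<bullet> mmul r r)) \<partial>wishart_sq d \<mu> s2) =
    (\<integral>r. exp (- (a \<bullet> mmul (psqrt (mmul s (mmul (mmul r r) s))) (psqrt (mmul s (mmul (mmul r r) s))))) \<partial>wishart d \<mu>)"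
    unfolding wishart_sq_eq[OF s2] s_def
    by (rule integral_distr[OF measurable_law[OF law_on_wishart conj_psqrt_measurable] em])
  also have "\<dots> = (\<integral>r. exp (- (mmul s (mmul a s) \<bullet> mmul r r)) \<partial>wishart d \<mu>)"
  proof (rule Bochner_Integration.integral_cong[OF refl])
    fix r :: "'q mat" assume "r \<in> space (wishart d \<mu>)"
    then have r: "r \<in> PiQ d" using law_onD(3)[OF law_on_wishart] by simp
    have "a \<bullet> mmul s (mmul (mmul r r) s) = mmul s (mmul a s) \<bullet> mmul r r"
    proof -
      have ms: "madj s = s" using s by simp
      have "mmul s (mmul a s) \<bullet> mmul r r = mmul a s \<bullet> mmul s (mmul r r)" by (simp add: inner_mmul_left ms)
      also have "\<dots> = a \<bullet> mmul (mmul s (mmul r r)) s" by (simp add: inner_mmul_right ms)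
      finally show ?thesis by (simp add: mmul_assoc)
    qed
    then show "exp (- (a \<bullet> mmul (psqrt (mmul s (mmul (mmul r r) s))) (psqrt (mmul s (mmul (mmul r r) s))))) =
      exp (- (mmul s (mmul a s) \<bullet> mmul r r))"
      unfolding psqrt_square[OF conj_square_PiQ[OF s r]] by simp
  qed
  also have "\<dots> = enn2real (\<integral>\<^sup>+r. ennreal (exp (- (mmul s (mmul a s) \<bullet> mmul r r))) \<partial>wishart d \<mu>)"
    by (rule integral_eq_nn_integral) (auto intro: measurable_law[OF law_on_wishart em])
  also have "\<dots> = (\<Prod>i\<in>UNIV. 1 + 2 * l i) powr (- \<mu>)"
    unfolding wishart_laplace[OF w] by simp
  also have "(\<Prod>i\<in>UNIV. 1 + 2 * l i) = Delta d (mid + 2 *\<^sub>R mmul s (mmul a s))"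
    unfolding w(3) by (rule Delta_one_plus_spectral[OF w(1,2), symmetric])
  finally show ?thesis .
qed

end

context clt_setting
begin

lemma laplace_convergence:
  assumes a: "a \<in> PiQ d"
  shows "(\<lambda>n. \<integral>r. exp (- (a \<bullet> mmul r r)) \<partial>convpow d \<mu> (nuc (1 / sqrt (real n))) n)
    \<longlonglongrightarrow> (\<integral>r. exp (- (a \<bullet> mmul r r)) \<partial>wishart_sq d \<mu> ((1 / (2 * \<mu>)) *\<^sub>R Y))"
proof -
  define s2 where "s2 = (1 / (2 * \<mu>)) *\<^sub>R Y"
  have s2: "s2 \<in> PiQ d" unfolding s2_def using Y_PiQ mu_pos by simp
  define \<alpha> where "\<alpha> = msqrt d a"
  have al: "\<alpha> \<in> PiQ d" "mmul \<alpha> \<alpha> = a" "madj \<alpha> = \<alpha>" "In_M d \<alpha>" using a by (simp_all add: \<alpha>_def)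
  have "mmul \<alpha> (mmul s2 \<alpha>) \<in> PiQ d" using PiQ_conj[OF al(4) s2] unfolding al(3) .
  then obtain u l where u: "unitary d u" "\<And>i. 0 \<le> l i" "mmul \<alpha> (mmul s2 \<alpha>) = mmul u (mmul (rdiag l) (madj u))"
    using spectral_psd by blast
  \<comment> \<open>This k satisfies \<open>mmul (madj k) k = a\<close> and carries s2 to the
    diagonal matrix of the l i.\<close>
  define k where "k = mmul (madj u) \<alpha>"
  have kk: "mmul (madj k) k = a"
    unfolding k_def using unitary_cancel u(1) by (simp add: al mmul_assoc unitary_right mmul_assoc[of u "madj u", symmetric])
  have Y2: "Y = (2 * \<mu>) *\<^sub>R s2" using mu_pos by (simp add: s2_def)
  have ks: "mmul k (mmul s2 (madj k)) = rdiag l"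
  proof -
    have "mmul k (mmul s2 (madj k)) = mmul (madj u) (mmul (mmul \<alpha> (mmul s2 \<alpha>)) u)"
      by (simp add: k_def al mmul_assoc)
    also have "\<dots> = mmul (mmul (madj u) u) (mmul (rdiag l) (mmul (madj u) u))" unfolding u(3) by (simp only: mmul_assoc)
    finally show ?thesis using unitary_left[OF u(1)] by simp
  qed
  interpret laplace_setting d \<mu> ty \<nu> k l
  proof
    show "In_M d k" unfolding k_def using al(4) u(1) by simp
    show "mmul k (mmul Y (madj k)) = (2 * \<mu>) *\<^sub>R rdiag l" by (simp add: Y2 ks)
  qed (rule u(2))
  have "exp (\<Sum>i\<in>UNIV. - \<mu> * ln (1 + 2 * l i)) = (\<Prod>i\<in>UNIV. 1 + 2 * l i) powr (- \<mu>)"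
  proof -
    have p: "0 < 1 + 2 * l i" for i using u(2)[of i] by simp
    then have "0 < (\<Prod>i\<in>UNIV. 1 + 2 * l i)" by (intro prod_pos) simp
    then show ?thesis using p by (simp add: powr_def ln_prod sum_distrib_left sum_negf less_imp_neq[symmetric])
  qed
  also have "(\<Prod>i\<in>UNIV. 1 + 2 * l i) = Delta d (mid + 2 *\<^sub>R mmul \<alpha> (mmul s2 \<alpha>))"
    unfolding u(3) by (rule Delta_one_plus_spectral[OF u(1,2), symmetric])
  \<comment> \<open>The limit has the root of a around s2, the Wishart transform the root of s2
    around a; the determinants agree.\<close>
  also have "\<dots> = Delta d (mid + 2 *\<^sub>R mmul (msqrt d s2) (mmul a (msqrt d s2)))"
    using Delta_one_plus_commute[OF al(1), of "msqrt d s2"] s2 al(2) by simp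
  also have "\<dots> powr (- \<mu>) = (\<integral>r. exp (- (a \<bullet> mmul r r)) \<partial>wishart_sq d \<mu> s2)"
    by (rule wishart_sq_laplace[OF a s2, symmetric])
  finally show ?thesis using laplace_limit unfolding kk s2_def[symmetric] by simp
qed

lemma weak_limit:
  "weak_conv_Pi d (\<lambda>n. Tmeas d ((1 / sqrt (real n)) *\<^sub>R mid) (convpow d \<mu> \<nu> n)) (wishart_sq d \<mu> ((1 / (2 * \<mu>)) *\<^sub>R Y))"
proof (rule weak_conv_of_laplace)
  let ?P = "\<lambda>n. Tmeas d ((1 / sqrt (real n)) *\<^sub>R mid) (convpow d \<mu> \<nu> n)"
  have s2: "(1 / (2 * \<mu>)) *\<^sub>R Y \<in> PiQ d" using Y_PiQ mu_pos by simp
  then show "law_on (wishart_sq d \<mu> ((1 / (2 * \<mu>)) *\<^sub>R Y))" by (rule law_on_wishart_sq)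
  show "law_on (?P n)" for n
    using law_on_scale[OF law_on_convpow[OF nu], of "1 / sqrt (real n)" n]
    by (simp add: Tmeas_scale[OF law_on_convpow[OF nu]])
  \<comment> \<open>Restricted to n \<ge> 1: at n = 0 the factor \<open>1 / sqrt 0\<close> is 0, and
    the scaling lemma speaks of positive factors.\<close>
  have eq: "?P n = convpow d \<mu> (nuc (1 / sqrt (real n))) n" if "n \<ge> 1" for n
    using Tmeas_convpow[OF nu, of "1 / sqrt (real n)" n] Tmeas_scale[OF nu, of "1 / sqrt (real n)"] that by simp
  show "(\<lambda>n. \<integral>r. exp (- (a \<bullet> mmul r r)) \<partial>?P n) \<longlonglongrightarrow> (\<integral>r. exp (- (a \<bullet> mmul r r)) \<partial>wishart_sq d \<mu> ((1 / (2 * \<mu>)) *\<^sub>R Y))"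
    if "a \<in> PiQ d" for a
  proof (rule Lim_transform_eventually[OF laplace_convergence[OF that]])
    show "\<forall>\<^sub>F n in sequentially. (\<integral>r. exp (- (a \<bullet> mmul r r)) \<partial>convpow d \<mu> (nuc (1 / sqrt (real n))) n) =
      (\<integral>r. exp (- (a \<bullet> mmul r r)) \<partial>?P n)"
      using eventually_ge_at_top[of 1] by eventually_elim (simp only: eq)
  qed
  \<comment> \<open>Each of the n factors has second moment 1/n times that of \<nu>, so one bound
    serves all n.\<close>
  show "(\<integral>\<^sup>+r. ennreal ((norm r)\<^sup>2) \<partial>?P n) \<le> ennreal (\<integral>r. (norm r)\<^sup>2 \<partial>\<nu>)" if n: "n \<ge> 1" for n
  proof -
    have fin: "(\<integral>\<^sup>+r. ennreal ((norm r)\<^sup>2) \<partial>\<nu>) = ennreal (\<integral>r. (norm r)\<^sup>2 \<partial>\<nu>)"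
      by (rule nn_integral_eq_integral[OF sq_int]) simp
    have "(\<integral>\<^sup>+r. ennreal ((norm r)\<^sup>2) \<partial>?P n) = of_nat n * (\<integral>\<^sup>+r. ennreal ((norm r)\<^sup>2) \<partial>nuc (1 / sqrt (real n)))"
      unfolding eq[OF n] by (rule convpow_second_moment) (rule law_on_scale[OF nu], simp)
    also have "(\<integral>\<^sup>+r. ennreal ((norm r)\<^sup>2) \<partial>nuc (1 / sqrt (real n))) = (\<integral>\<^sup>+r. ennreal ((norm ((1 / sqrt (real n)) *\<^sub>R r))\<^sup>2) \<partial>\<nu>)"
      using norm_sq_measurable by (intro nn_integral_distr measurable_law[OF nu scale_measurable]) simp_all
    also have "\<dots> = (\<integral>\<^sup>+r. ennreal (1 / real n) * ennreal ((norm r)\<^sup>2) \<partial>\<nu>)"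
      by (intro nn_integral_cong) (simp add: ennreal_mult'[symmetric] power_divide)
    also have "\<dots> = ennreal (1 / real n) * ennreal (\<integral>r. (norm r)\<^sup>2 \<partial>\<nu>)"
      unfolding fin[symmetric] by (rule nn_integral_cmult) (rule measurable_law[OF nu norm_sq_measurable])
    also have "of_nat n * (ennreal (1 / real n) * ennreal (\<integral>r. (norm r)\<^sup>2 \<partial>\<nu>)) = (ennreal (real n) * ennreal (1 / real n)) * ennreal (\<integral>r. (norm r)\<^sup>2 \<partial>\<nu>)"
      by (simp add: mult.assoc ennreal_of_nat_eq_real_of_nat)
    also have "ennreal (real n) * ennreal (1 / real n) = 1" using n by (simp add: ennreal_mult'[symmetric])
    finally show ?thesis by simp
  qed
qed

end

theorem mainTheorem19:
  fixes d :: nat and \<mu> :: real and \<nu> :: "'q::finite mat measure"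
  assumes "d \<in> {1, 2, 4}"
    and "\<mu> > rho d TYPE('q) - 1"
    and "prob_space \<nu>" and "sets \<nu> = sets (PiS d)"
    and "(\<integral>\<^sup>+ r. ennreal ((norm r)\<^sup>2) \<partial>\<nu>) < \<infinity>"
  shows "integrable \<nu> (\<lambda>r. mmul r r)
     \<and> (1 / (2 * \<mu>)) *\<^sub>R (\<integral> r. mmul r r \<partial>\<nu>) \<in> PiQ d
     \<and> (\<forall>n\<ge>1. Tmeas d ((1 / sqrt (real n)) *\<^sub>R mid) (convpow d \<mu> \<nu> n)
              = convpow d \<mu> (Tmeas d ((1 / sqrt (real n)) *\<^sub>R mid) \<nu>) n)
     \<and> weak_conv_Pi d
         (\<lambda>n. Tmeas d ((1 / sqrt (real n)) *\<^sub>R mid) (convpow d \<mu> \<nu> n))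
         (wishart_sq d \<mu> ((1 / (2 * \<mu>)) *\<^sub>R (\<integral> r. mmul r r \<partial>\<nu>)))"
proof -
  interpret wishart_setting d \<mu> "TYPE('q)"
    by unfold_locales (use assms in auto)
  have nu: "law_on \<nu>" using assms unfolding law_on_def by blast
  interpret clt_setting d \<mu> "TYPE('q)" \<nu>
  proof
    show "law_on \<nu>" by (rule nu)
    show "integrable \<nu> (\<lambda>r. (norm r)\<^sup>2)"
    proof (rule integrableI_nonneg)
      show "(\<lambda>r. (norm r)\<^sup>2) \<in> borel_measurable \<nu>"
        by (intro measurable_law[OF nu] measurable_PiS) measurable
    qed (use assms in auto)
  qed
  have "(1 / (2 * \<mu>)) *\<^sub>R Y \<in> PiQ d" using Y_PiQ mu_pos by simp
  moreover have "Tmeas d ((1 / sqrt (real n)) *\<^sub>R mid) (convpow d \<mu> \<nu> n)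
      = convpow d \<mu> (Tmeas d ((1 / sqrt (real n)) *\<^sub>R mid) \<nu>) n" if "n \<ge> 1" for n
    using that by (intro Tmeas_convpow nu) simp
  ultimately show ?thesis using sq_integrable weak_limit unfolding Y_def by blast
qed

end
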